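(* Consider LinUCB run for $T$ rounds on the unit ball $\mathcal B^d$ ($d\ge 2$) with exploration parameter $\beta$ (chosen as described in the context, at failure level $\delta=1/\log T$), under the sub-Gaussian noise assumption described in the context. Let $\lambda_{t,1}\ge\cdots\ge\lambda_{t,d}$ be the eigenvalues of $\boldsymbol\Lambda_t$. There exists $t_3=O\!\left(\beta^8/\sigma^6\right)$ such that, with probability at least $1-\frac1{\log T}$, the following holds simultaneously for all $t_3\le t\le T$. (a) (Near equality of non-leading eigenvalues) $$\lambda_{t,2}=\left[1+O\!\left(\frac{d(\sigma\sqrt{d+\log\log T}+1)}{\beta}\right)\right]\lambda_{t,d}.$$ (b) (Deterministic benchmark and deviations) For every $i\ge2$, $$\lambda_{t,i}=(1+\Delta_{t,i})\sqrt{\frac{2\beta^2t}{d+1}},$$ where $$|\Delta_{t,i}|\lesssim d\left(\frac{\beta^8}{t\sigma^6}\right)^{\frac{d+1}{d-1}}+\frac{(\sigma\sqrt{d+\log\log T}+1)^{1/2}}{\sqrt\beta}$$ whenever $\beta\gtrsim d^2(\sigma\sqrt{d+\log\log T}+1)$.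
   Context: Setting. Let $d\ge 2$, let $T\ge3$ be the horizon, and let $\boldsymbol\theta^\star\in\mathbb R^d$ with $\|\boldsymbol\theta^\star\|_2=1$. In each round $t=1,\dots,T$ the learner picks an action $\boldsymbol a_t$ in the unit ball $\mathcal B^d=\{\boldsymbol x\in\mathbb R^d:\|\boldsymbol x\|_2\le 1\}$ (every vector of the ball is available in every round) and observes $r_t=\langle\boldsymbol a_t,\boldsymbol\theta^\star\rangle+\epsilon_t$. With $\mathcal F_t=\sigma(\boldsymbol a_1,r_1,\dots,\boldsymbol a_t,r_t)$, the noise satisfies $\mathbb E[\epsilon_t\mid\mathcal F_{t-1}]=0$, $\mathrm{Var}[\epsilon_t\mid\mathcal F_{t-1}]=\sigma^2$, and $\mathbb E[\exp(\lambda\epsilon_t)\mid\mathcal F_{t-1}]\le\exp(\sigma^2\lambda^2/2)$ for all $\lambda\in\mathbb R$ and $t\ge1$, where $\sigma>0$. LinUCB with deterministic exploration parameter $\beta=\beta(T,d)>0$: $\boldsymbol\Lambda_0=\boldsymbol I_d$, $\boldsymbol\Lambda_t=\boldsymbol I_d+\sum_{s=1}^t\boldsymbol a_s\boldsymbol a_s^\top$, ridge estimator $\overline{\boldsymbol\theta}_t=\boldsymbol\Lambda_t^{-1}\sum_{s=1}^t\boldsymbol a_s r_s$, projected estimator $\widehat{\boldsymbol\theta}_t=\overline{\boldsymbol\theta}_t/\|\overline{\boldsymbol\theta}_t\|_2$ (an arbitrary unit vector if $\overline{\boldsymbol\theta}_t=0$, e.g. at $t=0$), UCB score $\mathrm{UCB}_t(\boldsymbol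 a)=\langle\boldsymbol a,\widehat{\boldsymbol\theta}_{t-1}\rangle+\beta\sqrt{\boldsymbol a^\top\boldsymbol\Lambda_{t-1}^{-1}\boldsymbol a}$, and $\boldsymbol a_t\in\arg\max_{\boldsymbol a\in\mathcal B^d}\mathrm{UCB}_t(\boldsymbol a)$. Choice of $\beta$ at failure level $\delta$: $\beta$ is chosen so that, with probability at least $1-\delta$, $\langle\boldsymbol a,\boldsymbol\theta^\star\rangle\le\mathrm{UCB}_t(\boldsymbol a)$ holds uniformly over all $t$ and all $\boldsymbol a\in\mathcal B^d$ (optimism). Notation: $f\lesssim g$ (equivalently $f=O(g)$) means $|f|\le c_1|g|$ for a constant $c_1>0$ not depending on $T$ (or $t$), and $f\gtrsim g$ means $|f|\ge c_2|g|$ for a constant $c_2>0$ not depending on $T$ (or $t$). *)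

theory Defs
  imports
    "HOL-Probability.Probability"
    "HOL-Computational_Algebra.Computational_Algebra"
begin

definition outer_square :: "real ^ 'n \<Rightarrow> real ^ 'n ^ 'n" where
  "outer_square x = (\<chi> i j. x $ i * x $ j)"

text \<open>Eigenvalues are listed with algebraic multiplicity, in decreasing order. Only real roots of
  the characteristic polynomial are listed; for a real symmetric matrix these are all of them.
  The list is indexed from 0, so the \<open>i\<close>-th largest eigenvalue is the entry \<open>i - 1\<close>.\<close>

definition charpoly :: "real ^ 'n ^ 'n \<Rightarrow> real poly" where
  "charpoly A = det (\<chi> i j. (if i = j then [:0, 1:] else 0) - [:A $ i $ j:])"

definition eigenvalues :: "real ^ 'n ^ 'n \<Rightarrow> real list" where
  "eigenvalues A = rev (sorted_list_of_multiset (proots (charpoly A)))"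

definition eigval :: "real ^ 'n ^ 'n \<Rightarrow> nat \<Rightarrow> real" where
  "eigval A i = eigenvalues A ! (i - 1)"

definition gram :: "(nat \<Rightarrow> real ^ 'n) \<Rightarrow> nat \<Rightarrow> real ^ 'n ^ 'n" where
  "gram a t = mat 1 + (\<Sum>s = 1..t. outer_square (a s))"

definition ridge :: "(nat \<Rightarrow> real ^ 'n) \<Rightarrow> (nat \<Rightarrow> real) \<Rightarrow> nat \<Rightarrow> real ^ 'n" where
  "ridge a r t = matrix_inv (gram a t) *v (\<Sum>s = 1..t. r s *\<^sub>R a s)"

text \<open>\<open>is_projected x u\<close>: \<open>u\<close> is the projection of \<open>x\<close> to the unit sphere; any unit vector is
  admitted for \<open>x = 0\<close>.\<close>

definition is_projected :: "real ^ 'n \<Rightarrow> real ^ 'n \<Rightarrow> bool" where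
  "is_projected x u \<longleftrightarrow> norm u = 1 \<and> (x \<noteq> 0 \<longrightarrow> u = x /\<^sub>R norm x)"

definition ucb :: "real \<Rightarrow> real ^ 'n ^ 'n \<Rightarrow> real ^ 'n \<Rightarrow> real ^ 'n \<Rightarrow> real" where
  "ucb \<beta> \<Lambda> u x = inner x u + \<beta> * sqrt (inner x (matrix_inv \<Lambda> *v x))"

text \<open>\<open>history M a r t\<close> is the \<open>\<sigma>\<close>-algebra generated by \<open>a 1, r 1, \<dots>, a t, r t\<close>; for
  \<open>t = 0\<close> it is trivial.\<close>

definition history ::
    "'w measure \<Rightarrow> (nat \<Rightarrow> 'w \<Rightarrow> real ^ 'n) \<Rightarrow> (nat \<Rightarrow> 'w \<Rightarrow> real) \<Rightarrow> nat \<Rightarrow> 'w measure" where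
  "history M a r t = vimage_algebra (space M)
     (\<lambda>\<omega>. \<lambda>s\<in>{1..t}. (a s \<omega>, r s \<omega>)) (PiM {1..t} (\<lambda>_. borel \<Otimes>\<^sub>M borel))"

definition cond_var :: "'w measure \<Rightarrow> 'w measure \<Rightarrow> ('w \<Rightarrow> real) \<Rightarrow> 'w \<Rightarrow> real" where
  "cond_var M F X = real_cond_exp M F (\<lambda>\<omega>. (X \<omega> - real_cond_exp M F X \<omega>)\<^sup>2)"

text \<open>A run of LinUCB on the unit ball for \<open>T\<close> rounds. The process \<open>\<theta>hat\<close> is the projected ridge
  estimator. Measurability of \<open>a t\<close> and \<open>\<theta>hat t\<close> with respect to the past says that ties in the
  maximisation, and the unit vector used when the ridge estimator vanishes, are not resolved by
  looking at future noise. Integrability of the exponential moments implies that the noise and its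
  square are integrable.\<close>

locale linucb = prob_space M
  for M :: "'w measure"
    and T :: nat
    and \<theta> :: "real ^ 'n"
    and \<sigma> \<beta> :: real
    and a :: "nat \<Rightarrow> 'w \<Rightarrow> real ^ 'n"
    and r \<epsilon> :: "nat \<Rightarrow> 'w \<Rightarrow> real"
    and \<theta>hat :: "nat \<Rightarrow> 'w \<Rightarrow> real ^ 'n" +
  assumes dim: "CARD('n) \<ge> 2"
    and horizon: "T \<ge> 3"
    and theta_norm: "norm \<theta> = 1"
    and sigma_pos: "\<sigma> > 0"
    and beta_pos: "\<beta> > 0"
    and reward_eq: "\<And>t \<omega>. t \<in> {1..T} \<Longrightarrow> \<omega> \<in> space M \<Longrightarrow> r t \<omega> = inner (a t \<omega>) \<theta> + \<epsilon> t \<omega>"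
    and noise_measurable: "\<And>t. t \<in> {1..T} \<Longrightarrow> \<epsilon> t \<in> borel_measurable M"
    and action_measurable:
      "\<And>t. t \<in> {1..T} \<Longrightarrow> a t \<in> borel_measurable (history M a r (t - 1))"
    and estimator_measurable:
      "\<And>t. t < T \<Longrightarrow> \<theta>hat t \<in> borel_measurable (history M a r t)"
    and noise_exp_integrable:
      "\<And>t l. t \<in> {1..T} \<Longrightarrow> integrable M (\<lambda>\<omega>. exp (l * \<epsilon> t \<omega>))"
    and noise_mean:
      "\<And>t. t \<in> {1..T} \<Longrightarrow> AE \<omega> in M. real_cond_exp M (history M a r (t - 1)) (\<epsilon> t) \<omega> = 0"
    and noise_var:
      "\<And>t. t \<in> {1..T} \<Longrightarrow> AE \<omega> in M. cond_var M (history M a r (t - 1)) (\<epsilon> t) \<omega> = \<sigma>\<^sup>2"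
    and noise_subgaussian:
      "\<And>t l. t \<in> {1..T} \<Longrightarrow>
         AE \<omega> in M. real_cond_exp M (history M a r (t - 1)) (\<lambda>\<omega>'. exp (l * \<epsilon> t \<omega>')) \<omega>
           \<le> exp (\<sigma>\<^sup>2 * l\<^sup>2 / 2)"
    and estimator_projected:
      "\<And>t \<omega>. t < T \<Longrightarrow> \<omega> \<in> space M \<Longrightarrow>
         is_projected (ridge (\<lambda>s. a s \<omega>) (\<lambda>s. r s \<omega>) t) (\<theta>hat t \<omega>)"
    and action_argmax:
      "\<And>t \<omega>. t \<in> {1..T} \<Longrightarrow> \<omega> \<in> space M \<Longrightarrow>
         is_arg_max (ucb \<beta> (gram (\<lambda>s. a s \<omega>) (t - 1)) (\<theta>hat (t - 1) \<omega>))
           (\<lambda>x. x \<in> cball 0 1) (a t \<omega>)"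

definition optimistic ::
    "'w measure \<Rightarrow> nat \<Rightarrow> real ^ 'n \<Rightarrow> real \<Rightarrow> (nat \<Rightarrow> 'w \<Rightarrow> real ^ 'n)
       \<Rightarrow> (nat \<Rightarrow> 'w \<Rightarrow> real ^ 'n) \<Rightarrow> real \<Rightarrow> bool" where
  "optimistic M T \<theta> \<beta> a \<theta>hat \<delta> \<longleftrightarrow>
     measure M {\<omega> \<in> space M. \<forall>t\<in>{1..T}. \<forall>x\<in>cball 0 1.
       inner x \<theta> \<le> ucb \<beta> (gram (\<lambda>s. a s \<omega>) (t - 1)) (\<theta>hat (t - 1) \<omega>) x} \<ge> 1 - \<delta>"

text \<open>The recurring factor \<open>\<sigma> \<surd>(d + log log T) + 1\<close>.\<close>

definition noise_scale :: "real \<Rightarrow> nat \<Rightarrow> nat \<Rightarrow> real" where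
  "noise_scale \<sigma> d T = \<sigma> * sqrt (real d + ln (ln (real T))) + 1"

end

theory Submission
  imports Defs
begin

text \<open>By the equality case of the Cauchy--Schwarz inequality the action maximising the score satisfies
 \<open>u a = \<theta>bar + u \<mu> \<Lambda>\<^sup>-\<^sup>1 a\<close> for the ridge estimate \<open>\<theta>bar\<close> and scalars \<open>u\<close> and \<open>\<mu>\<close>, where \<open>\<mu>\<close> is at most
 the least eigenvalue of the Gram matrix \<open>\<Lambda>\<close>. With \<open>w = a \<bullet> \<Lambda>\<^sup>-\<^sup>1 a\<close> the determinant is multiplied by \<open>1 + w\<close>,
 while the trace of \<open>\<Lambda>\<close> on the complement of \<open>\<theta>\<close> grows by \<open>O(\<beta> \<surd>w)\<close>; comparing the two shows that all
 non-leading eigenvalues are of order \<open>\<beta> \<surd>t\<close>. If the estimation error is small compared to \<open>\<beta>\<close>, then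
 \<open>\<theta>\<close> is almost an eigenvector, the component \<open>y\<close> of the action orthogonal to \<open>\<theta>\<close> satisfies
 \<open>\<mu> |y|\<^sup>2 = \<beta>\<^sup>2 - \<mu>\<^sup>2 / t\<close> up to a small error, and \<open>y\<close> points to the smallest eigenvalues. Hence the variance of the
 non-leading eigenvalues is damped, and the square \<open>U\<close> of their mean obeys
 \<open>U' - U = 2 (\<beta>\<^sup>2 - U / t) / (d - 1)\<close> approximately, whose solution is \<open>2 \<beta>\<^sup>2 t / (d + 1)\<close>.

 The error is controlled by a self-normalised bound whose prior has the predicted shape of
 \<open>\<Lambda>\<close>, which avoids a factor \<open>log t\<close>.\<close>

text \<open>The obstacle is a circle: the spectrum can be described only if the estimation error is
  far below \<beta>, while the sharp error bound needs a prior of the shape of the Gram matrix. It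
  is broken by strong induction on the round. Up to order \<beta>^6 rounds the identity prior
  suffices, since the log determinant is then small against \<beta>^2. Afterwards the earlier
  errors, already below a small multiple of \<beta>, give enough of the shape to justify the dyadic
  prior of the current scale; there are O(log T) of these. The power \<beta>^8 is this \<beta>^6
  times two factors \<beta>: one makes the initial rounds a fraction of order N / \<beta> of all
  rounds (N bounds the error), the other is the time in which the variance of the non-leading
  eigenvalues is damped. As \<sigma> is fixed before the constants, \<sigma>^6 is absorbed in
  them.\<close>

unbundle no fps_syntax

section \<open>Eigenvalues of symmetric matrices\<close>

lemma inner_matrix_symmetric:
 fixes A :: "real ^ 'n ^ 'n"
 assumes "transpose A = A"
 shows "x \<bullet> (A *v y) = (A *v x) \<bullet> y" using assms by (metis dot_lmul_matrix transpose_matrix_vector)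

text \<open>A point where a nonnegative quadratic form vanishes is a minimiser, so the first
  variation there is zero; a small step against the sign of a nonzero variation would make the form
  negative.\<close>

lemma psd_form_null:
 fixes A :: "real ^ 'n ^ 'n"
 assumes sym: "transpose A = A" and S: "subspace S"
  and psd: "\<And>x. x \<in> S \<Longrightarrow> 0 \<le> x \<bullet> (A *v x)"
  and v: "v \<in> S" "v \<bullet> (A *v v) = 0" and w: "w \<in> S"
 shows "w \<bullet> (A *v v) = 0"
proof (rule ccontr)
 define p where "p = w \<bullet> (A *v v)"
 define q where "q = w \<bullet> (A *v w)"
 assume "w \<bullet> (A *v v) \<noteq> 0"
 hence p: "p \<noteq> 0" by (simp add: p_def)
 have q: "q \<ge> 0" using psd w by (simp add: q_def)
 \<comment> \<open>The exact minimiser along \<open>w\<close> would be \<open>- p / q\<close>; the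
   shift by one covers \<open>q = 0\<close> and still gives a negative value.\<close>
 define s where "s = - p / (q + 1)"
 have sv: "v \<bullet> (A *v w) = p" using inner_matrix_symmetric[OF sym, of v w] by (simp add: p_def inner_commute)
 have "0 \<le> (v + s *\<^sub>R w) \<bullet> (A *v (v + s *\<^sub>R w))" by (intro psd subspace_add subspace_scale S v w)
 also have "... = 2 * s * p + s^2 * q"
  using v sv by (simp add: matrix_vector_right_distrib matrix_vector_mult_scaleR inner_add_left
    inner_add_right p_def q_def power2_eq_square algebra_simps)
 also have "... = - (p^2 * (q + 2)) / (q + 1)^2"
  using q by (simp add: s_def divide_simps power2_eq_square) (simp add: algebra_simps)
 also have "... < 0" using p q by (simp add: divide_less_0_iff mult_pos_pos)
 finally show False by simp
qed

text \<open>The Rayleigh quotient attains its maximum \<open>l\<close> on the unit sphere of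
  \<open>S\<close> by compactness. Then \<open>l I - A\<close> is nonnegative on \<open>S\<close>
  and its form vanishes at the maximiser, so \<open>psd_form_null\<close>, tested with the image of
  the maximiser, shows that this image is zero.\<close>

lemma symmetric_eigenvector_in_subspace:
 fixes A :: "real ^ 'n ^ 'n"
 assumes sym: "transpose A = A" and S: "subspace S" and inv: "\<And>x. x \<in> S \<Longrightarrow> A *v x \<in> S"
  and ne: "S \<noteq> {0}"
 obtains v l where "v \<in> S" "norm v = 1" "A *v v = l *\<^sub>R v"
proof -
 obtain z where z: "z \<in> S" "z \<noteq> 0" using ne S subspace_0 by blast
 have "z /\<^sub>R norm z \<in> S \<inter> sphere 0 1" using z S by (simp add: subspace_scale)
 moreover have "compact (S \<inter> sphere 0 1)" using S by (simp add: closed_Int_compact closed_subspace)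
 moreover have "continuous_on (S \<inter> sphere 0 1) (\<lambda>x. x \<bullet> (A *v x))"
  by (intro continuous_on_inner continuous_on_id matrix_vector_mult_linear_continuous_on)
 ultimately obtain v where v: "v \<in> S \<inter> sphere 0 1"
  and mx: "\<forall>x\<in>S \<inter> sphere 0 1. x \<bullet> (A *v x) \<le> v \<bullet> (A *v v)"
  using continuous_attains_sup[of "S \<inter> sphere 0 1" "\<lambda>x. x \<bullet> (A *v x)"] by blast
 define l where "l = v \<bullet> (A *v v)"
 define C where "C = l *\<^sub>R mat 1 - A"
 have Cv: "C *v x = l *\<^sub>R x - A *v x" for x
  by (simp add: C_def matrix_vector_mult_diff_rdistrib scaleR_matrix_vector_assoc[symmetric])
 have symC: "transpose C = C" using sym by (simp add: C_def transpose_def mat_def vec_eq_iff)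
 have vv: "v \<bullet> v = 1" using v by (simp add: dot_square_norm)
 have psd: "0 \<le> x \<bullet> (C *v x)" if "x \<in> S" for x
 proof (cases "x = 0")
  case False
  have "x /\<^sub>R norm x \<in> S \<inter> sphere 0 1" using that False S by (simp add: subspace_scale)
  hence "(x /\<^sub>R norm x) \<bullet> (A *v (x /\<^sub>R norm x)) \<le> l" using mx l_def by blast
  hence "(x \<bullet> (A *v x)) / (norm x)^2 \<le> l" by (simp add: matrix_vector_mult_scaleR power2_eq_square field_simps)
  hence "x \<bullet> (A *v x) \<le> l * (norm x)^2" using False by (simp add: field_simps)
  thus ?thesis by (simp add: Cv inner_diff_right power2_norm_eq_inner)
 qed simp
 have v0: "v \<bullet> (C *v v) = 0" using vv by (simp add: Cv inner_diff_right l_def)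
 have CvS: "C *v v \<in> S" unfolding Cv using v S inv by (simp add: subspace_diff subspace_scale)
 have "(C *v v) \<bullet> (C *v v) = 0" by (rule psd_form_null[OF symC S psd _ v0 CvS]) (use v in auto)
 hence "A *v v = l *\<^sub>R v" by (simp add: Cv)
 thus ?thesis using that v by auto
qed

text \<open>Induction on the dimension: one eigenvector is split off, and by symmetry its orthogonal
  complement within \<open>S\<close> is again invariant.\<close>

lemma symmetric_orthonormal_eigenvectors:
 fixes A :: "real ^ 'n ^ 'n"
 assumes sym: "transpose A = A"
 shows "subspace S \<Longrightarrow> (\<And>x. x \<in> S \<Longrightarrow> A *v x \<in> S) \<Longrightarrow>
  \<exists>B\<subseteq>S. finite B \<and> pairwise orthogonal B \<and> (\<forall>v\<in>B. norm v = 1 \<and> (\<exists>l. A *v v = l *\<^sub>R v)) \<and>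
   card B = dim S"
proof (induction "dim S" arbitrary: S)
 case 0
 thus ?case by (intro exI[of _ "{}"]) (auto simp: pairwise_def)
next
 case (Suc n)
 have "S \<noteq> {0}" using Suc.hyps(2) by auto
 then obtain v l where v: "v \<in> S" "norm v = 1" "A *v v = l *\<^sub>R v"
  using symmetric_eigenvector_in_subspace[OF sym Suc.prems] by metis
 define S' where "S' = {x \<in> S. orthogonal v x}"
 have sub': "subspace S'" unfolding S'_def using Suc.prems(1) by (auto simp: subspace_def orthogonal_def inner_add_right)
 have inv': "A *v x \<in> S'" if "x \<in> S'" for x using that Suc.prems(2) v(3)
  by (auto simp: S'_def orthogonal_def inner_matrix_symmetric[OF sym])
 have vn: "v \<noteq> 0" using v(2) by auto
 have dS: "dim S = Suc (dim S')"
 proof -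
  have vS': "v \<notin> span S'" using sub' vn by (auto simp: S'_def orthogonal_def span_eq_iff[THEN iffD2])
  have "S \<subseteq> span (insert v S')"
  proof
   fix x assume x: "x \<in> S"
   have "x - (v \<bullet> x) *\<^sub>R v \<in> S'" using x v Suc.prems(1)
    by (auto simp: S'_def orthogonal_def inner_diff_right subspace_diff subspace_scale dot_square_norm)
   hence "(x - (v \<bullet> x) *\<^sub>R v) + (v \<bullet> x) *\<^sub>R v \<in> span (insert v S')" by (intro span_add span_scale) (auto intro: span_base)
   thus "x \<in> span (insert v S')" by simp
  qed
  moreover have "insert v S' \<subseteq> S" using v by (auto simp: S'_def)
  ultimately have "dim S = dim (insert v S')" by (metis dim_subset dim_span order_antisym dim_subset)
  also have "... = Suc (dim S')" using vS' by (simp add: dim_insert)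
  finally show ?thesis .
 qed
 hence "n = dim S'" using Suc.hyps(2) by simp
 from Suc.hyps(1)[OF this sub' inv'] obtain B where B: "B \<subseteq> S'" "finite B" "pairwise orthogonal B"
  "\<forall>v\<in>B. norm v = 1 \<and> (\<exists>l. A *v v = l *\<^sub>R v)" "card B = dim S'" by blast
 have "v \<notin> B" using B(1) vn by (auto simp: S'_def orthogonal_def)
 moreover have "pairwise orthogonal (insert v B)" using B(1,3) by (auto simp: pairwise_insert S'_def orthogonal_commute)
 ultimately show ?case using B v dS by (intro exI[of _ "insert v B"]) (auto simp: S'_def)
qed

lemma symmetric_eigenbasis:
 fixes A :: "real ^ 'n ^ 'n"
 assumes sym: "transpose A = A"
 obtains e :: "'n \<Rightarrow> real ^ 'n" and l :: "'n \<Rightarrow> real"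
 where "\<And>i j. e i \<bullet> e j = (if i = j then 1 else 0)" "\<And>i. A *v e i = l i *\<^sub>R e i"
proof -
 obtain B where B: "finite B" "pairwise orthogonal B"
  "\<forall>v\<in>B. norm v = 1 \<and> (\<exists>l. A *v v = l *\<^sub>R v)" "card B = dim (UNIV :: (real^'n) set)"
  using symmetric_orthonormal_eigenvectors[OF sym subspace_UNIV] by auto
 have "card (UNIV :: 'n set) = card B" using B(4) by (simp add: dim_UNIV)
 then obtain e where e: "bij_betw e (UNIV :: 'n set) B" using finite_same_card_bij[OF finite B(1)] by blast
 have eB: "e i \<in> B" for i using e by (auto simp: bij_betw_def)
 have "\<forall>i. \<exists>l. A *v e i = l *\<^sub>R e i" using B(3) eB by blast
 hence "\<exists>l. \<forall>i. A *v e i = l i *\<^sub>R e i" by (rule choice)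
 then obtain l where l: "\<And>i. A *v e i = l i *\<^sub>R e i" by blast
 have "e i \<bullet> e j = (if i = j then 1 else 0)" for i j
 proof (cases "i = j")
  case True
  have "norm (e j) = 1" using B(3) eB by blast
  thus ?thesis using True by (simp add: dot_square_norm)
 next
  case False
  hence "e i \<noteq> e j" using e by (auto simp: bij_betw_def inj_on_def)
  thus ?thesis using B(2) eB[of i] eB[of j] False by (auto simp: pairwise_def orthogonal_def)
 qed
 thus ?thesis using that l by blast
qed

lemma poly_det: "poly (det M) x = det (\<chi> i j. poly (M $ i $ j) x)"
 for M :: "real poly ^ 'n ^ 'n"
proof -
 have 1: "poly (of_int (sign p)) x = of_int (sign p)" for p :: "'n \<Rightarrow> 'n" by (simp add: sign_def)
 show ?thesis unfolding det_def by (simp add: poly_sum poly_prod 1)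
qed

lemma orthonormal_basis_matrix:
 fixes e :: "'n \<Rightarrow> real ^ 'n"
 assumes on: "\<And>i j. e i \<bullet> e j = (if i = j then 1 else 0)"
  and ev: "\<And>i. A *v e i = l i *\<^sub>R e i"
 defines "Q \<equiv> \<chi> i j. e i $ j"
 shows "orthogonal_matrix Q" "A = transpose Q ** (\<chi> i j. if i = j then l i else 0) ** Q"
proof -
 have QQ: "Q ** transpose Q = mat 1" by (simp add: Q_def matrix_matrix_mult_def transpose_def mat_def vec_eq_iff)
   (use on in \<open>auto simp: inner_vec_def\<close>)
 thus o: "orthogonal_matrix Q" by (simp add: orthogonal_matrix matrix_left_right_inverse)
 have "A ** transpose Q = transpose Q ** (\<chi> i j. if i = j then l i else 0)"
 proof -
  have "(A ** transpose Q) $ i $ j = (A *v e j) $ i" for i j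
   by (simp add: matrix_matrix_mult_def transpose_def Q_def matrix_vector_mult_def)
  moreover have "(transpose Q ** (\<chi> i j. if i = j then l i else 0)) $ i $ j = l j * e j $ i" for i j
   by (simp add: matrix_matrix_mult_def transpose_def Q_def if_distrib cong: if_cong)
  ultimately show ?thesis by (simp add: ev vec_eq_iff)
 qed
 hence "A ** (transpose Q ** Q) = transpose Q ** (\<chi> i j. if i = j then l i else 0) ** Q" by (simp add: matrix_mul_assoc)
 thus "A = transpose Q ** (\<chi> i j. if i = j then l i else 0) ** Q" using o by (simp add: orthogonal_matrix)
qed

lemma orthonormal_basis_expansion:
 fixes e :: "'n \<Rightarrow> real ^ 'n"
 assumes on: "\<And>i j. e i \<bullet> e j = (if i = j then 1 else 0)"
 shows "x = (\<Sum>i\<in>UNIV. (e i \<bullet> x) *\<^sub>R e i)"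
proof -
 define Q where "Q = (\<chi> i j. e i $ j)"
 have "Q ** transpose Q = mat 1" by (simp add: Q_def matrix_matrix_mult_def transpose_def mat_def vec_eq_iff)
   (use on in \<open>auto simp: inner_vec_def\<close>)
 hence "transpose Q ** Q = mat 1" by (simp add: matrix_left_right_inverse)
 hence "x = transpose Q *v (Q *v x)" by (simp add: matrix_vector_mul_assoc)
 also have "... = (\<Sum>i\<in>UNIV. (e i \<bullet> x) *\<^sub>R e i)"
  by (simp add: Q_def transpose_def matrix_vector_mult_def vec_eq_iff inner_vec_def mult.commute)
 finally show ?thesis .
qed

lemma det_diag_mat: "det (\<chi> i j. if i = j then l i else 0) = (\<Prod>i\<in>UNIV. l i)"
 for l :: "'n::finite \<Rightarrow> 'a::comm_ring_1" by (subst det_diagonal) auto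

lemma trace_similar: "trace (P ** D ** Q) = trace (D ** (Q ** P))" for P D Q :: "real ^ 'n ^ 'n"
 by (metis matrix_mul_assoc trace_mul_sym)

lemma det_trace_eigenbasis:
 fixes e :: "'n \<Rightarrow> real ^ 'n"
 assumes on: "\<And>i j. e i \<bullet> e j = (if i = j then 1 else 0)"
  and ev: "\<And>i. A *v e i = l i *\<^sub>R e i"
 shows "det A = (\<Prod>i\<in>UNIV. l i)" "trace A = (\<Sum>i\<in>UNIV. l i)"
proof -
 define Q where "Q = (\<chi> i j. e i $ j)"
 define D where "D = (\<chi> i j. if i = j then l i else 0)"
 have Q: "orthogonal_matrix Q" and A: "A = transpose Q ** D ** Q"
  using orthonormal_basis_matrix[OF on ev] by (simp_all add: Q_def D_def)
 have "Q ** transpose Q = mat 1" using Q by (simp add: orthogonal_matrix_def)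
 hence "det Q * det Q = 1" by (metis det_I det_mul det_transpose)
 thus "det A = (\<Prod>i\<in>UNIV. l i)" unfolding A det_mul det_transpose D_def det_diag_mat
  by (metis mult.commute mult.left_commute mult.right_neutral)
 show "trace A = (\<Sum>i\<in>UNIV. l i)" unfolding A trace_similar using Q by (simp add: orthogonal_matrix_def D_def trace_def)
qed

lemma charpoly_eigenbasis:
 fixes e :: "'n \<Rightarrow> real ^ 'n"
 assumes on: "\<And>i j. e i \<bullet> e j = (if i = j then 1 else 0)"
  and ev: "\<And>i. A *v e i = l i *\<^sub>R e i"
 shows "charpoly A = (\<Prod>i\<in>UNIV. [:- l i, 1:])"
proof (rule poly_eq_poly_eq_iff[THEN iffD1], rule ext)
 fix x
 have "poly (charpoly A) x = det (x *\<^sub>R mat 1 - A)" unfolding charpoly_def poly_det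
  by (rule arg_cong[of _ _ det]) (simp add: vec_eq_iff mat_def)
 also have "... = (\<Prod>i\<in>UNIV. x - l i)" by (rule det_trace_eigenbasis[OF on])
   (simp add: matrix_vector_mult_diff_rdistrib scaleR_matrix_vector_assoc[symmetric] ev scaleR_diff_left)
 finally show "poly (charpoly A) x = poly (\<Prod>i\<in>UNIV. [:- l i, 1:]) x" by (simp add: poly_prod)
qed

text \<open>Connects the list of roots behind \<open>eigval\<close> with eigenvectors: sorting the
  indices of an eigenbasis by eigenvalue gives a sorted list with the multiset of roots of the
  characteristic polynomial, and such a list is unique.\<close>

lemma symmetric_sorted_eigenbasis:
 fixes A :: "real ^ 'n ^ 'n"
 assumes sym: "transpose A = A"
 obtains p :: "nat \<Rightarrow> 'n" and e :: "'n \<Rightarrow> real ^ 'n"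
 where "bij_betw p {1..CARD('n)} UNIV" "\<And>i j. e i \<bullet> e j = (if i = j then 1 else 0)"
  "\<And>i. i \<in> {1..CARD('n)} \<Longrightarrow> A *v e (p i) = eigval A i *\<^sub>R e (p i)"
  "\<And>i j. 1 \<le> i \<Longrightarrow> i \<le> j \<Longrightarrow> j \<le> CARD('n) \<Longrightarrow> eigval A j \<le> eigval A i"
proof -
 obtain e :: "'n \<Rightarrow> real ^ 'n" and l :: "'n \<Rightarrow> real"
 where on: "\<And>i j. e i \<bullet> e j = (if i = j then 1 else 0)" and ev: "\<And>i. A *v e i = l i *\<^sub>R e i"
  using symmetric_eigenbasis[OF sym] by blast
 have "proots (charpoly A) = image_mset l (mset_set UNIV)"
 proof -
  have "proots (charpoly A) = (\<Sum>i\<in>(UNIV::'n set). {#l i#})" unfolding charpoly_eigenbasis[OF on ev] by (subst proots_prod) auto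
  also have "... = image_mset l (mset_set UNIV)" by (simp add: sum_unfold_sum_mset)
  finally show ?thesis .
 qed
 hence ms: "mset (eigenvalues A) = image_mset l (mset_set UNIV)" by (simp add: eigenvalues_def)
 obtain us :: "'n list" where us: "set us = UNIV" "distinct us" using finite_distinct_list[of "UNIV :: 'n set"] by auto
 define ix where "ix = rev (sort_key l us)"
 have ix: "set ix = UNIV" "distinct ix" "mset ix = mset_set UNIV" using us by (auto simp: ix_def mset_set_set[symmetric])
 have "sorted (map l (sort_key l us))" by simp
 moreover have "mset (map l (sort_key l us)) = proots (charpoly A)" using ms ix(3) by (simp add: eigenvalues_def ix_def)
 ultimately have "map l (sort_key l us) = sorted_list_of_multiset (proots (charpoly A))"
  by (metis sorted_list_of_multiset_mset sorted_sort_id)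
 hence "rev (map l (sort_key l us)) = eigenvalues A" by (simp only: eigenvalues_def)
 hence eigs: "eigenvalues A = map l ix" unfolding ix_def by (simp only: rev_map)
 have len: "length ix = CARD('n)" using ix distinct_card by metis
 define p where "p i = ix ! (i - 1)" for i
 have eigp: "eigval A i = l (p i)" if "i \<in> {1..CARD('n)}" for i
 proof -
  have "i - 1 < length ix" using that len by auto
  thus ?thesis by (simp only: eigval_def eigs p_def nth_map)
 qed
 have "bij_betw p {1..CARD('n)} UNIV"
 proof -
  have "bij_betw (\<lambda>i. i - 1) {1..CARD('n)} {..<CARD('n)}" by (rule bij_betwI[where g = Suc]) auto
  moreover have "bij_betw (\<lambda>i. ix ! i) {..<CARD('n)} UNIV" by (rule bij_betw_nth) (use ix len in auto)
  ultimately have "bij_betw ((\<lambda>i. ix ! i) \<circ> (\<lambda>i. i - 1)) {1..CARD('n)} UNIV" by (rule bij_betw_trans)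
  thus ?thesis by (simp add: p_def o_def cong: bij_betw_cong)
 qed
 moreover have "eigval A j \<le> eigval A i" if "1 \<le> i" "i \<le> j" "j \<le> CARD('n)" for i j
 proof -
  have "sorted (rev (map l ix))" by (simp add: ix_def rev_map)
  hence "(map l ix) ! (j - 1) \<le> (map l ix) ! (i - 1)" by (intro sorted_rev_nth_mono) (use that len in auto)
  thus ?thesis by (simp add: eigval_def eigs)
 qed
 ultimately show ?thesis using that[of p e] on ev eigp by metis
qed

text \<open>Indexed by the numbers from 1 to d, as \<open>eigval\<close> is, so that
  \<open>f i\<close> belongs to the \<open>i\<close>-th largest eigenvalue. The last conjunct is
  completeness.\<close>

definition eigval_basis :: "real ^ 'n ^ 'n \<Rightarrow> (nat \<Rightarrow> real ^ 'n) \<Rightarrow> bool" where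
 "eigval_basis A f \<longleftrightarrow>
  (\<forall>i\<in>{1..CARD('n)}. \<forall>j\<in>{1..CARD('n)}. f i \<bullet> f j = (if i = j then 1 else 0)) \<and>
  (\<forall>i\<in>{1..CARD('n)}. A *v f i = eigval A i *\<^sub>R f i) \<and>
  (\<forall>x. (\<Sum>i=1..CARD('n). (f i \<bullet> x) *\<^sub>R f i) = x)"

lemma symmetric_eigval_basis:
 fixes A :: "real ^ 'n ^ 'n"
 assumes symm: "transpose A = A"
 shows "\<exists>f. eigval_basis A f"
  and det_eq_prod_eigval: "det A = (\<Prod>i=1..CARD('n). eigval A i)"
  and trace_eq_sum_eigval: "trace A = (\<Sum>i=1..CARD('n). eigval A i)"
  and eigval_antimono: "1 \<le> i \<Longrightarrow> i \<le> j \<Longrightarrow> j \<le> CARD('n) \<Longrightarrow> eigval A j \<le> eigval A i"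
proof -
 obtain p :: "nat \<Rightarrow> 'n" and e :: "'n \<Rightarrow> real ^ 'n"
 where p: "bij_betw p {1..CARD('n)} UNIV" and on: "\<And>i j. e i \<bullet> e j = (if i = j then 1 else 0)"
  and ev: "\<And>i. i \<in> {1..CARD('n)} \<Longrightarrow> A *v e (p i) = eigval A i *\<^sub>R e (p i)"
  and srt: "\<And>i j. 1 \<le> i \<Longrightarrow> i \<le> j \<Longrightarrow> j \<le> CARD('n) \<Longrightarrow> eigval A j \<le> eigval A i" by (rule symmetric_sorted_eigenbasis[OF symm]) blast
 define q where "q = inv_into {1..CARD('n)} p"
 have q1: "q j \<in> {1..CARD('n)}" for j unfolding q_def by (rule inv_into_into) (use p in \<open>simp add: bij_betw_def\<close>)
 have q2: "p (q j) = j" for j unfolding q_def by (rule f_inv_into_f) (use p in \<open>simp add: bij_betw_def\<close>)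
 have qp: "q (p i) = i" if "i \<in> {1..CARD('n)}" for i unfolding q_def by (rule bij_betw_inv_into_left[OF p that])
 have ev': "A *v e j = eigval A (q j) *\<^sub>R e j" for j using ev[OF q1[of j]] unfolding q2 .
 have re: "(\<Sum>j\<in>UNIV. g j) = (\<Sum>i=1..CARD('n). g (p i))" for g :: "'n \<Rightarrow> 'b::comm_monoid_add"
  by (rule sum.reindex_bij_betw[OF p, symmetric])
 have rp: "(\<Prod>j\<in>UNIV. g j) = (\<Prod>i=1..CARD('n). g (p i))" for g :: "'n \<Rightarrow> real" by (rule prod.reindex_bij_betw[OF p, symmetric])
 have E1: "e (p i) \<bullet> e (p j) = (if i = j then 1 else 0)"
  if "i \<in> {1..CARD('n)}" "j \<in> {1..CARD('n)}" for i j
 proof -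
  have "p i = p j \<longleftrightarrow> i = j" by (rule inj_on_eq_iff[OF bij_betw_imp_inj_on[OF p] that])
  thus ?thesis unfolding on by simp
 qed
 have E2: "(\<Sum>i=1..CARD('n). (e (p i) \<bullet> x) *\<^sub>R e (p i)) = x" for x
  using orthonormal_basis_expansion[OF on, of x] unfolding re by (rule sym)
 have "eigval_basis A (\<lambda>i. e (p i))" unfolding eigval_basis_def by (intro conjI ballI allI E1 E2 ev)
 thus "\<exists>f. eigval_basis A f" by (rule exI[of _ "\<lambda>i. e (p i)"])
 show "det A = (\<Prod>i=1..CARD('n). eigval A i)" unfolding det_trace_eigenbasis(1)[OF on ev'] rp using qp by (intro prod.cong) auto
 show "trace A = (\<Sum>i=1..CARD('n). eigval A i)" unfolding det_trace_eigenbasis(2)[OF on ev'] re using qp by (intro sum.cong) auto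
 show "1 \<le> i \<Longrightarrow> i \<le> j \<Longrightarrow> j \<le> CARD('n) \<Longrightarrow> eigval A j \<le> eigval A i" by (rule srt)
qed

lemma eigval_basisD:
 fixes A :: "real ^ 'n ^ 'n"
 assumes "eigval_basis A f"
 shows "i \<in> {1..CARD('n)} \<Longrightarrow> j \<in> {1..CARD('n)} \<Longrightarrow> f i \<bullet> f j = (if i = j then 1 else 0)"
  and "i \<in> {1..CARD('n)} \<Longrightarrow> A *v f i = eigval A i *\<^sub>R f i"
  and "(\<Sum>i=1..CARD('n). (f i \<bullet> x) *\<^sub>R f i) = x" using assms unfolding eigval_basis_def by blast+

lemma eigval_ge:
 fixes A :: "real ^ 'n ^ 'n"
 assumes sym: "transpose A = A" and i: "i \<in> {1..CARD('n)}"
  and k: "\<And>x. k * (norm x)^2 \<le> x \<bullet> (A *v x)"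
 shows "k \<le> eigval A i"
proof -
 obtain f where "eigval_basis A f" using symmetric_eigval_basis[OF sym] by blast
 note f = eigval_basisD(1)[OF this i i, simplified] eigval_basisD(2)[OF this i]
 show ?thesis using k[of "f i"] f by (simp add: power2_norm_eq_inner)
qed

lemma eigval_form:
 fixes A :: "real ^ 'n ^ 'n"
 assumes f: "eigval_basis A f"
 shows "x \<bullet> (A *v x) = (\<Sum>i=1..CARD('n). eigval A i * (f i \<bullet> x)^2)"
  "(norm x)^2 = (\<Sum>i=1..CARD('n). (f i \<bullet> x)^2)"
proof -
 have "A *v x = A *v (\<Sum>i=1..CARD('n). (f i \<bullet> x) *\<^sub>R f i)" by (simp only: eigval_basisD(3)[OF f])
 also have "... = (\<Sum>i=1..CARD('n). (f i \<bullet> x) *\<^sub>R eigval A i *\<^sub>R f i)"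
  unfolding linear_sum[OF matrix_vector_mul_linear] matrix_vector_mult_scaleR
  by (intro sum.cong) (auto simp: eigval_basisD(2)[OF f])
 finally show "x \<bullet> (A *v x) = (\<Sum>i=1..CARD('n). eigval A i * (f i \<bullet> x)^2)"
  by (simp add: inner_sum_right power2_eq_square inner_commute algebra_simps)
 have "(norm x)^2 = x \<bullet> (\<Sum>i=1..CARD('n). (f i \<bullet> x) *\<^sub>R f i)" by (simp only: eigval_basisD(3)[OF f] power2_norm_eq_inner)
 thus "(norm x)^2 = (\<Sum>i=1..CARD('n). (f i \<bullet> x)^2)" by (simp add: inner_sum_right power2_eq_square inner_commute)
qed

lemma eigval_min_form:
 fixes A :: "real ^ 'n ^ 'n"
 assumes sym: "transpose A = A"
 shows "eigval A CARD('n) * (norm x)^2 \<le> x \<bullet> (A *v x)"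
proof -
 obtain f where eb: "eigval_basis A f" using symmetric_eigval_basis[OF sym] by blast
 note f = eigval_basisD(1)[OF eb]
 note Q = eigval_form[OF eb]
 show ?thesis unfolding Q sum_distrib_left
 proof (rule sum_mono)
  fix j assume "j \<in> {1..CARD('n)}"
  hence "eigval A CARD('n) \<le> eigval A j" by (intro eigval_antimono[OF sym]) auto
  thus "eigval A CARD('n) * (f j \<bullet> x)^2 \<le> eigval A j * (f j \<bullet> x)^2" by (rule mult_right_mono) simp
 qed
qed

text \<open>One half of the Courant-Fischer principle: by a dimension count \<open>S\<close>
  contains a nonzero vector from the span of the first \<open>i\<close> eigenvectors, and there the
  form is at least \<open>eigval A i\<close> times the squared norm.\<close>

lemma eigval_le_on_subspace:
 fixes A :: "real ^ 'n ^ 'n"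
 assumes sym: "transpose A = A" and i: "i \<in> {1..CARD('n)}"
  and S: "subspace S" "dim S + i > CARD('n)"
  and k: "\<And>x. x \<in> S \<Longrightarrow> x \<bullet> (A *v x) \<le> k * (norm x)^2"
 shows "eigval A i \<le> k"
proof -
 obtain f where eb: "eigval_basis A f" using symmetric_eigval_basis[OF sym] by blast
 note f = eigval_basisD(1)[OF eb]
 note Q = eigval_form[OF eb]
 define U where "U = span (f ` {1..i})"
 have U: "subspace U" by (simp add: U_def)
 have inj: "inj_on f {1..i}"
 proof (rule inj_onI, rule ccontr)
  fix x y assume "x \<in> {1..i}" "y \<in> {1..i}" "f x = f y" "x \<noteq> y"
  thus False using f[of x x] f[of x y] i by auto
 qed
 have "pairwise orthogonal (f ` {1..i})" using f i by (force simp: pairwise_def orthogonal_def)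
 moreover have "0 \<notin> f ` {1..i}" using f i by force
 ultimately have "independent (f ` {1..i})" by (rule pairwise_orthogonal_independent)
 hence dU: "dim U = i" using card_image[OF inj] by (simp add: U_def dim_eq_card_independent)
 have perp: "f j \<bullet> x = 0" if x: "x \<in> U" and j: "j \<in> {1..CARD('n)}" "j > i" for x j using x unfolding U_def
 proof (induction rule: span_induct)
  case base
  show ?case by (simp add: subspace_def inner_add_right)
 next
  case (step y)
  thus ?case using f j i by auto
 qed
 have "dim {x + y |x y. x \<in> U \<and> y \<in> S} \<le> CARD('n)" using dim_subset_UNIV[of "{x + y |x y. x \<in> U \<and> y \<in> S}"] by simp
 hence "dim (U \<inter> S) \<noteq> 0" using dim_sums_Int[OF U S(1)] dU S(2) by linarith
 then obtain x where x: "x \<in> U" "x \<in> S" "x \<noteq> 0" by (auto simp: dim_eq_0)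
 have "eigval A i * (norm x)^2 \<le> x \<bullet> (A *v x)" unfolding Q sum_distrib_left
 proof (rule sum_mono)
  fix j assume j: "j \<in> {1..CARD('n)}"
  show "eigval A i * (f j \<bullet> x)^2 \<le> eigval A j * (f j \<bullet> x)^2"
  proof (cases "j \<le> i")
   case True
   thus ?thesis using eigval_antimono[OF sym, of j i] j i by (intro mult_right_mono) auto
  next
   case False
   thus ?thesis using perp[OF x(1) j] by simp
  qed
 qed
 also have "... \<le> k * (norm x)^2" using k x by simp
 finally show ?thesis using x(3) by simp
qed

text \<open>The witness is the span of the eigenvectors with indices from \<open>i\<close>
  on.\<close>

lemma eigval_le_tail_form:
 fixes A :: "real ^ 'n ^ 'n"
 assumes sym: "transpose A = A" and i: "i \<in> {1..CARD('n)}"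
 obtains S where "subspace S" "dim S + i > CARD('n)"
  "\<And>x. x \<in> S \<Longrightarrow> x \<bullet> (A *v x) \<le> eigval A i * (norm x)^2"
proof -
 obtain f where eb: "eigval_basis A f" using symmetric_eigval_basis[OF sym] by blast
 note f = eigval_basisD(1)[OF eb]
 note Q = eigval_form[OF eb]
 define U where "U = span (f ` {i..CARD('n)})"
 have inj: "inj_on f {i..CARD('n)}"
 proof (rule inj_onI, rule ccontr)
  fix x y assume "x \<in> {i..CARD('n)}" "y \<in> {i..CARD('n)}" "f x = f y" "x \<noteq> y"
  thus False using f[of x x] f[of x y] i by auto
 qed
 have "pairwise orthogonal (f ` {i..CARD('n)})" using f i by (force simp: pairwise_def orthogonal_def)
 moreover have "0 \<notin> f ` {i..CARD('n)}"
 proof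
  assume "0 \<in> f ` {i..CARD('n)}"
  then obtain j where "j \<in> {i..CARD('n)}" "f j = 0" by auto
  thus False using f[of j j] i by auto
 qed
 ultimately have "independent (f ` {i..CARD('n)})" by (rule pairwise_orthogonal_independent)
 hence dU: "dim U = CARD('n) + 1 - i" using card_image[OF inj] by (simp add: U_def dim_eq_card_independent)
 have perp: "f j \<bullet> x = 0" if x: "x \<in> U" and j: "j \<in> {1..CARD('n)}" "j < i" for x j using x unfolding U_def
 proof (induction rule: span_induct)
  case base
  show ?case by (simp add: subspace_def inner_add_right)
 next
  case (step y)
  thus ?case using f j i by auto
 qed
 have le: "x \<bullet> (A *v x) \<le> eigval A i * (norm x)^2" if x: "x \<in> U" for x unfolding Q sum_distrib_left
 proof (rule sum_mono)
  fix j assume j: "j \<in> {1..CARD('n)}"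
  show "eigval A j * (f j \<bullet> x)^2 \<le> eigval A i * (f j \<bullet> x)^2"
  proof (cases "j < i")
   case False
   thus ?thesis using eigval_antimono[OF sym, of i j] j i by (intro mult_right_mono) auto
  next
   case True
   thus ?thesis using perp[OF x j] by simp
  qed
 qed
 show ?thesis by (rule that[of U]) (use le dU i in \<open>auto simp: U_def\<close>)
qed

lemma norm_matrix_vector_le: "norm (M *v x) \<le> norm M * norm x" for M :: "real ^ 'n ^ 'm"
proof -
 have "norm (M *v x) \<le> L2_set (\<lambda>i. norm (M $ i) * norm x) UNIV" unfolding norm_vec_def[of "M *v x"]
  by (rule L2_set_mono) (auto simp: matrix_vector_mul_component Cauchy_Schwarz_ineq2)
 also have "... = norm M * norm x" by (simp add: L2_set_left_distrib norm_vec_def[of M])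
 finally show ?thesis .
qed

lemma abs_form_le_norm: "\<bar>x \<bullet> (M *v x)\<bar> \<le> norm M * (norm x)^2" for M :: "real ^ 'n ^ 'n"
proof -
 have "\<bar>x \<bullet> (M *v x)\<bar> \<le> norm x * norm (M *v x)" by (rule Cauchy_Schwarz_ineq2)
 also have "... \<le> norm x * (norm M * norm x)" by (intro mult_left_mono norm_matrix_vector_le) auto
 finally show ?thesis by (simp add: power2_eq_square algebra_simps)
qed

text \<open>Weyl's perturbation inequality, with the Frobenius norm as a bound for the operator
  norm.\<close>

lemma eigval_le_add_norm_diff:
 fixes A B :: "real ^ 'n ^ 'n"
 assumes "transpose A = A" "transpose B = B" and i: "i \<in> {1..CARD('n)}"
 shows "eigval A i \<le> eigval B i + norm (A - B)"
proof -
 obtain S where S: "subspace S" "dim S + i > CARD('n)"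
  and le: "\<And>x. x \<in> S \<Longrightarrow> x \<bullet> (B *v x) \<le> eigval B i * (norm x)^2" using eigval_le_tail_form[OF assms(2) i] by blast
 show ?thesis
 proof (rule eigval_le_on_subspace[OF assms(1) i S])
  fix x assume x: "x \<in> S"
  have "x \<bullet> (A *v x) = x \<bullet> (B *v x) + x \<bullet> ((A - B) *v x)" by (simp add: matrix_vector_mult_diff_rdistrib inner_diff_right)
  also have "... \<le> eigval B i * (norm x)^2 + norm (A - B) * (norm x)^2"
   using le[OF x] abs_form_le_norm[of x "A - B"] by linarith
  finally show "x \<bullet> (A *v x) \<le> (eigval B i + norm (A - B)) * (norm x)^2" by (simp add: algebra_simps)
 qed
qed

text \<open>By the perturbation inequality eigenvalues are Lipschitz on symmetric matrices, hence
  continuous.\<close>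

lemma eigval_measurable:
 fixes f :: "'w \<Rightarrow> real ^ 'n ^ 'n"
 assumes f: "f \<in> borel_measurable M" and sym: "\<And>\<omega>. \<omega> \<in> space M \<Longrightarrow> transpose (f \<omega>) = f \<omega>"
  and i: "i \<in> {1..CARD('n)}"
 shows "(\<lambda>\<omega>. eigval (f \<omega>) i) \<in> borel_measurable M"
proof -
 \<comment> \<open>The perturbation bound is available for symmetric matrices only; composition with
   the symmetric part gives a function that is continuous on all matrices.\<close>
 define s :: "real ^ 'n ^ 'n \<Rightarrow> real ^ 'n ^ 'n" where "s A = (1/2) *\<^sub>R (A + transpose A)" for A
 have tr: "transpose (s A) = s A" for A by (simp add: s_def transpose_def vec_eq_iff)
 have lin: "s A - s B = s (A - B)" for A B by (simp add: s_def transpose_def vec_eq_iff algebra_simps)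
 have nt: "norm (transpose A) = norm A" for A :: "real ^ 'n ^ 'n"
 proof -
  have "A \<bullet> A = transpose A \<bullet> transpose A" unfolding inner_vec_def transpose_def by (simp, rule sum.swap)
  thus ?thesis by (simp add: norm_eq_sqrt_inner)
 qed
 have "norm (s A) \<le> norm A" for A using norm_triangle_ineq[of A "transpose A"] by (simp add: s_def nt)
 hence "dist (eigval (s A) i) (eigval (s B) i) \<le> dist A B" for A B
  using eigval_le_add_norm_diff[OF tr tr i, of A B] eigval_le_add_norm_diff[OF tr tr i, of B A]
  unfolding lin dist_norm by (smt (verit) norm_minus_commute real_norm_def)
 hence "continuous_on UNIV (\<lambda>A. eigval (s A) i)" by (intro continuous_on_iff[THEN iffD2]) (metis order_le_less_trans)
 hence "(\<lambda>A. eigval (s A) i) \<in> borel_measurable borel" by (rule borel_measurable_continuous_onI)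
 hence "(\<lambda>\<omega>. eigval (s (f \<omega>)) i) \<in> borel_measurable M" using f by (rule measurable_compose_rev)
 moreover have "s (f \<omega>) = f \<omega>" if "\<omega> \<in> space M" for \<omega> unfolding s_def sym[OF that] by (simp add: vec_eq_iff)
 ultimately show ?thesis by (subst measurable_cong[where g = "\<lambda>\<omega>. eigval (s (f \<omega>)) i"]) auto
qed

section \<open>Positive definite matrices\<close>

definition spd :: "real ^ 'n ^ 'n \<Rightarrow> bool" where
 "spd A \<longleftrightarrow> transpose A = A \<and> (\<forall>x. x \<noteq> 0 \<longrightarrow> 0 < x \<bullet> (A *v x))"

lemma spd_sym: "spd A \<Longrightarrow> transpose A = A"
 and spd_pos: "spd A \<Longrightarrow> x \<noteq> 0 \<Longrightarrow> 0 < x \<bullet> (A *v x)" by (auto simp: spd_def)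

lemma spd_nonneg: "spd A \<Longrightarrow> 0 \<le> x \<bullet> (A *v x)" using spd_pos[of A x] by (cases "x = 0") auto

lemma spd_inner: "spd A \<Longrightarrow> x \<bullet> (A *v y) = (A *v x) \<bullet> y" by (rule inner_matrix_symmetric[OF spd_sym])

lemma spd_cauchy_schwarz:
 assumes A: "spd A"
 shows "(x \<bullet> (A *v y))^2 \<le> (x \<bullet> (A *v x)) * (y \<bullet> (A *v y))"
proof (cases "y = 0")
 case False
 define q where "q = y \<bullet> (A *v y)"
 define p where "p = x \<bullet> (A *v y)"
 have q: "q > 0" using spd_pos[OF A False] by (simp add: q_def)
 have p': "y \<bullet> (A *v x) = p" using spd_inner[OF A, of y x] by (simp add: p_def inner_commute)
 have "0 \<le> (x - (p / q) *\<^sub>R y) \<bullet> (A *v (x - (p / q) *\<^sub>R y))" by (rule spd_nonneg[OF A])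
 also have "... = x \<bullet> (A *v x) - 2 * (p / q) * p + (p / q)^2 * q"
  by (simp add: matrix_vector_mult_diff_distrib matrix_vector_mult_scaleR inner_diff_left inner_diff_right
    p' p_def[symmetric] q_def[symmetric] power2_eq_square algebra_simps)
 also have "... = x \<bullet> (A *v x) - p^2 / q" using q by (simp add: field_simps power2_eq_square)
 finally show ?thesis using q by (simp add: field_simps p_def[symmetric] q_def[symmetric])
qed simp

lemma spd_inverse:
 fixes A :: "real ^ 'n ^ 'n"
 assumes A: "spd A"
 shows "A *v (matrix_inv A *v x) = x" "matrix_inv A *v (A *v x) = x"
proof -
 have "inj ((*v) A)"
 proof (rule injI)
  fix x y assume e: "A *v x = A *v y"
  show "x = y"
  proof (rule ccontr)
   assume "x \<noteq> y"
   hence "0 < (x - y) \<bullet> (A *v (x - y))" using spd_pos[OF A] by simp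
   thus False using e by (simp add: matrix_vector_mult_diff_distrib)
  qed
 qed
 hence "invertible A" using matrix_left_invertible_injective[of A] by (simp add: invertible_left_inverse)
 hence "A ** matrix_inv A = mat 1 \<and> matrix_inv A ** A = mat 1" unfolding matrix_inv_def invertible_def by (rule someI_ex)
 thus "A *v (matrix_inv A *v x) = x" "matrix_inv A *v (A *v x) = x" by (simp_all add: matrix_vector_mul_assoc)
qed

lemma spd_matrix_inv:
 fixes A :: "real ^ 'n ^ 'n"
 assumes A: "spd A"
 shows "spd (matrix_inv A)"
proof -
 have i: "x \<bullet> (matrix_inv A *v y) = (matrix_inv A *v x) \<bullet> y" for x y
 proof -
  have "x \<bullet> (matrix_inv A *v y) = (A *v (matrix_inv A *v x)) \<bullet> (matrix_inv A *v y)" by (simp add: spd_inverse[OF A])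
  also have "... = (matrix_inv A *v x) \<bullet> y"
   using spd_inner[OF A, of "matrix_inv A *v x" "matrix_inv A *v y"] by (simp add: spd_inverse[OF A])
  finally show ?thesis .
 qed
 have "(transpose (matrix_inv A)) *v y = matrix_inv A *v y" for y
 proof (rule vector_eq_ldot[THEN iffD1], rule allI)
  fix x
  have "x \<bullet> (transpose (matrix_inv A) *v y) = (matrix_inv A *v x) \<bullet> y"
   by (metis dot_lmul_matrix inner_commute transpose_matrix_vector)
  thus "x \<bullet> (transpose (matrix_inv A) *v y) = x \<bullet> (matrix_inv A *v y)" by (simp add: i)
 qed
 hence "transpose (matrix_inv A) = matrix_inv A" by (simp add: matrix_eq)
 moreover have "0 < x \<bullet> (matrix_inv A *v x)" if "x \<noteq> 0" for x
 proof -
  have "matrix_inv A *v x \<noteq> 0" using that spd_inverse(1)[OF A, of x] by auto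
  hence "0 < (matrix_inv A *v x) \<bullet> (A *v (matrix_inv A *v x))" by (rule spd_pos[OF A])
  thus ?thesis by (simp add: spd_inverse[OF A] i)
 qed
 ultimately show ?thesis by (simp add: spd_def)
qed

text \<open>In operator terms k \<le> A gives k A^-2 \<le> A^-1 and k A^-1 \<le> I. The first is the
  hypothesis at A^-1 x, the second follows from it by Cauchy-Schwarz.\<close>

lemma spd_inv_bounds:
 fixes A :: "real ^ 'n ^ 'n"
 assumes A: "spd A" and k: "k \<ge> 0" "\<And>x. k * (norm x)^2 \<le> x \<bullet> (A *v x)"
 shows "k * (norm (matrix_inv A *v x))^2 \<le> x \<bullet> (matrix_inv A *v x)"
  and "k * (x \<bullet> (matrix_inv A *v x)) \<le> (norm x)^2"
proof -
 define z where "z = matrix_inv A *v x"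
 have zA: "z \<bullet> (A *v z) = x \<bullet> z" by (simp add: z_def spd_inverse[OF A] inner_commute)
 show 1: "k * (norm (matrix_inv A *v x))^2 \<le> x \<bullet> (matrix_inv A *v x)" using k(2)[of z] zA by (simp add: z_def)
 show "k * (x \<bullet> (matrix_inv A *v x)) \<le> (norm x)^2"
 proof (cases "x \<bullet> z = 0")
  case False
  hence p: "x \<bullet> z > 0" using spd_nonneg[OF spd_matrix_inv[OF A], of x] by (simp add: z_def)
  have "k * (x \<bullet> z)^2 \<le> k * ((norm x)^2 * (norm z)^2)"
   using Cauchy_Schwarz_ineq[of x z] k(1) by (intro mult_left_mono) (auto simp: power2_norm_eq_inner)
  also have "... = (norm x)^2 * (k * (norm z)^2)" by simp
  also have "... \<le> (norm x)^2 * (x \<bullet> z)" using 1 by (intro mult_left_mono) (auto simp: z_def)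
  finally have "(k * (x \<bullet> z)) * (x \<bullet> z) \<le> (norm x)^2 * (x \<bullet> z)" by (simp add: power2_eq_square)
  thus ?thesis using p by (simp add: z_def)
 qed (simp add: z_def)
qed

lemma outer_square_mult: "outer_square a *v x = (a \<bullet> x) *\<^sub>R a"
 by (simp add: outer_square_def matrix_vector_mult_def vec_eq_iff inner_vec_def sum_distrib_left
   sum_distrib_right algebra_simps)

lemma outer_square_sym: "transpose (outer_square a) = outer_square a"
 by (simp add: outer_square_def transpose_def vec_eq_iff mult.commute)

lemma trace_outer_square: "trace (outer_square a) = (norm a)^2"
 by (simp add: outer_square_def trace_def power2_norm_eq_inner inner_vec_def)

lemma transpose_add: "transpose (A + B) = transpose A + transpose B" by (simp add: transpose_def vec_eq_iff)

lemma spd_add_outer: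
 assumes "spd A"
 shows "spd (A + outer_square a)" unfolding spd_def
proof (intro conjI allI impI)
 show "transpose (A + outer_square a) = A + outer_square a" using spd_sym[OF assms] by (simp add: transpose_add outer_square_sym)
 show "0 < x \<bullet> ((A + outer_square a) *v x)" if "x \<noteq> 0" for x using spd_pos[OF assms that]
  by (simp add: matrix_vector_mult_add_rdistrib outer_square_mult inner_add_right inner_commute
    add_pos_nonneg flip: power2_eq_square)
qed

lemma sherman_morrison:
 fixes A :: "real ^ 'n ^ 'n"
 assumes A: "spd A"
 defines "L \<equiv> matrix_inv A"
 shows "matrix_inv (A + outer_square a) *v x =
  L *v x - ((L *v a) \<bullet> x / (1 + a \<bullet> (L *v a))) *\<^sub>R (L *v a)"
proof -
 have w: "1 + a \<bullet> (L *v a) > 0" using spd_nonneg[OF spd_matrix_inv[OF A], of a] by (simp add: L_def add_pos_nonneg)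
 define k where "k = (L *v a) \<bullet> x / (1 + a \<bullet> (L *v a))"
 have k: "k * (1 + a \<bullet> (L *v a)) = a \<bullet> (L *v x)" using w by (simp add: k_def L_def spd_inner[OF spd_matrix_inv[OF A]])
 have "(A + outer_square a) *v (L *v x - k *\<^sub>R (L *v a)) =
   x + (a \<bullet> (L *v x) - k * (1 + a \<bullet> (L *v a))) *\<^sub>R a"
  by (simp add: matrix_vector_mult_add_rdistrib outer_square_mult matrix_vector_mult_diff_distrib
    matrix_vector_mult_scaleR L_def spd_inverse[OF A] inner_diff_right algebra_simps)
 also have "... = x" by (simp add: k)
 finally have "matrix_inv (A + outer_square a) *v x = L *v x - k *\<^sub>R (L *v a)" by (metis spd_inverse(2)[OF spd_add_outer[OF A]])
 thus ?thesis by (simp add: k_def)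
qed

lemma outer_square_congruence: "P ** outer_square z ** transpose P = outer_square (P *v z)"
proof -
 have "(P ** outer_square z ** transpose P) *v x = outer_square (P *v z) *v x" for x
 proof -
  have "z \<bullet> (transpose P *v x) = (P *v z) \<bullet> x" by (metis dot_lmul_matrix inner_commute transpose_matrix_vector)
  thus ?thesis by (simp add: matrix_vector_mul_assoc[symmetric] outer_square_mult matrix_vector_mult_scaleR)
 qed
 thus ?thesis by (simp add: matrix_eq)
qed

lemma matrix_mult_add_left: "(A + B) ** C = A ** C + B ** C" for A B C :: "real ^ 'n ^ 'n"
 by (simp add: matrix_matrix_mult_def vec_eq_iff sum.distrib algebra_simps)

text \<open>An orthogonal matrix takes a multiple of a coordinate axis to \<open>z\<close>, and for
  such a multiple the matrix is diagonal.\<close>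

lemma det_one_plus_outer: "det (mat 1 + outer_square z) = 1 + (norm z)^2" for z :: "real ^ 'n"
proof (cases "z = 0")
 case True
 hence "outer_square z = 0" by (simp add: outer_square_def vec_eq_iff)
 thus ?thesis using True by simp
next
 case False
 define k :: 'n where "k = undefined"
 obtain Q where Q: "orthogonal_matrix Q" "Q *v axis k 1 = z /\<^sub>R norm z"
  using orthogonal_matrix_exists_basis[of "z /\<^sub>R norm z" k] False by auto
 have Qz: "Q *v (norm z *\<^sub>R axis k 1) = z" using False Q(2) by (simp add: matrix_vector_mult_scaleR)
 have QQ: "Q ** transpose Q = mat 1" using Q by (simp add: orthogonal_matrix_def)
 have e: "Q ** (mat 1 + outer_square (norm z *\<^sub>R axis k 1)) ** transpose Q = mat 1 + outer_square z"
  by (simp add: matrix_add_ldistrib matrix_mult_add_left outer_square_congruence Qz QQ)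
 have "det (mat 1 + outer_square z)
   = det Q * det (mat 1 + outer_square (norm z *\<^sub>R axis k 1)) * det Q"
  unfolding e[symmetric] det_mul det_transpose by (rule refl)
 also have "... = det (mat 1 + outer_square (norm z *\<^sub>R axis k 1))"
 proof -
  have "det Q * det Q = 1" using arg_cong[OF QQ, of det] by (simp add: det_mul)
  thus ?thesis by algebra
 qed
 also have "... = (\<Prod>i\<in>UNIV. (mat 1 + outer_square (norm z *\<^sub>R axis k 1)) $ i $ i)"
  by (rule det_diagonal) (auto simp: mat_def outer_square_def axis_def)
 also have "... = (\<Prod>i\<in>UNIV. if i = k then 1 + (norm z)^2 else 1)"
  by (rule prod.cong) (auto simp: mat_def outer_square_def axis_def power2_eq_square)
 finally show ?thesis by simp
qed

text \<open>Write A = R R^T with R built from the square roots of the eigenvalues. For the vector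
  \<open>z\<close> with R z = a the updated matrix is R (I + z z^T) R^T, so its determinant
  factors.\<close>

lemma matrix_determinant_lemma:
 fixes A :: "real ^ 'n ^ 'n"
 assumes A: "spd A"
 shows "det (A + outer_square a) = det A * (1 + a \<bullet> (matrix_inv A *v a))"
proof -
 obtain e :: "'n \<Rightarrow> real ^ 'n" and l :: "'n \<Rightarrow> real"
 where on: "\<And>i j. e i \<bullet> e j = (if i = j then 1 else 0)" and ev: "\<And>i. A *v e i = l i *\<^sub>R e i"
  using symmetric_eigenbasis[OF spd_sym[OF A]] by blast
 have l: "l i > 0" for i
 proof -
  have "e i \<noteq> 0" using on[of i i] by auto
  thus ?thesis using spd_pos[OF A, of "e i"] on[of i i] by (simp add: ev)
 qed
 define Q where "Q = (\<chi> i j. e i $ j)"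
 define S where "S = (\<chi> i j. if i = j then sqrt (l i) else 0)"
 define D where "D = (\<chi> i j. if i = j then l i else 0)"
 have Q: "orthogonal_matrix Q" and AQ: "A = transpose Q ** D ** Q"
  using orthonormal_basis_matrix[OF on ev] by (simp_all add: Q_def D_def)
 have SS: "S ** transpose S = D"
 proof -
  have "(S ** transpose S) $ i $ j = D $ i $ j" for i j
  proof -
   have "(S ** transpose S) $ i $ j = (\<Sum>k\<in>UNIV. S $ i $ k * S $ j $ k)" by (simp add: matrix_matrix_mult_def transpose_def)
   also have "... = (\<Sum>k\<in>UNIV. if k = i then D $ i $ j else 0)" using l[of i] by (intro sum.cong) (auto simp: S_def D_def)
   finally show ?thesis by simp
  qed
  thus ?thesis by (simp add: vec_eq_iff)
 qed
 define R where "R = transpose Q ** S"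
 have RR: "R ** transpose R = A"
 proof -
  have "R ** transpose R = transpose Q ** (S ** transpose S) ** Q" by (simp add: R_def matrix_transpose_mul matrix_mul_assoc)
  thus ?thesis by (simp add: SS AQ)
 qed
 define z where "z = transpose R *v (matrix_inv A *v a)"
 have Rz: "R *v z = a" using matrix_vector_mul_assoc[of R "transpose R" "matrix_inv A *v a"]
  unfolding RR z_def by (simp add: spd_inverse[OF A] del: transpose_matrix_vector)
 have nz: "(norm z)^2 = a \<bullet> (matrix_inv A *v a)"
 proof -
  have "(norm z)^2 = z \<bullet> (transpose R *v (matrix_inv A *v a))" by (simp add: power2_norm_eq_inner z_def)
  also have "... = (R *v z) \<bullet> (matrix_inv A *v a)" by (metis dot_lmul_matrix inner_commute transpose_matrix_vector)
  finally show ?thesis by (simp add: Rz)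
 qed
 have "A + outer_square a = R ** (mat 1 + outer_square z) ** transpose R"
  by (simp add: matrix_add_ldistrib matrix_mult_add_left outer_square_congruence Rz RR)
 hence "det (A + outer_square a) = det R * det (mat 1 + outer_square z) * det (transpose R)" by (simp add: det_mul)
 also have "... = det A * (1 + (norm z)^2)" unfolding det_one_plus_outer RR[symmetric] det_mul by simp
 finally show ?thesis by (simp add: nz)
qed

lemma gram_0: "gram a 0 = mat 1"
 and gram_Suc: "gram a (Suc t) = gram a t + outer_square (a (Suc t))" by (simp_all add: gram_def add.assoc)

lemma gram_mult: "gram a t *v x = x + (\<Sum>s=1..t. (a s \<bullet> x) *\<^sub>R a s)"
 by (induction t) (simp_all add: gram_0 gram_Suc matrix_vector_mult_add_rdistrib outer_square_mult)

lemma gram_form: "x \<bullet> (gram a t *v x) = (norm x)^2 + (\<Sum>s=1..t. (a s \<bullet> x)^2)"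
 by (simp add: gram_mult inner_add_right inner_sum_right dot_square_norm power2_eq_square inner_commute)

lemma spd_gram: "spd (gram a t)"
proof (induction t)
 case 0
 show ?case by (simp add: gram_0 spd_def transpose_mat)
qed (simp add: gram_Suc spd_add_outer)

lemma gram_ge: "(norm x)^2 \<le> x \<bullet> (gram a t *v x)" by (simp add: gram_form sum_nonneg)

lemma gram_mono: "s \<le> t \<Longrightarrow> x \<bullet> (gram a s *v x) \<le> x \<bullet> (gram a t *v x)" by (simp add: gram_form) (intro sum_mono2, auto)

lemma trace_gram: "trace (gram a t :: real ^ 'n ^ 'n) = CARD('n) + (\<Sum>s=1..t. (norm (a s))^2)"
 by (induction t) (simp_all add: gram_0 gram_Suc trace_add trace_I trace_outer_square)

lemma det_gram_Suc:
 "det (gram a (Suc t)) = det (gram a t) * (1 + a (Suc t) \<bullet> (matrix_inv (gram a t) *v a (Suc t)))"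
 by (simp add: gram_Suc matrix_determinant_lemma spd_gram)

section \<open>The action of LinUCB\<close>

text \<open>Optimality conditions for the action \<open>a\<close>: \<open>U\<close> is the optimal score and \<open>\<mu>\<close> a Lagrange
 multiplier. It is bounded by the least eigenvalue since \<open>U a\<close> has the largest norm in an ellipsoid
 around \<open>v\<close>.\<close>

definition ucb_step ::
  "real ^ 'n ^ 'n \<Rightarrow> real \<Rightarrow> real ^ 'n \<Rightarrow> real ^ 'n \<Rightarrow> real \<Rightarrow> real \<Rightarrow> bool" where
 "ucb_step A \<beta> v a U \<mu> \<longleftrightarrow> norm a = 1 \<and> 1 \<le> U \<and> 0 < \<mu> \<and> 0 < a \<bullet> (matrix_inv A *v a) \<and>
   U \<le> 1 + \<beta> * sqrt (a \<bullet> (matrix_inv A *v a)) \<and>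
   U * \<mu> * sqrt (a \<bullet> (matrix_inv A *v a)) = \<beta> \<and>
   U *\<^sub>R a = v + (U * \<mu>) *\<^sub>R (matrix_inv A *v a) \<and>
   (\<forall>h. \<mu> * (norm h)^2 \<le> h \<bullet> (A *v h))"

lemma norm_add_squared: "(norm (x + y))^2 = (norm x)^2 + 2 * (x \<bullet> y) + (norm y)^2"
 and norm_diff_squared: "(norm (x - y))^2 = (norm x)^2 - 2 * (x \<bullet> y) + (norm y)^2"
 for x y :: "'a :: real_inner" unfolding power2_norm_eq_inner by (simp_all add: inner_add_left inner_add_right inner_diff_left
   inner_diff_right inner_commute)

text \<open>The score is the support function of the ellipsoid of all \<open>v + z\<close> with z .
  A z \<le> \<beta>^2. Its maximum \<open>U\<close> over the unit ball is thus the radius of the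
  smallest centred ball containing the ellipsoid, and the maximiser \<open>a\<close> points to a
  touching point. This is the stationarity equation; comparing the touching point with other points
  of the ellipsoid bounds the multiplier.\<close>

lemma ucb_step_exists:
 fixes A :: "real ^ 'n ^ 'n"
 assumes A: "spd A" and \<beta>: "\<beta> > 0" and v: "norm v = 1"
  and am: "is_arg_max (ucb \<beta> A v) (\<lambda>x. x \<in> cball 0 1) a"
 shows "\<exists>U \<mu>. ucb_step A \<beta> v a U \<mu>"
proof -
 define L where "L = matrix_inv A"
 define f where "f x = x \<bullet> v + \<beta> * sqrt (x \<bullet> (L *v x))" for x
 have fu: "ucb \<beta> A v = f" by (simp add: ucb_def f_def L_def fun_eq_iff)
 have SL: "spd L" using spd_matrix_inv[OF A] by (simp add: L_def)
 have ac: "norm a \<le> 1" and mx: "\<And>x. norm x \<le> 1 \<Longrightarrow> f x \<le> f a" using am by (auto simp: is_arg_max_def fu not_less)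
 have fs: "f (c *\<^sub>R x) = c * f x" if "c \<ge> 0" for c x
  using that by (simp add: f_def matrix_vector_mult_scaleR real_sqrt_mult algebra_simps)
 define U where "U = f a"
 define w where "w = a \<bullet> (L *v a)"
 have U1: "1 \<le> U"
 proof -
  have "1 \<le> f v" using spd_nonneg[OF SL, of v] v \<beta> by (simp add: f_def dot_square_norm)
  also have "... \<le> U" using mx[of v] v by (simp add: U_def)
  finally show ?thesis .
 qed
 have a0: "a \<noteq> 0" using U1 by (auto simp: U_def f_def)
 have fle: "f x \<le> U * norm x" for x
 proof (cases "x = 0")
  case False
  have "f ((1 / norm x) *\<^sub>R x) \<le> U" unfolding U_def by (rule mx) (use False in auto)
  thus ?thesis using False by (subst (asm) fs) (auto simp: field_simps)
 qed (simp add: f_def)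
 have na: "norm a = 1" using fle[of a] U1 ac by (simp add: U_def[symmetric])
 have w: "w > 0" using spd_pos[OF SL a0] by (simp add: w_def)
 \<comment> \<open>\<open>k\<close> is \<open>U\<close> times the multiplier; this value puts
   \<open>z0\<close> below on the boundary of the ellipsoid.\<close>
 define k where "k = \<beta> / sqrt w"
 have k: "k > 0" using \<beta> w by (simp add: k_def)
 have kw: "k * sqrt w = \<beta>" using w by (simp add: k_def)
 have kw2: "k^2 * w = \<beta>^2" using w by (simp add: kw[symmetric] power_mult_distrib)
 have Uf: "U = a \<bullet> v + \<beta> * sqrt w" by (simp add: U_def f_def w_def)
 have U2: "U \<le> 1 + \<beta> * sqrt w" using Cauchy_Schwarz_ineq2[of a v] na v by (simp add: Uf)
 define z0 where "z0 = k *\<^sub>R (L *v a)"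
 have Az0: "A *v z0 = k *\<^sub>R a" by (simp add: z0_def matrix_vector_mult_scaleR L_def spd_inverse[OF A])
 have z0n: "z0 \<bullet> (A *v z0) = \<beta>^2" unfolding Az0 using kw2 by (simp add: z0_def w_def inner_commute power2_eq_square)
 have ell: "norm (v + z) \<le> U" if z: "z \<bullet> (A *v z) \<le> \<beta>^2" for z
 proof -
  define x where "x = v + z"
  have "(x \<bullet> z)^2 \<le> (x \<bullet> (L *v x)) * (z \<bullet> (A *v z))"
   using spd_cauchy_schwarz[OF A, of "L *v x" z] spd_inner[OF A, of "L *v x" z]
    inner_commute[of x "L *v x"] by (simp add: L_def spd_inverse[OF A])
  also have "... \<le> (x \<bullet> (L *v x)) * \<beta>^2" using z spd_nonneg[OF SL] by (intro mult_left_mono) auto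
  also have "... = (\<beta> * sqrt (x \<bullet> (L *v x)))^2" using spd_nonneg[OF SL, of x] by (simp add: power_mult_distrib)
  finally have "x \<bullet> z \<le> \<beta> * sqrt (x \<bullet> (L *v x))" using \<beta> spd_nonneg[OF SL, of x] by (intro power2_le_imp_le[of "x \<bullet> z"]) auto
  hence "x \<bullet> x \<le> f x" by (simp add: f_def x_def inner_add_right)
  hence "norm x * norm x \<le> U * norm x" using fle[of x] by (simp add: dot_square_norm power2_eq_square)
  thus ?thesis using U1 by (cases "norm x = 0") (auto simp: x_def)
 qed
 have Ua: "U *\<^sub>R a = v + z0"
 proof -
  have ng: "norm (v + z0) \<le> U" by (rule ell) (simp add: z0n)
  have ag: "a \<bullet> (v + z0) = U"
  proof -
   have "a \<bullet> z0 = k * w" by (simp add: z0_def w_def)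
   also have "... = \<beta> * sqrt w" using kw w by (simp add: kw[symmetric])
   finally show ?thesis by (simp add: Uf inner_add_right)
  qed
  have "(norm (v + z0 - U *\<^sub>R a))^2 = (norm (v + z0))^2 - U^2"
   using norm_diff_squared[of "v + z0" "U *\<^sub>R a"] ag na U1 by (simp add: inner_commute power2_eq_square)
  also have "... \<le> 0" using ng U1 by (simp add: power_mono)
  finally show ?thesis by simp
 qed
 have form1: "k * (norm h)^2 \<le> U * (h \<bullet> (A *v h))" if s: "h \<bullet> a \<noteq> 0" for h
 proof -
  define H where "H = h \<bullet> (A *v h)"
  have H: "H > 0" unfolding H_def by (rule spd_pos[OF A]) (use s in auto)
  \<comment> \<open>Reflection along \<open>h\<close> in the form of \<open>A\<close>: for this
    \<open>\<tau>\<close> the point \<open>z0 - \<tau> h\<close> has the same form value as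
    \<open>z0\<close>, so it stays in the ellipsoid and \<open>ell\<close> applies to it.\<close>
  define \<tau> where "\<tau> = 2 * (k * (h \<bullet> a)) / H"
  have hz: "h \<bullet> (A *v z0) = k * (h \<bullet> a)" by (simp add: Az0)
  have zh: "z0 \<bullet> (A *v h) = k * (h \<bullet> a)" using spd_inner[OF A, of z0 h] by (simp add: Az0 inner_commute)
  have "(z0 - \<tau> *\<^sub>R h) \<bullet> (A *v (z0 - \<tau> *\<^sub>R h)) = \<beta>^2 - 2 * \<tau> * (k * (h \<bullet> a)) + \<tau>^2 * H"
   using z0n hz zh by (simp add: matrix_vector_mult_diff_distrib matrix_vector_mult_scaleR inner_diff_left
    inner_diff_right H_def power2_eq_square algebra_simps)
  also have "... = \<beta>^2" using H by (simp add: \<tau>_def power2_eq_square field_simps)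
  finally have "norm (v + (z0 - \<tau> *\<^sub>R h)) \<le> U" by (intro ell) simp
  hence "(norm (U *\<^sub>R a - \<tau> *\<^sub>R h))^2 \<le> U^2" by (simp add: Ua algebra_simps power_mono)
  moreover have "(norm (U *\<^sub>R a - \<tau> *\<^sub>R h))^2 = U^2 - 2 * \<tau> * U * (h \<bullet> a) + \<tau>^2 * (norm h)^2"
   using na U1 by (simp add: norm_diff_squared inner_commute power_mult_distrib)
  ultimately have "\<tau>^2 * (norm h)^2 \<le> 2 * \<tau> * U * (h \<bullet> a)" by simp
  hence "\<tau>^2 * (norm h)^2 * H^2 \<le> 2 * \<tau> * U * (h \<bullet> a) * H^2" using H by (intro mult_right_mono) auto
  moreover have "\<tau> * H = 2 * (k * (h \<bullet> a))" using H by (simp add: \<tau>_def)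
  hence "\<tau>^2 * (norm h)^2 * H^2 = 4 * (k * (h \<bullet> a)^2) * (k * (norm h)^2)"
   "2 * \<tau> * U * (h \<bullet> a) * H^2 = 4 * (k * (h \<bullet> a)^2) * (U * H)" by algebra+
  ultimately have "4 * (k * (h \<bullet> a)^2) * (k * (norm h)^2) \<le> 4 * (k * (h \<bullet> a)^2) * (U * H)" by simp
  thus ?thesis using k s by (simp add: H_def mult_le_cancel_left_pos)
 qed
 have form: "k * (norm h)^2 \<le> U * (h \<bullet> (A *v h))" for h
 proof (cases "h \<bullet> a = 0")
  case True
  define gp where "gp = k * (norm h)^2 - U * (h \<bullet> (A *v h))"
  define K where "K = U * (a \<bullet> (A *v a))"
  have K: "K \<ge> 0" using U1 spd_nonneg[OF A, of a] by (simp add: K_def)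
  \<comment> \<open>For \<open>h\<close> orthogonal to \<open>a\<close> the reflection is trivial.
    The bound is therefore taken at \<open>h\<close> plus and minus \<open>e a\<close> and averaged,
    which cancels the terms linear in \<open>e\<close>.\<close>
  have e: "gp \<le> e^2 * K" if "e > 0" for e
  proof -
   have 1: "k * (norm (h + e *\<^sub>R a))^2 \<le> U * ((h + e *\<^sub>R a) \<bullet> (A *v (h + e *\<^sub>R a)))"
    by (rule form1) (use True na that in \<open>simp add: inner_add_left dot_square_norm\<close>)
   have 2: "k * (norm (h - e *\<^sub>R a))^2 \<le> U * ((h - e *\<^sub>R a) \<bullet> (A *v (h - e *\<^sub>R a)))"
    by (rule form1) (use True na that in \<open>simp add: inner_diff_left dot_square_norm\<close>)
   have "k * (norm (h + e *\<^sub>R a))^2 + k * (norm (h - e *\<^sub>R a))^2 = 2 * k * (norm h)^2 + 2 * k * e^2"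
    using na by (simp add: norm_add_squared norm_diff_squared power_mult_distrib distrib_left
     right_diff_distrib)
   moreover have "U * ((h + e *\<^sub>R a) \<bullet> (A *v (h + e *\<^sub>R a))) + U * ((h - e *\<^sub>R a) \<bullet> (A *v (h - e *\<^sub>R a)))
    = 2 * U * (h \<bullet> (A *v h)) + 2 * e^2 * K"
    by (simp add: K_def matrix_vector_mult_add_rdistrib matrix_vector_right_distrib matrix_vector_mult_diff_distrib
     matrix_vector_mult_scaleR inner_add_left inner_add_right inner_diff_left
     inner_diff_right power2_eq_square algebra_simps)
   moreover have "2 * k * e^2 \<ge> 0" using k by simp
   ultimately show ?thesis using 1 2 by (simp add: gp_def)
  qed
  have "gp \<le> 0"
  proof (rule ccontr)
   assume "\<not> gp \<le> 0"
   hence g: "gp > 0" by simp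
   define e where "e = sqrt (gp / (2 * (K + 1)))"
   have "e > 0" using g K by (simp add: e_def)
   from e[OF this] have "gp \<le> gp / (2 * (K + 1)) * K" using g K by (simp add: e_def)
   moreover have "gp / (2 * (K + 1)) * K < gp"
   proof -
    have "gp * K < gp * (2 * (K + 1))" using g K by (intro mult_strict_left_mono) auto
    thus ?thesis using K by (simp add: divide_less_eq add_nonneg_pos)
   qed
   ultimately show False by simp
  qed
  thus ?thesis by (simp add: gp_def)
 qed (rule form1)
 show ?thesis
 proof (intro exI)
  have Uk: "U * (k / U) = k" using U1 by simp
  show "ucb_step A \<beta> v a U (k / U)" unfolding ucb_step_def L_def[symmetric] w_def[symmetric] Uk
  proof (intro conjI allI)
   show "k / U * (norm h)^2 \<le> h \<bullet> (A *v h)" for h using form[of h] U1 by (simp add: field_simps)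
   show "U *\<^sub>R a = v + k *\<^sub>R (L *v a)" using Ua by (simp add: z0_def)
  qed (use na U1 k w U2 kw in auto)
 qed
qed

text \<open>Normalising costs a factor two because \<open>1 - U\<close> is a difference of norms and
  hence itself bounded by the distance of \<open>U x\<close> to \<open>v\<close>.\<close>

lemma norm_normalize_diff:
 fixes x v :: "'a :: real_normed_vector"
 assumes "norm v = 1" "norm x = 1" "U \<ge> 0"
 shows "norm (x - v) \<le> 2 * norm (U *\<^sub>R x - v)"
proof -
 have "norm (x - U *\<^sub>R x) = \<bar>1 - U\<bar>" using assms(2) norm_scaleR[of "1 - U" x] by (simp add: scaleR_left_diff_distrib)
 also have "... = \<bar>norm v - norm (U *\<^sub>R x)\<bar>" using assms by simp
 also have "... \<le> norm (U *\<^sub>R x - v)" using norm_triangle_ineq3[of v "U *\<^sub>R x"] by (simp add: norm_minus_commute)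
 finally have "norm (x - U *\<^sub>R x) \<le> norm (U *\<^sub>R x - v)" .
 moreover have "norm (x - v) \<le> norm (x - U *\<^sub>R x) + norm (U *\<^sub>R x - v)"
  using norm_triangle_ineq[of "x - U *\<^sub>R x" "U *\<^sub>R x - v"] by simp
 ultimately show ?thesis by simp
qed

lemma is_projected_diff:
 assumes "is_projected x u" "norm \<theta> = 1"
 shows "norm (u - \<theta>) \<le> 2 * norm (x - \<theta>)"
proof -
 have u: "norm u = 1" using assms(1) by (simp add: is_projected_def)
 have x: "norm x *\<^sub>R u = x"
 proof (cases "x = 0")
  case False
  hence "u = x /\<^sub>R norm x" using assms(1) by (simp add: is_projected_def)
  thus ?thesis using False by simp
 qed simp
 show ?thesis using norm_normalize_diff[OF assms(2) u, of "norm x"] unfolding x by simp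
qed

text \<open>By stationarity \<open>U a - v\<close> is U \<mu> A^-1 a, and A^-1 a has norm at most
  sqrt (w / k). Since U \<mu> sqrt w = \<beta>, the product is \<beta> / sqrt k, which normalisation
  doubles.\<close>

lemma ucb_step_near_estimate:
 assumes st: "ucb_step A \<beta> v a U \<mu>" and A: "spd A" and v: "norm v = 1"
  and k: "k > 0" "\<And>x. k * (norm x)^2 \<le> x \<bullet> (A *v x)"
 shows "norm (a - v) \<le> 2 * \<beta> / sqrt k"
proof -
 define w where "w = a \<bullet> (matrix_inv A *v a)"
 have na: "norm a = 1" and U: "U \<ge> 1" and \<mu>: "\<mu> > 0" and w: "w > 0" and Uw: "U * \<mu> * sqrt w = \<beta>"
  and Ua: "U *\<^sub>R a = v + (U * \<mu>) *\<^sub>R (matrix_inv A *v a)" using st unfolding ucb_step_def w_def by blast+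
 have "k * (norm (matrix_inv A *v a))^2 \<le> w" unfolding w_def by (rule spd_inv_bounds(1)[OF A]) (use k in auto)
 hence "(norm (matrix_inv A *v a))^2 \<le> w / k" using k(1) by (simp add: pos_le_divide_eq mult.commute)
 hence "norm (matrix_inv A *v a) \<le> sqrt w / sqrt k" unfolding real_sqrt_divide[symmetric] by (rule real_le_rsqrt)
 hence "(U * \<mu>) * norm (matrix_inv A *v a) \<le> (U * \<mu>) * (sqrt w / sqrt k)" using U \<mu> by (intro mult_left_mono) auto
 also have "... = \<beta> / sqrt k" using Uw by simp
 finally have "norm (U *\<^sub>R a - v) \<le> \<beta> / sqrt k" using U \<mu> by (simp add: Ua)
 thus ?thesis using norm_normalize_diff[OF v na, of U] U by simp
qed

section \<open>Crude growth of the Gram matrix\<close>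

text \<open>The assumption \<open>near\<close> is all that the crude bounds need to know about the estimates. Optimism
 implies it, and so does an estimation error below \<open>\<beta>\<close>.\<close>

locale ucb_run =
 fixes a v :: "nat \<Rightarrow> real ^ 'n" and \<theta> :: "real ^ 'n" and \<beta> :: real and n :: nat
  and U \<mu> :: "nat \<Rightarrow> real" and d :: real
 assumes d: "d = real CARD('n)" and dim: "CARD('n) \<ge> 2" and \<theta>: "norm \<theta> = 1" and \<beta>: "\<beta> > 0"
  and step: "\<And>t. t < n \<Longrightarrow> ucb_step (gram a t) \<beta> (v t) (a (Suc t)) (U t) (\<mu> t)"
  and near: "\<And>t k. t < n \<Longrightarrow> k > 0 \<Longrightarrow> (\<And>x. k * (norm x)^2 \<le> x \<bullet> (gram a t *v x)) \<Longrightarrow>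
   (norm (a (Suc t) - \<theta>))\<^sup>2 \<le> 16 * \<beta>^2 / k"
begin

definition w :: "nat \<Rightarrow> real" where
 "w t = a (Suc t) \<bullet> (matrix_inv (gram a t) *v a (Suc t))"

definition y :: "nat \<Rightarrow> real ^ 'n" where "y t = a t - (a t \<bullet> \<theta>) *\<^sub>R \<theta>"

text \<open>The trace of the Gram matrix on the complement of \<theta>; the summand
  \<open>d - 1\<close> comes from the regularising identity matrix.\<close>

definition tr_perp :: "nat \<Rightarrow> real" where
 "tr_perp t = d - 1 + (\<Sum>s=1..t. (norm (y s))^2)"

definition mineig :: "nat \<Rightarrow> real" where "mineig t = eigval (gram a t) CARD('n)"

definition D :: "nat \<Rightarrow> real" where "D t = det (gram a t)"

lemma stepD:
 assumes "t < n"
 shows "norm (a (Suc t)) = 1" "1 \<le> U t" "0 < \<mu> t" "0 < w t" "U t \<le> 1 + \<beta> * sqrt (w t)"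
  "U t * \<mu> t * sqrt (w t) = \<beta>" "\<mu> t * (norm h)^2 \<le> h \<bullet> (gram a t *v h)"
  "U t *\<^sub>R a (Suc t) = v t + (U t * \<mu> t) *\<^sub>R (matrix_inv (gram a t) *v a (Suc t))"
 using step[OF assms] unfolding ucb_step_def w_def by blast+

lemma norm_a: "t \<in> {1..n} \<Longrightarrow> norm (a t) = 1" using stepD(1)[of "t - 1"] by auto

lemma theta_inner: "\<theta> \<bullet> \<theta> = 1" using \<theta> by (simp add: dot_square_norm)

lemma norm_y: "(norm (y t))^2 = (norm (a t))^2 - (a t \<bullet> \<theta>)^2" unfolding y_def norm_diff_squared by (simp add: \<theta> power2_eq_square)

lemma norm_y_le: "t < n \<Longrightarrow> (norm (y (Suc t)))\<^sup>2 \<le> (norm (a (Suc t) - \<theta>))^2"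
proof -
 assume t: "t < n"
 have "0 \<le> (1 - a (Suc t) \<bullet> \<theta>)^2" by simp
 thus ?thesis unfolding norm_y norm_diff_squared stepD(1)[OF t] \<theta> by (simp add: power2_eq_square algebra_simps)
qed

lemma norm_y_le_1: "t < n \<Longrightarrow> (norm (y (Suc t)))\<^sup>2 \<le> 1" using stepD(1)[of t] by (simp add: norm_y)

lemma y_le:
 "t < n \<Longrightarrow> k > 0 \<Longrightarrow> (\<And>x. k * (norm x)^2 \<le> x \<bullet> (gram a t *v x)) \<Longrightarrow>
  (norm (y (Suc t)))\<^sup>2 \<le> 16 * \<beta>^2 / k" by (rule order_trans[OF norm_y_le near])

lemma tr_perp_Suc: "tr_perp (Suc t) = tr_perp t + (norm (y (Suc t)))^2" by (simp add: tr_perp_def)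

lemma tr_perp_ge_1: "1 \<le> tr_perp t"
proof -
 have "d - 1 \<le> tr_perp t" by (simp add: tr_perp_def sum_nonneg)
 thus ?thesis using dim d by linarith
qed

lemma tr_perp_le: "t \<le> n \<Longrightarrow> tr_perp t \<le> d + real t"
proof (induction t)
 case (Suc t)
 thus ?case using norm_y_le_1[of t] by (simp add: tr_perp_Suc)
qed (simp add: tr_perp_def)

lemma form_perp_le: "x \<bullet> \<theta> = 0 \<Longrightarrow> x \<bullet> (gram a t *v x) \<le> tr_perp t * (norm x)^2"
proof -
 assume x: "x \<bullet> \<theta> = 0"
 have "(\<Sum>s=1..t. (a s \<bullet> x)^2) \<le> (\<Sum>s=1..t. (norm (y s))^2 * (norm x)^2)"
 proof (rule sum_mono)
  fix s
  have "a s \<bullet> x = y s \<bullet> x" using x inner_commute[of x \<theta>] by (simp add: y_def inner_diff_left)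
  thus "(a s \<bullet> x)^2 \<le> (norm (y s))^2 * (norm x)^2" using Cauchy_Schwarz_ineq[of "y s" x] by (simp add: power2_norm_eq_inner)
 qed
 moreover have "(norm x)^2 \<le> (d - 1) * (norm x)^2" using dim d mult_right_mono[of 1 "d - 1" "(norm x)^2"] by simp
 ultimately show ?thesis by (simp add: gram_form tr_perp_def distrib_right sum_distrib_right)
qed

lemma d2: "d \<ge> 2" using d dim by simp

lemma card_m1: "real (CARD('n) - 1) = d - 1" and card_p1: "real (CARD('n) + 1) = d + 1" using d dim by (simp_all add: of_nat_diff)

lemma card_m1_times: "real (CARD('n) - 1) * (2 / (d - 1)) = 2" unfolding card_m1 using d2 by (simp add: field_simps)

lemma gram_sym: "transpose (gram a t) = gram a t" by (rule spd_sym[OF spd_gram])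

lemma form_le: "t \<le> n \<Longrightarrow> x \<bullet> (gram a t *v x) \<le> (1 + real t) * (norm x)^2"
proof -
 assume t: "t \<le> n"
 have "(\<Sum>s=1..t. (a s \<bullet> x)^2) \<le> (\<Sum>s=1..t. (norm x)^2)"
 proof (rule sum_mono)
  fix s assume "s \<in> {1..t}"
  hence "norm (a s) = 1" using t norm_a by auto
  thus "(a s \<bullet> x)^2 \<le> (norm x)^2" using Cauchy_Schwarz_ineq[of "a s" x] by (simp add: dot_square_norm)
 qed
 thus ?thesis by (simp add: gram_form distrib_right)
qed

lemma eigval_ge_1: "i \<in> {1..CARD('n)} \<Longrightarrow> 1 \<le> eigval (gram a t) i" by (rule eigval_ge[OF gram_sym]) (auto simp: gram_ge)

lemma eigval_1_le: "t \<le> n \<Longrightarrow> i \<in> {1..CARD('n)} \<Longrightarrow> eigval (gram a t) i \<le> 1 + real t"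
 using dim by (intro eigval_le_on_subspace[OF gram_sym, of _ UNIV]) (auto simp: form_le)

lemma dim_perp: "dim {x. x \<bullet> \<theta> = 0} = CARD('n) - 1"
proof -
 have "{x. x \<bullet> \<theta> = 0} = {x. \<theta> \<bullet> x = 0}" by (simp add: inner_commute)
 moreover have "\<theta> \<noteq> 0" using \<theta> by auto
 ultimately show ?thesis using dim_hyperplane[of \<theta>] by simp
qed

lemma eigval_perp_le:
 assumes k: "\<And>x. x \<bullet> \<theta> = 0 \<Longrightarrow> x \<bullet> (gram a t *v x) \<le> k * (norm x)^2" and i: "i \<in> {2..CARD('n)}"
 shows "eigval (gram a t) i \<le> k"
proof (rule eigval_le_on_subspace[OF gram_sym, of _ "{x. x \<bullet> \<theta> = 0}"])
 show "subspace {x. x \<bullet> \<theta> = 0}" by (simp add: subspace_def inner_add_left)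
qed (use i k dim in \<open>auto simp: dim_perp\<close>)

lemma mineig_form: "mineig t * (norm x)^2 \<le> x \<bullet> (gram a t *v x)" unfolding mineig_def by (rule eigval_min_form[OF gram_sym])

lemma mineig_ge: "(\<And>x. k * (norm x)^2 \<le> x \<bullet> (gram a t *v x)) \<Longrightarrow> k \<le> mineig t"
 unfolding mineig_def using dim by (intro eigval_ge[OF gram_sym]) auto

lemma mineig_ge_1: "1 \<le> mineig t" by (rule mineig_ge) (simp add: gram_ge)

lemma mineig_mono: "s \<le> t \<Longrightarrow> mineig s \<le> mineig t" by (rule mineig_ge) (meson gram_mono mineig_form order_trans)

lemma mu_le_mineig: "t < n \<Longrightarrow> \<mu> t \<le> mineig t" by (rule mineig_ge) (rule stepD(7))

lemma mineig_le_tr_perp: "mineig t \<le> tr_perp t" unfolding mineig_def using dim by (intro eigval_perp_le form_perp_le) auto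

lemma w_le: "t < n \<Longrightarrow> mineig t * w t \<le> 1"
 using spd_inv_bounds(2)[OF spd_gram, of "mineig t" a t "a (Suc t)"] mineig_form mineig_ge_1[of t] by (simp add: stepD(1) w_def)

lemma w_le_1: "t < n \<Longrightarrow> w t \<le> 1"
 using w_le[of t] mineig_ge_1[of t] stepD(4)[of t] mult_right_mono[of 1 "mineig t" "w t"] by linarith

lemma D_prod: "D t = (\<Prod>i=1..CARD('n). eigval (gram a t) i)" unfolding D_def by (rule det_eq_prod_eigval[OF gram_sym])

lemma split_prod: "(\<Prod>i=1..CARD('n). f i) = f 1 * (\<Prod>i=2..CARD('n). (f i :: real))"
proof -
 have "{1..CARD('n)} = insert 1 {2..CARD('n)}" using dim by auto
 thus ?thesis by simp
qed

lemma D_ge_1: "1 \<le> D t" unfolding D_prod by (rule prod_ge_1) (rule eigval_ge_1)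

lemma D_Suc: "D (Suc t) = D t * (1 + w t)" unfolding D_def w_def by (rule det_gram_Suc)

text \<open>The leading eigenvalue is at least the mean of all eigenvalues, which is 1 + t / d, and
  the others are at least \<open>k\<close>.\<close>

lemma D_ge:
 assumes t: "t \<le> n" and k: "0 \<le> k" "\<And>x. k * (norm x)^2 \<le> x \<bullet> (gram a t *v x)"
 shows "(real t / d) * k ^ (CARD('n) - 1) \<le> D t"
proof -
 have "d + real t = trace (gram a t)" using t by (simp add: trace_gram norm_a d)
 also have "... = (\<Sum>i=1..CARD('n). eigval (gram a t) i)" by (rule trace_eq_sum_eigval[OF gram_sym])
 also have "... \<le> (\<Sum>i=1..CARD('n). eigval (gram a t) 1)" by (intro sum_mono eigval_antimono[OF gram_sym]) auto
 finally have e1: "real t / d \<le> eigval (gram a t) 1" using dim by (simp add: d field_simps)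
 have "k ^ (CARD('n) - 1) = (\<Prod>i=2..CARD('n). k)" by simp
 also have "... \<le> (\<Prod>i=2..CARD('n). eigval (gram a t) i)" by (intro prod_mono) (auto intro!: k eigval_ge[OF gram_sym])
 finally have "k ^ (CARD('n) - 1) \<le> (\<Prod>i=2..CARD('n). eigval (gram a t) i)" .
 moreover have "0 \<le> eigval (gram a t) 1" using eigval_ge_1[of 1 t] dim by simp
 ultimately show ?thesis unfolding D_prod split_prod using k e1 by (intro mult_mono) auto
qed

lemma D_le:
 assumes t: "t \<le> n"
 shows "D t \<le> (1 + real t) * tr_perp t ^ (CARD('n) - 1)"
proof -
 have "(\<Prod>i=2..CARD('n). eigval (gram a t) i) \<le> (\<Prod>i=2..CARD('n). tr_perp t)"
 proof (intro prod_mono conjI)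
  fix i assume i: "i \<in> {2..CARD('n)}"
  show "0 \<le> eigval (gram a t) i" using eigval_ge_1[of i t] i by simp
  show "eigval (gram a t) i \<le> tr_perp t" by (rule eigval_perp_le[OF form_perp_le i])
 qed
 moreover have "0 \<le> (\<Prod>i=2..CARD('n). eigval (gram a t) i)"
 proof (rule prod_nonneg)
  fix i assume "i \<in> {2..CARD('n)}"
  thus "0 \<le> eigval (gram a t) i" using eigval_ge_1[of i t] by simp
 qed
 moreover have "eigval (gram a t) 1 \<le> 1 + real t" using eigval_1_le[OF t, of 1] dim by simp
 ultimately show ?thesis unfolding D_prod split_prod by (intro mult_mono) auto
qed

text \<open>The least eigenvalue is kept as a separate factor: a lower bound for the determinant and
  an upper bound for \<open>tr_perp\<close> then combine to a lower bound for
  \<open>mineig\<close>.\<close>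

lemma D_le_mineig:
 assumes t: "t \<le> n"
 shows "D t \<le> (1 + real t) * tr_perp t ^ (CARD('n) - 2) * mineig t"
proof -
 have s: "(\<Prod>i=2..CARD('n). eigval (gram a t) i) = (\<Prod>i=2..<CARD('n). eigval (gram a t) i) * mineig t"
 proof -
  have "{2..CARD('n)} = insert CARD('n) {2..<CARD('n)}" using dim by auto
  thus ?thesis by (simp add: mineig_def)
 qed
 have "(\<Prod>i=2..<CARD('n). eigval (gram a t) i) \<le> (\<Prod>i=2..<CARD('n). tr_perp t)"
 proof (intro prod_mono conjI)
  fix i assume i: "i \<in> {2..<CARD('n)}"
  show "0 \<le> eigval (gram a t) i" using eigval_ge_1[of i t] i by simp
  show "eigval (gram a t) i \<le> tr_perp t" by (rule eigval_perp_le[OF form_perp_le]) (use i in auto)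
 qed
 moreover have "0 \<le> (\<Prod>i=2..<CARD('n). eigval (gram a t) i)"
 proof (rule prod_nonneg)
  fix i assume "i \<in> {2..<CARD('n)}"
  thus "0 \<le> eigval (gram a t) i" using eigval_ge_1[of i t] by simp
 qed
 moreover have "eigval (gram a t) 1 \<le> 1 + real t" using eigval_1_le[OF t, of 1] dim by simp
 moreover have "0 \<le> tr_perp t" using tr_perp_ge_1[of t] by linarith
 ultimately have "eigval (gram a t) 1 * (\<Prod>i=2..<CARD('n). eigval (gram a t) i)
   \<le> (1 + real t) * tr_perp t ^ (CARD('n) - 2)" by (intro mult_mono) auto
 hence "eigval (gram a t) 1 * (\<Prod>i=2..<CARD('n). eigval (gram a t) i) * mineig t
   \<le> (1 + real t) * tr_perp t ^ (CARD('n) - 2) * mineig t" using mineig_ge_1[of t] by (intro mult_right_mono) auto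
 thus ?thesis unfolding D_prod split_prod s by (simp add: mult.assoc)
qed

lemma D_le_pow: "t \<le> n \<Longrightarrow> D t \<le> (1 + real t) ^ CARD('n)"
proof -
 assume t: "t \<le> n"
 have "D t \<le> (\<Prod>i=1..CARD('n). 1 + real t)" unfolding D_prod using eigval_1_le[OF t] eigval_ge_1
  by (intro prod_mono conjI) (auto intro: order_trans[OF zero_le_one])
 thus ?thesis by simp
qed

lemma half_w_le_ln: "t < n \<Longrightarrow> w t / 2 \<le> ln (1 + w t)"
proof -
 assume t: "t < n"
 have w: "0 < w t" "w t \<le> 1" using stepD(4)[OF t] w_le_1[OF t] .
 have "ln (1 / (1 + w t)) \<le> 1 / (1 + w t) - 1" by (rule ln_le_minus_one) (use w in simp)
 hence "w t / (1 + w t) \<le> ln (1 + w t)" using w by (simp add: ln_div field_simps)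
 moreover have "w t / 2 \<le> w t / (1 + w t)" using w by (intro divide_left_mono) auto
 ultimately show ?thesis by linarith
qed

text \<open>The elliptical potential bound: \<open>ln (D t)\<close> telescopes into the terms ln (1
  + w), each at least w / 2 because w \<le> 1.\<close>

lemma sum_w_le: "t \<le> n \<Longrightarrow> (\<Sum>s<t. w s) \<le> 2 * ln (D t)"
proof (induction t)
 case 0
 thus ?case using D_ge_1[of 0] by simp
next
 case (Suc t)
 have "ln (D (Suc t)) = ln (D t) + ln (1 + w t)"
  unfolding D_Suc using D_ge_1[of t] stepD(4)[of t] Suc.prems by (intro ln_mult_pos) auto
 thus ?case using Suc half_w_le_ln[of t] by simp
qed

text \<open>As long as the multiplier is below \<beta>^2, the relation U \<mu> sqrt w = \<beta>
  together with U \<le> 1 + \<beta> sqrt w leaves no room for a small \<open>w\<close>.\<close>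

lemma w_lower_small: "t < n \<Longrightarrow> mineig t < \<beta>^2 \<Longrightarrow> 1 / (4 * \<beta>^2) \<le> w t"
proof -
 assume t: "t < n" and m: "mineig t < \<beta>^2"
 define z where "z = \<beta> * sqrt (w t)"
 note s = stepD[OF t]
 have z: "z > 0" using s(4) \<beta> by (simp add: z_def)
 have "\<beta> * 1 = U t * (\<mu> t * sqrt (w t))" using s(6) by simp
 also have "... \<le> (1 + z) * (\<beta>^2 * sqrt (w t))" using s m mu_le_mineig[OF t] z by (intro mult_mono) (auto simp: z_def)
 also have "... = \<beta> * ((1 + z) * z)" by (simp add: z_def power2_eq_square)
 finally have 1: "1 \<le> (1 + z) * z" using \<beta> by (simp only: mult_le_cancel_left_pos)
 have "1 / 2 \<le> z"
 proof (rule ccontr)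
  assume "\<not> 1 / 2 \<le> z"
  hence "(1 + z) * z \<le> (1 + 1 / 2) * (1 / 2)" using z by (intro mult_mono) auto
  thus False using 1 by simp
 qed
 hence "(1 / 2)^2 \<le> z^2" by (intro power_mono) auto
 moreover have "z^2 = \<beta>^2 * w t" using s(4) by (simp add: z_def power_mult_distrib)
 ultimately have "1 / 4 \<le> \<beta>^2 * w t" by (simp add: power2_eq_square)
 thus ?thesis using \<beta> by (simp add: field_simps)
qed

text \<open>While the least eigenvalue is below \<beta>^2, every round adds at least 1 / (4
  \<beta>^2) to the sum of the \<open>w\<close>, but that sum is at most logarithmic in the number
  of rounds.\<close>

lemma mineig_ge_beta:
 assumes t: "t \<le> n" and \<beta>1: "\<beta> \<ge> 1" and tb: "real t \<ge> (64 * d)^2 * \<beta> ^ 3"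
 shows "\<beta>^2 \<le> mineig t"
proof (rule ccontr)
 assume "\<not> \<beta>\<^sup>2 \<le> mineig t"
 hence m: "mineig s < \<beta>^2" if "s \<le> t" for s using mineig_mono[OF that] by simp
 have d2: "d \<ge> 2" using d dim by simp
 \<comment> \<open>ln (1 + t) = 4 ln q \<le> 4 (q - 1), and the factor \<open>q - 1\<close> cancels
   against t = q^4 - 1. What remains bounds t by order (d \<beta>^2)^(4/3), which is below the
   threshold of order \<beta>^3.\<close>
 define q where "q = root 4 (1 + real t)"
 have q: "q ^ 4 = 1 + real t" by (simp add: q_def)
 have tpos: "real t > 0"
 proof -
  have "0 < (64 * d)^2 * \<beta> ^ 3" using d2 \<beta>1 by simp
  thus ?thesis using tb by linarith
 qed
 have q1: "q > 1" unfolding q_def using tpos by simp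
 have "real t / (4 * \<beta>^2) = (\<Sum>s<t. 1 / (4 * \<beta>^2))" by simp
 also have "... \<le> (\<Sum>s<t. w s)" by (intro sum_mono w_lower_small m) (use t in auto)
 also have "... \<le> 2 * ln (D t)" by (rule sum_w_le[OF t])
 also have "... \<le> 2 * ln ((1 + real t) ^ CARD('n))" using D_le_pow[OF t] D_ge_1[of t] by simp
 also have "... = 2 * d * ln (1 + real t)" by (simp add: ln_realpow d)
 also have "... = 8 * d * ln q" unfolding q[symmetric] using q1 by (simp add: ln_realpow)
 also have "... \<le> 8 * d * (q - 1)" using ln_le_minus_one[of q] q1 d2 by simp
 finally have "real t \<le> 32 * d * \<beta>^2 * (q - 1)" using \<beta> by (simp add: field_simps)
 moreover have "(q - 1) * q ^ 3 \<le> real t"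
 proof -
  have "real t = (q - 1) * (q ^ 3 + q^2 + q + 1)" using q by algebra
  moreover have "(q - 1) * q ^ 3 \<le> (q - 1) * (q ^ 3 + q^2 + q + 1)"
   using q1 by (intro mult_left_mono) (auto intro: add_nonneg_nonneg)
  ultimately show ?thesis by simp
 qed
 ultimately have "(q - 1) * q ^ 3 \<le> (q - 1) * (32 * d * \<beta>^2)" by (simp add: mult.commute)
 hence q3: "q ^ 3 \<le> 32 * d * \<beta>^2" using q1 by simp
 have "(real t) ^ 3 \<le> (q ^ 4) ^ 3" unfolding q by (intro power_mono) auto
 also have "... = (q ^ 3) ^ 4" by (simp flip: power_mult)
 also have "... \<le> (32 * d * \<beta>^2) ^ 4" using q3 q1 by (intro power_mono) auto
 also have "... = (32 * d) ^ 4 * \<beta> ^ 8" by (simp add: power_mult_distrib flip: power_mult)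
 also have "... < (64 * d) ^ 4 * \<beta> ^ 8" using d2 \<beta> by (intro mult_strict_right_mono power_strict_mono) auto
 also have "... \<le> (64 * d) ^ 6 * \<beta> ^ 9" using d2 \<beta>1 by (intro mult_mono power_increasing) auto
 also have "... = ((64 * d)^2 * \<beta> ^ 3) ^ 3" by (simp add: power_mult_distrib flip: power_mult)
 also have "... \<le> (real t) ^ 3" using tb d2 \<beta> by (intro power_mono) auto
 finally show False by simp
qed

section \<open>Growth of the determinant once the least eigenvalue has reached \<beta>^2\<close>

lemma late_step:
 assumes t: "t < n" and m: "\<beta>^2 \<le> mineig t"
 shows "U t \<le> 2" "\<beta> \<le> 2 * \<mu> t * sqrt (w t)"
proof -
 note s = stepD[OF t]
 have "\<beta>^2 * w t \<le> mineig t * w t" using m s(4) by (intro mult_right_mono) auto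
 also have "... \<le> 1" by (rule w_le[OF t])
 finally have "(\<beta> * sqrt (w t))^2 \<le> 1^2" using s(4) by (simp add: power_mult_distrib)
 hence "\<beta> * sqrt (w t) \<le> 1" by (rule power2_le_imp_le) simp
 thus U: "U t \<le> 2" using s(5) by linarith
 have "U t * (\<mu> t * sqrt (w t)) \<le> 2 * (\<mu> t * sqrt (w t))" using U s by (intro mult_right_mono) auto
 thus "\<beta> \<le> 2 * \<mu> t * sqrt (w t)" using s(6) by (simp add: mult.assoc)
qed

text \<open>The exponent \<open>e\<close> turns \<mu>^(d-1) into \<mu>^2. As D is at least (t / d)
  \<mu>^(d-1) and \<mu>^2 w is at least \<beta>^2 / 4, the unknown \<mu> cancels and the power of D
  gains a known amount.\<close>

lemma D_powr_step:
 assumes t: "t < n" "1 \<le> t" and m: "\<beta>^2 \<le> mineig t"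
 defines "e \<equiv> 2 / (d - 1)"
 shows "D t powr e + \<beta>^2 / (4 * (d - 1)) * (real t / d) powr e \<le> D (Suc t) powr e"
proof -
 note s = stepD[OF t(1)]
 have e: "e > 0" using d2 by (simp add: e_def)
 have "\<beta>^2 \<le> (2 * \<mu> t * sqrt (w t))^2" using late_step(2)[OF t(1) m] \<beta> by (intro power_mono) auto
 hence b: "\<beta>^2 / 4 \<le> (\<mu> t)^2 * w t" using s(4) by (simp add: power_mult_distrib)
 have "(real t / d) powr e * (\<mu> t)^2 = ((real t / d) * \<mu> t ^ (CARD('n) - 1)) powr e"
 proof -
  have "(\<mu> t ^ (CARD('n) - 1)) powr e = \<mu> t powr (real (CARD('n) - 1) * e)"
   using s(3) by (simp add: powr_realpow[symmetric] powr_powr)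
  also have "real (CARD('n) - 1) * e = 2" unfolding e_def by (rule card_m1_times)
  finally have "(\<mu> t ^ (CARD('n) - 1)) powr e = (\<mu> t)^2" using s(3) by (simp add: powr_numeral)
  thus ?thesis using s(3) d2 by (subst powr_mult) auto
 qed
 also have "... \<le> D t powr e" using e s(3) d2 t by (intro powr_mono2 D_ge s(7)) auto
 finally have 1: "(real t / d) powr e * (\<mu> t)^2 \<le> D t powr e" .
 have "e * (w t / 2) \<le> e * ln (1 + w t)" using e half_w_le_ln[OF t(1)] by (intro mult_left_mono) auto
 also have "... \<le> (1 + w t) powr e - 1"
  using s(4) exp_ge_add_one_self[of "e * ln (1 + w t)"] unfolding powr_def by (simp del: exp_ge_add_one_self)
 finally have "e * (w t / 2) \<le> (1 + w t) powr e - 1" .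
 moreover have "e * (w t / 2) = w t / (d - 1)" using d2 by (simp add: e_def field_simps)
 ultimately have 2: "1 + w t / (d - 1) \<le> (1 + w t) powr e" by linarith
 have "\<beta>^2 / (4 * (d - 1)) * (real t / d) powr e = (\<beta>^2 / 4) * ((real t / d) powr e / (d - 1))" by simp
 also have "... \<le> ((\<mu> t)^2 * w t) * ((real t / d) powr e / (d - 1))" using b d2 by (intro mult_right_mono) auto
 also have "... = ((real t / d) powr e * (\<mu> t)^2) * (w t / (d - 1))" by simp
 also have "... \<le> D t powr e * (w t / (d - 1))" using 1 s(4) d2 by (intro mult_right_mono) auto
 finally have "D t powr e + \<beta>^2 / (4 * (d - 1)) * (real t / d) powr e \<le> D t powr e * (1 + w t / (d - 1))"
  by (simp add: distrib_left)
 also have "... \<le> D t powr e * (1 + w t) powr e" using 2 by (intro mult_left_mono) auto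
 also have "... = D (Suc t) powr e" unfolding D_Suc using D_ge_1[of t] s(4) by (subst powr_mult) auto
 finally show ?thesis .
qed

definition \<delta> :: real where "\<delta> = 1 / (4 * d)"

lemma \<delta>: "0 < \<delta>" "\<delta> \<le> 1" using d2 by (auto simp: \<delta>_def)

lemma D_lower:
 assumes t: "t \<le> n" "2 * t0 \<le> t" "2 \<le> t" and m: "\<beta>^2 \<le> mineig t0"
 shows "\<delta> * real t * (\<delta> * \<beta> * sqrt (real t)) ^ (CARD('n) - 1) \<le> D t"
proof -
 define e where "e = 2 / (d - 1)"
 have e: "e > 0" using d2 by (simp add: e_def)
 \<comment> \<open>Only the second half of the rounds is summed: it lies after \<open>t0\<close>,
   its increments are at least the one at \<open>h\<close>, and it has at least t / 4
   rounds.\<close>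
 define h where "h = (t + 1) div 2"
 have h: "t0 \<le> h" "1 \<le> h" "real t / 2 \<le> real h" "real t / 4 \<le> real t - real h" "h \<le> t" using t by (auto simp: h_def)
 define K where "K = \<beta>^2 / (4 * (d - 1)) * (real h / d) powr e"
 have K: "K \<ge> 0" using d2 by (simp add: K_def)
 have mh: "\<beta>^2 \<le> mineig s" if "h \<le> s" for s using m mineig_mono[of t0 s] h(1) that by linarith
 have "h + k \<le> n \<Longrightarrow> real k * K \<le> D (h + k) powr e" for k
 proof (induction k)
  case (Suc k)
  have "real (Suc k) * K = real k * K + K" by (simp add: algebra_simps)
  also have "... \<le> D (h + k) powr e + \<beta>^2 / (4 * (d - 1)) * (real (h + k) / d) powr e"
  proof (rule add_mono)
   show "real k * K \<le> D (h + k) powr e" using Suc by simp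
   show "K \<le> \<beta>^2 / (4 * (d - 1)) * (real (h + k) / d) powr e"
    unfolding K_def using d2 e by (intro mult_left_mono powr_mono2 divide_right_mono) auto
  qed
  also have "... \<le> D (Suc (h + k)) powr e" unfolding e_def by (rule D_powr_step) (use Suc.prems h mh in auto)
  finally show ?case by simp
 qed simp
 from this[of "t - h"] have "(real t - real h) * K \<le> D t powr e" using t h by (simp add: of_nat_diff)
 moreover have "real t / 4 * K \<le> (real t - real h) * K" using h K by (intro mult_right_mono) auto
 moreover have "(\<delta> * \<beta> * sqrt (real t))^2 * (\<delta> * real t) powr e \<le> real t / 4 * K"
 proof -
  have "(\<delta> * \<beta> * sqrt (real t))^2 \<le> real t / 4 * (\<beta>^2 / (4 * (d - 1)))"
  proof -
   have "d - 1 \<le> d * d" using d2 mult_mono[of 1 d "d - 1" d] by simp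
   hence "1 / (d * d) \<le> 1 / (d - 1)" using d2 by (intro divide_left_mono) auto
   hence "(real t * \<beta>^2 / 16) * (1 / (d * d)) \<le> (real t * \<beta>^2 / 16) * (1 / (d - 1))" by (intro mult_left_mono) auto
   moreover have "(\<delta> * \<beta> * sqrt (real t))^2 = (real t * \<beta>^2 / 16) * (1 / (d * d))"
    by (simp add: \<delta>_def power_mult_distrib power_divide) (simp add: power2_eq_square)
   moreover have "real t / 4 * (\<beta>^2 / (4 * (d - 1))) = (real t * \<beta>^2 / 16) * (1 / (d - 1))" using d2 by (simp add: field_simps)
   ultimately show ?thesis by simp
  qed
  moreover have "(\<delta> * real t) powr e \<le> (real h / d) powr e"
  proof (rule powr_mono2)
   have "\<delta> * real t = real t / 4 / d" by (simp add: \<delta>_def)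
   also have "... \<le> real h / d" using h d2 by (intro divide_right_mono) auto
   finally show "\<delta> * real t \<le> real h / d" .
  qed (use e \<delta> in auto)
  ultimately have "(\<delta> * \<beta> * sqrt (real t))^2 * (\<delta> * real t) powr e
    \<le> (real t / 4 * (\<beta>^2 / (4 * (d - 1)))) * (real h / d) powr e" by (intro mult_mono) (use d2 in auto)
  thus ?thesis by (simp add: K_def)
 qed
 ultimately have 1: "(\<delta> * \<beta> * sqrt (real t))^2 * (\<delta> * real t) powr e \<le> D t powr e" by linarith
 define x where "x = \<delta> * \<beta> * sqrt (real t)"
 have x: "x > 0" using \<delta> \<beta> t by (simp add: x_def)
 have "x^2 = (x ^ (CARD('n) - 1)) powr e"
 proof -
  have "(x ^ (CARD('n) - 1)) powr e = x powr (real (CARD('n) - 1) * e)" using x by (simp add: powr_realpow[symmetric] powr_powr)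
  also have "real (CARD('n) - 1) * e = 2" unfolding e_def by (rule card_m1_times)
  finally show ?thesis using x by (simp add: powr_numeral)
 qed
 hence "(\<delta> * real t * x ^ (CARD('n) - 1)) powr e = x^2 * (\<delta> * real t) powr e" using x \<delta> by (subst powr_mult) auto
 with 1 have "(\<delta> * real t * x ^ (CARD('n) - 1)) powr e \<le> D t powr e" by (simp only: x_def)
 hence 3: "((\<delta> * real t * x ^ (CARD('n) - 1)) powr e) powr (1 / e) \<le> (D t powr e) powr (1 / e)"
  by (rule powr_mono2[rotated 2]) (use e in auto)
 have "0 \<le> \<delta> * real t * x ^ (CARD('n) - 1)" using x \<delta> by simp
 hence "\<delta> * real t * x ^ (CARD('n) - 1) \<le> D t" using 3 e D_ge_1[of t] unfolding powr_powr by simp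
 thus ?thesis by (simp only: x_def)
qed

text \<open>In one round \<open>tr_perp\<close> grows by \<open>O(\<beta> \<surd>w)\<close> and \<open>D\<close> by the factor \<open>1 + w\<close>, so that by completing
 the square in \<open>\<surd>w\<close> the potential \<open>Y\<close> grows by \<open>O(\<beta>\<^sup>2 / D powr g)\<close> only.\<close>

definition g :: real where "g = 1 / (d + 1)"
definition Y :: "nat \<Rightarrow> real" where "Y t = (tr_perp t)^2 / D t powr g"
definition KE :: real where "KE = 2048 * (d + 1) * exp (2048 * (d + 1))"

lemma Y_step:
 assumes t: "t < n" and m: "\<beta>^2 \<le> mineig t"
 shows "Y (Suc t) \<le> Y t + KE * \<beta>^2 / D t powr g"
proof -
 note s = stepD[OF t]
 have g: "g > 0" using d2 by (simp add: g_def)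
 define T where "T = tr_perp t"
 \<comment> \<open>\<open>b\<close> is at most one because T is at least 1 and at least \<beta>^2;
   this permits linearising the exponential of \<open>K * b^2\<close> below.\<close>
 define b where "b = \<beta> / T"
 define r where "r = sqrt (w t)"
 define K where "K = 2048 * (d + 1)"
 have K: "K > 0" using d2 by (simp add: K_def)
 have r: "r > 0" using s(4) by (simp add: r_def)
 have T: "T \<ge> 1" "T \<ge> \<beta>^2" using tr_perp_ge_1[of t] mineig_le_tr_perp[of t] m by (auto simp: T_def)
 have b: "b > 0" using \<beta> T by (simp add: b_def)
 have b1: "b^2 \<le> 1"
 proof -
  have "\<beta>^2 * 1 \<le> T * T" using T by (intro mult_mono) auto
  thus ?thesis using T by (simp add: b_def power_divide power2_eq_square)
 qed
 have "(norm (y (Suc t)))^2 \<le> 16 * \<beta>^2 / \<mu> t" by (rule y_le[OF t s(3) s(7)])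
 also have "... = 16 * \<beta> * (\<beta> / \<mu> t)" by (simp add: power2_eq_square)
 also have "... \<le> 16 * \<beta> * (2 * r)"
  using late_step(2)[OF t m] s(3) \<beta> by (intro mult_left_mono) (auto simp: r_def divide_le_eq mult.commute mult.left_commute)
 finally have "tr_perp (Suc t) \<le> T * (1 + 32 * b * r)" using T by (simp add: tr_perp_Suc T_def[symmetric] b_def distrib_left)
 also have "... \<le> T * exp (32 * b * r)" using T by (intro mult_left_mono exp_ge_add_one_self) auto
 finally have "(tr_perp (Suc t))^2 \<le> (T * exp (32 * b * r))^2" using tr_perp_ge_1[of "Suc t"] by (intro power_mono) auto
 also have "... = T^2 * exp (64 * b * r)" by (simp add: power_mult_distrib power2_eq_square flip: exp_add)
 finally have 1: "(tr_perp (Suc t))^2 \<le> T^2 * exp (64 * b * r)" .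
 have 2: "D t powr g * exp (g * r^2 / 2) \<le> D (Suc t) powr g"
 proof -
  have "g * (w t / 2) \<le> g * ln (1 + w t)" using g half_w_le_ln[OF t] by (intro mult_left_mono) auto
  hence "exp (g * r^2 / 2) \<le> (1 + w t) powr g" using s(4) by (simp add: powr_def r_def)
  hence "D t powr g * exp (g * r^2 / 2) \<le> D t powr g * (1 + w t) powr g" by (intro mult_left_mono) auto
  also have "... = D (Suc t) powr g" unfolding D_Suc using D_ge_1[of t] s(4) by (subst powr_mult) auto
  finally show ?thesis .
 qed
 have Dp: "D t powr g > 0" using D_ge_1[of t] by simp
 have "Y (Suc t) \<le> (T^2 * exp (64 * b * r)) / (D t powr g * exp (g * r^2 / 2))"
  unfolding Y_def using 1 2 Dp by (intro frac_le) auto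
 also have "... = Y t * exp (64 * b * r - g * r^2 / 2)" by (simp add: Y_def T_def exp_diff)
 also have "... \<le> Y t * exp (K * b^2)"
 proof (intro mult_left_mono)
  have "0 \<le> (g / 2) * (r - 64 * b / g)^2" using g by simp
  also have "... = g * r^2 / 2 - 64 * b * r + 2048 / g * b^2" using g by (simp add: power2_diff field_simps power2_eq_square)
  also have "2048 / g = K" by (simp add: g_def K_def)
  finally show "exp (64 * b * r - g * r^2 / 2) \<le> exp (K * b^2)" by simp
 qed (simp add: Y_def)
 also have "... \<le> Y t * (1 + K * b^2 * exp K)"
 proof (intro mult_left_mono)
  have "exp (K * b^2) \<le> 1 + K * b^2 * exp (K * b^2)"
  proof -
   have "(1 - K * b^2) * exp (K * b^2) \<le> exp (- (K * b^2)) * exp (K * b^2)"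
    using exp_ge_add_one_self[of "- (K * b^2)"] by (intro mult_right_mono) auto
   also have "... = 1" by (simp flip: exp_add)
   finally show ?thesis by (simp add: algebra_simps)
  qed
  also have "... \<le> 1 + K * b^2 * exp K" using K b1 mult_left_mono[OF b1, of K] by (intro add_left_mono mult_left_mono) auto
  finally show "exp (K * b^2) \<le> 1 + K * b^2 * exp K" .
 qed (simp add: Y_def)
 \<comment> \<open>The factor 1 / T^2 in \<open>b^2\<close> cancels the square of
   \<open>tr_perp\<close> in \<open>Y\<close>, so the increment no longer contains
   \<open>tr_perp\<close>.\<close>
 also have "... = Y t + KE * \<beta>^2 / D t powr g"
  using T by (simp add: distrib_left Y_def T_def[symmetric] b_def KE_def K_def power_divide)
 finally show ?thesis .
qed

text \<open>The predicted order of D is t (\<beta> sqrt t)^(d-1); its (d+1)-st root is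
  \<open>B * sqrt t\<close>.\<close>

definition B :: real where "B = \<beta> powr ((d - 1) / (d + 1))"

lemma B: "B > 0" "B ^ (CARD('n) + 1) = \<beta> ^ (CARD('n) - 1)"
proof -
 show "B > 0" using \<beta> by (simp add: B_def)
 have "B ^ (CARD('n) + 1) = B powr (d + 1)" unfolding powr_realpow[OF \<open>B > 0\<close>, symmetric] card_p1 ..
 also have "... = \<beta> powr ((d - 1) / (d + 1) * (d + 1))" by (simp add: B_def powr_powr)
 also have "(d - 1) / (d + 1) * (d + 1) = real (CARD('n) - 1)" using d2 unfolding card_m1 by simp
 finally show "B ^ (CARD('n) + 1) = \<beta> ^ (CARD('n) - 1)" unfolding powr_realpow[OF \<beta>] .
qed

lemma D_powr_lower:
 assumes t: "t \<le> n" "2 * t0 \<le> t" "2 \<le> t" and m: "\<beta>^2 \<le> mineig t0"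
 shows "\<delta> * B * sqrt (real t) \<le> D t powr g"
proof -
 define X where "X = \<delta> * B * sqrt (real t)"
 have X: "X > 0" using \<delta> B t by (simp add: X_def)
 have N: "z ^ (CARD('n) + 1) = z * z * z ^ (CARD('n) - 1)" for z :: real
 proof -
  have "CARD('n) + 1 = Suc (Suc (CARD('n) - 1))" using dim by simp
  thus ?thesis by (simp only: power_Suc mult.assoc)
 qed
 have "X ^ (CARD('n) + 1) = \<delta> ^ (CARD('n) + 1) * \<beta> ^ (CARD('n) - 1) * sqrt (real t) ^ (CARD('n) + 1)"
  unfolding X_def power_mult_distrib B(2) ..
 also have "... = \<delta> * (\<delta> * real t * (\<delta> * \<beta> * sqrt (real t)) ^ (CARD('n) - 1))"
  unfolding N power_mult_distrib by (simp add: mult_ac)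
 also have "... \<le> 1 * (\<delta> * real t * (\<delta> * \<beta> * sqrt (real t)) ^ (CARD('n) - 1))" using \<delta> \<beta> by (intro mult_right_mono) auto
 also have "... \<le> D t" using D_lower[OF t m] by simp
 finally have "(X ^ (CARD('n) + 1)) powr g \<le> D t powr g" using d2 X by (intro powr_mono2) (auto simp: g_def)
 moreover have "(X ^ (CARD('n) + 1)) powr g = X"
 proof -
  have "(X ^ (CARD('n) + 1)) powr g = X powr ((d + 1) * g)" unfolding powr_realpow[OF X, symmetric] powr_powr card_p1 ..
  also have "(d + 1) * g = 1" using d2 by (simp add: g_def)
  finally show ?thesis using X by simp
 qed
 ultimately show ?thesis by (simp add: X_def)
qed

definition C1 :: "real \<Rightarrow> real" where "C1 B2 = 1 + (B2 + 4 * KE) / \<delta>"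

lemma inverse_sqrt_le: "1 \<le> t \<Longrightarrow> 1 / sqrt (real t) \<le> 4 * (sqrt (real (Suc t)) - sqrt (real t))"
proof -
 assume t: "1 \<le> t"
 have "real (Suc t) \<le> 9 * real t" using t by simp
 hence "sqrt (real (Suc t)) \<le> 3 * sqrt (real t)"
  using real_sqrt_le_mono[of "real (Suc t)" "9 * real t"] by (simp add: real_sqrt_mult)
 hence "(sqrt (real (Suc t)) + sqrt (real t)) * (sqrt (real (Suc t)) - sqrt (real t))
   \<le> (4 * sqrt (real t)) * (sqrt (real (Suc t)) - sqrt (real t))" by (intro mult_right_mono) auto
 hence "1 \<le> (4 * sqrt (real t)) * (sqrt (real (Suc t)) - sqrt (real t))" by (simp add: algebra_simps)
 thus ?thesis using t by (simp add: divide_le_eq mult_ac)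
qed

text \<open>Sums \<open>Y_step\<close> from \<open>\<tau>\<close> on: D powr g is at least of order
  B sqrt s, so the increments add up to order sqrt t. The geometric mean of \<open>\<tau>\<close>
  and \<open>t\<close> in the hypothesis on \<open>B2\<close> is chosen so that dividing by D powr g
  at \<open>\<tau>\<close>, of order B sqrt \<tau>, leaves an initial value of the same
  order.\<close>

lemma Y_bound:
 assumes m: "\<beta>^2 \<le> mineig t0" and \<tau>: "2 * t0 \<le> \<tau>" "2 \<le> \<tau>" "\<tau> \<le> t" and t: "t \<le> n"
  and B2: "(tr_perp \<tau>)^2 \<le> B2 * \<beta>^2 * sqrt (real \<tau>) * sqrt (real t)"
 shows "Y t \<le> C1 B2 * \<beta>^2 * sqrt (real t) / B"
proof -
 have KE: "KE > 0" using d2 by (simp add: KE_def)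
 define c where "c = 4 * (KE * \<beta>^2 / (\<delta> * B))"
 have c: "c > 0" using KE \<beta> \<delta> B by (simp add: c_def)
 have ms: "\<beta>^2 \<le> mineig s" if "\<tau> \<le> s" for s using m mineig_mono[of t0 s] \<tau> that by linarith
 have 1: "\<tau> + k \<le> n \<Longrightarrow> Y (\<tau> + k) \<le> Y \<tau> + c * (sqrt (real (\<tau> + k)) - sqrt (real \<tau>))" for k
 proof (induction k)
  case (Suc k)
  have "Y (\<tau> + Suc k) \<le> Y (\<tau> + k) + KE * \<beta>^2 / D (\<tau> + k) powr g" using Y_step[of "\<tau> + k"] ms[of "\<tau> + k"] Suc.prems by simp
  also have "KE * \<beta>^2 / D (\<tau> + k) powr g \<le> KE * \<beta>^2 / (\<delta> * B * sqrt (real (\<tau> + k)))"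
   by (intro divide_left_mono D_powr_lower[OF _ _ _ m] mult_pos_pos)
    (use \<tau> Suc.prems KE \<beta> \<delta> B D_ge_1[of "\<tau> + k"] in auto)
  also have "... = c / 4 * (1 / sqrt (real (\<tau> + k)))" by (simp add: c_def)
  also have "... \<le> c / 4 * (4 * (sqrt (real (Suc (\<tau> + k))) - sqrt (real (\<tau> + k))))"
   using c \<tau> by (intro mult_left_mono inverse_sqrt_le) auto
  finally show ?case using Suc by (simp add: algebra_simps)
 qed simp
 have Dl: "\<delta> * B * sqrt (real \<tau>) \<le> D \<tau> powr g" using \<tau> t by (intro D_powr_lower[OF _ _ _ m]) auto
 have B2p: "B2 \<ge> 0"
 proof -
  have "0 \<le> (tr_perp \<tau>)^2" by simp
  hence "0 \<le> B2 * (\<beta>^2 * sqrt (real \<tau>) * sqrt (real t))" using B2 unfolding mult.assoc by linarith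
  moreover have "0 < \<beta>^2 * sqrt (real \<tau>) * sqrt (real t)" using \<beta> \<tau> by auto
  ultimately show ?thesis by (simp only: zero_le_mult_iff) linarith
 qed
 have "Y \<tau> \<le> (B2 * \<beta>^2 * sqrt (real \<tau>) * sqrt (real t)) / (\<delta> * B * sqrt (real \<tau>))"
  unfolding Y_def by (intro frac_le B2 Dl) (use B2p \<tau> \<delta> B in auto)
 also have "... = (B2 / \<delta>) * (\<beta>^2 * sqrt (real t) / B)" using \<tau> by simp
 finally have "Y \<tau> \<le> (B2 / \<delta>) * (\<beta>^2 * sqrt (real t) / B)" .
 moreover have "Y t \<le> Y \<tau> + c * (sqrt (real t) - sqrt (real \<tau>))" using 1[of "t - \<tau>"] \<tau> t by simp
 moreover have "c * (sqrt (real t) - sqrt (real \<tau>)) \<le> c * sqrt (real t)" using c by simp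
 moreover have "c * sqrt (real t) = (4 * KE / \<delta>) * (\<beta>^2 * sqrt (real t) / B)" by (simp add: c_def)
 moreover have "0 \<le> \<beta>^2 * sqrt (real t) / B" using B by simp
 moreover have "C1 B2 * \<beta>^2 * sqrt (real t) / B = \<beta>^2 * sqrt (real t) / B +
   (B2 / \<delta>) * (\<beta>^2 * sqrt (real t) / B) + (4 * KE / \<delta>) * (\<beta>^2 * sqrt (real t) / B)"
  by (simp add: C1_def add_divide_distrib distrib_right)
 ultimately show ?thesis by linarith
qed

text \<open>The square of \<open>tr_perp\<close> is Y times D powr g, and D is at most (1 + t)
  tr_perp^(d-1). The (d+1)-st power of the identity thus bounds tr_perp^(2d+2) by Y^(d+1) (1 + t)
  tr_perp^(d-1); cancelling leaves d + 3 factors \<open>tr_perp\<close> on the left.\<close>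

lemma tr_perp_upper:
 assumes m: "\<beta>^2 \<le> mineig t0" and \<tau>: "2 * t0 \<le> \<tau>" "2 \<le> \<tau>" "\<tau> \<le> t" and t: "t \<le> n"
  and B2: "B2 \<ge> 0" "(tr_perp \<tau>)^2 \<le> B2 * \<beta>^2 * sqrt (real \<tau>) * sqrt (real t)"
 shows "tr_perp t \<le> 2 * C1 B2 * \<beta> * sqrt (real t)"
proof -
 define T where "T = tr_perp t"
 define N where "N = CARD('n)"
 have T: "T \<ge> 1" using tr_perp_ge_1 by (simp add: T_def)
 have N: "N \<ge> 2" using dim by (simp add: N_def)
 have KE: "KE > 0" using d2 by (simp add: KE_def)
 have C: "C1 B2 \<ge> 1" using B2 KE \<delta> by (simp add: C1_def)
 have Dp: "D t powr g > 0" using D_ge_1[of t] by simp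
 have DN: "(D t powr g) ^ (N + 1) = D t"
 proof -
  have "(D t powr g) ^ (N + 1) = D t powr (g * (d + 1))" unfolding powr_realpow[OF Dp, symmetric] powr_powr N_def card_p1 ..
  also have "g * (d + 1) = 1" using d2 by (simp add: g_def)
  finally show ?thesis using D_ge_1[of t] by simp
 qed
 have Y0: "Y t \<ge> 0" by (simp add: Y_def)
 have N3: "N + 3 = Suc (N + 2)" by simp
 have "T ^ (N + 3) * T ^ (N - 1) = (T^2) ^ (N + 1)" using N by (simp flip: power_add power_mult)
 also have "... = (Y t * D t powr g) ^ (N + 1)" using Dp by (simp add: Y_def T_def)
 also have "... = Y t ^ (N + 1) * D t" by (simp only: power_mult_distrib DN)
 also have "... \<le> Y t ^ (N + 1) * ((1 + real t) * T ^ (N - 1))"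
  using D_le[OF t] Y0 by (intro mult_left_mono) (auto simp: T_def N_def)
 finally have "T ^ (N + 3) * T ^ (N - 1) \<le> (Y t ^ (N + 1) * (1 + real t)) * T ^ (N - 1)" by simp
 hence "T ^ (N + 3) \<le> Y t ^ (N + 1) * (1 + real t)" using T by (simp add: mult_le_cancel_right)
 also have "... \<le> (C1 B2 * \<beta>^2 * sqrt (real t) / B) ^ (N + 1) * (1 + real t)"
  using Y_bound[OF m \<tau> t B2(2)] Y0 by (intro mult_right_mono power_mono) auto
 also have "... \<le> (C1 B2 * \<beta>^2 * sqrt (real t) / B) ^ (N + 1) * (2 * (sqrt (real t))^2)"
  using \<tau> C \<beta> B by (intro mult_left_mono) auto
 also have "... = 2 * C1 B2 ^ (N + 1) * (\<beta> * sqrt (real t)) ^ (N + 3)"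
 proof -
  have "B ^ (N + 1) = \<beta> ^ (N - 1)" using B(2) by (simp add: N_def)
  moreover have "(\<beta>^2) ^ (N + 1) = \<beta> ^ (N + 3) * \<beta> ^ (N - 1)" using N by (simp flip: power_add power_mult)
  moreover have "sqrt (real t) ^ (N + 3) = sqrt (real t) ^ (N + 1) * (sqrt (real t))^2"
   unfolding power_add[symmetric] by (rule arg_cong[of _ _ "\<lambda>k. sqrt (real t) ^ k"]) simp
  ultimately show ?thesis using \<beta> by (simp only: power_mult_distrib power_divide) (simp add: field_simps)
 qed
 also have "... \<le> (2 * C1 B2) ^ (N + 3) * (\<beta> * sqrt (real t)) ^ (N + 3)"
 proof (intro mult_right_mono)
  have "2 * C1 B2 ^ (N + 1) \<le> 2 ^ (N + 3) * C1 B2 ^ (N + 3)" using C by (intro mult_mono power_increasing self_le_power) auto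
  thus "2 * C1 B2 ^ (N + 1) \<le> (2 * C1 B2) ^ (N + 3)" by (simp only: power_mult_distrib)
 qed (use \<beta> in simp)
 finally have "T ^ (N + 3) \<le> (2 * C1 B2 * (\<beta> * sqrt (real t))) ^ (N + 3)" by (simp only: power_mult_distrib)
 hence "T \<le> 2 * C1 B2 * (\<beta> * sqrt (real t))" unfolding N3 by (rule power_le_imp_le_base) (use C \<beta> in auto)
 thus ?thesis by (simp add: T_def mult.assoc)
qed

text \<open>Compares \<open>D_lower\<close> with \<open>D_le_mineig\<close>, where all factors but
  one are bounded through \<open>tr_perp\<close>.\<close>

lemma mineig_lower:
 assumes m: "\<beta>^2 \<le> mineig t0" and t: "2 * t0 \<le> t" "2 \<le> t" "t \<le> n"
  and A: "A \<ge> 1" "tr_perp t \<le> A * \<beta> * sqrt (real t)"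
 shows "\<delta> ^ CARD('n) / (2 * A ^ (CARD('n) - 2)) * \<beta> * sqrt (real t) \<le> mineig t"
proof -
 define N where "N = CARD('n)"
 have N: "N \<ge> 2" using dim by (simp add: N_def)
 define s where "s = \<beta> * sqrt (real t)"
 have s: "s > 0" using \<beta> t by (simp add: s_def)
 have "\<delta> * real t * (\<delta> * s) ^ (N - 1) \<le> D t" using D_lower[OF t(3,1,2) m] by (simp add: N_def s_def mult.assoc)
 also have "... \<le> (1 + real t) * tr_perp t ^ (N - 2) * mineig t" using D_le_mineig[OF t(3)] by (simp add: N_def)
 also have "... \<le> (2 * real t) * (A * s) ^ (N - 2) * mineig t" using t A(2) tr_perp_ge_1[of t] mineig_ge_1[of t]
  by (intro mult_right_mono mult_mono power_mono) (auto simp: s_def mult.assoc)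
 finally have "real t * (\<delta> * (\<delta> * s) ^ (N - 1)) \<le> real t * (2 * (A * s) ^ (N - 2) * mineig t)" by (simp add: mult_ac)
 hence "\<delta> * (\<delta> * s) ^ (N - 1) \<le> 2 * (A * s) ^ (N - 2) * mineig t" using t by simp
 moreover have "\<delta> * (\<delta> * s) ^ (N - 1) = \<delta> ^ N * s * s ^ (N - 2)"
 proof -
  have "N = Suc (N - 1)" "N - 1 = Suc (N - 2)" using N by auto
  hence "\<delta> ^ N = \<delta> * \<delta> ^ (N - 1)" "s ^ (N - 1) = s * s ^ (N - 2)" by (metis power_Suc)+
  thus ?thesis by (simp add: power_mult_distrib)
 qed
 ultimately have "(\<delta> ^ N * s) * s ^ (N - 2) \<le> (2 * A ^ (N - 2) * mineig t) * s ^ (N - 2)"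
  by (simp add: power_mult_distrib mult_ac)
 hence "\<delta> ^ N * s \<le> 2 * A ^ (N - 2) * mineig t" using s by (simp add: mult_le_cancel_right)
 thus ?thesis using A(1) by (simp add: N_def s_def field_simps)
qed

text \<open>Powers are written with real exponents in \<open>d\<close>, so that outside the locale
  the constant is a function of \<open>d\<close> and \<open>B2\<close> alone and can be fixed before
  the run.\<close>

definition A0 :: "real \<Rightarrow> real" where
 "A0 B2 = 1 + 2 * C1 B2 + 2 * (2 * C1 B2) powr (d - 2) / \<delta> powr d"

lemma C1_ge_1: "B2 \<ge> 0 \<Longrightarrow> C1 B2 \<ge> 1" using d2 \<delta> by (simp add: C1_def KE_def)

lemma A0_ge_1: "B2 \<ge> 0 \<Longrightarrow> A0 B2 \<ge> 1" using C1_ge_1[of B2] by (simp add: A0_def)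

lemma crude_bounds:
 assumes m: "\<beta>^2 \<le> mineig t0" and \<tau>: "2 * t0 \<le> \<tau>" "2 \<le> \<tau>" "\<tau> \<le> t" and t: "t \<le> n"
  and B2: "B2 \<ge> 0" "(tr_perp \<tau>)^2 \<le> B2 * \<beta>^2 * sqrt (real \<tau>) * sqrt (real t)"
 shows "tr_perp t \<le> A0 B2 * (\<beta> * sqrt (real t))" "\<beta> * sqrt (real t) \<le> A0 B2 * mineig t"
proof -
 have C: "C1 B2 \<ge> 1" by (rule C1_ge_1[OF B2(1)])
 have T: "tr_perp t \<le> 2 * C1 B2 * \<beta> * sqrt (real t)" by (rule tr_perp_upper[OF m \<tau> t B2])
 also have "... = (2 * C1 B2) * (\<beta> * sqrt (real t))" by simp
 also have "... \<le> A0 B2 * (\<beta> * sqrt (real t))" using \<beta> C by (intro mult_right_mono) (auto simp: A0_def)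
 finally show "tr_perp t \<le> A0 B2 * (\<beta> * sqrt (real t))" .
 define K where "K = 2 * (2 * C1 B2) powr (d - 2) / \<delta> powr d"
 have p: "\<delta> ^ CARD('n) = \<delta> powr d" "(2 * C1 B2) ^ (CARD('n) - 2) = (2 * C1 B2) powr (d - 2)"
 proof -
  have "real (CARD('n) - 2) = d - 2" using d dim by (simp add: of_nat_diff)
  thus "(2 * C1 B2) ^ (CARD('n) - 2) = (2 * C1 B2) powr (d - 2)" using C powr_realpow[of "2 * C1 B2" "CARD('n) - 2"] by simp
  show "\<delta> ^ CARD('n) = \<delta> powr d" using \<delta> powr_realpow[of \<delta> "CARD('n)"] by (simp add: d)
 qed
 have "\<delta> ^ CARD('n) / (2 * (2 * C1 B2) ^ (CARD('n) - 2)) * \<beta> * sqrt (real t) \<le> mineig t"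
  using m \<tau> t T C by (intro mineig_lower) auto
 hence "(\<beta> * sqrt (real t)) / K \<le> mineig t" unfolding p by (simp add: K_def mult_ac)
 moreover have "K > 0" using C \<delta> by (simp add: K_def)
 ultimately have "\<beta> * sqrt (real t) \<le> K * mineig t" by (simp add: divide_le_eq mult.commute)
 also have "... \<le> A0 B2 * mineig t" using C mineig_ge_1[of t] by (intro mult_right_mono) (auto simp: A0_def K_def)
 finally show "\<beta> * sqrt (real t) \<le> A0 B2 * mineig t" .
qed

section \<open>Crude bounds for large and for small \<beta>\<close>

definition K0 :: real where "K0 = (64 * d)^2"
definition A1 :: real where "A1 = A0 (64 * K0^2)"

lemma A1_ge_1: "A1 \<ge> 1" unfolding A1_def by (rule A0_ge_1) simp

lemma K0_ge: "K0 \<ge> d" "K0 \<ge> 1"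
proof -
 have "d * 1 \<le> d * (4096 * d)" using d2 by (intro mult_left_mono) auto
 thus "K0 \<ge> d" by (simp add: K0_def power2_eq_square)
 thus "K0 \<ge> 1" using d2 by linarith
qed

text \<open>After \<open>t0\<close>, of order \<beta>^3, the least eigenvalue is at least \<beta>^2.
  At \<open>\<tau> = 2 * t0\<close> only the trivial bound 2 \<tau> for \<open>tr_perp\<close> is at
  hand; from order \<beta>^6 on, t is large enough for this start to be forgotten.\<close>

lemma late_crude:
 assumes \<beta>1: "\<beta> \<ge> 1" and t: "t \<le> n" "4 * K0 * \<beta> ^ 6 \<le> real t"
 shows "tr_perp t \<le> A1 * (\<beta> * sqrt (real t))" "\<beta> * sqrt (real t) \<le> A1 * mineig t"
proof -
 define t0 where "t0 = nat \<lceil>K0 * \<beta> ^ 3\<rceil>"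
 define \<tau> where "\<tau> = 2 * t0"
 have b3: "\<beta> ^ 3 \<ge> 1" using \<beta>1 by simp
 have k1: "K0 * \<beta> ^ 3 \<ge> 1" using mult_mono[of 1 K0 1 "\<beta> ^ 3"] K0_ge b3 by simp
 have kd: "K0 * \<beta> ^ 3 \<ge> d" using mult_mono[of d K0 1 "\<beta> ^ 3"] K0_ge b3 d2 by simp
 have t0: "K0 * \<beta> ^ 3 \<le> real t0" "real t0 \<le> K0 * \<beta> ^ 3 + 1" using k1 by (auto simp: t0_def)
 have \<tau>: "real \<tau> \<le> 4 * K0 * \<beta> ^ 3" "2 \<le> \<tau>" "d \<le> real \<tau>" using t0 k1 kd by (auto simp: \<tau>_def)
 have "4 * K0 * \<beta> ^ 3 \<le> 4 * K0 * \<beta> ^ 6" using \<beta>1 K0_ge by (intro mult_left_mono power_increasing) auto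
 hence "real \<tau> \<le> real t" using \<tau> t by linarith
 hence \<tau>t: "\<tau> \<le> t" by simp
 have m: "\<beta>^2 \<le> mineig t0" by (rule mineig_ge_beta) (use \<beta>1 t0 \<tau>t t in \<open>auto simp: \<tau>_def K0_def\<close>)
 have B2: "(tr_perp \<tau>)^2 \<le> (64 * K0^2) * \<beta>^2 * sqrt (real \<tau>) * sqrt (real t)"
 proof -
  have "tr_perp \<tau> \<le> 2 * real \<tau>" using tr_perp_le[of \<tau>] \<tau> \<tau>t t by simp
  hence "(tr_perp \<tau>)^2 \<le> (2 * real \<tau>)^2" using tr_perp_ge_1[of \<tau>] by (intro power_mono) auto
  also have "... = 4 * (real \<tau> * sqrt (real \<tau>)) * sqrt (real \<tau>)" by (simp add: power2_eq_square)
  also have "... \<le> 4 * (16 * K0^2 * (\<beta>^2 * sqrt (real t))) * sqrt (real \<tau>)"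
  proof (intro mult_right_mono mult_left_mono)
   have "sqrt (real \<tau>) \<le> 4 * K0 * \<beta>^2"
   proof (rule real_le_lsqrt)
    have "real \<tau> \<le> 1 * (4 * K0 * \<beta> ^ 3)" using \<tau> by simp
    also have "... \<le> (4 * K0 * \<beta>) * (4 * K0 * \<beta> ^ 3)"
     using K0_ge \<beta>1 mult_mono[of 1 "4 * K0" 1 \<beta>] by (intro mult_right_mono) auto
    also have "... = (4 * K0 * \<beta>^2)^2" by algebra
    finally show "real \<tau> \<le> (4 * K0 * \<beta>^2)^2" .
   qed (use K0_ge in auto)
   hence "real \<tau> * sqrt (real \<tau>) \<le> (4 * K0 * \<beta> ^ 3) * (4 * K0 * \<beta>^2)" using \<tau> K0_ge \<beta>1 by (intro mult_mono) auto
   also have "... = 16 * K0^2 * (\<beta>^2 * \<beta> ^ 3)" by algebra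
   also have "... \<le> 16 * K0^2 * (\<beta>^2 * sqrt (real t))"
   proof (intro mult_left_mono)
    have "(\<beta> ^ 3)^2 = 1 * \<beta> ^ 6" by simp
    also have "... \<le> 4 * K0 * \<beta> ^ 6" using K0_ge \<beta>1 by (intro mult_right_mono) auto
    also have "... \<le> real t" by (rule t(2))
    finally show "\<beta> ^ 3 \<le> sqrt (real t)" by (rule real_le_rsqrt)
   qed auto
   finally show "real \<tau> * sqrt (real \<tau>) \<le> 16 * K0^2 * (\<beta>^2 * sqrt (real t))" .
  qed auto
  finally show ?thesis by (simp add: mult_ac)
 qed
 show "tr_perp t \<le> A1 * (\<beta> * sqrt (real t))" "\<beta> * sqrt (real t) \<le> A1 * mineig t"
  unfolding A1_def by (rule crude_bounds[OF m _ \<tau>(2) \<tau>t t(1) _ B2]; simp add: \<tau>_def)+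
qed

definition A2 :: real where "A2 = A0 ((d + 32)^2) + (d + 32)"

text \<open>For \<beta> below one the least eigenvalue exceeds \<beta>^2 from the start. During the
  first rounds, about 1 / \<beta>^2 of them, \<open>tr_perp\<close> gains at most 16 \<beta>^2 per
  round and stays bounded, whence the summand one; afterwards \<open>crude_bounds\<close>
  applies.\<close>

lemma small_beta_crude:
 assumes \<beta>1: "\<beta> < 1" and t: "t \<le> n"
 shows "tr_perp t \<le> A2 * (1 + \<beta> * sqrt (real t))" "tr_perp t \<le> A2^2 * mineig t"
proof -
 define \<tau> where "\<tau> = nat \<lceil>1 / \<beta>^2\<rceil>"
 have b2: "\<beta>^2 < 1" "\<beta>^2 > 0" using \<beta> \<beta>1 power_strict_mono[of \<beta> 1 2] by auto
 have i: "1 / \<beta>^2 > 1" using b2 by simp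
 have \<tau>: "1 / \<beta>^2 \<le> real \<tau>" "real \<tau> \<le> 2 / \<beta>^2" "2 \<le> \<tau>"
 proof -
  show 1: "1 / \<beta>^2 \<le> real \<tau>" using i by (auto simp: \<tau>_def)
  have "real \<tau> \<le> 1 / \<beta>^2 + 1" using i by (auto simp: \<tau>_def)
  moreover have "2 / \<beta>^2 = 1 / \<beta>^2 + 1 / \<beta>^2" by simp
  ultimately show "real \<tau> \<le> 2 / \<beta>^2" using i by linarith
  have "real \<tau> > 1" using 1 i by linarith
  thus "2 \<le> \<tau>" by simp
 qed
 have T: "s \<le> n \<Longrightarrow> tr_perp s \<le> d + 16 * \<beta>^2 * real s" for s
 proof (induction s)
  case (Suc s)
  have "(norm (y (Suc s)))^2 \<le> 16 * \<beta>^2 / 1" by (rule y_le) (use Suc.prems in \<open>auto simp: gram_ge\<close>)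
  thus ?case using Suc by (simp add: tr_perp_Suc algebra_simps)
 qed (simp add: tr_perp_def)
 have Ts: "tr_perp s \<le> d + 32" if "s \<le> n" "s \<le> \<tau>" for s
 proof -
  have "real s \<le> 2 / \<beta>^2" using that(2) \<tau>(2) by linarith
  hence "\<beta>^2 * real s \<le> 2" using b2 by (simp add: field_simps)
  thus ?thesis using T[OF that(1)] by simp
 qed
 have A: "A0 ((d + 32)^2) \<ge> 1" by (rule A0_ge_1) simp
 have A2: "A2 \<ge> d + 32" "A2 \<ge> 1" "A2 \<ge> A0 ((d + 32)^2)" using A d2 by (auto simp: A2_def)
 have "tr_perp t \<le> A2 * (1 + \<beta> * sqrt (real t)) \<and> tr_perp t \<le> A2^2 * mineig t"
 proof (cases "t \<le> \<tau>")
  case True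
  have 1: "tr_perp t \<le> A2" using Ts[OF t True] A2 by linarith
  moreover have "A2 * 1 \<le> A2 * (1 + \<beta> * sqrt (real t))" using A2 \<beta> by (intro mult_left_mono) auto
  moreover have "A2 * 1 \<le> A2 * (A2 * mineig t)"
   using A2 mineig_ge_1[of t] mult_mono[of 1 A2 1 "mineig t"] by (intro mult_left_mono) auto
  ultimately show ?thesis by (simp add: power2_eq_square mult.assoc)
 next
  case False
  have m: "\<beta>^2 \<le> mineig 0" using mineig_ge_1[of 0] b2 by linarith
  have B2: "(tr_perp \<tau>)^2 \<le> (d + 32)^2 * \<beta>^2 * sqrt (real \<tau>) * sqrt (real t)"
  proof -
   have "(tr_perp \<tau>)^2 \<le> (d + 32)^2 * 1" using Ts[of \<tau>] False t tr_perp_ge_1[of \<tau>] by (simp add: power_mono)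
   also have "... \<le> (d + 32)^2 * (\<beta>^2 * (sqrt (real \<tau>) * sqrt (real t)))"
   proof (intro mult_left_mono)
    have "1 \<le> \<beta>^2 * real \<tau>" using \<tau>(1) b2 by (simp add: field_simps)
    also have "real \<tau> = sqrt (real \<tau>) * sqrt (real \<tau>)" by simp
    also have "\<beta>^2 * (sqrt (real \<tau>) * sqrt (real \<tau>)) \<le> \<beta>^2 * (sqrt (real \<tau>) * sqrt (real t))"
     using False by (intro mult_left_mono) auto
    finally show "1 \<le> \<beta>^2 * (sqrt (real \<tau>) * sqrt (real t))" .
   qed simp
   finally show ?thesis by (simp add: mult.assoc)
  qed
  have 1: "tr_perp t \<le> A0 ((d + 32)^2) * (\<beta> * sqrt (real t))"
   "\<beta> * sqrt (real t) \<le> A0 ((d + 32)^2) * mineig t" by (rule crude_bounds[OF m _ \<tau>(3) _ t _ B2]; use False in simp)+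
  have 2: "A0 ((d + 32)^2) * (\<beta> * sqrt (real t)) \<le> A2 * (\<beta> * sqrt (real t))" using A2 \<beta> by (intro mult_right_mono) auto
  have "A2 * (\<beta> * sqrt (real t)) \<le> A2 * (1 + \<beta> * sqrt (real t))" using A2 by (intro mult_left_mono) auto
  moreover have "A2 * (\<beta> * sqrt (real t)) \<le> A2 * (A2 * mineig t)"
  proof (rule mult_left_mono)
   have "A0 ((d + 32)^2) * mineig t \<le> A2 * mineig t" using A2 mineig_ge_1[of t] by (intro mult_right_mono) auto
   thus "\<beta> * sqrt (real t) \<le> A2 * mineig t" using 1(2) by linarith
  qed (use A2 in simp)
  ultimately show ?thesis using 1 2 by (simp add: power2_eq_square mult.assoc)
 qed
 thus "tr_perp t \<le> A2 * (1 + \<beta> * sqrt (real t))" "tr_perp t \<le> A2^2 * mineig t" by auto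
qed

lemma eigval_le_tr_perp: "i \<in> {2..CARD('n)} \<Longrightarrow> eigval (gram a t) i \<le> tr_perp t" by (rule eigval_perp_le[OF form_perp_le])

definition A3 :: real where "A3 = A1^2 + A1 + A2^2 + A2"

lemma A3_ge_1: "A3 \<ge> 1"
proof -
 have "A2 \<ge> 0" using A0_ge_1[of "(d + 32)^2"] d2 by (simp add: A2_def)
 moreover have "0 \<le> A1^2 + A2^2" by simp
 ultimately show ?thesis using A1_ge_1 unfolding A3_def by linarith
qed

lemma crude:
 assumes t: "t \<le> n" "4 * K0 * \<beta> ^ 6 \<le> real t"
 shows "tr_perp t \<le> A3 * (1 + \<beta> * sqrt (real t))" "tr_perp t \<le> A3 * mineig t"
proof -
 have p: "1 + \<beta> * sqrt (real t) > 0" "mineig t > 0" using \<beta> mineig_ge_1[of t] by (auto intro: add_pos_nonneg)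
 have A2: "A2 \<ge> 0" using A0_ge_1[of "(d + 32)^2"] d2 by (simp add: A2_def)
 have "tr_perp t \<le> A3 * (1 + \<beta> * sqrt (real t)) \<and> tr_perp t \<le> A3 * mineig t"
 proof (cases "\<beta> < 1")
  case True
  have "A2 * (1 + \<beta> * sqrt (real t)) \<le> A3 * (1 + \<beta> * sqrt (real t))"
   using p A2 A1_ge_1 by (intro mult_right_mono) (auto simp: A3_def)
  moreover have "A2^2 * mineig t \<le> A3 * mineig t" using p A2 A1_ge_1 by (intro mult_right_mono) (auto simp: A3_def)
  ultimately show ?thesis using small_beta_crude[OF True t(1)] by linarith
 next
  case False
  have \<beta>1: "\<beta> \<ge> 1" using False by simp
  note l = late_crude[OF \<beta>1 t]
  have "A1 * (\<beta> * sqrt (real t)) \<le> A3 * (1 + \<beta> * sqrt (real t))" using p A2 A1_ge_1 \<beta> by (intro mult_mono) (auto simp: A3_def)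
  moreover have "A1 * (\<beta> * sqrt (real t)) \<le> A1 * (A1 * mineig t)" using l A1_ge_1 by (intro mult_left_mono) auto
  moreover have "A1^2 * mineig t \<le> A3 * mineig t" using p A2 A1_ge_1 by (intro mult_right_mono) (auto simp: A3_def)
  ultimately show ?thesis using l by (simp add: power2_eq_square mult.assoc)
 qed
 thus "tr_perp t \<le> A3 * (1 + \<beta> * sqrt (real t))" "tr_perp t \<le> A3 * mineig t" by auto
qed

end

section \<open>Alignment of the action with \<theta>\<close>

lemma spd_cauchy_schwarz_abs:
 "spd A \<Longrightarrow> \<bar>x \<bullet> (A *v y)\<bar> \<le> sqrt (x \<bullet> (A *v x)) * sqrt (y \<bullet> (A *v y))"
 using real_sqrt_le_mono[OF spd_cauchy_schwarz[of A x y]] by (simp add: real_sqrt_mult)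

lemma spd_triangle:
 assumes "spd A"
 shows "sqrt ((x + y) \<bullet> (A *v (x + y))) \<le> sqrt (x \<bullet> (A *v x)) + sqrt (y \<bullet> (A *v y))"
proof (rule real_le_lsqrt)
 have "y \<bullet> (A *v x) = x \<bullet> (A *v y)" using spd_inner[OF assms, of y x] by (simp add: inner_commute)
 hence "(x + y) \<bullet> (A *v (x + y)) = x \<bullet> (A *v x) + 2 * (x \<bullet> (A *v y)) + y \<bullet> (A *v y)"
  by (simp add: matrix_vector_right_distrib inner_add_left inner_add_right)
 also have "... \<le> x \<bullet> (A *v x) + 2 * (sqrt (x \<bullet> (A *v x)) * sqrt (y \<bullet> (A *v y))) + y \<bullet> (A *v y)"
  using spd_cauchy_schwarz_abs[OF assms, of x y] by linarith
 also have "... = (sqrt (x \<bullet> (A *v x)) + sqrt (y \<bullet> (A *v y)))^2"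
  using spd_nonneg[OF assms, of x] spd_nonneg[OF assms, of y] by (simp add: power2_sum)
 finally show "(x + y) \<bullet> (A *v (x + y)) \<le> (sqrt (x \<bullet> (A *v x)) + sqrt (y \<bullet> (A *v y)))^2" .
qed (simp add: spd_nonneg[OF assms])

lemma spd_inv_sym: "spd A \<Longrightarrow> x \<bullet> (matrix_inv A *v y) = (matrix_inv A *v x) \<bullet> y" by (rule spd_inner[OF spd_matrix_inv])

lemma spd_dual_bound:
 assumes A: "spd A" and z: "z \<bullet> (A *v z) \<le> N^2" "N \<ge> 0"
 shows "\<bar>h \<bullet> z\<bar> \<le> N * sqrt (h \<bullet> (matrix_inv A *v h))"
proof -
 define q where "q = matrix_inv A *v h"
 have "h \<bullet> z = q \<bullet> (A *v z)" using spd_inner[OF A, of q z] by (simp add: q_def spd_inverse[OF A])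
 moreover have "q \<bullet> (A *v q) = h \<bullet> q" by (simp add: q_def spd_inverse[OF A] inner_commute)
 ultimately have "\<bar>h \<bullet> z\<bar> \<le> sqrt (h \<bullet> q) * sqrt (z \<bullet> (A *v z))" using spd_cauchy_schwarz_abs[OF A, of q z] by simp
 also have "... \<le> sqrt (h \<bullet> q) * N" using z real_sqrt_le_mono[OF z(1)] spd_nonneg[OF spd_matrix_inv[OF A], of h]
  by (intro mult_left_mono) (auto simp: q_def)
 finally show ?thesis by (simp add: q_def mult.commute)
qed

text \<open>The noise-free part of the right-hand side is exact up to a nonnegative term because
 \<open>I - \<mu> A\<^sup>-\<^sup>1\<close> is positive semidefinite and commutes with \<open>A\<close>.\<close>

lemma alignment_lower_bound:
 fixes A :: "real ^ 'n ^ 'n"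
 assumes A: "spd A" and m: "m > 0" "\<And>x. m * (norm x)^2 \<le> x \<bullet> (A *v x)"
  and \<mu>: "0 < \<mu>" "\<mu> \<le> m" and u: "u > 0"
  and st: "u *\<^sub>R a = \<theta> + \<zeta> + (u * \<mu>) *\<^sub>R (matrix_inv A *v a)"
  and \<zeta>: "\<zeta> \<bullet> (A *v \<zeta>) \<le> N^2" "N \<ge> 0"
 defines "L \<equiv> matrix_inv A"
 shows "(\<theta> \<bullet> (L *v \<theta>)) / u - N * sqrt (\<theta> \<bullet> (L *v \<theta>)) / (m * u) - N * sqrt (a \<bullet> (L *v a)) / m
  \<le> \<theta> \<bullet> (L *v a)"
proof -
 have SL: "spd L" unfolding L_def by (rule spd_matrix_inv[OF A])
 have sy: "x \<bullet> (L *v y) = (L *v x) \<bullet> y" for x y by (rule spd_inner[OF SL])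
 have ib: "m * (norm (L *v x))^2 \<le> x \<bullet> (L *v x)" "m * (x \<bullet> (L *v x)) \<le> (norm x)^2" for x
  unfolding L_def using spd_inv_bounds[OF A _ m(2)] m(1) by auto
 have ib2: "m^2 * ((L *v x) \<bullet> (L *v (L *v x))) \<le> x \<bullet> (L *v x)" for x
 proof -
  have "m * (m * ((L *v x) \<bullet> (L *v (L *v x)))) \<le> m * (norm (L *v x))^2" using ib(2) m(1) by (intro mult_left_mono) auto
  also have "... \<le> x \<bullet> (L *v x)" by (rule ib(1))
  finally show ?thesis by (simp add: power2_eq_square mult.assoc)
 qed
 have db: "\<bar>h \<bullet> \<zeta>\<bar> \<le> N * sqrt (h \<bullet> (L *v h))" for h unfolding L_def by (rule spd_dual_bound[OF A \<zeta>])
 have p1: "\<bar>\<theta> \<bullet> (L *v \<zeta>)\<bar> \<le> N * sqrt (\<theta> \<bullet> (L *v \<theta>)) / m"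
 proof -
  have "sqrt ((L *v \<theta>) \<bullet> (L *v (L *v \<theta>))) \<le> sqrt (\<theta> \<bullet> (L *v \<theta>)) / m"
  proof (rule real_le_lsqrt)
   show "(L *v \<theta>) \<bullet> (L *v (L *v \<theta>)) \<le> (sqrt (\<theta> \<bullet> (L *v \<theta>)) / m)^2"
    using ib2[of \<theta>] m(1) spd_nonneg[OF SL, of \<theta>] by (simp add: power_divide field_simps)
  qed (use spd_nonneg[OF SL] m in auto)
  hence "N * sqrt ((L *v \<theta>) \<bullet> (L *v (L *v \<theta>))) \<le> N * (sqrt (\<theta> \<bullet> (L *v \<theta>)) / m)" using \<zeta>(2) by (intro mult_left_mono) auto
  thus ?thesis using db[of "L *v \<theta>"] by (simp add: sy)
 qed
 define q where "q = L *v (L *v a)"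
 have p2: "\<mu> * \<bar>\<zeta> \<bullet> q\<bar> \<le> N * sqrt (a \<bullet> (L *v a)) / m"
 proof -
  have 1: "m^2 * (m^2 * (q \<bullet> (L *v q))) \<le> a \<bullet> (L *v a)"
  proof -
   have "m^2 * (q \<bullet> (L *v q)) \<le> (L *v a) \<bullet> (L *v (L *v a))" unfolding q_def by (rule ib2)
   hence "m^2 * (m^2 * (q \<bullet> (L *v q))) \<le> m^2 * ((L *v a) \<bullet> (L *v (L *v a)))" by (intro mult_left_mono) auto
   also have "... \<le> a \<bullet> (L *v a)" by (rule ib2)
   finally show ?thesis .
  qed
  have "sqrt (q \<bullet> (L *v q)) \<le> sqrt (a \<bullet> (L *v a)) / m^2"
  proof (rule real_le_lsqrt)
   show "q \<bullet> (L *v q) \<le> (sqrt (a \<bullet> (L *v a)) / m^2)^2"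
    using 1 m(1) spd_nonneg[OF SL, of a] by (simp add: power_divide field_simps power2_eq_square)
  qed (use spd_nonneg[OF SL] m in auto)
  hence "N * sqrt (q \<bullet> (L *v q)) \<le> N * (sqrt (a \<bullet> (L *v a)) / m^2)" using \<zeta>(2) by (intro mult_left_mono) auto
  hence "\<bar>\<zeta> \<bullet> q\<bar> \<le> N * (sqrt (a \<bullet> (L *v a)) / m^2)" using db[of q] by (simp add: inner_commute)
  hence "\<mu> * \<bar>\<zeta> \<bullet> q\<bar> \<le> m * (N * (sqrt (a \<bullet> (L *v a)) / m^2))" using \<mu> by (intro mult_mono) auto
  thus ?thesis using m(1) by (simp add: power2_eq_square)
 qed
 have ua: "u *\<^sub>R a = \<theta> + \<zeta> + (u * \<mu>) *\<^sub>R (L *v a)" using st by (simp add: L_def)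
 \<comment> \<open>With \<theta> eliminated by the stationarity equation, the part free of \<zeta>
   is \<open>u\<close> times the form of I - \<mu> A^-1 at A^-1 a.\<close>
 have p3: "- (\<zeta> \<bullet> q) \<le> \<theta> \<bullet> q"
 proof -
  have "\<theta> = u *\<^sub>R a - \<zeta> - (u * \<mu>) *\<^sub>R (L *v a)" using ua by (simp add: algebra_simps)
  hence "\<theta> \<bullet> q = u * (a \<bullet> q) - \<zeta> \<bullet> q - u * \<mu> * ((L *v a) \<bullet> q)" by (simp add: inner_diff_left)
  moreover have "a \<bullet> q = (norm (L *v a))^2" by (simp add: q_def sy dot_square_norm)
  moreover have "\<mu> * ((L *v a) \<bullet> q) \<le> m * ((L *v a) \<bullet> q)"
   using \<mu> spd_nonneg[OF SL, of "L *v a"] by (intro mult_right_mono) (auto simp: q_def)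
  hence "\<mu> * ((L *v a) \<bullet> q) \<le> (norm (L *v a))^2" using ib(2)[of "L *v a"] by (simp add: q_def)
  hence "u * (\<mu> * ((L *v a) \<bullet> q)) \<le> u * (norm (L *v a))^2" using u by (intro mult_left_mono) auto
  ultimately show ?thesis by (simp add: mult.assoc)
 qed
 have "u * (\<theta> \<bullet> (L *v a)) = (L *v \<theta>) \<bullet> (u *\<^sub>R a)" by (simp add: sy)
 also have "... = \<theta> \<bullet> (L *v \<theta>) + \<theta> \<bullet> (L *v \<zeta>) + u * \<mu> * (\<theta> \<bullet> q)" unfolding ua inner_add_right inner_scaleR_right
  using sy[of \<theta> \<theta>] sy[of \<theta> \<zeta>] sy[of \<theta> "L *v a"] by (simp add: q_def)
 finally have e: "u * (\<theta> \<bullet> (L *v a)) = \<theta> \<bullet> (L *v \<theta>) + \<theta> \<bullet> (L *v \<zeta>) + u * (\<mu> * (\<theta> \<bullet> q))" by simp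
 have "\<mu> * (- \<bar>\<zeta> \<bullet> q\<bar>) \<le> \<mu> * (\<theta> \<bullet> q)" using p3 \<mu> by (intro mult_left_mono) auto
 hence "- (N * sqrt (a \<bullet> (L *v a)) / m) \<le> \<mu> * (\<theta> \<bullet> q)" using p2 by linarith
 hence "u * (- (N * sqrt (a \<bullet> (L *v a)) / m)) \<le> u * (\<mu> * (\<theta> \<bullet> q))" using u by (intro mult_left_mono) auto
 hence "\<theta> \<bullet> (L *v \<theta>) - N * sqrt (\<theta> \<bullet> (L *v \<theta>)) / m - u * (N * sqrt (a \<bullet> (L *v a)) / m)
   \<le> u * (\<theta> \<bullet> (L *v a))" using e p1 by linarith
 hence "(\<theta> \<bullet> (L *v \<theta>) - N * sqrt (\<theta> \<bullet> (L *v \<theta>)) / m - u * (N * sqrt (a \<bullet> (L *v a)) / m)) / u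
   \<le> \<theta> \<bullet> (L *v a)" using u by (simp add: divide_le_eq mult.commute)
 moreover have "(\<theta> \<bullet> (L *v \<theta>) - N * sqrt (\<theta> \<bullet> (L *v \<theta>)) / m - u * (N * sqrt (a \<bullet> (L *v a)) / m)) / u
   = (\<theta> \<bullet> (L *v \<theta>)) / u - N * sqrt (\<theta> \<bullet> (L *v \<theta>)) / (m * u) - N * sqrt (a \<bullet> (L *v a)) / m"
  using u by (simp add: diff_divide_distrib)
 ultimately show ?thesis by simp
qed

section \<open>Growth in the direction of the parameter\<close>

locale ucb_fine = ucb_run a v \<theta> \<beta> n U \<mu> d
 for a v :: "nat \<Rightarrow> real ^ 'n" and \<theta> and \<beta> and n and U \<mu> and d +
 fixes \<theta>bar :: "nat \<Rightarrow> real ^ 'n" and N :: real and t1 :: nat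
 assumes proj: "\<And>t. t < n \<Longrightarrow> is_projected (\<theta>bar t) (v t)"
  and err: "\<And>t. t1 \<le> t \<Longrightarrow> t < n \<Longrightarrow> (\<theta>bar t - \<theta>) \<bullet> (gram a t *v (\<theta>bar t - \<theta>)) \<le> N^2"
  and \<beta>1: "\<beta> \<ge> 1" and N1: "1 \<le> N" and N\<beta>: "200 * A1^2 * N \<le> \<beta>"
  and t1: "(10 ^ 4 * A1^2 * K0 * \<beta> ^ 3)^2 \<le> real t1"
begin

abbreviation A :: real where "A \<equiv> A1"

definition \<epsilon> :: real where "\<epsilon> = N / \<beta>"

lemma A1: "1 \<le> A" by (rule A1_ge_1)

lemma A_pow: "1 \<le> A ^ k" using A1 by simp

lemma \<epsilon>: "0 < \<epsilon>" "1 / \<beta> \<le> \<epsilon>" "\<epsilon> * \<beta> = N" "200 * A^2 * \<epsilon> \<le> 1" "\<epsilon> \<le> 1 / 200"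
proof -
 show "0 < \<epsilon>" "1 / \<beta> \<le> \<epsilon>" "\<epsilon> * \<beta> = N" using \<beta> N1 by (auto simp: \<epsilon>_def divide_right_mono)
 show 1: "200 * A^2 * \<epsilon> \<le> 1" using N\<beta> \<beta> by (simp add: \<epsilon>_def field_simps)
 have "200 * 1 * \<epsilon> \<le> 200 * A^2 * \<epsilon>" using A_pow[of 2] \<open>0 < \<epsilon>\<close> by (intro mult_right_mono mult_left_mono) auto
 thus "\<epsilon> \<le> 1 / 200" using 1 by simp
qed

lemma s_ge: "t1 \<le> t \<Longrightarrow> 10 ^ 4 * A^2 * \<beta> ^ 3 \<le> sqrt (real t)"
proof -
 assume "t1 \<le> t"
 hence "(10 ^ 4 * A^2 * K0 * \<beta> ^ 3)^2 \<le> real t" using t1 by simp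
 hence "10 ^ 4 * A^2 * K0 * \<beta> ^ 3 \<le> sqrt (real t)" by (rule real_le_rsqrt)
 moreover have "10 ^ 4 * A^2 * 1 * \<beta> ^ 3 \<le> 10 ^ 4 * A^2 * K0 * \<beta> ^ 3"
  using \<beta>1 A1 K0_ge by (intro mult_right_mono mult_left_mono) auto
 ultimately show ?thesis by simp
qed

lemma s_ge': "t1 \<le> t \<Longrightarrow> 10 ^ 4 * A^2 \<le> sqrt (real t)" "t1 \<le> t \<Longrightarrow> 10 ^ 4 * A * \<beta> ^ 3 \<le> sqrt (real t)"
 "t1 \<le> t \<Longrightarrow> 1 \<le> sqrt (real t)" "t1 \<le> t \<Longrightarrow> 10 ^ 4 * \<beta> \<le> sqrt (real t)"
proof -
 assume t: "t1 \<le> t"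
 have b: "1 \<le> \<beta> ^ 3" "\<beta> \<le> \<beta> ^ 3" using \<beta>1 by (simp_all add: self_le_power)
 have "10 ^ 4 * A^2 * 1 \<le> 10 ^ 4 * A^2 * \<beta> ^ 3" using b by (intro mult_left_mono) auto
 thus 1: "10 ^ 4 * A^2 \<le> sqrt (real t)" using s_ge[OF t] by simp
 have "10 ^ 4 * A * \<beta> ^ 3 \<le> 10 ^ 4 * A^2 * \<beta> ^ 3"
  using A1 \<beta>1 by (intro mult_right_mono mult_left_mono) (auto simp: power2_eq_square)
 thus 2: "10 ^ 4 * A * \<beta> ^ 3 \<le> sqrt (real t)" using s_ge[OF t] by simp
 have "10000 * A^2 \<le> sqrt (real t)" using 1 by simp
 thus "1 \<le> sqrt (real t)" using A_pow[of 2] by linarith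
 have "10 ^ 4 * 1 * \<beta> \<le> 10 ^ 4 * A * \<beta> ^ 3" using b A1 \<beta>1 by (intro mult_mono) auto
 thus "10 ^ 4 * \<beta> \<le> sqrt (real t)" using 2 by simp
qed

lemma t_pos: "t1 \<le> t \<Longrightarrow> 1 \<le> real t" using s_ge'(3)[of t] by simp

lemma crude_t:
 assumes "t1 \<le> t" "t \<le> n"
 shows "tr_perp t \<le> A * (\<beta> * sqrt (real t))" "\<beta> * sqrt (real t) \<le> A * mineig t" "\<beta> ^ 4 \<le> mineig t"
proof -
 have "4 * K0 * \<beta> ^ 6 \<le> (10 ^ 4 * A^2 * K0 * \<beta> ^ 3)^2"
 proof -
  have "4 * K0 * \<beta> ^ 6 \<le> (10 ^ 4 * A^2)^2 * (K0 * K0) * \<beta> ^ 6"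
  proof (intro mult_right_mono mult_mono)
   have "(10 ^ 4 * 1)^2 \<le> (10 ^ 4 * A^2)^2" using A_pow[of 2] by (intro power_mono mult_left_mono) auto
   thus "4 \<le> (10 ^ 4 * A^2)^2" by simp
   show "K0 \<le> K0 * K0" using K0_ge by simp
  qed (use K0_ge in auto)
  also have "... = (10 ^ 4 * A^2 * K0 * \<beta> ^ 3)^2" by algebra
  finally show ?thesis .
 qed
 hence "4 * K0 * \<beta> ^ 6 \<le> real t" using t1 assms(1) by simp
 note l = late_crude[OF \<beta>1 assms(2) this]
 show "tr_perp t \<le> A * (\<beta> * sqrt (real t))" "\<beta> * sqrt (real t) \<le> A * mineig t" using l .
 have "A * \<beta> ^ 4 \<le> \<beta> * (10 ^ 4 * A * \<beta> ^ 3)" using A1 \<beta>1 by (simp add: power_numeral_reduce mult_ac)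
 also have "... \<le> \<beta> * sqrt (real t)" using s_ge'(2)[OF assms(1)] \<beta> by (intro mult_left_mono) auto
 also have "... \<le> A * mineig t" by (rule l(2))
 finally show "\<beta> ^ 4 \<le> mineig t" using A1 by simp
qed

text \<open>Rescaling the stationarity equation by the norm of the ridge estimate removes the
  projection to the sphere: \<open>u a\<close> is the ridge estimate itself plus u \<mu>
  \<Lambda>^-1 a.\<close>

definition u :: "nat \<Rightarrow> real" where "u t = U t * norm (\<theta>bar t)"
definition \<zeta> :: "nat \<Rightarrow> real ^ 'n" where "\<zeta> t = \<theta>bar t - \<theta>"

text \<open>The Schur complement in the Gram matrix of its block on the complement of \<open>\<theta>\<close>.\<close>

definition c :: "nat \<Rightarrow> real" where "c t = 1 / (\<theta> \<bullet> (matrix_inv (gram a t) *v \<theta>))"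

lemma theta_nz: "\<theta> \<noteq> 0" using \<theta> by auto

lemma c_pos: "0 < c t" unfolding c_def using spd_pos[OF spd_matrix_inv[OF spd_gram] theta_nz] by simp

lemma c_inv: "\<theta> \<bullet> (matrix_inv (gram a t) *v \<theta>) = 1 / c t" by (simp add: c_def)

lemma c_le_form: "c t \<le> \<theta> \<bullet> (gram a t *v \<theta>)"
proof -
 have "(\<theta> \<bullet> \<theta>)^2 \<le> (\<theta> \<bullet> (matrix_inv (gram a t) *v \<theta>)) * (\<theta> \<bullet> (gram a t *v \<theta>))"
  using spd_cauchy_schwarz[OF spd_gram[of a t], of "matrix_inv (gram a t) *v \<theta>" \<theta>]
   spd_inner[OF spd_gram[of a t], of "matrix_inv (gram a t) *v \<theta>" \<theta>] by (simp add: spd_inverse[OF spd_gram] inner_commute)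
 thus ?thesis using c_pos[of t] by (simp add: c_inv theta_inner field_simps)
qed

lemma form_theta_le: "t \<le> n \<Longrightarrow> \<theta> \<bullet> (gram a t *v \<theta>) \<le> 1 + real t" using form_le[of t \<theta>] \<theta> by simp

lemma c_le: "t1 \<le> t \<Longrightarrow> t \<le> n \<Longrightarrow> c t \<le> 2 * real t" using c_le_form[of t] form_theta_le[of t] t_pos[of t] by linarith

lemma norm_zeta:
 assumes "t1 \<le> t" "t < n"
 shows "norm (\<zeta> t) \<le> \<epsilon>" "\<zeta> t \<bullet> (gram a t *v \<zeta> t) \<le> N^2"
proof -
 show e: "\<zeta> t \<bullet> (gram a t *v \<zeta> t) \<le> N^2" using err[OF assms] by (simp add: \<zeta>_def)
 have "(\<beta> * norm (\<zeta> t))^2 = \<beta>^2 * (norm (\<zeta> t))^2" by (simp add: power_mult_distrib)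
 also have "... \<le> mineig t * (norm (\<zeta> t))^2"
 proof (rule mult_right_mono)
  have "\<beta>^2 \<le> \<beta> ^ 4" by (rule power_increasing) (use \<beta>1 in auto)
  thus "\<beta>^2 \<le> mineig t" using crude_t(3)[of t] assms by linarith
 qed simp
 also have "... \<le> N^2" using mineig_form[of t "\<zeta> t"] e by linarith
 finally have "\<beta> * norm (\<zeta> t) \<le> N" by (rule power2_le_imp_le) (use N1 in linarith)
 thus "norm (\<zeta> t) \<le> \<epsilon>" using \<beta> by (simp add: \<epsilon>_def pos_le_divide_eq mult.commute)
qed

lemma u_step:
 assumes t: "t1 \<le> t" "t < n"
 shows "u t *\<^sub>R a (Suc t) = \<theta> + \<zeta> t + (u t * \<mu> t) *\<^sub>R (matrix_inv (gram a t) *v a (Suc t))"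
  "1 - \<epsilon> \<le> norm (\<theta>bar t)" "norm (\<theta>bar t) \<le> 1 + \<epsilon>"
proof -
 have z: "\<theta>bar t = \<theta> + \<zeta> t" by (simp add: \<zeta>_def)
 show 1: "1 - \<epsilon> \<le> norm (\<theta>bar t)" "norm (\<theta>bar t) \<le> 1 + \<epsilon>"
  using norm_zeta(1)[OF t] norm_triangle_ineq[of \<theta> "\<zeta> t"] norm_diff_ineq[of \<theta> "\<zeta> t"] \<theta> unfolding z by linarith+
 have "\<theta>bar t \<noteq> 0" using 1 \<epsilon>(5) by auto
 hence v: "norm (\<theta>bar t) *\<^sub>R v t = \<theta>bar t" using proj[OF t(2)] by (simp add: is_projected_def)
 have "u t *\<^sub>R a (Suc t) = norm (\<theta>bar t) *\<^sub>R (U t *\<^sub>R a (Suc t))" by (simp add: u_def mult.commute)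
 also have "... = norm (\<theta>bar t) *\<^sub>R v t + (u t * \<mu> t) *\<^sub>R (matrix_inv (gram a t) *v a (Suc t))"
  unfolding stepD(8)[OF t(2)] scaleR_add_right by (simp add: u_def mult_ac)
 finally show "u t *\<^sub>R a (Suc t) = \<theta> + \<zeta> t + (u t * \<mu> t) *\<^sub>R (matrix_inv (gram a t) *v a (Suc t))" unfolding v unfolding z .
qed

text \<open>For the last bound the action is split into \<theta> and the remainder
  \<open>a - \<theta>\<close>: the first contributes 1 / sqrt c by definition of \<open>c\<close>,
  the second is controlled by \<open>near\<close>.\<close>

lemma sqrt_w_le:
 assumes t: "t1 \<le> t" "t < n"
 shows "\<beta> * sqrt (w t) \<le> \<epsilon>" "w t \<le> \<epsilon>" "sqrt (w t) \<le> 1 / sqrt (c t) + 4 * \<beta> / mineig t"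
proof -
 note s = stepD[OF t(2)]
 have m: "mineig t > 0" "\<beta> ^ 4 \<le> mineig t" using mineig_ge_1[of t] crude_t(3)[of t] t by auto
 have "\<beta> ^ 4 * w t \<le> 1" using w_le[OF t(2)] m s(4) mult_right_mono[OF m(2), of "w t"] by linarith
 hence "(\<beta>^2 * sqrt (w t))^2 \<le> 1^2" using s(4) by (simp add: power_mult_distrib)
 hence 1: "\<beta>^2 * sqrt (w t) \<le> 1" by (rule power2_le_imp_le) simp
 hence "\<beta> * sqrt (w t) \<le> 1 / \<beta>" using \<beta> by (simp add: power2_eq_square field_simps)
 thus b: "\<beta> * sqrt (w t) \<le> \<epsilon>" using \<epsilon>(2) by linarith
 have sw: "sqrt (w t) \<le> \<beta> * sqrt (w t)" using \<beta>1 s(4) by simp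
 have "w t = sqrt (w t) * sqrt (w t)" using s(4) by simp
 also have "... \<le> \<epsilon> * 1"
 proof (rule mult_mono)
  show "sqrt (w t) \<le> \<epsilon>" using sw b by linarith
  thus "sqrt (w t) \<le> 1" using \<epsilon>(5) by linarith
 qed (use s(4) \<epsilon>(1) in auto)
 finally show "w t \<le> \<epsilon>" by simp
 let ?L = "matrix_inv (gram a t)" and ?a = "a (Suc t)"
 have "sqrt (w t) = sqrt ((\<theta> + (?a - \<theta>)) \<bullet> (?L *v (\<theta> + (?a - \<theta>))))" by (simp add: w_def)
 also have "... \<le> sqrt (\<theta> \<bullet> (?L *v \<theta>)) + sqrt ((?a - \<theta>) \<bullet> (?L *v (?a - \<theta>)))"
  by (rule spd_triangle[OF spd_matrix_inv[OF spd_gram]])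
 also have "sqrt ((?a - \<theta>) \<bullet> (?L *v (?a - \<theta>))) \<le> 4 * \<beta> / mineig t"
 proof (rule real_le_lsqrt)
  have "mineig t * ((?a - \<theta>) \<bullet> (?L *v (?a - \<theta>))) \<le> (norm (?a - \<theta>))^2"
   by (rule spd_inv_bounds(2)[OF spd_gram]) (use m mineig_form in auto)
  also have "... \<le> 16 * \<beta>^2 / mineig t" by (rule near[OF t(2) m(1) mineig_form])
  finally show "(?a - \<theta>) \<bullet> (?L *v (?a - \<theta>)) \<le> (4 * \<beta> / mineig t)^2" using m(1) by (simp add: field_simps power2_eq_square)
 qed (use m \<beta> in auto)
 finally show "sqrt (w t) \<le> 1 / sqrt (c t) + 4 * \<beta> / mineig t" by (simp add: c_inv real_sqrt_divide)
qed

lemma u_bounds: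
 assumes t: "t1 \<le> t" "t < n"
 shows "1 - \<epsilon> \<le> u t" "u t \<le> 1 + 3 * \<epsilon>" "1 - 3 * \<epsilon> \<le> 1 / u t" "1 / u t \<le> 1 + 2 * \<epsilon>" "0 < u t"
  "1 \<le> U t" "U t \<le> 1 + \<epsilon>"
proof -
 note s = stepD[OF t(2)]
 show U: "1 \<le> U t" "U t \<le> 1 + \<epsilon>" using s(2,5) sqrt_w_le(1)[OF t] by auto
 have "1 * (1 - \<epsilon>) \<le> u t" unfolding u_def using U u_step(2)[OF t] \<epsilon> by (intro mult_mono) auto
 thus 1: "1 - \<epsilon> \<le> u t" by simp
 have "u t \<le> (1 + \<epsilon>) * (1 + \<epsilon>)" unfolding u_def using U u_step(3)[OF t] \<epsilon> by (intro mult_mono) auto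
 also have "... = 1 + (2 + \<epsilon>) * \<epsilon>" by algebra
 also have "... \<le> 1 + 3 * \<epsilon>" using \<epsilon> by (intro add_left_mono mult_right_mono) auto
 finally show 2: "u t \<le> 1 + 3 * \<epsilon>" .
 show p: "0 < u t" using 1 \<epsilon>(5) by simp
 have "(1 - 3 * \<epsilon>) * u t \<le> (1 - 3 * \<epsilon>) * (1 + 3 * \<epsilon>)" using 2 \<epsilon>(5) by (intro mult_left_mono) auto
 also have "... \<le> 1" by (simp add: algebra_simps)
 finally show "1 - 3 * \<epsilon> \<le> 1 / u t" using p by (simp add: pos_le_divide_eq)
 have "\<epsilon> * (2 * \<epsilon>) \<le> \<epsilon> * 1" using \<epsilon> by (intro mult_left_mono) auto
 hence "1 \<le> (1 + 2 * \<epsilon>) * (1 - \<epsilon>)" by (simp add: algebra_simps)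
 also have "... \<le> (1 + 2 * \<epsilon>) * u t" using 1 \<epsilon> by (intro mult_left_mono) auto
 finally show "1 / u t \<le> 1 + 2 * \<epsilon>" using p by (simp add: pos_divide_le_eq)
qed

text \<open>By the Sherman-Morrison formula 1 / c drops by (G / c)^2 / (1 + w), so \<open>c\<close>
  grows by at least G^2 / (1 + w), where \<open>G\<close> is \<open>c\<close> times the pairing of
  \<theta> with \<Lambda>^-1 a. The alignment bound makes \<open>G\<close> almost one, hence the
  Schur complement gains almost one per round.\<close>

lemma c_step:
 assumes t: "t1 \<le> t" "t < n"
 shows "c t + (1 - 40 * A^2 * \<epsilon>) \<le> c (Suc t)"
proof -
 note s = stepD[OF t(2)]
 let ?L = "matrix_inv (gram a t)" and ?a = "a (Suc t)"
 define m where "m = mineig t"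
 define r where "r = sqrt (real t)"
 have m: "m > 0" using mineig_ge_1[of t] by (simp add: m_def)
 have r: "r > 0" using t_pos[OF t(1)] by (simp add: r_def)
 have rm: "\<beta> * r \<le> A * m" using crude_t(2)[of t] t by (simp add: m_def r_def)
 have g1: "1 / c t / u t - N * sqrt (1 / c t) / (m * u t) - N * sqrt (w t) / m \<le> \<theta> \<bullet> (?L *v ?a)"
  using alignment_lower_bound[OF spd_gram m _ s(3) _ u_bounds(5)[OF t] u_step(1)[OF t] norm_zeta(2)[OF t]]
   mineig_form mu_le_mineig[OF t(2)] N1 by (simp add: c_inv m_def w_def)
 have cr: "sqrt (c t) \<le> 2 * r"
 proof (rule real_le_lsqrt)
  show "c t \<le> (2 * r)^2" using c_le[of t] t by (simp add: r_def power_mult_distrib)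
 qed (use r in auto)
 have sc: "c t * sqrt (1 / c t) = sqrt (c t)" using c_pos[of t] by (simp add: real_sqrt_divide real_div_sqrt)
 have rN: "N * r / m \<le> A * \<epsilon>"
 proof -
  have "N * r / m = \<epsilon> * (\<beta> * r) / m" using \<epsilon>(3) by (simp add: mult.assoc[symmetric])
  also have "... \<le> \<epsilon> * (A * m) / m" using rm \<epsilon> m by (intro divide_right_mono mult_left_mono) auto
  finally show ?thesis using m by (simp add: mult.commute)
 qed
 have e1: "c t * (N * sqrt (1 / c t) / (m * u t)) \<le> 4 * (A * \<epsilon>)"
 proof -
  have "c t * (N * sqrt (1 / c t) / (m * u t)) = N * sqrt (c t) / m * (1 / u t)" using sc by simp
  also have "... \<le> N * (2 * r) / m * (1 + 2 * \<epsilon>)"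
   using cr u_bounds[OF t] \<epsilon> N1 m r c_pos[of t] by (intro mult_mono divide_right_mono mult_left_mono) auto
  also have "... = 2 * (1 + 2 * \<epsilon>) * (N * r / m)" by simp
  also have "... \<le> 4 * (A * \<epsilon>)" using rN \<epsilon> N1 r m by (intro mult_mono) auto
  finally show ?thesis .
 qed
 have e2: "c t * (N * sqrt (w t) / m) \<le> 12 * (A^2 * \<epsilon>)"
 proof -
  have "c t * sqrt (w t) \<le> c t * (1 / sqrt (c t) + 4 * \<beta> / m)"
   using sqrt_w_le(3)[OF t] c_pos[of t] by (intro mult_left_mono) (auto simp: m_def)
  also have "... = sqrt (c t) + 4 * (\<beta> * c t / m)" using c_pos[of t] by (simp add: distrib_left real_div_sqrt)
  also have "... \<le> 2 * r + 4 * (2 * A * r)"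
  proof -
   have "\<beta> * c t \<le> \<beta> * (2 * r^2)" using c_le[of t] t \<beta> by (intro mult_left_mono) (auto simp: r_def)
   also have "... = (\<beta> * r) * (2 * r)" by (simp add: power2_eq_square)
   also have "... \<le> (A * m) * (2 * r)" using rm r by (intro mult_right_mono) auto
   finally have "\<beta> * c t / m \<le> 2 * A * r" using m by (simp add: pos_divide_le_eq mult_ac)
   thus ?thesis using cr by linarith
  qed
  also have "... \<le> 10 * A * r" using A1 r by (simp add: algebra_simps)
  finally have "c t * sqrt (w t) \<le> 10 * A * r" .
  hence "N / m * (c t * sqrt (w t)) \<le> N / m * (10 * A * r)" using N1 m by (intro mult_left_mono) auto
  hence "c t * (N * sqrt (w t) / m) \<le> 10 * A * (N * r / m)" by (simp add: mult_ac)
  also have "... \<le> 10 * A * (A * \<epsilon>)" using rN A1 by (intro mult_left_mono) auto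
  also have "... = 10 * (A^2 * \<epsilon>)" by (simp add: power2_eq_square)
  also have "... \<le> 12 * (A^2 * \<epsilon>)" using \<epsilon>(1) by (intro mult_right_mono) auto
  finally show ?thesis .
 qed
 define G where "G = c t * (\<theta> \<bullet> (?L *v ?a))"
 have "c t * (1 / c t / u t - N * sqrt (1 / c t) / (m * u t) - N * sqrt (w t) / m) \<le> G"
  unfolding G_def using g1 c_pos[of t] by (intro mult_left_mono) auto
 hence "1 / u t - c t * (N * sqrt (1 / c t) / (m * u t)) - c t * (N * sqrt (w t) / m) \<le> G"
  using c_pos[of t] by (simp add: right_diff_distrib)
 hence "1 - 3 * \<epsilon> - 4 * (A * \<epsilon>) - 12 * (A^2 * \<epsilon>) \<le> G" using e1 e2 u_bounds(3)[OF t] by linarith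
 moreover have "A * \<epsilon> \<le> A^2 * \<epsilon>" using A1 \<epsilon> by (intro mult_right_mono) (auto simp: power2_eq_square)
 moreover have "\<epsilon> \<le> A^2 * \<epsilon>" using A_pow[of 2] \<epsilon> mult_right_mono[of 1 "A^2" \<epsilon>] by simp
 ultimately have G: "1 - 19 * (A^2 * \<epsilon>) \<le> G" and eA: "\<epsilon> \<le> A^2 * \<epsilon>" by linarith+
 define x where "x = A^2 * \<epsilon>"
 have x: "0 \<le> x" "200 * x \<le> 1" using \<epsilon> A_pow[of 2] by (auto simp: x_def)
 have G2: "1 - 38 * x \<le> G^2"
 proof -
  have "1 - 38 * x \<le> (1 - 19 * x)^2" by (simp add: power2_eq_square algebra_simps)
  also have "... \<le> G^2" using G x by (intro power_mono) (auto simp: x_def)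
  finally show ?thesis .
 qed
 have w: "0 < w t" "w t \<le> x" using s(4) sqrt_w_le(2)[OF t] eA unfolding x_def by linarith+
 have gain: "1 - 40 * x \<le> G^2 / (1 + w t)"
 proof -
  have "(1 - 40 * x) * (1 + w t) \<le> (1 - 40 * x) * (1 + x)" using w x by (intro mult_left_mono) auto
  also have "... \<le> 1 - 38 * x" using x by (simp add: algebra_simps)
  also have "... \<le> G^2" by (rule G2)
  finally show ?thesis using w by (simp add: pos_le_divide_eq)
 qed
 have SM: "1 / c (Suc t) = 1 / c t - (G / c t)^2 / (1 + w t)"
 proof -
  have Gc: "\<theta> \<bullet> (?L *v ?a) = G / c t" using c_pos[of t] by (simp add: G_def)
  have "(?L *v ?a) \<bullet> \<theta> = G / c t" by (subst inner_commute) (rule Gc)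
  hence "1 / c (Suc t) = \<theta> \<bullet> (?L *v \<theta> - (G / c t / (1 + w t)) *\<^sub>R (?L *v ?a))"
   unfolding c_inv[symmetric] gram_Suc sherman_morrison[OF spd_gram] w_def by simp
  also have "... = 1 / c t - G / c t / (1 + w t) * (G / c t)" unfolding inner_diff_right inner_scaleR_right Gc c_inv ..
  finally show ?thesis by (simp add: power2_eq_square)
 qed
 define h where "h = G^2 / (1 + w t)"
 have e: "1 / c (Suc t) = (1 - h / c t) / c t" unfolding SM by (simp add: h_def power2_eq_square diff_divide_distrib)
 have p: "0 < 1 - h / c t"
 proof -
  have "0 < (1 - h / c t) / c t" unfolding e[symmetric] using c_pos[of "Suc t"] by simp
  thus ?thesis using c_pos[of t] by (simp only: zero_less_divide_iff) linarith
 qed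
 have "c (Suc t) = 1 / (1 / c (Suc t))" by simp
 also have "... = c t / (1 - h / c t)" unfolding e by simp
 finally have q: "c (Suc t) = c t / (1 - h / c t)" .
 have "(c t + h) * (1 - h / c t) = c t - h^2 / c t" using c_pos[of t] by (simp add: field_simps power2_eq_square)
 also have "... \<le> c t" using c_pos[of t] by simp
 finally have "c t + h \<le> c (Suc t)" unfolding q using p by (simp add: pos_le_divide_eq)
 hence "c t + G^2 / (1 + w t) \<le> c (Suc t)" by (simp only: h_def)
 thus ?thesis using gain by (simp add: x_def)
qed

lemma c_lower: "t1 \<le> t \<Longrightarrow> t \<le> n \<Longrightarrow> (real t - real t1) * (1 - 40 * A^2 * \<epsilon>) \<le> c t"
proof (induction t rule: dec_induct)
 case base
 thus ?case using c_pos[of t1] by simp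
next
 case (step t)
 have "(real (Suc t) - real t1) * (1 - 40 * A^2 * \<epsilon>)
   = (real t - real t1) * (1 - 40 * A^2 * \<epsilon>) + (1 - 40 * A^2 * \<epsilon>)" by (simp add: algebra_simps)
 also have "... \<le> c t + (1 - 40 * A^2 * \<epsilon>)" using step by simp
 also have "... \<le> c (Suc t)" using step by (intro c_step) auto
 finally show ?case .
qed

lemma c_half: "4 * t1 \<le> t \<Longrightarrow> t \<le> n \<Longrightarrow> real t / 2 \<le> c t"
proof -
 assume t: "4 * t1 \<le> t" "t \<le> n"
 have "3 / 4 * real t \<le> real t - real t1" using t(1) by simp
 moreover have "4 / 5 \<le> 1 - 40 * A^2 * \<epsilon>" using \<epsilon>(4) by simp
 ultimately have "(3 / 4 * real t) * (4 / 5) \<le> (real t - real t1) * (1 - 40 * A^2 * \<epsilon>)" by (intro mult_mono) auto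
 thus ?thesis using c_lower[of t] t by simp
qed

text \<open>The form of \<open>gram a t\<close> couples \<open>\<theta>\<close> to its orthogonal complement only through the excess of
 \<open>\<theta> \<bullet> gram a t \<theta>\<close> over its Schur complement \<open>c t\<close>.\<close>

lemma cross_term_le:
 assumes h: "h \<bullet> \<theta> = 0"
 shows "(\<theta> \<bullet> (gram a t *v h))^2 \<le> (\<theta> \<bullet> (gram a t *v \<theta>) - c t) * (h \<bullet> (gram a t *v h))"
  "(c t)^2 * mineig t * (\<theta> \<bullet> (matrix_inv (gram a t) *v h))^2
   \<le> (\<theta> \<bullet> (gram a t *v \<theta>) - c t) * (norm h)^2"
proof -
 let ?L = "matrix_inv (gram a t)" and ?G = "gram a t"
 \<comment> \<open>\<open>f\<close> is orthogonal to \<theta>, its image under the Gram matrix pairs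
   with vectors orthogonal to \<theta> as the image of \<theta> does, and its form value is exactly
   the excess. Both bounds are Cauchy-Schwarz against \<open>f\<close>.\<close>
 define f where "f = \<theta> - c t *\<^sub>R (?L *v \<theta>)"
 have Gf: "?G *v f = ?G *v \<theta> - c t *\<^sub>R \<theta>"
  by (simp add: f_def matrix_vector_mult_diff_distrib matrix_vector_mult_scaleR spd_inverse[OF spd_gram])
 have Lt: "(?L *v \<theta>) \<bullet> (?G *v \<theta>) = 1"
  using spd_inner[OF spd_gram[of a t], of "?L *v \<theta>" \<theta>] theta_inner by (simp add: spd_inverse[OF spd_gram])
 have cL: "(?L *v \<theta>) \<bullet> \<theta> = 1 / c t" using c_inv[of t] by (simp add: inner_commute)
 have ff: "f \<bullet> (?G *v f) = \<theta> \<bullet> (?G *v \<theta>) - c t" unfolding Gf using c_pos[of t]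
  by (simp add: f_def inner_diff_left inner_diff_right Lt cL theta_inner)
 have hf: "h \<bullet> (?G *v f) = \<theta> \<bullet> (?G *v h)"
  unfolding Gf using h spd_inner[OF spd_gram[of a t], of h \<theta>] by (simp add: inner_diff_right inner_commute)
 have "(h \<bullet> (?G *v f))^2 \<le> (h \<bullet> (?G *v h)) * (f \<bullet> (?G *v f))" by (rule spd_cauchy_schwarz[OF spd_gram])
 thus "(\<theta> \<bullet> (?G *v h))^2 \<le> (\<theta> \<bullet> (?G *v \<theta>) - c t) * (h \<bullet> (?G *v h))" unfolding hf ff by (simp add: mult.commute)
 have "f \<bullet> h = - (c t * (\<theta> \<bullet> (?L *v h)))" using h inner_commute[of \<theta> h] spd_inv_sym[OF spd_gram[of a t], of \<theta> h]
  by (simp add: f_def inner_diff_left)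
 hence "(c t)^2 * (\<theta> \<bullet> (?L *v h))^2 = (f \<bullet> h)^2" by (simp add: power_mult_distrib)
 also have "... \<le> (norm f)^2 * (norm h)^2" using Cauchy_Schwarz_ineq[of f h] by (simp add: dot_square_norm)
 finally have "mineig t * ((c t)^2 * (\<theta> \<bullet> (?L *v h))^2) \<le> mineig t * ((norm f)^2 * (norm h)^2)"
  using mineig_ge_1[of t] by (intro mult_left_mono) auto
 also have "... = mineig t * (norm f)^2 * (norm h)^2" by simp
 also have "... \<le> (f \<bullet> (?G *v f)) * (norm h)^2" using mineig_form[of t f] by (intro mult_right_mono) auto
 finally show "(c t)^2 * mineig t * (\<theta> \<bullet> (?L *v h))^2 \<le> (\<theta> \<bullet> (?G *v \<theta>) - c t) * (norm h)^2" unfolding ff by (simp add: mult_ac)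
qed

end

section \<open>The exploration rate\<close>

context ucb_fine
begin

text \<open>The coupling between \<theta> and its complement is known only through an excess of
  order \<epsilon> t, of which Cauchy-Schwarz takes the square root. This is the origin of the
  square root in part (b).\<close>

definition \<kappa> :: real where "\<kappa> = sqrt \<epsilon>"

lemma \<kappa>: "0 < \<kappa>" "\<kappa>^2 = \<epsilon>" "\<epsilon> \<le> \<kappa>" "\<kappa> \<le> 1"
proof -
 show 1: "0 < \<kappa>" "\<kappa>^2 = \<epsilon>" using \<epsilon>(1) by (auto simp: \<kappa>_def)
 show 2: "\<kappa> \<le> 1" using \<epsilon>(5) unfolding \<kappa>_def by (intro real_le_lsqrt) auto
 have "\<kappa>^2 \<le> \<kappa> * 1" using 1 2 unfolding power2_eq_square by (intro mult_left_mono) auto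
 thus "\<epsilon> \<le> \<kappa>" using 1 by simp
qed

lemma N_le: "N \<le> \<beta>"
proof -
 have "\<epsilon> * \<beta> \<le> 1 * \<beta>" using \<epsilon>(5) \<beta> by (intro mult_right_mono) auto
 thus ?thesis using \<epsilon>(3) by simp
qed

text \<open>The factor \<beta> makes the rounds before \<open>t1\<close>, in which the growth of
  \<open>c\<close> is not controlled, at most a fraction \<epsilon> / 2 of all rounds.\<close>

definition late :: "nat \<Rightarrow> bool" where "late t \<longleftrightarrow> 2 * \<beta> * real t1 \<le> real t \<and> t \<le> n"

lemma late_n: "late t \<Longrightarrow> t \<le> n" by (simp add: late_def)

lemma late_t1: "late t \<Longrightarrow> 4 * t1 \<le> t"
proof -
 assume "late t"
 have "200 * 1 * 1 \<le> 200 * A^2 * N" using A_pow[of 2] N1 by (intro mult_mono) auto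
 hence "2 \<le> \<beta>" using N\<beta> by linarith
 hence "2 * 2 * real t1 \<le> 2 * \<beta> * real t1" by (intro mult_right_mono mult_left_mono) auto
 thus ?thesis using \<open>late t\<close> by (simp add: late_def)
qed

lemma late_t1': "late t \<Longrightarrow> t1 \<le> t" using late_t1[of t] by simp

lemma A_le_pow: "1 \<le> k \<Longrightarrow> A \<le> A ^ k" and A_pow_mono: "j \<le> k \<Longrightarrow> A ^ j \<le> A ^ k"
 using A1 by (simp_all add: self_le_power power_increasing)

context
 fixes t assumes lt: "late t"
begin

abbreviation "r \<equiv> sqrt (real t)"
abbreviation "m \<equiv> mineig t"
abbreviation "G \<equiv> gram a t"
abbreviation "L \<equiv> matrix_inv (gram a t)"
definition "Bt = \<theta> \<bullet> (gram a t *v \<theta>) - c t"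

lemma r: "0 < r" "r * r = real t" "1 \<le> r" "10 ^ 4 * A * \<beta> ^ 3 \<le> r" "10 ^ 4 * \<beta> \<le> r" "10 ^ 4 * A^2 \<le> r"
 using s_ge'[OF late_t1'[OF lt]] by auto

lemma m: "0 < m" "\<beta> * r \<le> A * m" "m \<le> A * (\<beta> * r)" "tr_perp t \<le> A * (\<beta> * r)"
 using mineig_ge_1[of t] crude_t[OF late_t1'[OF lt] late_n[OF lt]] mineig_le_tr_perp[of t] by auto

lemma t_eps: "1 \<le> \<epsilon> * real t" "1 / real t \<le> \<epsilon>" "real t1 \<le> \<epsilon> * real t / 2"
proof -
 have "2 * \<beta> * real t1 \<le> real t" using lt by (simp add: late_def)
 hence "real t1 \<le> 1 / \<beta> * real t / 2" using \<beta> by (simp add: field_simps)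
 also have "... \<le> \<epsilon> * real t / 2" using \<epsilon>(2) by (intro divide_right_mono mult_right_mono) auto
 finally show "real t1 \<le> \<epsilon> * real t / 2" .
 have "\<beta> * 1 \<le> r * r" using r(1,3,5) \<beta> by (intro mult_mono) auto
 hence "1 \<le> 1 / \<beta> * real t" using \<beta> r(2) by (simp add: field_simps)
 also have "... \<le> \<epsilon> * real t" using \<epsilon>(2) by (intro mult_right_mono) auto
 finally show "1 \<le> \<epsilon> * real t" .
 thus "1 / real t \<le> \<epsilon>" using r by (simp add: pos_divide_le_eq)
qed

lemma c_bounds: "real t / 2 \<le> c t" "c t \<le> 1 + real t" "real t * (1 - 41 * A^2 * \<epsilon>) \<le> c t"
 "\<theta> \<bullet> (G *v \<theta>) \<le> 1 + real t" "c t \<le> \<theta> \<bullet> (G *v \<theta>)" "Bt \<le> 42 * A^2 * \<epsilon> * real t" "0 \<le> Bt"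
proof -
 show "real t / 2 \<le> c t" by (rule c_half[OF late_t1[OF lt] late_n[OF lt]])
 show 1: "\<theta> \<bullet> (G *v \<theta>) \<le> 1 + real t" "c t \<le> \<theta> \<bullet> (G *v \<theta>)" using form_theta_le[OF late_n[OF lt]] c_le_form[of t] by auto
 thus "c t \<le> 1 + real t" by linarith
 have eA: "\<epsilon> \<le> A^2 * \<epsilon>" using A_pow[of 2] \<epsilon>(1) by simp
 hence eAt: "\<epsilon> * real t \<le> A^2 * \<epsilon> * real t" by (intro mult_right_mono) auto
 have "real t1 * (1 - 40 * A^2 * \<epsilon>) \<le> real t1" using \<epsilon>(1) by (simp add: mult_left_le)
 moreover have "(real t - real t1) * (1 - 40 * A^2 * \<epsilon>) \<le> c t" by (rule c_lower[OF late_t1'[OF lt] late_n[OF lt]])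
 ultimately have "real t - 40 * A^2 * \<epsilon> * real t - real t1 \<le> c t" by (simp add: algebra_simps)
 thus 2: "real t * (1 - 41 * A^2 * \<epsilon>) \<le> c t" using t_eps(3) eAt by (simp add: algebra_simps)
 thus "Bt \<le> 42 * A^2 * \<epsilon> * real t" using 1 t_eps(1) eAt by (simp add: Bt_def algebra_simps)
 show "0 \<le> Bt" using 1 by (simp add: Bt_def)
qed

lemma cross_le:
 assumes h: "h \<bullet> \<theta> = 0"
 shows "\<bar>\<theta> \<bullet> (G *v h)\<bar> \<le> 7 * A * \<kappa> * r * sqrt (h \<bullet> (G *v h))"
proof -
 have "(\<theta> \<bullet> (G *v h))^2 \<le> (42 * A^2 * \<epsilon> * real t) * (h \<bullet> (G *v h))" by (rule order_trans[OF cross_term_le(1)[OF h]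
     mult_right_mono[OF c_bounds(6)[unfolded Bt_def] spd_nonneg[OF spd_gram]]])
 also have "... \<le> (49 * A^2 * \<epsilon> * real t) * (h \<bullet> (G *v h))"
  using \<epsilon>(1) spd_nonneg[OF spd_gram[of a t], of h] by (intro mult_right_mono) auto
 also have "... = (7 * A * \<kappa> * r * sqrt (h \<bullet> (G *v h)))^2"
  using spd_nonneg[OF spd_gram[of a t], of h] by (simp add: power_mult_distrib \<kappa>(2))
 finally have "\<bar>\<theta> \<bullet> (G *v h)\<bar> \<le> \<bar>7 * A * \<kappa> * r * sqrt (h \<bullet> (G *v h))\<bar>" by (simp add: abs_le_square_iff)
 thus ?thesis using A1 \<kappa>(1) spd_nonneg[OF spd_gram[of a t], of h] by simp
qed

context
 assumes ltn: "t < n"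
begin

definition "x = a (Suc t) \<bullet> \<theta>"
definition "p = (norm (y (Suc t)))^2"
text \<open>\<open>E\<close> and \<open>F\<close> are the forms of the Gram matrix and of its
  inverse at the exploratory component; by p^2 \<le> E F they squeeze the exploration rate.\<close>

definition "E = y (Suc t) \<bullet> (G *v y (Suc t))"
definition "F = y (Suc t) \<bullet> (L *v y (Suc t))"
definition "\<eta> = \<theta> \<bullet> (G *v y (Suc t))"

lemma a_decomp: "a (Suc t) = x *\<^sub>R \<theta> + y (Suc t)" by (simp add: y_def x_def)

lemma y_perp: "y (Suc t) \<bullet> \<theta> = 0" by (simp add: y_def inner_diff_left theta_inner)

text \<open>\<open>p\<close> is at most of order \<beta> / sqrt t because it is at most 16 \<beta>^2
  / m and the least eigenvalue is of order \<beta> sqrt t.\<close>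

lemma p: "0 \<le> p" "p \<le> 1" "x^2 = 1 - p" "p * r \<le> 16 * A * \<beta>" "p \<le> \<epsilon>" "\<bar>x\<bar> \<le> 1"
proof -
 show "0 \<le> p" by (simp add: p_def)
 show 1: "p \<le> 1" unfolding p_def by (rule norm_y_le_1[OF ltn])
 show x: "x^2 = 1 - p" using norm_y[of "Suc t"] stepD(1)[OF ltn] by (simp add: p_def x_def)
 have "p \<le> 16 * \<beta>^2 / m" unfolding p_def by (rule y_le[OF ltn m(1) mineig_form])
 hence "p * m \<le> 16 * \<beta>^2" using m(1) by (simp add: pos_le_divide_eq)
 have "\<beta> * (p * r) = p * (\<beta> * r)" by simp
 also have "... \<le> p * (A * m)" using m(2) by (intro mult_left_mono) (auto simp: p_def)
 also have "... = A * (p * m)" by simp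
 also have "... \<le> A * (16 * \<beta>^2)" using \<open>p * m \<le> _\<close> A1 by (intro mult_left_mono) auto
 also have "... = \<beta> * (16 * A * \<beta>)" by (simp add: power2_eq_square)
 finally show pr: "p * r \<le> 16 * A * \<beta>" using \<beta> by (simp only: mult_le_cancel_left_pos)
 have "p * (10 ^ 4 * A * \<beta> ^ 3) \<le> p * r" using r(4) by (intro mult_left_mono) (auto simp: p_def)
 hence "(A * \<beta>) * (p * (10 ^ 4 * \<beta>^2)) \<le> (A * \<beta>) * 16" using pr by (simp add: power_numeral_reduce mult_ac)
 hence "p * (10 ^ 4 * \<beta>^2) \<le> 16" using A1 \<beta> by (subst (asm) mult_le_cancel_left_pos) auto
 moreover have "p * \<beta> \<le> p * (10 ^ 4 * \<beta>^2) / 16"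
 proof -
  have "\<beta> \<le> 10 ^ 4 * \<beta>^2 / 16" using \<beta>1 by (simp add: power2_eq_square)
  hence "p * \<beta> \<le> p * (10 ^ 4 * \<beta>^2 / 16)" by (intro mult_left_mono) (auto simp: p_def)
  thus ?thesis by simp
 qed
 ultimately have "p \<le> 1 / \<beta>" using \<beta> by (simp add: pos_le_divide_eq)
 thus "p \<le> \<epsilon>" using \<epsilon>(2) by linarith
 have "x^2 \<le> 1^2" using x by (simp add: p_def)
 thus "\<bar>x\<bar> \<le> 1" using abs_le_square_iff[of x 1] by simp
qed

lemma E_bounds: "0 \<le> E" "E \<le> tr_perp t * p" "E \<le> (4 * A * \<beta>)^2" "sqrt E \<le> 4 * A * \<beta>"
proof -
 show "0 \<le> E" unfolding E_def by (rule spd_nonneg[OF spd_gram])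
 show 1: "E \<le> tr_perp t * p" unfolding E_def p_def by (rule form_perp_le[OF y_perp])
 also have "... \<le> (A * (\<beta> * r)) * p" using m(4) p(1) by (intro mult_right_mono) auto
 also have "... = A * \<beta> * (p * r)" by simp
 also have "... \<le> A * \<beta> * (16 * A * \<beta>)" using p(4) A1 \<beta> by (intro mult_left_mono) auto
 also have "... = (4 * A * \<beta>)^2" by (simp add: power2_eq_square)
 finally show "E \<le> (4 * A * \<beta>)^2" .
 thus "sqrt E \<le> 4 * A * \<beta>" using A1 \<beta> by (intro real_le_lsqrt) auto
qed

lemma \<eta>_bound: "\<bar>\<eta>\<bar> \<le> 28 * A^2 * \<kappa> * \<beta> * r"
proof -
 have "\<bar>\<eta>\<bar> \<le> 7 * A * \<kappa> * r * sqrt E" unfolding \<eta>_def E_def by (rule cross_le[OF y_perp])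
 also have "... \<le> 7 * A * \<kappa> * r * (4 * A * \<beta>)" using E_bounds(4) A1 \<kappa>(1) by (intro mult_left_mono) auto
 finally show ?thesis by (simp add: power2_eq_square mult_ac)
qed

lemma w_r: "sqrt (w t) * r \<le> 6 * A"
proof -
 have "sqrt (w t) \<le> 1 / sqrt (c t) + 4 * \<beta> / m" by (rule sqrt_w_le(3)[OF late_t1'[OF lt] ltn])
 hence "sqrt (w t) * r \<le> (1 / sqrt (c t) + 4 * \<beta> / m) * r" by (intro mult_right_mono) auto
 also have "... = r / sqrt (c t) + 4 * ((\<beta> * r) / m)" by (simp add: algebra_simps)
 also have "(\<beta> * r) / m \<le> A" using m by (simp add: pos_divide_le_eq)
 also have "r / sqrt (c t) \<le> 2"
 proof -
  have "r \<le> sqrt (4 * c t)" using c_bounds(1) c_pos[of t] by (intro real_sqrt_le_mono) linarith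
  hence "r \<le> 2 * sqrt (c t)" by (simp add: real_sqrt_mult)
  thus ?thesis using c_pos[of t] by (simp add: pos_divide_le_eq)
 qed
 finally show ?thesis using A1 by simp
qed

text \<open>The multiplier has the order \<beta> sqrt t of the eigenvalues: it is below the least
  one, and U \<mu> sqrt w = \<beta> with sqrt w at most of order 1 / sqrt t.\<close>

lemma \<mu>_bounds: "0 < \<mu> t" "\<mu> t \<le> m" "\<beta> * r \<le> 12 * A * \<mu> t" "\<mu> t \<le> A * (\<beta> * r)" "(\<mu> t)^2 / real t \<le> A^2 * \<beta>^2"
proof -
 note s = stepD[OF ltn]
 show 1: "0 < \<mu> t" "\<mu> t \<le> m" using s(3) mu_le_mineig[OF ltn] .
 thus 2: "\<mu> t \<le> A * (\<beta> * r)" using m(3) by linarith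
 have "\<beta> * r = U t * \<mu> t * (sqrt (w t) * r)" using s(6) by (simp add: mult.assoc[symmetric])
 also have "... \<le> 2 * \<mu> t * (6 * A)"
 proof (rule mult_mono)
  have "U t \<le> 2" using u_bounds(7)[OF late_t1'[OF lt] ltn] \<epsilon>(5) by linarith
  thus "U t * \<mu> t \<le> 2 * \<mu> t" using 1 by (intro mult_right_mono) auto
 qed (use 1 w_r s(4) in auto)
 finally show "\<beta> * r \<le> 12 * A * \<mu> t" by (simp add: mult_ac)
 have "(\<mu> t)^2 \<le> (A * (\<beta> * r))^2" using 1 2 by (intro power_mono) auto
 thus "(\<mu> t)^2 / real t \<le> A^2 * \<beta>^2" using r(1,2) by (simp add: power_mult_distrib pos_divide_le_eq mult_ac)
qed

lemma \<theta>Ly: "\<bar>\<theta> \<bullet> (L *v y (Suc t))\<bar> \<le> 52 * A^2 * \<kappa> / real t"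
proof -
 define q where "q = \<theta> \<bullet> (L *v y (Suc t))"
 have "(real t / 2)^2 * (\<beta> * r / A) * q^2 \<le> (c t)^2 * m * q^2"
  using c_bounds(1) m A1 \<beta> by (intro mult_right_mono mult_mono power_mono) (auto simp: pos_divide_le_eq mult.commute)
 also have "... \<le> Bt * p" unfolding q_def Bt_def p_def by (rule cross_term_le(2)[OF y_perp])
 also have "... \<le> (42 * A^2 * \<epsilon> * real t) * p" using c_bounds(6) p(1) by (intro mult_right_mono) auto
 finally have "(real t / 2)^2 * (\<beta> * r / A) * q^2 * (r * A) \<le> (42 * A^2 * \<epsilon> * real t) * p * (r * A)"
  using A1 by (intro mult_right_mono) auto
 hence "(\<beta> * real t) * (real t * q)^2 / 4 \<le> 42 * A ^ 3 * \<epsilon> * real t * (p * r)"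
  using A1 r(2) by (simp add: power2_eq_square power3_eq_cube mult_ac)
 also have "... \<le> 42 * A ^ 3 * \<epsilon> * real t * (16 * A * \<beta>)" using p(4) A1 \<epsilon>(1) by (intro mult_left_mono) auto
 also have "... = (\<beta> * real t) * (672 * A ^ 4 * \<epsilon>)" by (simp add: power_numeral_reduce mult_ac)
 finally have "(\<beta> * real t) * ((real t * q)^2 / 4) \<le> (\<beta> * real t) * (672 * A ^ 4 * \<epsilon>)" by simp
 hence "(real t * q)^2 / 4 \<le> 672 * A ^ 4 * \<epsilon>" using \<beta> r(1) by (subst (asm) mult_le_cancel_left_pos) auto
 moreover have "0 \<le> A ^ 4 * \<epsilon>" using \<epsilon>(1) A1 by simp
 ultimately have "(real t * q)^2 \<le> 2704 * (A ^ 4 * \<epsilon>)" by linarith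
 also have "... = (52 * A^2 * \<kappa>)^2" by (simp add: power_mult_distrib \<kappa>(2) flip: power_mult)
 finally have "\<bar>real t * q\<bar> \<le> \<bar>52 * A^2 * \<kappa>\<bar>" by (simp only: abs_le_square_iff)
 hence "real t * \<bar>q\<bar> \<le> 52 * A^2 * \<kappa>" using A1 \<kappa>(1) by (simp add: abs_mult)
 thus ?thesis using r(1) by (simp add: q_def pos_le_divide_eq mult.commute)
qed

text \<open>Expanding \<open>w\<close> along a = x \<theta> + y gives x^2 / c, which is almost 1 /
  t, a cross term bounded by \<open>\<theta>Ly\<close>, and \<open>F\<close>.\<close>

lemma F_bound: "\<bar>F - (w t - 1 / real t)\<bar> \<le> 190 * A^2 * \<kappa> / real t"
proof -
 have tp: "real t > 0" using r(1) by simp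
 have we: "w t = x^2 / c t + 2 * x * (\<theta> \<bullet> (L *v y (Suc t))) + F"
 proof -
  have "y (Suc t) \<bullet> (L *v \<theta>) = \<theta> \<bullet> (L *v y (Suc t))"
   using spd_inv_sym[OF spd_gram[of a t], of \<theta> "y (Suc t)"] by (simp add: inner_commute)
  moreover have "\<theta> \<bullet> (L *v \<theta>) = 1 / c t" by (rule c_inv)
  ultimately show ?thesis unfolding w_def a_decomp F_def
   by (simp add: matrix_vector_right_distrib matrix_vector_mult_scaleR inner_add_left inner_add_right
     power2_eq_square algebra_simps)
 qed
 have "\<bar>2 * x * (\<theta> \<bullet> (L *v y (Suc t)))\<bar> \<le> 2 * 1 * (52 * A^2 * \<kappa> / real t)"
  unfolding abs_mult using p(6) \<theta>Ly A1 \<kappa>(1) by (intro mult_mono) auto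
 hence e1: "\<bar>2 * x * (\<theta> \<bullet> (L *v y (Suc t)))\<bar> \<le> 104 * (A^2 * \<kappa> / real t)" by simp
 have e2: "x^2 / c t \<le> 1 / real t + 82 * (A^2 * \<kappa> / real t)"
 proof -
  define z where "z = 41 * A^2 * \<epsilon>"
  have z: "0 \<le> z" "z \<le> 1 / 2" using \<epsilon>(1,4) by (auto simp: z_def)
  have "x^2 / c t \<le> 1 / (real t * (1 - z))" using p(1,3) c_bounds(3) tp z by (intro frac_le) (auto simp: z_def)
  also have "... \<le> (1 + 2 * z) / real t"
  proof -
   have "z * (2 * z) \<le> z * 1" using z by (intro mult_left_mono) auto
   hence "1 \<le> (1 + 2 * z) * (1 - z)" by (simp add: algebra_simps)
   hence "1 / (1 - z) \<le> 1 + 2 * z" using z by (simp add: pos_divide_le_eq)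
   hence "1 / (1 - z) / real t \<le> (1 + 2 * z) / real t" using tp by (intro divide_right_mono) auto
   thus ?thesis by (simp add: mult.commute)
  qed
  also have "... = 1 / real t + 82 * (A^2 * \<epsilon> / real t)" by (simp add: z_def add_divide_distrib)
  also have "... \<le> 1 / real t + 82 * (A^2 * \<kappa> / real t)"
   using \<kappa>(3) tp by (intro add_left_mono mult_left_mono divide_right_mono) auto
  finally show ?thesis .
 qed
 have e3: "1 / real t - 2 * (A^2 * \<kappa> / real t) \<le> x^2 / c t"
 proof -
  have "(1 - 2 * \<epsilon>) * (1 + real t) \<le> (1 - p) * real t"
  proof -
   have "p * real t \<le> \<epsilon> * real t" using p(5) by (intro mult_right_mono) auto
   thus ?thesis using t_eps(1) \<epsilon>(1) by (simp add: algebra_simps)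
  qed
  hence "(1 - 2 * \<epsilon>) / real t \<le> (1 - p) / (1 + real t)" using tp by (simp add: divide_simps mult.commute)
  also have "... \<le> x^2 / c t" unfolding p(3) using c_bounds(2) c_pos[of t] p(2) by (intro divide_left_mono) auto
  finally have "1 / real t - 2 * (\<epsilon> / real t) \<le> x^2 / c t" by (simp add: diff_divide_distrib)
  moreover have "1 * \<epsilon> \<le> A^2 * \<kappa>" using A_pow[of 2] \<kappa>(3) \<epsilon>(1) by (intro mult_mono) auto
  hence "\<epsilon> / real t \<le> A^2 * \<kappa> / real t" using tp by (intro divide_right_mono) auto
  ultimately show ?thesis by linarith
 qed
 have q: "0 \<le> A^2 * \<kappa> / real t" using \<kappa>(1) by simp
 have "190 * A^2 * \<kappa> / real t = 190 * (A^2 * \<kappa> / real t)" by simp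
 moreover have "\<bar>F - (w t - 1 / real t)\<bar> \<le> 190 * (A^2 * \<kappa> / real t)" using e1 e2 e3 q unfolding we by linarith
 ultimately show ?thesis by simp
qed

text \<open>U^2 \<mu>^2 w = \<beta>^2 with \<open>U\<close> close to one turns the estimate of
  \<open>F\<close> into one free of \<open>w\<close>.\<close>

lemma mu2_F: "\<bar>(\<mu> t)^2 * F - (\<beta>^2 - (\<mu> t)^2 / real t)\<bar> \<le> 192 * A ^ 4 * \<kappa> * \<beta>^2"
proof -
 note s = stepD[OF ltn]
 note ub = u_bounds(6,7)[OF late_t1'[OF lt] ltn]
 have tp: "real t > 0" using r(1) by simp
 have b: "(U t)^2 * ((\<mu> t)^2 * w t) = \<beta>^2" unfolding s(6)[symmetric] using s(4) by (simp add: power_mult_distrib)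
 have 1: "(\<mu> t)^2 * w t \<le> \<beta>^2"
 proof -
  have "1 * ((\<mu> t)^2 * w t) \<le> (U t)^2 * ((\<mu> t)^2 * w t)" using ub s(4) by (intro mult_right_mono) auto
  thus ?thesis using b by simp
 qed
 have 2: "\<beta>^2 - 2 * (\<epsilon> * \<beta>^2) \<le> (\<mu> t)^2 * w t"
 proof -
  have U2: "(U t)^2 \<le> (1 + \<epsilon>)^2" using ub by (intro power_mono) auto
  have "(1 - 2 * \<epsilon>) * (U t)^2 \<le> (1 - 2 * \<epsilon>) * (1 + \<epsilon>)^2" using U2 \<epsilon>(5) by (intro mult_left_mono) auto
  also have "... = 1 - \<epsilon>^2 * (3 + 2 * \<epsilon>)" by algebra
  also have "... \<le> 1" using \<epsilon>(1) by simp
  finally have "(1 - 2 * \<epsilon>) * (U t)^2 * ((\<mu> t)^2 * w t) \<le> 1 * ((\<mu> t)^2 * w t)" using s(4) by (intro mult_right_mono) auto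
  hence "(1 - 2 * \<epsilon>) * \<beta>^2 \<le> (\<mu> t)^2 * w t" unfolding mult.assoc b by simp
  thus ?thesis by (simp add: algebra_simps)
 qed
 have "(\<mu> t)^2 * F - ((\<mu> t)^2 * w t - (\<mu> t)^2 / real t) = (\<mu> t)^2 * (F - (w t - 1 / real t))" by (simp add: right_diff_distrib)
 hence "\<bar>(\<mu> t)^2 * F - ((\<mu> t)^2 * w t - (\<mu> t)^2 / real t)\<bar> = (\<mu> t)^2 * \<bar>F - (w t - 1 / real t)\<bar>" by (simp only: abs_mult) simp
 also have "... \<le> (\<mu> t)^2 * (190 * A^2 * \<kappa> / real t)" by (intro mult_left_mono F_bound) auto
 also have "... = 190 * A^2 * \<kappa> * ((\<mu> t)^2 / real t)" by simp
 also have "... \<le> 190 * A^2 * \<kappa> * (A^2 * \<beta>^2)" using \<mu>_bounds(5) \<kappa>(1) by (intro mult_left_mono) auto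
 finally have 3: "\<bar>(\<mu> t)^2 * F - ((\<mu> t)^2 * w t - (\<mu> t)^2 / real t)\<bar> \<le> 190 * (A ^ 4 * \<kappa> * \<beta>^2)"
  by (simp add: power_numeral_reduce mult_ac)
 have "1 * \<epsilon> * \<beta>^2 \<le> A ^ 4 * \<kappa> * \<beta>^2" using A_pow[of 4] \<kappa> \<epsilon>(1) by (intro mult_mono) auto
 hence "\<epsilon> * \<beta>^2 \<le> A ^ 4 * \<kappa> * \<beta>^2" "0 \<le> \<epsilon> * \<beta>^2" using \<epsilon>(1) by auto
 hence "\<bar>(\<mu> t)^2 * F - (\<beta>^2 - (\<mu> t)^2 / real t)\<bar> \<le> 192 * (A ^ 4 * \<kappa> * \<beta>^2)" using 1 2 3 by linarith
 thus ?thesis by (simp add: mult_ac)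
qed

lemma stationarity:
 "h \<bullet> (G *v a (Suc t)) - \<mu> t * (h \<bullet> a (Suc t)) = (h \<bullet> (G *v \<theta>) + h \<bullet> (G *v \<zeta> t)) / u t"
proof -
 have u: "u t > 0" by (rule u_bounds(5)[OF late_t1'[OF lt] ltn])
 have "G *v (u t *\<^sub>R a (Suc t)) = G *v \<theta> + G *v \<zeta> t + (u t * \<mu> t) *\<^sub>R a (Suc t)" unfolding u_step(1)[OF late_t1'[OF lt] ltn]
  by (simp only: matrix_vector_right_distrib matrix_vector_mult_scaleR spd_inverse[OF spd_gram])
 hence "u t * (h \<bullet> (G *v a (Suc t))) = h \<bullet> (G *v \<theta>) + h \<bullet> (G *v \<zeta> t) + (u t * \<mu> t) * (h \<bullet> a (Suc t))"
  unfolding matrix_vector_mult_scaleR by (metis inner_add_right inner_scaleR_right)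
 thus ?thesis using u by (simp add: field_simps)
qed

lemma \<zeta>_pair: "\<bar>h \<bullet> (G *v \<zeta> t)\<bar> \<le> N * sqrt (h \<bullet> (G *v h))"
proof -
 have "\<bar>h \<bullet> (G *v \<zeta> t)\<bar> \<le> sqrt (h \<bullet> (G *v h)) * sqrt (\<zeta> t \<bullet> (G *v \<zeta> t))" by (rule spd_cauchy_schwarz_abs[OF spd_gram])
 also have "... \<le> sqrt (h \<bullet> (G *v h)) * N" using norm_zeta(2)[OF late_t1'[OF lt] ltn] N1 spd_nonneg[OF spd_gram[of a t], of h]
  by (intro mult_left_mono real_le_lsqrt) auto
 finally show ?thesis by (simp add: mult.commute)
qed

text \<open>The stationarity equation tested with the exploratory component and with \<theta>. The
  first makes E almost \<mu> p; the second determines size and sign of x - 1 / u.\<close>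

lemma drive_scalar:
 "E - \<mu> t * p = (1 / u t - x) * \<eta> + (y (Suc t) \<bullet> (G *v \<zeta> t)) / u t"
 "(\<theta> \<bullet> (G *v \<theta>)) * (x - 1 / u t) = \<mu> t * x - \<eta> + (\<theta> \<bullet> (G *v \<zeta> t)) / u t"
proof -
 have yt: "\<theta> \<bullet> y (Suc t) = 0" using y_perp by (simp add: inner_commute)
 have yG: "y (Suc t) \<bullet> (G *v \<theta>) = \<eta>" using spd_inner[OF spd_gram[of a t], of "y (Suc t)" \<theta>] by (simp add: \<eta>_def inner_commute)
 have "y (Suc t) \<bullet> (G *v a (Suc t)) = x * \<eta> + E"
  unfolding a_decomp by (simp add: matrix_vector_right_distrib matrix_vector_mult_scaleR inner_add_right yG E_def)
 moreover have "y (Suc t) \<bullet> a (Suc t) = p" unfolding a_decomp by (simp add: inner_add_right y_perp p_def dot_square_norm)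
 ultimately show "E - \<mu> t * p = (1 / u t - x) * \<eta> + (y (Suc t) \<bullet> (G *v \<zeta> t)) / u t"
  using stationarity[of "y (Suc t)"] yG by (simp add: algebra_simps add_divide_distrib)
 have "\<theta> \<bullet> (G *v a (Suc t)) = x * (\<theta> \<bullet> (G *v \<theta>)) + \<eta>"
  unfolding a_decomp by (simp add: matrix_vector_right_distrib matrix_vector_mult_scaleR inner_add_right \<eta>_def)
 moreover have "\<theta> \<bullet> a (Suc t) = x" by (simp add: x_def inner_commute)
 ultimately show "(\<theta> \<bullet> (G *v \<theta>)) * (x - 1 / u t) = \<mu> t * x - \<eta> + (\<theta> \<bullet> (G *v \<zeta> t)) / u t"
  using stationarity[of \<theta>] by (simp add: algebra_simps add_divide_distrib)
qed

lemma inv_u: "0 < 1 / u t" "1 / u t \<le> 2" using u_bounds(4,5)[OF late_t1'[OF lt] ltn] \<epsilon>(5) by auto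

lemma \<zeta>_bounds: "\<bar>y (Suc t) \<bullet> (G *v \<zeta> t)\<bar> / u t \<le> 8 * A * \<epsilon> * \<beta>^2" "\<bar>\<theta> \<bullet> (G *v \<zeta> t)\<bar> / u t \<le> 4 * N * r"
proof -
 have "\<bar>y (Suc t) \<bullet> (G *v \<zeta> t)\<bar> \<le> N * sqrt E" unfolding E_def by (rule \<zeta>_pair)
 also have "... \<le> N * (4 * A * \<beta>)" using E_bounds(4) N1 by (intro mult_left_mono) auto
 finally have "(1 / u t) * \<bar>y (Suc t) \<bullet> (G *v \<zeta> t)\<bar> \<le> 2 * (N * (4 * A * \<beta>))" using inv_u by (intro mult_mono) auto
 thus "\<bar>y (Suc t) \<bullet> (G *v \<zeta> t)\<bar> / u t \<le> 8 * A * \<epsilon> * \<beta>^2"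
 proof -
  have "8 * A * \<epsilon> * \<beta>^2 = 8 * A * (\<epsilon> * \<beta>) * \<beta>" by (simp add: power2_eq_square)
  hence "8 * A * \<epsilon> * \<beta>^2 = 2 * (N * (4 * A * \<beta>))" unfolding \<epsilon>(3) by simp
  moreover have "\<bar>y (Suc t) \<bullet> (G *v \<zeta> t)\<bar> / u t = (1 / u t) * \<bar>y (Suc t) \<bullet> (G *v \<zeta> t)\<bar>" by simp
  ultimately show ?thesis using \<open>(1 / u t) * \<bar>y (Suc t) \<bullet> (G *v \<zeta> t)\<bar> \<le> _\<close> by linarith
 qed
 have "\<bar>\<theta> \<bullet> (G *v \<zeta> t)\<bar> \<le> N * sqrt (\<theta> \<bullet> (G *v \<theta>))" by (rule \<zeta>_pair)
 also have "... \<le> N * (2 * r)"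
 proof (intro mult_left_mono real_le_lsqrt)
  show "\<theta> \<bullet> (G *v \<theta>) \<le> (2 * r)^2" using c_bounds(4) t_pos[OF late_t1'[OF lt]] by (simp add: power_mult_distrib)
 qed (use N1 r(1) in auto)
 finally have "(1 / u t) * \<bar>\<theta> \<bullet> (G *v \<zeta> t)\<bar> \<le> 2 * (N * (2 * r))" using inv_u by (intro mult_mono) auto
 thus "\<bar>\<theta> \<bullet> (G *v \<zeta> t)\<bar> / u t \<le> 4 * N * r" by simp
qed

lemma x_u: "\<bar>x - 1 / u t\<bar> * r \<le> 66 * A^2 * \<beta>"
proof -
 have "\<bar>\<theta> \<bullet> (G *v \<theta>)\<bar> * \<bar>x - 1 / u t\<bar> \<le> \<bar>\<mu> t * x\<bar> + \<bar>\<eta>\<bar> + \<bar>\<theta> \<bullet> (G *v \<zeta> t)\<bar> / u t"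
 proof -
  have "u t > 0" using inv_u(1) by simp
  hence "\<bar>(\<theta> \<bullet> (G *v \<zeta> t)) / u t\<bar> = \<bar>\<theta> \<bullet> (G *v \<zeta> t)\<bar> / u t" by (simp add: abs_divide)
  thus ?thesis unfolding abs_mult[symmetric] drive_scalar(2) by linarith
 qed
 also have "... \<le> A * (\<beta> * r) + 28 * A^2 * 1 * \<beta> * r + 4 * N * r"
 proof (intro add_mono)
  have "\<bar>\<mu> t\<bar> * \<bar>x\<bar> \<le> A * (\<beta> * r) * 1" using \<mu>_bounds(1,4) p(6) by (intro mult_mono) auto
  thus "\<bar>\<mu> t * x\<bar> \<le> A * (\<beta> * r)" by (simp add: abs_mult)
  have "28 * A^2 * \<kappa> * \<beta> * r \<le> 28 * A^2 * 1 * \<beta> * r" using \<kappa>(4) \<beta> r(1) by (intro mult_right_mono mult_left_mono) auto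
  thus "\<bar>\<eta>\<bar> \<le> 28 * A^2 * 1 * \<beta> * r" using \<eta>_bound by linarith
 qed (rule \<zeta>_bounds(2))
 also have "... \<le> 33 * A^2 * \<beta> * r"
 proof -
  have "A * (\<beta> * r) \<le> A^2 * (\<beta> * r)" using A_pow_mono[of 1 2] \<beta> r(1) by (intro mult_right_mono) auto
  moreover have "N * r \<le> A^2 * (\<beta> * r)"
  proof -
   have "N * 1 \<le> \<beta> * A^2" using A_pow[of 2] \<beta> N_le N1 by (intro mult_mono) auto
   hence "(N * 1) * r \<le> (\<beta> * A^2) * r" using r(1) by (intro mult_right_mono) auto
   thus ?thesis by (simp add: mult_ac)
  qed
  ultimately show ?thesis by (simp add: algebra_simps)
 qed
 finally have "\<bar>\<theta> \<bullet> (G *v \<theta>)\<bar> * \<bar>x - 1 / u t\<bar> \<le> 33 * A^2 * \<beta> * r" .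
 moreover have "(r * r / 2) * \<bar>x - 1 / u t\<bar> \<le> \<bar>\<theta> \<bullet> (G *v \<theta>)\<bar> * \<bar>x - 1 / u t\<bar>"
  using c_bounds(1,5) r(2) by (intro mult_right_mono) auto
 moreover have "r * (\<bar>x - 1 / u t\<bar> * r) = 2 * ((r * r / 2) * \<bar>x - 1 / u t\<bar>)" by simp
 moreover have "r * (66 * A^2 * \<beta>) = 2 * (33 * A^2 * \<beta> * r)" by simp
 ultimately have "r * (\<bar>x - 1 / u t\<bar> * r) \<le> r * (66 * A^2 * \<beta>)" by linarith
 thus ?thesis using r(1) by (simp only: mult_le_cancel_left_pos)
qed

text \<open>x - 1 / u is at most of order \<beta> / sqrt t and \<eta> of order \<kappa> \<beta> sqrt
  t, so their product is of order \<kappa> \<beta>^2.\<close>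

lemma E_mu_p: "\<bar>E - \<mu> t * p\<bar> \<le> 1860 * A ^ 4 * \<kappa> * \<beta>^2"
proof -
 have "\<bar>E - \<mu> t * p\<bar> \<le> \<bar>x - 1 / u t\<bar> * \<bar>\<eta>\<bar> + \<bar>y (Suc t) \<bullet> (G *v \<zeta> t)\<bar> / u t"
 proof -
  have "u t > 0" using inv_u(1) by simp
  hence "\<bar>(y (Suc t) \<bullet> (G *v \<zeta> t)) / u t\<bar> = \<bar>y (Suc t) \<bullet> (G *v \<zeta> t)\<bar> / u t" by (simp add: abs_divide)
  moreover have "\<bar>(1 / u t - x) * \<eta>\<bar> = \<bar>x - 1 / u t\<bar> * \<bar>\<eta>\<bar>" unfolding abs_mult by (simp only: abs_minus_commute)
  ultimately show ?thesis unfolding drive_scalar(1) by linarith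
 qed
 also have "... \<le> 1848 * (A ^ 4 * \<kappa> * \<beta>^2) + 8 * A * \<epsilon> * \<beta>^2"
 proof (rule add_mono[OF _ \<zeta>_bounds(1)])
  have "\<bar>x - 1 / u t\<bar> * \<bar>\<eta>\<bar> \<le> \<bar>x - 1 / u t\<bar> * (28 * A^2 * \<kappa> * \<beta> * r)" by (intro mult_left_mono \<eta>_bound) auto
  also have "... = (\<bar>x - 1 / u t\<bar> * r) * (28 * A^2 * \<kappa> * \<beta>)" by simp
  also have "... \<le> (66 * A^2 * \<beta>) * (28 * A^2 * \<kappa> * \<beta>)" using x_u \<kappa>(1) \<beta> by (intro mult_right_mono) auto
  finally show "\<bar>x - 1 / u t\<bar> * \<bar>\<eta>\<bar> \<le> 1848 * (A ^ 4 * \<kappa> * \<beta>^2)" by (simp add: power_numeral_reduce mult_ac)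
 qed
 also have "8 * A * \<epsilon> * \<beta>^2 \<le> 8 * (A ^ 4 * \<kappa> * \<beta>^2)"
 proof -
  have "A * \<epsilon> * \<beta>^2 \<le> A ^ 4 * \<kappa> * \<beta>^2" using A_le_pow[of 4] \<kappa> \<epsilon>(1) A1 by (intro mult_mono) auto
  thus ?thesis by simp
 qed
 also have "1848 * (A ^ 4 * \<kappa> * \<beta>^2) + 8 * (A ^ 4 * \<kappa> * \<beta>^2) \<le> 1860 * A ^ 4 * \<kappa> * \<beta>^2" using \<kappa>(1) A1 by simp
 finally show ?thesis by simp
qed

lemma F_le: "F \<le> p / \<mu> t" "0 \<le> F" "p^2 \<le> E * F"
proof -
 have "\<mu> t * F \<le> p" unfolding F_def p_def by (rule spd_inv_bounds(2)[OF spd_gram _ stepD(7)[OF ltn]]) (use \<mu>_bounds(1) in simp)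
 thus "F \<le> p / \<mu> t" using \<mu>_bounds(1) by (simp add: pos_le_divide_eq mult.commute)
 show "0 \<le> F" unfolding F_def by (rule spd_nonneg[OF spd_matrix_inv[OF spd_gram]])
 define q where "q = L *v y (Suc t)"
 have Gq: "G *v q = y (Suc t)" by (simp add: q_def spd_inverse[OF spd_gram])
 have "(y (Suc t) \<bullet> (G *v q))^2 \<le> (y (Suc t) \<bullet> (G *v y (Suc t))) * (q \<bullet> (G *v q))" by (rule spd_cauchy_schwarz[OF spd_gram])
 thus "p^2 \<le> E * F" unfolding Gq by (simp add: E_def F_def p_def q_def dot_square_norm inner_commute)
qed

text \<open>The exploration rate: \<open>\<mu> p\<close> is what the squared non-leading eigenvalues gain per round.\<close>

lemma exploration_rate: "\<bar>\<mu> t * p - (\<beta>^2 - (\<mu> t)^2 / real t)\<bar> \<le> 2100 * A ^ 4 * \<kappa> * \<beta>^2"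
proof -
 \<comment> \<open>\<open>R\<close> is the quantity known from \<open>mu2_F\<close>. From F \<le> p
   / \<mu> follows R \<le> q, and from p^2 \<le> E F follows q^2 \<le> R (q + e), hence q \<le> R +
   e.\<close>
 define R where "R = (\<mu> t)^2 * F"
 define q where "q = \<mu> t * p"
 define e where "e = \<bar>E - \<mu> t * p\<bar>"
 have q: "0 \<le> q" "R \<le> q" "0 \<le> R"
 proof -
  show "0 \<le> q" using \<mu>_bounds(1) p(1) by (simp add: q_def)
  have "(\<mu> t)^2 * F \<le> (\<mu> t)^2 * (p / \<mu> t)" using F_le(1) by (intro mult_left_mono) auto
  thus "R \<le> q" using \<mu>_bounds(1) by (simp add: R_def q_def power2_eq_square)
  show "0 \<le> R" using F_le(2) by (simp add: R_def)
 qed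
 have "q^2 = (\<mu> t)^2 * p^2" by (simp add: q_def power_mult_distrib)
 also have "... \<le> (\<mu> t)^2 * (E * F)" using F_le(3) by (intro mult_left_mono) auto
 also have "... = R * E" by (simp add: R_def)
 also have "... \<le> R * (q + e)" using q(3) by (intro mult_left_mono) (auto simp: q_def e_def)
 finally have q2: "q^2 \<le> R * (q + e)" .
 have "q \<le> R + e"
 proof (rule ccontr)
  assume c: "\<not> q \<le> R + e"
  have "0 \<le> e" by (simp add: e_def)
  hence "R * e \<le> q * e" using q(2) by (intro mult_right_mono) auto
  hence "R * (q + e) \<le> (R + e) * q" by (simp add: algebra_simps)
  also have "... < q * q" using c q \<open>0 \<le> e\<close> by (intro mult_strict_right_mono) auto
  finally show False using q2 by (simp add: power2_eq_square)
 qed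
 moreover have "e \<le> 1860 * (A ^ 4 * \<kappa> * \<beta>^2)" using E_mu_p by (simp add: e_def mult_ac)
 moreover have "\<bar>R - (\<beta>^2 - (\<mu> t)^2 / real t)\<bar> \<le> 192 * (A ^ 4 * \<kappa> * \<beta>^2)" using mu2_F by (simp add: R_def mult_ac)
 moreover have "0 \<le> A ^ 4 * \<kappa> * \<beta>^2" using A1 \<kappa>(1) by simp
 ultimately have "\<bar>q - (\<beta>^2 - (\<mu> t)^2 / real t)\<bar> \<le> 2100 * (A ^ 4 * \<kappa> * \<beta>^2)" using q(2) by linarith
 thus ?thesis by (simp add: q_def mult_ac)
qed

end
end
end

section \<open>Frobenius norm and trace\<close>

lemma inner_matrix_outer: "M \<bullet> outer_square z = z \<bullet> (M *v z)" for M :: "real ^ 'n ^ 'n"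
proof -
 have "M \<bullet> outer_square z = (\<Sum>i\<in>UNIV. \<Sum>j\<in>UNIV. M $ i $ j * (z $ i * z $ j))" unfolding inner_vec_def outer_square_def by simp
 also have "... = (\<Sum>i\<in>UNIV. z $ i * (\<Sum>j\<in>UNIV. M $ i $ j * z $ j))" unfolding sum_distrib_left by (intro sum.cong refl) simp
 also have "... = z \<bullet> (M *v z)" unfolding inner_vec_def matrix_vector_mult_def by simp
 finally show ?thesis .
qed

lemma psd_entries:
 fixes M :: "real ^ 'n ^ 'n"
 assumes sym: "transpose M = M" and psd: "\<And>z. 0 \<le> z \<bullet> (M *v z)"
 shows "(M $ i $ j)^2 \<le> M $ i $ i * M $ j $ j"
proof -
 define e :: "'n \<Rightarrow> real ^ 'n" where "e k = axis k 1" for k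
 have Me: "e k \<bullet> (M *v e l) = M $ k $ l" for k l by (simp add: e_def inner_axis' matrix_vector_mult_basis column_def)
 have "transpose M $ i $ j = M $ j $ i" by (simp add: transpose_def)
 hence s: "M $ j $ i = M $ i $ j" unfolding sym ..
 have q: "0 \<le> M $ i $ i + 2 * c * M $ i $ j + c^2 * M $ j $ j" for c
 proof -
  have "0 \<le> (e i + c *\<^sub>R e j) \<bullet> (M *v (e i + c *\<^sub>R e j))" by (rule psd)
  also have "... = M $ i $ i + 2 * c * M $ i $ j + c^2 * M $ j $ j"
   by (simp add: matrix_vector_right_distrib matrix_vector_mult_scaleR inner_add_left inner_add_right Me s
     power2_eq_square algebra_simps)
  finally show ?thesis .
 qed
 have d: "0 \<le> M $ j $ j" "0 \<le> M $ i $ i" using psd[of "e j"] psd[of "e i"] by (simp_all add: Me)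
 show ?thesis
 proof (cases "M $ j $ j = 0")
  case True
  have "M $ i $ j = 0"
  proof (rule ccontr)
   assume n: "M $ i $ j \<noteq> 0"
   define c where "c = - (M $ i $ i + 1) / (2 * M $ i $ j)"
   have "2 * c * M $ i $ j = - (M $ i $ i + 1)" using n by (simp add: c_def field_simps)
   thus False using q[of c] True by simp
  qed
  thus ?thesis using True by simp
 next
  case False
  hence p: "0 < M $ j $ j" using d by simp
  have "0 \<le> M $ i $ i - (M $ i $ j)^2 / M $ j $ j"
   using q[of "- (M $ i $ j) / M $ j $ j"] p by (simp add: power2_eq_square field_simps)
  thus ?thesis using p by (simp add: field_simps)
 qed
qed

text \<open>The square of each entry is at most the product of the two diagonal entries in its row
  and column, and summing these products gives the square of the trace. The norm of a matrix is the
  Frobenius norm.\<close>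

lemma psd_norm_le_trace:
 fixes M :: "real ^ 'n ^ 'n"
 assumes sym: "transpose M = M" and psd: "\<And>z. 0 \<le> z \<bullet> (M *v z)"
 shows "norm M \<le> trace M" "0 \<le> trace M"
proof -
 have d: "0 \<le> M $ i $ i" for i
 proof -
  have "0 \<le> axis i 1 \<bullet> (M *v axis i 1)" by (rule psd)
  thus ?thesis by (simp add: inner_axis' matrix_vector_mult_basis column_def)
 qed
 thus t: "0 \<le> trace M" by (simp add: trace_def sum_nonneg)
 have "(norm M)^2 = (\<Sum>i\<in>UNIV. \<Sum>j\<in>UNIV. (M $ i $ j)^2)"
  unfolding power2_norm_eq_inner by (simp add: inner_vec_def power2_eq_square)
 also have "... \<le> (\<Sum>i\<in>UNIV. \<Sum>j\<in>UNIV. M $ i $ i * M $ j $ j)" by (intro sum_mono psd_entries[OF sym psd])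
 also have "... = (trace M)^2" by (simp add: trace_def power2_eq_square sum_product)
 finally show "norm M \<le> trace M" using t by (rule power2_le_imp_le)
qed

context ucb_run
begin

section \<open>Equalisation of the non-leading eigenvalues\<close>

definition P :: "real ^ 'n ^ 'n" where "P = mat 1 - outer_square \<theta>"
text \<open>\<open>V\<close> is the block of the Gram matrix on the complement of \<theta> and
  \<open>b\<close> its off-diagonal block; \<open>vb\<close> is the mean of the d - 1 eigenvalues of
  \<open>V\<close> there, and \<open>W\<close> the sum of their squared deviations from it.\<close>

definition V :: "nat \<Rightarrow> real ^ 'n ^ 'n" where "V t = P + (\<Sum>s=1..t. outer_square (y s))"
definition vb :: "nat \<Rightarrow> real" where "vb t = tr_perp t / (d - 1)"
definition W :: "nat \<Rightarrow> real" where "W t = (norm (V t - vb t *\<^sub>R P))^2"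
definition b :: "nat \<Rightarrow> real ^ 'n" where "b t = (\<Sum>s=1..t. (a s \<bullet> \<theta>) *\<^sub>R y s)"

lemma y_perp_all: "y s \<bullet> \<theta> = 0" by (simp add: y_def inner_diff_left theta_inner)

lemma V_Suc: "V (Suc t) = V t + outer_square (y (Suc t))" and b_Suc: "b (Suc t) = b t + (a (Suc t) \<bullet> \<theta>) *\<^sub>R y (Suc t)"
 by (simp_all add: V_def b_def add.assoc)

lemma b_perp: "b t \<bullet> \<theta> = 0" by (simp add: b_def inner_sum_left y_perp_all)

lemma P_mult: "P *v h = h - (\<theta> \<bullet> h) *\<^sub>R \<theta>" by (simp add: P_def matrix_vector_mult_diff_rdistrib outer_square_mult)

lemma V_mult: "V t *v h = P *v h + (\<Sum>s=1..t. (y s \<bullet> h) *\<^sub>R y s)"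
 by (induction t) (simp_all add: V_def matrix_vector_mult_add_rdistrib outer_square_mult)

lemma V_form:
 assumes h: "h \<bullet> \<theta> = 0"
 shows "h' \<bullet> \<theta> = 0 \<Longrightarrow> h' \<bullet> (gram a t *v h) = h' \<bullet> (V t *v h)" "\<theta> \<bullet> (gram a t *v h) = b t \<bullet> h"
proof -
 have ys: "a s \<bullet> h = y s \<bullet> h" if "h \<bullet> \<theta> = 0" for s h using that inner_commute[of h \<theta>] by (simp add: y_def inner_diff_left)
 have ht: "\<theta> \<bullet> h = 0" using h by (simp add: inner_commute)
 show "h' \<bullet> (gram a t *v h) = h' \<bullet> (V t *v h)" if h': "h' \<bullet> \<theta> = 0" using ys[OF h] ys[OF h'] h' ht inner_commute[of h']
  by (simp add: gram_mult V_mult P_mult inner_add_right inner_diff_right inner_sum_right)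
 show "\<theta> \<bullet> (gram a t *v h) = b t \<bullet> h" using ys[OF h] ht inner_commute[of \<theta>]
  by (simp add: gram_mult b_def inner_add_right inner_sum_right inner_sum_left mult_ac)
qed

lemma trace_P: "trace P = d - 1" using \<theta> by (simp add: P_def trace_sub trace_I trace_outer_square d)

lemma P_sym: "transpose P = P" and V_sym: "transpose (V t) = V t"
proof -
 have "transpose (M - M') = transpose M - transpose M'" for M M' :: "real ^ 'n ^ 'n" by (simp add: transpose_def vec_eq_iff)
 thus P: "transpose P = P" by (simp add: P_def outer_square_sym transpose_mat)
 show "transpose (V t) = V t"
 proof (induction t)
  case 0
  show ?case using P by (simp add: V_def)
 qed (simp add: V_Suc transpose_add outer_square_sym)
qed

lemma trace_V: "trace (V t) = tr_perp t"
proof (induction t)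
 case 0
 show ?case by (simp add: V_def tr_perp_def trace_P)
qed (simp add: V_Suc trace_add trace_outer_square tr_perp_Suc)

lemma inner_PP: "P \<bullet> P = d - 1"
proof -
 have "mat 1 \<bullet> (mat 1 :: real ^ 'n ^ 'n) = d" by (simp add: inner_vec_def mat_def d if_distrib cong: if_cong)
 moreover have "outer_square \<theta> \<bullet> mat 1 = 1" "mat 1 \<bullet> outer_square \<theta> = 1"
  by (simp_all add: inner_matrix_outer inner_commute[of "outer_square \<theta>"] theta_inner)
 moreover have "outer_square \<theta> \<bullet> outer_square \<theta> = 1" by (simp add: inner_matrix_outer outer_square_mult theta_inner)
 ultimately show ?thesis by (simp add: P_def inner_diff_left inner_diff_right)
qed

lemma inner_VP: "V t \<bullet> P = tr_perp t"
proof (induction t)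
 case 0
 show ?case by (simp add: V_def tr_perp_def inner_PP)
next
 case (Suc t)
 have "outer_square (y (Suc t)) \<bullet> P = (norm (y (Suc t)))^2" using y_perp_all[of "Suc t"] inner_commute[of \<theta> "y (Suc t)"]
  by (simp add: inner_commute[of _ P] inner_matrix_outer P_mult dot_square_norm)
 thus ?case using Suc by (simp add: V_Suc inner_add_left tr_perp_Suc)
qed

lemma W_eq: "W t = V t \<bullet> V t - (tr_perp t)^2 / (d - 1)"
proof -
 have "W t = V t \<bullet> V t - 2 * vb t * (V t \<bullet> P) + (vb t)^2 * (P \<bullet> P)"
  unfolding W_def norm_diff_squared by (simp add: power_mult_distrib power2_norm_eq_inner)
 also have "... = V t \<bullet> V t - (tr_perp t)^2 / (d - 1)"
 proof -
  define D where "D = d - 1"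
  have "D > 0" using d2 by (simp add: D_def)
  hence "(tr_perp t / D)^2 * D = (tr_perp t)^2 / D" by (simp add: power2_eq_square)
  thus ?thesis unfolding inner_VP inner_PP vb_def D_def[symmetric] by (simp add: power2_eq_square)
 qed
 finally show ?thesis .
qed

lemma W_nonneg: "0 \<le> W t" by (simp add: W_def)

text \<open>\<open>W\<close> is the squared norm of \<open>V\<close> minus its value for equal
  eigenvalues, so a rank one update is explicit. As E is close to \<mu> p and \<mu> \<le> vb, the
  drift 2 (E - vb p) is negative up to errors: exploration in directions of below-average
  eigenvalues equalises them.\<close>

lemma W_Suc:
 "W (Suc t) = W t + 2 * (y (Suc t) \<bullet> (gram a t *v y (Suc t)) - vb t * (norm (y (Suc t)))^2)
   + (norm (y (Suc t)))\<^sup>2 ^ 2 * (1 - 1 / (d - 1))"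
proof -
 define q where "q = (norm (y (Suc t)))^2"
 have oo: "outer_square (y (Suc t)) \<bullet> outer_square (y (Suc t)) = q ^ 2"
  unfolding inner_matrix_outer outer_square_mult by (simp add: q_def dot_square_norm power2_eq_square)
 have Vo: "V t \<bullet> outer_square (y (Suc t)) = y (Suc t) \<bullet> (gram a t *v y (Suc t))"
  by (simp add: inner_matrix_outer V_form(1)[OF y_perp_all y_perp_all])
 have "V (Suc t) \<bullet> V (Suc t) = V t \<bullet> V t + 2 * (y (Suc t) \<bullet> (gram a t *v y (Suc t))) + q ^ 2"
  by (simp add: V_Suc inner_add_left inner_add_right oo Vo inner_commute[of "outer_square (y (Suc t))" "V t"])
 moreover have "(tr_perp (Suc t))^2 / (d - 1) = (tr_perp t)^2 / (d - 1) + 2 * (vb t * q) + q ^ 2 * (1 / (d - 1))"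
  by (simp add: tr_perp_Suc q_def[symmetric] vb_def power2_sum add_divide_distrib)
 ultimately have "W (Suc t) = W t + 2 * (y (Suc t) \<bullet> (gram a t *v y (Suc t)) - vb t * q) + q ^ 2 * (1 - 1 / (d - 1))"
  by (simp add: W_eq algebra_simps)
 thus ?thesis by (simp only: q_def)
qed

lemma form_dev:
 assumes h: "h \<bullet> \<theta> = 0"
 shows "\<bar>h \<bullet> (gram a t *v h) - vb t * (norm h)^2\<bar> \<le> sqrt (W t) * (norm h)^2"
proof -
 have "\<theta> \<bullet> h = 0" using h by (simp add: inner_commute)
 hence "h \<bullet> ((V t - vb t *\<^sub>R P) *v h) = h \<bullet> (gram a t *v h) - vb t * (norm h)^2"
  by (simp add: matrix_vector_mult_diff_rdistrib scaleR_matrix_vector_assoc[symmetric] inner_diff_right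
    P_mult V_form(1)[OF h h] dot_square_norm)
 moreover have "sqrt (W t) = norm (V t - vb t *\<^sub>R P)" by (simp add: W_def)
 ultimately show ?thesis using abs_form_le_norm[of h "V t - vb t *\<^sub>R P"] by simp
qed

text \<open>\<open>V - k P\<close> is positive semidefinite and annihilates \<theta>, so its norm is
  at most its trace. For k = \<mu> the single number vb - \<mu> thus controls the whole spread of
  the eigenvalues.\<close>

lemma perp_psd:
 assumes k: "\<And>h. k * (norm h)^2 \<le> h \<bullet> (gram a t *v h)"
 shows "k \<le> vb t" "norm (V t - k *\<^sub>R P) \<le> (d - 1) * (vb t - k)"
proof -
 define M where "M = V t - k *\<^sub>R P"
 have M_sym: "transpose M = M" using V_sym[of t] P_sym by (simp add: M_def transpose_def vec_eq_iff)
 have "0 \<le> z \<bullet> (M *v z)" for z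
 proof -
  define h where "h = P *v z"
  have hp: "h \<bullet> \<theta> = 0" using inner_commute[of z \<theta>] by (simp add: h_def P_mult inner_diff_left theta_inner)
  have z: "z = (\<theta> \<bullet> z) *\<^sub>R \<theta> + h" by (simp add: h_def P_mult)
  have M\<theta>: "M *v \<theta> = 0" by (simp add: M_def matrix_vector_mult_diff_rdistrib scaleR_matrix_vector_assoc[symmetric] V_mult P_mult
     theta_inner y_perp_all)
  have Mz: "M *v z = M *v h"
   using arg_cong[OF z, of "(*v) M"] by (simp only: matrix_vector_right_distrib matrix_vector_mult_scaleR M\<theta>) simp
  have "z \<bullet> (M *v z) = z \<bullet> (M *v h)" by (simp only: Mz)
  also have "... = (M *v z) \<bullet> h" by (rule inner_matrix_symmetric[OF M_sym])
  also have "... = (M *v h) \<bullet> h" by (simp only: Mz)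
  also have "... = h \<bullet> (M *v h)" by (rule inner_commute)
  also have "... = h \<bullet> (gram a t *v h) - k * (norm h)^2"
   using hp inner_commute[of \<theta> h] by (simp add: M_def matrix_vector_mult_diff_rdistrib
    scaleR_matrix_vector_assoc[symmetric] inner_diff_right P_mult V_form(1)[OF hp hp] dot_square_norm)
  finally show ?thesis using k[of h] by simp
 qed
 note tn = psd_norm_le_trace[OF M_sym this]
 have "trace M = tr_perp t - k * (d - 1)"
  using trace_V[of t] trace_P by (simp add: M_def trace_def sum_subtractf sum_distrib_left[symmetric])
 also have "... = (d - 1) * (vb t - k)" using d2 by (simp add: vb_def field_simps)
 finally have tr: "trace M = (d - 1) * (vb t - k)" .
 show "norm (V t - k *\<^sub>R P) \<le> (d - 1) * (vb t - k)" using tn(1) unfolding tr unfolding M_def .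
 show "k \<le> vb t" using tn(2) d2 by (simp add: tr zero_le_mult_iff)
qed

lemma vb_le_tr: "vb t \<le> tr_perp t" and mineig_le_vb: "mineig t \<le> vb t" and vb_pos: "0 < vb t"
proof -
 show "vb t \<le> tr_perp t" using d2 tr_perp_ge_1[of t] mult_left_mono[of 1 "d - 1" "tr_perp t"] by (simp add: vb_def divide_le_eq)
 show "mineig t \<le> vb t" by (rule perp_psd(1)) (rule mineig_form)
 thus "0 < vb t" using mineig_ge_1[of t] by linarith
qed

lemma vb_Suc: "vb (Suc t) = vb t + (norm (y (Suc t)))^2 / (d - 1)" by (simp add: vb_def tr_perp_Suc add_divide_distrib)

lemma W_le_tr: "W t \<le> (tr_perp t)^2"
proof -
 have "norm (V t - 0 *\<^sub>R P) \<le> (d - 1) * (vb t - 0)" by (rule perp_psd(2)) (simp add: spd_nonneg[OF spd_gram])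
 hence "norm (V t) \<le> tr_perp t" using d2 by (simp add: vb_def)
 hence "V t \<bullet> V t \<le> (tr_perp t)^2" by (simp add: dot_square_norm power_mono)
 moreover have "0 \<le> (tr_perp t)^2 / (d - 1)" using d2 by simp
 ultimately show ?thesis by (simp add: W_eq)
qed

lemma W_le_trace_gap:
 assumes k: "\<And>h. k * (norm h)^2 \<le> h \<bullet> (gram a t *v h)"
 shows "W t \<le> (d * (vb t - k))^2"
proof -
 \<comment> \<open>Pythagoras: \<open>V - vb P\<close> is orthogonal to \<open>P\<close>, so the
   squared norm splits into \<open>W\<close> and a multiple of \<open>(vb - k)^2\<close>.\<close>
 have "(norm (V t - k *\<^sub>R P))^2 = V t \<bullet> V t - 2 * k * (V t \<bullet> P) + k^2 * (P \<bullet> P)"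
  unfolding norm_diff_squared by (simp add: power_mult_distrib power2_norm_eq_inner)
 also have "... = W t + (d - 1) * (vb t - k)^2"
 proof -
  have T: "tr_perp t = (d - 1) * vb t" using d2 by (simp add: vb_def)
  have "(tr_perp t)^2 / (d - 1) = (d - 1) * (vb t)^2" using d2 unfolding T by (simp add: power2_eq_square)
  thus ?thesis unfolding W_eq inner_VP inner_PP T by (simp add: power2_eq_square algebra_simps)
 qed
 finally have "W t \<le> (norm (V t - k *\<^sub>R P))^2" using d2 by simp
 also have "... \<le> (d * (vb t - k))^2"
 proof (rule power_mono)
  have "(d - 1) * (vb t - k) \<le> d * (vb t - k)" using perp_psd(1)[OF k] d2 by (intro mult_right_mono) auto
  thus "norm (V t - k *\<^sub>R P) \<le> d * (vb t - k)" using perp_psd(2)[OF k] by linarith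
 qed simp
 finally show ?thesis .
qed

lemma d_le_A: "d \<le> A1"
proof -
 have "1 \<le> exp (2048 * (d + 1))" using d2 by simp
 hence "2048 * (d + 1) * 1 \<le> KE" unfolding KE_def using d2 by (intro mult_left_mono) auto
 hence "d \<le> (64 * K0^2 + 4 * KE)" using d2 by (simp add: add_increasing)
 also have "... \<le> (64 * K0^2 + 4 * KE) / \<delta>" using \<delta> d2 by (simp add: pos_le_divide_eq mult_left_le KE_def)
 finally have "d \<le> C1 (64 * K0^2)" by (simp add: C1_def)
 moreover have "0 \<le> 2 * (2 * C1 (64 * K0^2)) powr (d - 2) / \<delta> powr d" by simp
 moreover have "1 \<le> C1 (64 * K0^2)" by (rule C1_ge_1) simp
 ultimately show ?thesis unfolding A1_def A0_def by linarith
qed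

end

section \<open>Settling of the variance and the mean of the non-leading eigenvalues\<close>

locale ucb_small = ucb_fine a v \<theta> \<beta> n U \<mu> d \<theta>bar N t1
 for a v :: "nat \<Rightarrow> real ^ 'n" and \<theta> and \<beta> and n and U \<mu> and d and \<theta>bar and N and t1 +
 assumes small: "10 ^ 16 * A ^ 10 * \<kappa> \<le> 1"
begin

lemma \<kappa>_small: "k \<le> 10 \<Longrightarrow> 10 ^ 16 * A ^ k * \<kappa> \<le> 1" "k \<le> 10 \<Longrightarrow> 10 ^ 16 * (A ^ (10 - k) * (A ^ k * \<kappa>)) \<le> 1"
proof -
 assume k: "k \<le> 10"
 have "10 ^ 16 * A ^ k * \<kappa> \<le> 10 ^ 16 * A ^ 10 * \<kappa>" using A_pow_mono[OF k] \<kappa>(1) by (intro mult_right_mono mult_left_mono) auto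
 thus "10 ^ 16 * A ^ k * \<kappa> \<le> 1" using small by linarith
 have "A ^ (10 - k) * A ^ k = A ^ 10" using k by (simp flip: power_add)
 thus "10 ^ 16 * (A ^ (10 - k) * (A ^ k * \<kappa>)) \<le> 1" using small by (simp add: mult.assoc[symmetric])
qed

text \<open>First of four waiting times: \<open>\<tau>0\<close> starts \<open>late\<close>,
  \<open>\<tau>1\<close> makes \<open>W\<close> small against \<beta>^2 t, \<open>\<tau>2\<close>
  brings the square of \<open>vb\<close> below its threshold, and \<open>\<tau>3\<close> lets the
  Lyapunov function decay. Only \<open>\<tau>0\<close> and \<open>\<tau>3\<close> cost a factor
  \<beta>.\<close>

definition \<tau>0 :: nat where "\<tau>0 = nat \<lceil>2 * \<beta> * real t1\<rceil>"

lemma t1_ge_1: "1 \<le> real t1" by (rule t_pos) simp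

lemma \<tau>0: "2 * \<beta> * real t1 \<le> real \<tau>0" "real \<tau>0 \<le> 3 * \<beta> * real t1" "1 \<le> real \<tau>0"
proof -
 have 1: "1 * 1 \<le> \<beta> * real t1" using \<beta>1 t1_ge_1 by (intro mult_mono) auto
 thus "2 * \<beta> * real t1 \<le> real \<tau>0" "real \<tau>0 \<le> 3 * \<beta> * real t1" unfolding \<tau>0_def by linarith+
 thus "1 \<le> real \<tau>0" using 1 by linarith
qed

lemma late_iff: "\<tau>0 \<le> t \<Longrightarrow> t \<le> n \<Longrightarrow> late t" unfolding late_def using \<tau>0(1) by linarith

lemma vb_le: "late t \<Longrightarrow> vb t \<le> A * (\<beta> * sqrt (real t))" using vb_le_tr[of t] m(4)[of t] by linarith

lemma eps_le: "\<epsilon> \<le> A ^ k * \<kappa> * \<beta>^2"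
proof -
 have "1 * \<epsilon> * 1 \<le> A ^ k * \<kappa> * \<beta>^2" using A_pow[of k] \<kappa> \<beta>1 \<epsilon>(1) by (intro mult_mono) auto
 thus ?thesis by simp
qed

context
 fixes t assumes lt: "late t" and ltn: "t < n"
begin

lemma mu_le_vb: "\<mu> t \<le> vb t" using perp_psd(1)[of "\<mu> t" t] stepD(7)[OF ltn] by blast

text \<open>E is close to \<mu> p but at least vb p minus sqrt W p, so a gap between mean and
  multiplier must be paid for by the spread.\<close>

lemma gap_p: "(vb t - \<mu> t) * p t \<le> 1860 * A ^ 4 * \<kappa> * \<beta>^2 + sqrt (W t) * p t"
proof -
 have "\<bar>E t - vb t * p t\<bar> \<le> sqrt (W t) * p t"
  using form_dev[OF y_perp_all[of "Suc t"], of t] by (simp add: E_def[OF lt ltn] p_def[OF lt ltn])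
 thus ?thesis using E_mu_p[OF lt ltn] by (simp add: algebra_simps)
qed

lemma W_step: "W (Suc t) \<le> W t + 3722 * A ^ 4 * \<kappa> * \<beta>^2"
proof -
 have p: "0 \<le> p t" "p t \<le> 1" "p t \<le> \<epsilon>" using p[OF lt ltn] by auto
 have "(p t)^2 * (1 - 1 / (d - 1)) \<le> (p t)^2 * 1" using d2 by (intro mult_left_mono) auto
 also have "... \<le> p t" using p by (simp add: power2_eq_square mult_left_le)
 also have "... \<le> A ^ 4 * \<kappa> * \<beta>^2" using p(3) eps_le[of 4] by linarith
 finally have 1: "(p t)^2 * (1 - 1 / (d - 1)) \<le> A ^ 4 * \<kappa> * \<beta>^2" .
 have "W (Suc t) = W t + 2 * (E t - vb t * p t) + (p t)^2 * (1 - 1 / (d - 1))"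
  using W_Suc[of t] by (simp add: E_def[OF lt ltn] p_def[OF lt ltn])
 hence "W (Suc t) \<le> W t + 2 * (E t - vb t * p t) + A ^ 4 * \<kappa> * \<beta>^2" using 1 by simp
 moreover have "\<mu> t * p t \<le> vb t * p t" using mu_le_vb p by (intro mult_right_mono) auto
 moreover have "E t - \<mu> t * p t \<le> 1860 * (A ^ 4 * \<kappa> * \<beta>^2)" using E_mu_p[OF lt ltn] by (simp add: mult.assoc)
 moreover have "0 \<le> A ^ 4 * \<kappa> * \<beta>^2" using A1 \<kappa>(1) by simp
 ultimately have "W (Suc t) \<le> W t + 3722 * (A ^ 4 * \<kappa> * \<beta>^2)" by argo
 thus ?thesis by (simp add: mult.assoc)
qed

lemma vb2_step: "(vb (Suc t))^2 \<le> (vb t)^2 + 2 * (vb t * p t) + \<epsilon>"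
proof -
 have p: "0 \<le> p t" "p t \<le> 1" "p t \<le> \<epsilon>" using p[OF lt ltn] by auto
 have "vb (Suc t) \<le> vb t + p t" using d2 p(1) by (simp add: vb_Suc p_def[OF lt ltn, symmetric] divide_le_eq mult_le_cancel_left1)
 hence "(vb (Suc t))^2 \<le> (vb t + p t)^2" using vb_pos[of "Suc t"] by (intro power_mono) auto
 also have "... = (vb t)^2 + 2 * (vb t * p t) + p t * p t" by (simp add: power2_eq_square algebra_simps)
 also have "p t * p t \<le> \<epsilon> * 1" using p \<epsilon>(1) by (intro mult_mono) auto
 finally show ?thesis by simp
qed

lemma vb_p_le: "vb t * p t \<le> 16 * A^2 * \<beta>^2"
proof -
 have "vb t * p t \<le> (A * (\<beta> * r t)) * p t" using vb_le[OF lt] p(1)[OF lt ltn] by (intro mult_right_mono) auto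
 also have "... = A * \<beta> * (p t * r t)" by simp
 also have "... \<le> A * \<beta> * (16 * A * \<beta>)" using p(4)[OF lt ltn] A1 \<beta> by (intro mult_left_mono) auto
 finally show ?thesis by (simp add: power2_eq_square mult_ac)
qed

end

text \<open>A first rough stage: the drift is at worst of order \<kappa> \<beta>^2 per round, so
  \<open>W\<close> grows at most linearly with a small slope.\<close>

lemma W_upper: "\<tau>0 \<le> t \<Longrightarrow> t \<le> n \<Longrightarrow> W t \<le> A^2 * \<beta>^2 * real \<tau>0 + 3722 * A ^ 4 * \<kappa> * \<beta>^2 * (real t - real \<tau>0)"
proof (induction t rule: dec_induct)
 case base
 have l: "late \<tau>0" by (rule late_iff) (use base in auto)
 have "W \<tau>0 \<le> (tr_perp \<tau>0)^2" by (rule W_le_tr)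
 also have "... \<le> (A * (\<beta> * sqrt (real \<tau>0)))^2" using m(4)[OF l] tr_perp_ge_1[of \<tau>0] by (intro power_mono) auto
 finally show ?case by (simp add: power_mult_distrib mult.assoc)
next
 case (step t)
 have "W (Suc t) \<le> W t + 3722 * A ^ 4 * \<kappa> * \<beta>^2" by (rule W_step) (use step late_iff in auto)
 thus ?case using step by (simp add: algebra_simps)
qed

definition \<tau>1 :: nat where "\<tau>1 = nat \<lceil>10 ^ 12 * A ^ 8 * real \<tau>0\<rceil>"

lemma \<tau>1: "10 ^ 12 * A ^ 8 * real \<tau>0 \<le> real \<tau>1" "real \<tau>1 \<le> 2 * 10 ^ 12 * A ^ 8 * real \<tau>0" "\<tau>0 \<le> \<tau>1"
proof -
 have "1 * 1 * real \<tau>0 \<le> 10 ^ 12 * A ^ 8 * real \<tau>0" using A_pow[of 8] by (intro mult_right_mono mult_mono) auto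
 hence 1: "real \<tau>0 \<le> 10 ^ 12 * A ^ 8 * real \<tau>0" by simp
 show 2: "10 ^ 12 * A ^ 8 * real \<tau>0 \<le> real \<tau>1" "real \<tau>1 \<le> 2 * 10 ^ 12 * A ^ 8 * real \<tau>0"
  unfolding \<tau>1_def using 1 \<tau>0(3) by linarith+
 show "\<tau>0 \<le> \<tau>1" using 1 2 by linarith
qed

lemma W_small:
 assumes t: "\<tau>1 \<le> t" "t \<le> n"
 shows "10 ^ 6 * A ^ 3 * sqrt (W t) \<le> 2 * (\<beta> * sqrt (real t))"
proof -
 have "A^2 * \<beta>^2 * real \<tau>0 * (10 ^ 12 * A ^ 6) = \<beta>^2 * (10 ^ 12 * A ^ 8 * real \<tau>0)" by (simp add: power_numeral_reduce)
 also have "... \<le> \<beta>^2 * real t" using \<tau>1(1) t by (intro mult_left_mono) auto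
 finally have 1: "A^2 * \<beta>^2 * real \<tau>0 * (10 ^ 12 * A ^ 6) \<le> \<beta>^2 * real t" .
 have "3722 * A ^ 4 * \<kappa> * \<beta>^2 * (real t - real \<tau>0) * (10 ^ 12 * A ^ 6)
   = (3722 / 10 ^ 4) * (10 ^ 16 * A ^ 10 * \<kappa>) * (\<beta>^2 * (real t - real \<tau>0))" by (simp add: power_numeral_reduce)
 also have "... \<le> 1 * 1 * (\<beta>^2 * real t)" using small \<tau>1(3) t \<kappa>(1) A1 by (intro mult_mono mult_left_mono) auto
 finally have 2: "3722 * A ^ 4 * \<kappa> * \<beta>^2 * (real t - real \<tau>0) * (10 ^ 12 * A ^ 6) \<le> \<beta>^2 * real t" by simp
 have "W t * (10 ^ 12 * A ^ 6)
   \<le> (A^2 * \<beta>^2 * real \<tau>0 + 3722 * A ^ 4 * \<kappa> * \<beta>^2 * (real t - real \<tau>0)) * (10 ^ 12 * A ^ 6)"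
  using W_upper[of t] t \<tau>1(3) A1 by (intro mult_right_mono) auto
 also have "... \<le> 2 * (\<beta>^2 * real t)" using 1 2 unfolding distrib_right by linarith
 also have "... \<le> 4 * (\<beta>^2 * real t)" by simp
 finally have "W t * (10 ^ 12 * A ^ 6) \<le> 4 * (\<beta>^2 * real t)" .
 moreover have "(10 ^ 6 * A ^ 3 * sqrt (W t))^2 = W t * (10 ^ 12 * A ^ 6)"
  using W_nonneg[of t] by (simp add: power_mult_distrib flip: power_mult)
 moreover have "(2 * (\<beta> * sqrt (real t)))^2 = 4 * (\<beta>^2 * real t)" by (simp add: power_mult_distrib)
 ultimately have "(10 ^ 6 * A ^ 3 * sqrt (W t))^2 \<le> (2 * (\<beta> * sqrt (real t)))^2" by simp
 thus ?thesis by (rule power2_le_imp_le) (use \<beta> in simp)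
qed

text \<open>The exploration rate is known in terms of \<mu> but needed in terms of
  \<open>vb\<close>. If \<open>p * r\<close> is small, so is the left-hand side. Otherwise the bound
  on (vb - \<mu>) p can be divided by \<open>p\<close>, and \<mu> is replaced by \<open>vb\<close>
  at small cost.\<close>

lemma vb_p_decay:
 assumes t: "\<tau>1 \<le> t" "t < n"
 shows "vb t * p t \<le> max 0 (\<beta>^2 - (vb t)^2 / real t) + \<beta>^2 / 50"
proof -
 have lt: "late t" by (rule late_iff) (use t \<tau>1(3) in auto)
 have ltn: "t < n" by (rule t(2))
 have rp: "0 < r t" "r t * r t = real t" using r[OF lt] by auto
 have p: "0 \<le> p t" "p t * r t \<le> 16 * A * \<beta>" using p[OF lt ltn] by auto
 have k4: "A^2 * (10 ^ 12 * (A ^ 4 * \<kappa>)) \<le> 1 / 10 ^ 4" using \<kappa>_small(1)[of 6] by (simp add: power_numeral_reduce mult_ac)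
 have k4': "10 ^ 12 * (A ^ 4 * \<kappa>) \<le> 1" using \<kappa>_small(1)[of 4] \<kappa>(1) A1 by simp
 have "A^2 * (sqrt (W t) * p t) \<le> 33 / 1000000 * \<beta>^2"
 proof -
  have "10 ^ 6 * A ^ 3 * sqrt (W t) * p t \<le> 2 * (\<beta> * r t) * p t" using W_small[of t] t p(1) by (intro mult_right_mono) auto
  also have "... = 2 * \<beta> * (p t * r t)" by simp
  also have "... \<le> 2 * \<beta> * (16 * A * \<beta>)" using p(2) \<beta> by (intro mult_left_mono) auto
  finally have "A * (A^2 * (sqrt (W t) * p t)) \<le> A * (32 / 1000000 * \<beta>^2)" by (simp add: power_numeral_reduce mult_ac)
  hence "A^2 * (sqrt (W t) * p t) \<le> 32 / 1000000 * \<beta>^2" using A1 by (subst (asm) mult_le_cancel_left_pos) auto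
  thus ?thesis using zero_le_power2[of \<beta>] by linarith
 qed
 moreover have "A^2 * (1860 * A ^ 4 * \<kappa> * \<beta>^2) \<le> 1 / 1000000 * \<beta>^2"
 proof -
  have "A^2 * (1860 * A ^ 4 * \<kappa> * \<beta>^2) = 1860 / 10 ^ 12 * (A^2 * (10 ^ 12 * (A ^ 4 * \<kappa>))) * \<beta>^2" by simp
  also have "... \<le> 1860 / 10 ^ 12 * (1 / 10 ^ 4) * \<beta>^2" using k4 by (intro mult_right_mono mult_left_mono) auto
  also have "... \<le> 1 / 1000000 * \<beta>^2" by (intro mult_right_mono) auto
  finally show ?thesis .
 qed
 moreover have "A^2 * ((vb t - \<mu> t) * p t) \<le> A^2 * (1860 * A ^ 4 * \<kappa> * \<beta>^2 + sqrt (W t) * p t)"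
  using gap_p[OF lt ltn] by (intro mult_left_mono) auto
 ultimately have gp: "A^2 * ((vb t - \<mu> t) * p t) \<le> 34 / 1000000 * \<beta>^2" unfolding distrib_left by linarith
 have g0: "0 \<le> vb t - \<mu> t" using mu_le_vb[OF lt ltn] by simp
 have gp1: "(vb t - \<mu> t) * p t \<le> \<beta>^2 / 1000"
 proof -
  have "1 * ((vb t - \<mu> t) * p t) \<le> A^2 * ((vb t - \<mu> t) * p t)" using A_pow[of 2] g0 p(1) by (intro mult_right_mono) auto
  thus ?thesis using gp zero_le_power2[of \<beta>] by (simp; linarith)
 qed
 show ?thesis
 proof (cases "150 * A * (p t * r t) < \<beta>")
  case True
  have "vb t * p t \<le> (A * (\<beta> * r t)) * p t" using vb_le[OF lt] p(1) by (intro mult_right_mono) auto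
  also have "... = \<beta> * (150 * A * (p t * r t)) / 150" by simp
  also have "... \<le> \<beta> * \<beta> / 150" using True \<beta> by (intro divide_right_mono mult_left_mono) auto
  finally have "vb t * p t \<le> \<beta>^2 / 150" by (simp add: power2_eq_square)
  thus ?thesis using zero_le_power2[of \<beta>] by linarith
 next
  case False
  have "(vb t - \<mu> t) * \<beta> \<le> (vb t - \<mu> t) * (150 * A * (p t * r t))" using False g0 by (intro mult_left_mono) auto
  hence "A * ((vb t - \<mu> t) * \<beta>) \<le> A * ((vb t - \<mu> t) * (150 * A * (p t * r t)))" by (rule mult_left_mono) (use A1 in simp)
  also have "... = 150 * r t * (A^2 * ((vb t - \<mu> t) * p t))" by (simp add: power2_eq_square)
  also have "... \<le> 150 * r t * (34 / 1000000 * \<beta>^2)" using gp rp(1) by (intro mult_left_mono) auto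
  finally have "\<beta> * (A * (vb t - \<mu> t)) \<le> \<beta> * (150 * r t * (34 / 1000000) * \<beta>)" by (simp add: power2_eq_square mult_ac)
  hence ga: "A * (vb t - \<mu> t) \<le> 150 * r t * (34 / 1000000) * \<beta>" using \<beta> by (subst (asm) mult_le_cancel_left_pos) auto
  have "(vb t)^2 - (\<mu> t)^2 \<le> 2 * vb t * (vb t - \<mu> t)"
   using zero_le_power2[of "vb t - \<mu> t"] by (simp add: power2_eq_square algebra_simps)
  also have "... \<le> 2 * (A * (\<beta> * r t)) * (vb t - \<mu> t)" using vb_le[OF lt] g0 by (intro mult_right_mono) auto
  also have "... = 2 * \<beta> * r t * (A * (vb t - \<mu> t))" by simp
  also have "... \<le> 2 * \<beta> * r t * (150 * r t * (34 / 1000000) * \<beta>)" using ga \<beta> rp(1) by (intro mult_left_mono) auto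
  also have "... = 300 * (34 / 1000000) * (\<beta>^2 * (r t * r t))" by (simp add: power2_eq_square)
  also have "... \<le> \<beta>^2 * real t / 90" unfolding rp(2) by simp
  finally have "((vb t)^2 - (\<mu> t)^2) / real t \<le> \<beta>^2 * real t / 90 / real t" by (rule divide_right_mono) simp
  hence "(vb t)^2 / real t - (\<mu> t)^2 / real t \<le> \<beta>^2 / 90" using rp by (simp add: diff_divide_distrib)
  moreover have "\<mu> t * p t \<le> \<beta>^2 - (\<mu> t)^2 / real t + 2100 * A ^ 4 * \<kappa> * \<beta>^2" using exploration_rate[OF lt ltn] by linarith
  moreover have "2100 * A ^ 4 * \<kappa> * \<beta>^2 \<le> \<beta>^2 / 1000"
  proof -
   have "2100 * A ^ 4 * \<kappa> * \<beta>^2 = 2100 / 10 ^ 12 * (10 ^ 12 * (A ^ 4 * \<kappa>)) * \<beta>^2" by simp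
   also have "... \<le> 2100 / 10 ^ 12 * 1 * \<beta>^2" using k4' by (intro mult_right_mono mult_left_mono) auto
   also have "... \<le> \<beta>^2 / 1000" by simp
   finally show ?thesis .
  qed
  moreover have "vb t * p t = \<mu> t * p t + (vb t - \<mu> t) * p t" by (simp add: algebra_simps)
  ultimately have "vb t * p t \<le> \<beta>^2 - (vb t)^2 / real t + \<beta>^2 / 50" using gp1 zero_le_power2[of \<beta>] by linarith
  thus ?thesis by linarith
 qed
qed

lemma vb2_upper: "\<tau>1 \<le> t \<Longrightarrow> t \<le> n \<Longrightarrow>
 (vb t)\<^sup>2 - 9 / 10 * \<beta>^2 * real t \<le> 33 * A^2 * \<beta>^2 + \<beta>^2 * max 0 (A^2 * real \<tau>1 - (real t - real \<tau>1) / 2)"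
proof (induction t rule: dec_induct)
 case base
 have l: "late \<tau>1" by (rule late_iff) (use base \<tau>1(3) in auto)
 have "(vb \<tau>1)^2 \<le> (A * (\<beta> * sqrt (real \<tau>1)))^2" using vb_le[OF l] vb_pos[of \<tau>1] by (intro power_mono) auto
 also have "... = \<beta>^2 * (A^2 * real \<tau>1)" by (simp add: power_mult_distrib)
 also have "... \<le> \<beta>^2 * max 0 (A^2 * real \<tau>1 - (real \<tau>1 - real \<tau>1) / 2)" by (intro mult_left_mono) auto
 finally have "(vb \<tau>1)^2 \<le> \<beta>^2 * max 0 (A^2 * real \<tau>1 - (real \<tau>1 - real \<tau>1) / 2)" .
 moreover have "0 \<le> 33 * A^2 * \<beta>^2" "0 \<le> 9 / 10 * \<beta>^2 * real \<tau>1" by simp_all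
 ultimately show ?case by linarith
next
 case (step t)
 have tn: "t < n" and lt: "late t" using step \<tau>1(3) late_iff[of t] by auto
 have e: "\<epsilon> \<le> \<beta>^2 / 100"
 proof -
  have "1 \<le> \<beta>^2" using \<beta>1 by simp
  thus ?thesis using \<epsilon>(5) by linarith
 qed
 define f where "f s = \<beta>^2 * max 0 (A^2 * real \<tau>1 - (real s - real \<tau>1) / 2)" for s
 have f0: "0 \<le> f (Suc t)" by (simp add: f_def)
 have f1: "f t - \<beta>^2 / 2 \<le> f (Suc t)"
 proof -
  have "max 0 (A^2 * real \<tau>1 - (real t - real \<tau>1) / 2) - 1 / 2
    \<le> max 0 (A^2 * real \<tau>1 - (real (Suc t) - real \<tau>1) / 2)" by (simp add: field_simps max_def)
  hence "\<beta>^2 * (max 0 (A^2 * real \<tau>1 - (real t - real \<tau>1) / 2) - 1 / 2)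
    \<le> \<beta>^2 * max 0 (A^2 * real \<tau>1 - (real (Suc t) - real \<tau>1) / 2)" by (intro mult_left_mono) auto
  thus ?thesis by (simp add: f_def right_diff_distrib)
 qed
 have tp: "0 < real t" using r(1)[OF lt] by simp
 have vs: "(vb (Suc t))^2 \<le> (vb t)^2 + 2 * (vb t * p t) + \<epsilon>" by (rule vb2_step[OF lt tn])
 have S: "9 / 10 * \<beta>^2 * real (Suc t) = 9 / 10 * \<beta>^2 * real t + 9 / 10 * \<beta>^2" by (simp add: algebra_simps)
 have IH: "(vb t)^2 - 9 / 10 * \<beta>^2 * real t \<le> 33 * A^2 * \<beta>^2 + f t" using step by (simp add: f_def)
 have "(vb (Suc t))^2 - 9 / 10 * \<beta>^2 * real (Suc t) \<le> 33 * A^2 * \<beta>^2 + f (Suc t)"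
 proof (cases "9 / 10 * \<beta>^2 * real t \<le> (vb t)^2")
  case True
  hence "9 / 10 * \<beta>^2 \<le> (vb t)^2 / real t" using tp by (simp add: pos_le_divide_eq)
  hence "max 0 (\<beta>^2 - (vb t)^2 / real t) \<le> \<beta>^2 / 10" using zero_le_power2[of \<beta>] by (intro max.boundedI) linarith+
  hence "vb t * p t \<le> 12 / 100 * \<beta>^2" using vb_p_decay[OF step(1) tn] by linarith
  thus ?thesis using vs S IH f1 e zero_le_power2[of \<beta>] by linarith
 next
  case False
  have "1 * \<beta>^2 \<le> A^2 * \<beta>^2" using A_pow[of 2] by (intro mult_right_mono) auto
  moreover have "vb t * p t \<le> 16 * (A^2 * \<beta>^2)" using vb_p_le[OF lt tn] by simp
  moreover have "33 * A^2 * \<beta>^2 = 33 * (A^2 * \<beta>^2)" by simp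
  ultimately show ?thesis using vs S False e f0 zero_le_power2[of \<beta>] by linarith
 qed
 thus ?case by (simp add: f_def)
qed

definition \<tau>2 :: nat where "\<tau>2 = nat \<lceil>3 * A^2 * real \<tau>1\<rceil>"

lemma \<tau>2: "3 * A^2 * real \<tau>1 \<le> real \<tau>2" "real \<tau>2 \<le> 4 * A^2 * real \<tau>1" "\<tau>1 \<le> \<tau>2"
proof -
 have t1: "1 \<le> real \<tau>1" using \<tau>1(3) \<tau>0(3) by linarith
 have 1: "1 * real \<tau>1 \<le> A^2 * real \<tau>1" using A_pow[of 2] by (intro mult_right_mono) auto
 show 2: "3 * A^2 * real \<tau>1 \<le> real \<tau>2" "real \<tau>2 \<le> 4 * A^2 * real \<tau>1" unfolding \<tau>2_def using 1 t1 by linarith+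
 show "\<tau>1 \<le> \<tau>2" using 1 2 by linarith
qed

text \<open>As \<mu> \<le> vb, this keeps \<beta>^2 - \<mu>^2 / t at least 0.09 \<beta>^2, so that
  exploration never dies out; \<open>p_lower\<close> makes this quantitative.\<close>

lemma vb2_settled:
 assumes t: "\<tau>2 \<le> t" "t \<le> n"
 shows "(vb t)^2 \<le> 91 / 100 * \<beta>^2 * real t"
proof -
 have lt: "late t" by (rule late_iff) (use t \<tau>1(3) \<tau>2(3) in auto)
 have "1 * real \<tau>1 \<le> A^2 * real \<tau>1" using A_pow[of 2] by (intro mult_right_mono) auto
 moreover have "3 * (A^2 * real \<tau>1) \<le> real t" using \<tau>2(1) t(1) by simp
 ultimately have "A^2 * real \<tau>1 - (real t - real \<tau>1) / 2 \<le> 0" by argo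
 hence 1: "(vb t)^2 - 9 / 10 * \<beta>^2 * real t \<le> 33 * A^2 * \<beta>^2" using vb2_upper[of t] t \<tau>2(3) by simp
 have "3300 * A^2 \<le> r t * r t"
 proof -
  have "10 ^ 4 * A^2 * 1 \<le> r t * r t" using r(3,6)[OF lt] A1 by (intro mult_mono) auto
  thus ?thesis by simp
 qed
 hence "\<beta>^2 * (3300 * A^2) \<le> \<beta>^2 * real t" using r(2)[OF lt] by (intro mult_left_mono) auto
 thus ?thesis using 1 by (simp add: mult_ac)
qed

end

section \<open>One-step decrease of the Lyapunov function\<close>

context ucb_small
begin

definition Z :: "nat \<Rightarrow> real" where "Z t = \<theta> \<bullet> (gram a t *v \<theta>)"

text \<open>In the increment of \<open>W\<close> the coupling \<open>b\<close> to \<open>\<theta>\<close> enters without a sign; the second summand of the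
 Lyapunov function cancels this term.\<close>

definition \<Omega> :: "nat \<Rightarrow> real" where "\<Omega> t = W t + vb t / Z t * (norm (b t))^2"

lemma Z_ge: "1 \<le> Z t" using gram_ge[of \<theta> a t] \<theta> by (simp add: Z_def)

lemma Z_Suc: "Z (Suc t) = Z t + (a (Suc t) \<bullet> \<theta>)^2"
 by (simp add: Z_def gram_Suc matrix_vector_mult_add_rdistrib outer_square_mult inner_add_right
   inner_commute power2_eq_square)

lemma W_le_\<Omega>: "W t \<le> \<Omega> t" using vb_pos[of t] Z_ge[of t] by (simp add: \<Omega>_def)

lemma settled_late: "\<tau>2 \<le> t \<Longrightarrow> t \<le> n \<Longrightarrow> late t" using late_iff[of t] \<tau>1(3) \<tau>2(3) by simp

text \<open>The squared norm of \<open>b\<close> is the coupling of \<theta> and \<open>b\<close> in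
  the Gram matrix, which \<open>cross_le\<close> bounds by the square root of the form at
  \<open>b\<close>. That form is again at most \<open>tr_perp\<close> times the squared norm, and
  one such factor cancels.\<close>

lemma norm_b_le:
 assumes lt: "late t"
 shows "(norm (b t))^2 \<le> 49 * A ^ 3 * \<epsilon> * \<beta> * r t * real t"
proof -
 define s where "s = sqrt (b t \<bullet> (G t *v b t))"
 have "\<bar>b t \<bullet> b t\<bar> \<le> 7 * A * \<kappa> * r t * s" using cross_le[OF lt b_perp[of t]] V_form(2)[OF b_perp, of t t] by (simp add: s_def)
 hence 1: "(norm (b t))^2 \<le> 7 * A * \<kappa> * r t * s" by (simp add: dot_square_norm)
 have "((norm (b t))^2)^2 \<le> (7 * A * \<kappa> * r t * s)^2" using 1 by (intro power_mono) auto
 also have "... = 49 * A^2 * \<epsilon> * real t * s^2" by (simp add: power_mult_distrib \<kappa>(2))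
 also have "s^2 = b t \<bullet> (G t *v b t)" using spd_nonneg[OF spd_gram[of a t]] by (simp add: s_def)
 also have "49 * A^2 * \<epsilon> * real t * (b t \<bullet> (G t *v b t)) \<le> 49 * A^2 * \<epsilon> * real t * (A * (\<beta> * r t) * (norm (b t))^2)"
 proof (intro mult_left_mono)
  have "b t \<bullet> (G t *v b t) \<le> tr_perp t * (norm (b t))^2" by (rule form_perp_le[OF b_perp])
  also have "... \<le> A * (\<beta> * r t) * (norm (b t))^2" using m(4)[OF lt] by (intro mult_right_mono) auto
  finally show "b t \<bullet> (G t *v b t) \<le> A * (\<beta> * r t) * (norm (b t))^2" .
 qed (use \<epsilon>(1) in auto)
 finally have 2: "(norm (b t))^2 * (norm (b t))^2 \<le> (49 * A ^ 3 * \<epsilon> * \<beta> * r t * real t) * (norm (b t))^2"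
  by (simp add: power2_eq_square power3_eq_cube mult_ac)
 show ?thesis
 proof (cases "norm (b t) = 0")
  case False
  thus ?thesis using 2 by (subst (asm) mult_le_cancel_right_pos) auto
 qed (use A1 \<epsilon>(1) \<beta> in auto)
qed

context
 fixes t assumes st: "\<tau>2 \<le> t" and ltn: "t < n"
begin

lemma lt: "late t" by (rule settled_late) (use st ltn in auto)

definition "gap = vb t - \<mu> t"

lemma gap: "0 \<le> gap" using mu_le_vb[OF lt ltn] by (simp add: gap_def)

lemmas rt = r[OF lt] and pt = p[OF lt ltn] and mut = \<mu>_bounds[OF lt ltn]

lemma Zt: "real t / 2 \<le> Z t" "Z t \<le> 2 * real t" "c t \<le> Z t"
 using c_bounds(1,4,5)[OF lt] t_pos[OF late_t1'[OF lt]] unfolding Z_def by linarith+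

lemma inv_Z: "1 / Z t \<le> 2 / real t" using Zt(1) rt(1,2) Z_ge[of t] by (simp add: field_simps)

lemma p_lower: "8 / 100 * \<beta> \<le> A * (p t * r t)"
proof -
 have tp: "0 < real t" using rt by simp
 have "(\<mu> t)^2 \<le> (vb t)^2" using mu_le_vb[OF lt ltn] mut(1) by (intro power_mono) auto
 also have "... \<le> 91 / 100 * \<beta>^2 * real t" by (rule vb2_settled) (use st ltn in auto)
 finally have 1: "(\<mu> t)^2 / real t \<le> 91 / 100 * \<beta>^2" using tp by (simp add: pos_divide_le_eq)
 have "2100 * A ^ 4 * \<kappa> * \<beta>^2 \<le> 1 / 100 * \<beta>^2"
 proof (rule mult_right_mono)
  have "1000000 * (A ^ 4 * \<kappa>) \<le> 10 ^ 16 * (A ^ 4 * \<kappa>)" using A1 \<kappa>(1) by (intro mult_right_mono) auto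
  hence "1000000 * (A ^ 4 * \<kappa>) \<le> 1" using \<kappa>_small(1)[of 4] by simp
  thus "2100 * A ^ 4 * \<kappa> \<le> 1 / 100" by (simp add: mult.assoc)
 qed simp
 hence "8 / 100 * \<beta>^2 \<le> \<mu> t * p t" using exploration_rate[OF lt ltn] 1 by linarith
 also have "... \<le> (A * (\<beta> * r t)) * p t" using mut(4) pt(1) by (intro mult_right_mono) auto
 finally have "\<beta> * (8 / 100 * \<beta>) \<le> \<beta> * (A * (p t * r t))" by (simp add: power2_eq_square mult_ac)
 thus ?thesis using \<beta> by (simp only: mult_le_cancel_left_pos)
qed

lemma beta_r_le_p: "\<beta> / r t \<le> 13 * A * p t"
proof -
 have "\<beta> \<le> 13 * A * p t * r t" using p_lower \<beta> by argo
 thus ?thesis using rt(1) by (simp add: pos_divide_le_eq)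
qed

lemma x_half: "1 / 2 \<le> x t"
proof -
 have "(norm (a (Suc t) - \<theta>))^2 \<le> 16 * \<beta>^2 / m t" by (rule near[OF ltn m(1)[OF lt] mineig_form])
 moreover have "(norm (a (Suc t) - \<theta>))^2 = 2 - 2 * x t" unfolding norm_diff_squared stepD(1)[OF ltn] \<theta> x_def[OF lt ltn] by simp
 moreover have "16 * \<beta>^2 / m t \<le> 1"
 proof -
  have "200 * 1 * 1 \<le> 200 * A^2 * N" using A_pow[of 2] N1 by (intro mult_mono) auto
  hence "200 \<le> \<beta>" using N\<beta> by linarith
  hence "16 * \<beta>^2 \<le> \<beta>^2 * \<beta>^2" using \<beta> by (intro mult_right_mono) (auto simp: power2_eq_square intro!: mult_mono[of 4 \<beta> 4 \<beta>, simplified])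
  also have "... = \<beta> ^ 4" by algebra
  also have "... \<le> m t" by (rule crude_t(3)[OF late_t1'[OF lt] late_n[OF lt]])
  finally show ?thesis using m(1)[OF lt] by (simp add: pos_divide_le_eq)
 qed
 ultimately show ?thesis by linarith
qed

lemma eta_le: "\<bar>\<eta> t\<bar> \<le> 28 * A^2 * \<kappa> * \<beta> * r t" by (rule \<eta>_bound[OF lt ltn])

lemma small_k: "10 ^ 12 * A ^ k * \<kappa> \<le> 1 / 10000" if "k \<le> 10" using \<kappa>_small(1)[OF that] by simp

text \<open>In the second equation of \<open>drive_scalar\<close> the term \<mu> x dominates
  coupling and noise, so x - 1 / u is positive and at least of order \<beta> / sqrt t. It is the
  factor in front of \<open>b\<close> in \<open>b_drive\<close>.\<close>

lemma x_minus_inv_u: "\<beta> \<le> 200 * A * r t * (x t - 1 / u t)" "0 \<le> x t - 1 / u t"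
proof -
 have e1: "\<bar>\<eta> t\<bar> \<le> \<beta> * r t / (100 * A)"
 proof -
  have "A * (28 * A^2 * \<kappa>) \<le> 1 / 100"
  proof -
   have "A ^ 3 * \<kappa> \<le> 10 ^ 12 * (A ^ 3 * \<kappa>)" using A1 \<kappa>(1) by simp
   thus ?thesis using small_k[of 3] by (simp add: power_numeral_reduce mult_ac)
  qed
  hence "28 * A^2 * \<kappa> \<le> 1 / (100 * A)" using A1 by (simp add: field_simps)
  hence "28 * A^2 * \<kappa> * (\<beta> * r t) \<le> 1 / (100 * A) * (\<beta> * r t)" using \<beta> rt(1) by (intro mult_right_mono) auto
  thus ?thesis using eta_le by (simp add: mult_ac)
 qed
 have e2: "4 * N * r t \<le> \<beta> * r t / (50 * A)"
 proof -
  have "200 * A * N \<le> 200 * A^2 * N" using A_pow_mono[of 1 2] N1 by (intro mult_right_mono mult_left_mono) auto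
  hence "4 * N \<le> \<beta> / (50 * A)" using N\<beta> A1 by (simp add: field_simps)
  hence "4 * N * r t \<le> \<beta> / (50 * A) * r t" using rt(1) by (intro mult_right_mono) auto
  thus ?thesis by simp
 qed
 have e3: "\<beta> * r t / (24 * A) \<le> \<mu> t * x t"
 proof -
  have "\<beta> * r t / (12 * A) \<le> \<mu> t" using mut(3) A1 by (simp add: pos_divide_le_eq mult_ac)
  hence "\<beta> * r t / (12 * A) * (1 / 2) \<le> \<mu> t * x t" using x_half mut(1) \<beta> rt(1) A1 by (intro mult_mono) auto
  thus ?thesis by simp
 qed
 define q where "q = \<beta> * r t / A"
 have q: "0 < q" using \<beta> rt(1) A1 by (simp add: q_def)
 have "\<bar>\<theta> \<bullet> (G t *v \<zeta> t) / u t\<bar> = \<bar>\<theta> \<bullet> (G t *v \<zeta> t)\<bar> / u t" using inv_u(1)[OF lt ltn] by (simp add: abs_divide)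
 moreover have "\<beta> * r t / (50 * A) = q / 50" by (simp add: q_def)
 ultimately have "- (q / 50) \<le> \<theta> \<bullet> (G t *v \<zeta> t) / u t" using \<zeta>_bounds(2)[OF lt ltn] e2 by linarith
 moreover have "q / 24 \<le> \<mu> t * x t" "\<eta> t \<le> q / 100" using e1 e3 by (simp_all add: q_def mult.commute)
 ultimately have "q / 100 \<le> Z t * (x t - 1 / u t)" using drive_scalar(2)[OF lt ltn] q unfolding Z_def by linarith
 moreover have "0 < Z t" using Z_ge[of t] by linarith
 ultimately show nn: "0 \<le> x t - 1 / u t" using q zero_less_mult_pos[of "Z t" "x t - 1 / u t"] by linarith
 have "Z t * (x t - 1 / u t) \<le> 2 * real t * (x t - 1 / u t)" using Zt(2) nn by (intro mult_right_mono) auto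
 with \<open>q / 100 \<le> _\<close> have "q \<le> 200 * real t * (x t - 1 / u t)" by linarith
 hence "A * q \<le> A * (200 * (r t * r t) * (x t - 1 / u t))" unfolding rt(2) using A1 by (intro mult_left_mono) auto
 moreover have "A * q = r t * \<beta>" using A1 by (simp add: q_def)
 moreover have "A * (200 * (r t * r t) * (x t - 1 / u t)) = r t * (200 * A * r t * (x t - 1 / u t))" by algebra
 ultimately have "r t * \<beta> \<le> r t * (200 * A * r t * (x t - 1 / u t))" by argo
 thus "\<beta> \<le> 200 * A * r t * (x t - 1 / u t)" using rt(1) by (simp only: mult_le_cancel_left_pos)
qed

text \<open>The stationarity equation tested with \<open>b\<close> itself: x - 1 / u times the
  squared norm of \<open>b\<close> can be balanced only by noise and by V - \<mu> P paired with
  \<open>b\<close> and \<open>y\<close>, and the norm of V - \<mu> P is bounded by the gap.\<close>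

lemma b_drive: "(x t - 1 / u t) * norm (b t) \<le> d * gap * sqrt (p t) + 2 * N * sqrt (A * (\<beta> * r t))"
proof (cases "b t = 0")
 case True
 have "0 \<le> d * gap * sqrt (p t)" using d2 gap pt(1) by simp
 moreover have "0 \<le> 2 * N * sqrt (A * (\<beta> * r t))" using N1 A1 \<beta> rt(1) by simp
 ultimately show ?thesis using True by simp
next
 case False
 define M where "M = V t - \<mu> t *\<^sub>R P"
 have yt: "\<theta> \<bullet> y (Suc t) = 0" "b t \<bullet> \<theta> = 0" using y_perp_all[of "Suc t"] b_perp by (simp_all add: inner_commute)
 have bM: "b t \<bullet> (M *v y (Suc t)) = (1 / u t - x t) * (norm (b t))^2 + (b t \<bullet> (G t *v \<zeta> t)) / u t"
 proof -
  have bG: "b t \<bullet> (G t *v \<theta>) = (norm (b t))^2" using V_form(2)[OF b_perp, of t t] spd_inner[OF spd_gram[of a t], of "b t" \<theta>]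
   by (simp add: dot_square_norm inner_commute)
  have "b t \<bullet> (G t *v a (Suc t)) = x t * (norm (b t))^2 + b t \<bullet> (V t *v y (Suc t))" unfolding a_decomp[OF lt ltn]
   by (simp add: matrix_vector_right_distrib matrix_vector_mult_scaleR inner_add_right bG V_form(1)[OF y_perp_all b_perp])
  moreover have "b t \<bullet> a (Suc t) = b t \<bullet> y (Suc t)" unfolding a_decomp[OF lt ltn] by (simp add: inner_add_right yt)
  moreover have "b t \<bullet> (M *v y (Suc t)) = b t \<bullet> (V t *v y (Suc t)) - \<mu> t * (b t \<bullet> y (Suc t))"
   by (simp add: M_def matrix_vector_mult_diff_rdistrib scaleR_matrix_vector_assoc[symmetric] inner_diff_right P_mult yt)
  ultimately show ?thesis using stationarity[OF lt ltn, of "b t"] bG by (simp add: algebra_simps add_divide_distrib)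
 qed
 have "\<bar>b t \<bullet> (M *v y (Suc t))\<bar> \<le> norm (b t) * (d * gap * sqrt (p t))"
 proof -
  have "norm M \<le> (d - 1) * gap" unfolding M_def gap_def by (rule perp_psd(2)) (rule stepD(7)[OF ltn])
  also have "... \<le> d * gap" using gap by (intro mult_right_mono) auto
  finally have "norm (M *v y (Suc t)) \<le> d * gap * sqrt (p t)"
   using norm_matrix_vector_le[of M "y (Suc t)"] mult_right_mono[of "norm M" "d * gap" "norm (y (Suc t))"]
   by (simp add: p_def[OF lt ltn])
  hence "norm (b t) * norm (M *v y (Suc t)) \<le> norm (b t) * (d * gap * sqrt (p t))" by (intro mult_left_mono) auto
  thus ?thesis using Cauchy_Schwarz_ineq2[of "b t" "M *v y (Suc t)"] by linarith
 qed
 moreover have "\<bar>b t \<bullet> (G t *v \<zeta> t)\<bar> / u t \<le> norm (b t) * (2 * N * sqrt (A * (\<beta> * r t)))"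
 proof -
  have "sqrt (b t \<bullet> (G t *v b t)) \<le> sqrt (A * (\<beta> * r t)) * norm (b t)"
  proof (rule real_le_lsqrt)
   have "b t \<bullet> (G t *v b t) \<le> tr_perp t * (norm (b t))^2" by (rule form_perp_le[OF b_perp])
   also have "... \<le> A * (\<beta> * r t) * (norm (b t))^2" using m(4)[OF lt] by (intro mult_right_mono) auto
   also have "... = (sqrt (A * (\<beta> * r t)) * norm (b t))^2" using A1 \<beta> rt(1) by (simp add: power_mult_distrib)
   finally show "b t \<bullet> (G t *v b t) \<le> (sqrt (A * (\<beta> * r t)) * norm (b t))^2" .
  qed (use A1 \<beta> rt(1) in auto)
  hence "N * sqrt (b t \<bullet> (G t *v b t)) \<le> N * (sqrt (A * (\<beta> * r t)) * norm (b t))" using N1 by (intro mult_left_mono) auto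
  hence "\<bar>b t \<bullet> (G t *v \<zeta> t)\<bar> \<le> N * (sqrt (A * (\<beta> * r t)) * norm (b t))" using \<zeta>_pair[OF lt ltn, of "b t"] by linarith
  hence "(1 / u t) * \<bar>b t \<bullet> (G t *v \<zeta> t)\<bar> \<le> 2 * (N * (sqrt (A * (\<beta> * r t)) * norm (b t)))"
   using inv_u[OF lt ltn] by (intro mult_mono) auto
  thus ?thesis by (simp add: mult_ac)
 qed
 moreover have "\<bar>(b t \<bullet> (G t *v \<zeta> t)) / u t\<bar> = \<bar>b t \<bullet> (G t *v \<zeta> t)\<bar> / u t" using inv_u(1)[OF lt ltn] by (simp add: abs_divide)
 moreover have "(x t - 1 / u t) * (norm (b t))^2 = (b t \<bullet> (G t *v \<zeta> t)) / u t - b t \<bullet> (M *v y (Suc t))"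
  unfolding bM by (simp add: algebra_simps)
 ultimately have "(x t - 1 / u t) * (norm (b t))^2 \<le> norm (b t) * (d * gap * sqrt (p t)) + norm (b t) * (2 * N * sqrt (A * (\<beta> * r t)))"
  by linarith
 hence "norm (b t) * ((x t - 1 / u t) * norm (b t)) \<le> norm (b t) * (d * gap * sqrt (p t) + 2 * N * sqrt (A * (\<beta> * r t)))"
  by (simp add: power2_eq_square algebra_simps)
 thus ?thesis using False by (subst (asm) mult_le_cancel_left_pos) auto
qed

lemma r_div: "r t * (r t / real t) = 1" "r t / real t = 1 / r t"
proof -
 show "r t * (r t / real t) = 1" using rt(1) rt(2) by (metis less_irrefl mult_eq_0_iff right_inverse_eq times_divide_eq_right)
 thus "r t / real t = 1 / r t" using rt(1) by (simp only: eq_divide_eq) (simp add: mult.commute)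
qed

lemma sqrt_p_r: "sqrt (p t) * sqrt (A * (\<beta> * r t)) \<le> 4 * A * \<beta>"
proof -
 have "sqrt (p t) * sqrt (A * (\<beta> * r t)) = sqrt (A * \<beta> * (p t * r t))" by (simp add: real_sqrt_mult[symmetric] mult_ac)
 also have "... \<le> sqrt (A * \<beta> * (16 * A * \<beta>))" using pt(4) A1 \<beta> by (intro real_sqrt_le_mono mult_left_mono) auto
 also have "A * \<beta> * (16 * A * \<beta>) = (4 * A * \<beta>)^2" by (simp add: power2_eq_square)
 finally show ?thesis using A1 \<beta> by simp
qed

lemma b_y: "norm (b t) * sqrt (p t) * \<beta> \<le> 200 * A * r t * (d * gap * p t + 8 * A * N * \<beta>)"
proof -
 have "\<beta> * norm (b t) \<le> (200 * A * r t * (x t - 1 / u t)) * norm (b t)" using x_minus_inv_u(1) by (intro mult_right_mono) auto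
 also have "... = 200 * A * r t * ((x t - 1 / u t) * norm (b t))" by simp
 also have "... \<le> 200 * A * r t * (d * gap * sqrt (p t) + 2 * N * sqrt (A * (\<beta> * r t)))"
  using b_drive A1 rt(1) by (intro mult_left_mono) auto
 finally have "\<beta> * norm (b t) * sqrt (p t) \<le> 200 * A * r t * (d * gap * sqrt (p t) + 2 * N * sqrt (A * (\<beta> * r t))) * sqrt (p t)"
  using pt(1) by (intro mult_right_mono) auto
 also have "... = 200 * A * r t * (d * gap * (sqrt (p t) * sqrt (p t)) + 2 * N * (sqrt (p t) * sqrt (A * (\<beta> * r t))))"
  by (simp add: algebra_simps)
 also have "... \<le> 200 * A * r t * (d * gap * p t + 2 * N * (4 * A * \<beta>))"
  using sqrt_p_r pt(1) N1 A1 rt(1) d2 gap by (intro mult_left_mono add_mono) (simp_all only: real_sqrt_mult_self[symmetric], auto)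
 finally show ?thesis by (simp add: mult_ac)
qed

lemma b_sq_p: "\<bar>\<eta> t\<bar> \<le> norm (b t) * sqrt (p t)" "norm (b t) * sqrt (p t) \<le> 28 * A^2 * \<kappa> * \<beta> * r t"
proof -
 have "\<eta> t = b t \<bullet> y (Suc t)" unfolding \<eta>_def[OF lt ltn] by (rule V_form(2)[OF y_perp_all])
 thus "\<bar>\<eta> t\<bar> \<le> norm (b t) * sqrt (p t)" using Cauchy_Schwarz_ineq2[of "b t" "y (Suc t)"] by (simp add: p_def[OF lt ltn])
 have "(norm (b t) * sqrt (p t))^2 = (norm (b t))^2 * p t" using pt(1) by (simp add: power_mult_distrib)
 also have "... \<le> (49 * A ^ 3 * \<epsilon> * \<beta> * r t * real t) * p t" using norm_b_le[OF lt] pt(1) by (intro mult_right_mono) auto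
 also have "... = (49 * A ^ 3 * \<epsilon> * \<beta> * real t) * (p t * r t)" by simp
 also have "... \<le> (49 * A ^ 3 * \<epsilon> * \<beta> * real t) * (16 * A * \<beta>)" using pt(4) A1 \<epsilon>(1) \<beta> by (intro mult_left_mono) auto
 also have "... = 784 * A ^ 4 * \<kappa>^2 * \<beta>^2 * (r t * r t)" unfolding \<kappa>(2) rt(2) by algebra
 also have "... = (28 * A^2 * \<kappa> * \<beta> * r t)^2" by algebra
 finally show "norm (b t) * sqrt (p t) \<le> 28 * A^2 * \<kappa> * \<beta> * r t" by (rule power2_le_imp_le) (use A1 \<kappa>(1) \<beta> rt(1) in simp)
qed

text \<open>One factor \<open>norm (b t) * sqrt (p t)\<close> is bounded a priori by
  \<open>b_sq_p\<close>, the other through the gap by \<open>b_y\<close>; the small factor \<kappa>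
  lets the gap term be absorbed later.\<close>

lemma cross_quad: "2 / Z t * (norm (b t) * sqrt (p t))^2 \<le> gap * p t / 4 + N * \<beta>"
proof -
 define X where "X = norm (b t) * sqrt (p t)"
 have X: "0 \<le> X" using pt(1) by (simp add: X_def)
 have "2 / Z t * X^2 = 2 * (1 / Z t) * (X * X)" by (simp add: power2_eq_square)
 also have "... \<le> 2 * (2 / real t) * (28 * A^2 * \<kappa> * \<beta> * r t * X)"
  using inv_Z b_sq_p(2) X Z_ge[of t] A1 \<kappa>(1) \<beta> rt(1) by (intro mult_mono) (auto simp: X_def)
 also have "... = 112 * A^2 * \<kappa> * (X * \<beta>) * (r t / real t)" by simp
 also have "... \<le> 112 * A^2 * \<kappa> * (200 * A * r t * (d * gap * p t + 8 * A * N * \<beta>)) * (r t / real t)"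
  using b_y A1 \<kappa>(1) rt(1) by (intro mult_right_mono mult_left_mono) (auto simp: X_def)
 also have "... = 22400 * (A ^ 3 * \<kappa>) * (d * gap * p t + 8 * A * N * \<beta>) * (r t * (r t / real t))" by algebra
 also have "... = (22400 * (A ^ 3 * \<kappa>) * d) * (gap * p t) + (179200 * (A ^ 4 * \<kappa>)) * (N * \<beta>)" unfolding r_div(1) by algebra
 also have "... \<le> 1 / 4 * (gap * p t) + 1 * (N * \<beta>)"
 proof (intro add_mono mult_right_mono)
  have k4: "10 ^ 12 * (A ^ 4 * \<kappa>) \<le> 1" using small_k[of 4] by simp
  have "22400 * (A ^ 3 * \<kappa>) * d \<le> 22400 * (A ^ 3 * \<kappa>) * A" using d_le_A A1 \<kappa>(1) by (intro mult_left_mono) auto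
  also have "... = 22400 * (A ^ 4 * \<kappa>)" by (simp add: power_numeral_reduce)
  also have "... \<le> 1 / 4" using k4 by simp
  finally show "22400 * (A ^ 3 * \<kappa>) * d \<le> 1 / 4" .
  show "179200 * (A ^ 4 * \<kappa>) \<le> 1" using k4 by simp
 qed (use gap pt(1) N1 \<beta> in auto)
 finally show ?thesis by (simp add: X_def)
qed

lemma N\<beta>_ge: "1 \<le> N * \<beta>" using mult_mono[of 1 N 1 \<beta>] N1 \<beta>1 by simp

text \<open>The terms with \<eta> have no sign and are combined first. What is left is the damping
  by gap times p, small multiples of it, and noise of order N \<beta>.\<close>

lemma \<Omega>_step: "\<Omega> (Suc t) \<le> \<Omega> t - gap * p t + 24 * A * N * \<beta>"
proof -
 define e where "e = \<theta> \<bullet> (G t *v \<zeta> t)"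
 have u: "0 < u t" using inv_u(1)[OF lt ltn] by simp
 have Zp: "0 < Z t" using Z_ge[of t] by linarith
 have ZZ: "Z t \<le> Z (Suc t)" by (simp add: Z_Suc)
 have bs: "(norm (b (Suc t)))^2 = (norm (b t))^2 + 2 * x t * \<eta> t + (x t)^2 * p t"
 proof -
  have "\<eta> t = b t \<bullet> y (Suc t)" unfolding \<eta>_def[OF lt ltn] by (rule V_form(2)[OF y_perp_all])
  thus ?thesis unfolding b_Suc norm_add_squared by (simp add: x_def[OF lt ltn] p_def[OF lt ltn] power_mult_distrib)
 qed
 have x2: "(x t)^2 * p t \<le> p t" using pt(1-3) by (simp add: mult_left_le_one_le)
 have bs2: "(norm (b (Suc t)))^2 \<le> 2 * (norm (b t))^2 + 2 * p t"
 proof -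
  have "norm (b (Suc t)) \<le> norm (b t) + norm (x t *\<^sub>R y (Suc t))" unfolding b_Suc x_def[OF lt ltn] by (rule norm_triangle_ineq)
  also have "norm (x t *\<^sub>R y (Suc t)) \<le> 1 * sqrt (p t)" using pt(6) by (simp add: p_def[OF lt ltn] mult_left_le_one_le)
  finally have "(norm (b (Suc t)))^2 \<le> (norm (b t) + sqrt (p t))^2" by (intro power_mono) auto
  also have "... \<le> 2 * (norm (b t))^2 + 2 * (sqrt (p t))^2"
   using zero_le_power2[of "norm (b t) - sqrt (p t)"] by (simp add: power2_sum power2_diff)
  finally show ?thesis using pt(1) by simp
 qed
 have vs: "vb (Suc t) \<le> vb t + p t"
  using d2 pt(1) by (simp add: vb_Suc p_def[OF lt ltn, symmetric] divide_le_eq mult_le_cancel_left1)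
 have "vb (Suc t) / Z (Suc t) * (norm (b (Suc t)))^2 \<le> (vb t + p t) / Z t * (norm (b (Suc t)))^2"
  using vs ZZ Zp vb_pos[of "Suc t"] by (intro mult_right_mono frac_le) auto
 also have "... = vb t / Z t * (norm (b (Suc t)))^2 + p t / Z t * (norm (b (Suc t)))^2"
  by (simp add: add_divide_distrib distrib_right)
 also have "... \<le> vb t / Z t * ((norm (b t))^2 + 2 * x t * \<eta> t + p t) + p t / Z t * (2 * (norm (b t))^2 + 2 * p t)"
  using bs bs2 x2 vb_pos[of t] Zp pt(1) by (intro add_mono mult_left_mono) auto
 finally have q0: "vb (Suc t) / Z (Suc t) * (norm (b (Suc t)))^2 \<le>
   vb t / Z t * ((norm (b t))^2 + 2 * x t * \<eta> t + p t) + p t / Z t * (2 * (norm (b t))^2 + 2 * p t)" .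
 have q: "vb (Suc t) / Z (Suc t) * (norm (b (Suc t)))^2 \<le> vb t / Z t * (norm (b t))^2
   + 2 * (vb t / Z t * x t * \<eta> t) + vb t / Z t * p t + 2 / Z t * (norm (b t) * sqrt (p t))^2 + 2 / Z t * (p t)^2"
 proof -
  have e1: "(norm (b t) * sqrt (p t))^2 = (norm (b t))^2 * p t" using pt(1) by (simp add: power_mult_distrib)
  have e2: "p t / Z t * (2 * (norm (b t))^2 + 2 * p t) = 2 / Z t * ((norm (b t))^2 * p t) + 2 / Z t * (p t)^2"
   by (simp add: power2_eq_square distrib_left add_divide_distrib mult_ac)
  have e3: "vb t / Z t * ((norm (b t))^2 + 2 * x t * \<eta> t + p t) = vb t / Z t * (norm (b t))^2 + 2 * (vb t / Z t * x t * \<eta> t) + vb t / Z t * p t"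
   by (simp only: distrib_left) simp
  show ?thesis using q0 unfolding e1 e2 e3 by (simp only: add.assoc)
 qed
 have Ws: "W (Suc t) \<le> W t + 2 * (E t - vb t * p t) + (p t)^2"
 proof -
  have "(p t)^2 * (1 - 1 / (d - 1)) \<le> (p t)^2 * 1" using d2 by (intro mult_left_mono) auto
  thus ?thesis using W_Suc[of t] by (simp add: E_def[OF lt ltn] p_def[OF lt ltn])
 qed
 \<comment> \<open>The cancellation for which \<open>\<Omega>\<close> is built: x - 1 / u equals
   (\<mu> x - \<eta> + e / u) / Z, so adding the contribution of weight vb / Z replaces the factor
   \<mu> by the gap vb - \<mu>.\<close>
 have main: "(1 / u t - x t) * \<eta> t + vb t / Z t * x t * \<eta> t = (gap * x t * \<eta> t + (\<eta> t)^2 - \<eta> t * (e / u t)) / Z t"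
 proof -
  have "x t - 1 / u t = (\<mu> t * x t - \<eta> t + e / u t) / Z t"
   using drive_scalar(2)[OF lt ltn] Zp by (simp add: Z_def e_def field_simps)
  hence "1 / u t - x t = - ((\<mu> t * x t - \<eta> t + e / u t) / Z t)" by linarith
  hence "(1 / u t - x t) * \<eta> t + vb t / Z t * x t * \<eta> t = - ((\<mu> t * x t - \<eta> t + e / u t) / Z t) * \<eta> t + vb t / Z t * x t * \<eta> t" by (simp only:)
  also have "... = (- (\<mu> t * x t - \<eta> t + e / u t) * \<eta> t + vb t * x t * \<eta> t) / Z t" unfolding divide_inverse by algebra
  also have "- (\<mu> t * x t - \<eta> t + e / u t) * \<eta> t + vb t * x t * \<eta> t = gap * x t * \<eta> t + (\<eta> t)^2 - \<eta> t * (e / u t)"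
   by (simp add: gap_def power2_eq_square algebra_simps)
  finally show ?thesis .
 qed
 have m1: "2 * (gap * x t * \<eta> t) / Z t \<le> gap * p t / 4"
 proof -
  have "gap * x t * \<eta> t \<le> gap * (1 * (28 * A^2 * \<kappa> * \<beta> * r t))"
  proof -
   have "x t * \<eta> t \<le> \<bar>x t\<bar> * \<bar>\<eta> t\<bar>" by (simp add: abs_mult[symmetric])
   also have "... \<le> 1 * (28 * A^2 * \<kappa> * \<beta> * r t)" using pt(6) eta_le by (intro mult_mono) auto
   finally show ?thesis using gap by (simp only: mult.assoc) (rule mult_left_mono)
  qed
  hence "(2 / Z t) * (gap * x t * \<eta> t) \<le> (2 / Z t) * (gap * (1 * (28 * A^2 * \<kappa> * \<beta> * r t)))"
   using Zp by (intro mult_left_mono) auto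
  also have "... \<le> (4 / real t) * (gap * (1 * (28 * A^2 * \<kappa> * \<beta> * r t)))"
   using inv_Z gap A1 \<kappa>(1) \<beta> rt(1) by (intro mult_right_mono) auto
  also have "... = 112 * A^2 * \<kappa> * gap * \<beta> * (r t / real t)" by simp
  also have "... = 112 * A^2 * \<kappa> * gap * (\<beta> / r t)" unfolding r_div by simp
  also have "... \<le> 112 * A^2 * \<kappa> * gap * (13 * A * p t)" using beta_r_le_p A1 \<kappa>(1) gap by (intro mult_left_mono) auto
  also have "... = 1456 * (A ^ 3 * \<kappa>) * (gap * p t)" by (simp add: power_numeral_reduce)
  also have "... \<le> 1 / 4 * (gap * p t)" using small_k[of 3] gap pt(1) by (intro mult_right_mono) auto
  finally show ?thesis by simp
 qed
 have m2: "2 * (\<eta> t)^2 / Z t \<le> gap * p t / 4 + N * \<beta>"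
 proof -
  have "(\<eta> t)^2 \<le> (norm (b t) * sqrt (p t))^2" using power_mono[OF b_sq_p(1), of 2] by simp
  hence "2 / Z t * (\<eta> t)^2 \<le> 2 / Z t * (norm (b t) * sqrt (p t))^2" using Zp by (intro mult_left_mono) auto
  thus ?thesis using cross_quad by simp
 qed
 have m3: "2 * (- \<eta> t * (e / u t)) / Z t \<le> N * \<beta>"
 proof -
  have "\<bar>e / u t\<bar> = \<bar>e\<bar> / u t" using u by (simp add: abs_divide)
  hence eu: "\<bar>e / u t\<bar> \<le> 4 * N * r t" using \<zeta>_bounds(2)[OF lt ltn] unfolding e_def by linarith
  have "- \<eta> t * (e / u t) \<le> \<bar>\<eta> t\<bar> * \<bar>e / u t\<bar>" unfolding abs_mult[symmetric] using abs_ge_minus_self[of "\<eta> t * (e / u t)"] by simp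
  also have "... \<le> (28 * A^2 * \<kappa> * \<beta> * r t) * (4 * N * r t)" using eta_le eu A1 \<kappa>(1) \<beta> rt(1) by (intro mult_mono) auto
  also have "... = (112 * (A^2 * \<kappa>)) * (N * \<beta>) * (r t * r t)" by simp
  also have "... \<le> 1 / 4 * (N * \<beta>) * (r t * r t)" using small_k[of 2] N\<beta>_ge by (intro mult_right_mono) auto
  finally have "2 / Z t * (- \<eta> t * (e / u t)) \<le> 2 / Z t * (1 / 4 * (N * \<beta>) * (r t * r t))" using Zp by (intro mult_left_mono) auto
  also have "... \<le> 4 / real t * (1 / 4 * (N * \<beta>) * (r t * r t))" using inv_Z N\<beta>_ge by (intro mult_right_mono) auto
  also have "... = N * \<beta>" unfolding rt(2) using rt(1) by simp
  finally show ?thesis by (simp add: mult.commute)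
 qed
 have m4: "2 * ((y (Suc t) \<bullet> (G t *v \<zeta> t)) / u t) \<le> 16 * A * N * \<beta>"
 proof -
  have "(y (Suc t) \<bullet> (G t *v \<zeta> t)) / u t \<le> \<bar>y (Suc t) \<bullet> (G t *v \<zeta> t)\<bar> / u t" using u by (intro divide_right_mono) auto
  also have "... \<le> 8 * A * \<epsilon> * \<beta>^2" by (rule \<zeta>_bounds(1)[OF lt ltn])
  also have "... = 8 * A * (\<epsilon> * \<beta>) * \<beta>" by (simp add: power2_eq_square)
  finally show ?thesis unfolding \<epsilon>(3) by simp
 qed
 have m5: "(p t)^2 \<le> N * \<beta>" using power_le_one[OF pt(1,2), of 2] N\<beta>_ge by linarith
 have r2: "4 \<le> real t" using rt(6) rt(2) A_pow[of 2] mult_mono[of 2 "r t" 2 "r t"] by simp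
 have m6: "vb t / Z t * p t \<le> N * \<beta>"
 proof -
  have "vb t * p t * (1 / Z t) \<le> 16 * A^2 * \<beta>^2 * (2 / real t)" by (rule mult_mono) (use vb_p_le[OF lt ltn] inv_Z Zp in auto)
  also have "... = (32 * A^2 / r t) * (\<beta> / r t) * \<beta>" by (simp add: power2_eq_square)
  also have "... \<le> 1 * 1 * \<beta>"
  proof (intro mult_right_mono mult_mono)
   have "32 * A^2 \<le> 10 ^ 4 * A^2" by (rule mult_right_mono) auto
   hence "32 * A^2 \<le> r t" using rt(6) by (rule order_trans)
   thus "32 * A^2 / r t \<le> 1" using rt(1) by (simp add: pos_divide_le_eq)
   show "\<beta> / r t \<le> 1" using rt(1,5) \<beta> by (simp add: pos_divide_le_eq)
  qed (use rt(1) \<beta> in auto)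
  also have "... \<le> N * \<beta>" using N1 \<beta> by simp
  finally show ?thesis by simp
 qed
 have m7: "2 / Z t * (p t)^2 \<le> N * \<beta>"
 proof -
  have "2 / Z t * (p t)^2 \<le> 4 / real t * 1" using inv_Z pt(1,2) Zp by (intro mult_mono power_le_one) auto
  also have "... \<le> 1" using r2 by simp
  finally show ?thesis using N\<beta>_ge by linarith
 qed
 have Eg: "E t - vb t * p t = - (gap * p t) + (1 / u t - x t) * \<eta> t + (y (Suc t) \<bullet> (G t *v \<zeta> t)) / u t"
  using drive_scalar(1)[OF lt ltn] by (simp add: gap_def algebra_simps)
 have main2: "2 * ((1 / u t - x t) * \<eta> t) + 2 * (vb t / Z t * x t * \<eta> t) \<le> gap * p t / 2 + 2 * (N * \<beta>)"
 proof -
  have "2 * ((1 / u t - x t) * \<eta> t) + 2 * (vb t / Z t * x t * \<eta> t) =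
   2 * (gap * x t * \<eta> t) / Z t + 2 * (\<eta> t)^2 / Z t + 2 * (- \<eta> t * (e / u t)) / Z t"
   using main by (simp add: add_divide_distrib diff_divide_distrib)
  thus ?thesis using m1 m2 m3 by linarith
 qed
 have "\<Omega> (Suc t) \<le> \<Omega> t + 2 * (E t - vb t * p t) + (p t)^2 + 2 * (vb t / Z t * x t * \<eta> t) + vb t / Z t * p t
   + 2 / Z t * (norm (b t) * sqrt (p t))^2 + 2 / Z t * (p t)^2" unfolding \<Omega>_def using q Ws by linarith
 hence "\<Omega> (Suc t) \<le> \<Omega> t - 5 / 4 * (gap * p t) + 6 * (N * \<beta>) + 16 * A * N * \<beta>"
  unfolding Eg using main2 m4 m5 m6 m7 cross_quad by argo
 moreover have "6 * (N * \<beta>) \<le> 6 * A * (N * \<beta>)" using A1 N\<beta>_ge by (intro mult_right_mono) auto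
 moreover have "0 \<le> gap * p t" using gap pt(1) by simp
 ultimately have "\<Omega> (Suc t) \<le> \<Omega> t - gap * p t + 22 * (A * N * \<beta>)" by argo
 moreover have "0 \<le> A * N * \<beta>" using A1 N1 \<beta> by simp
 ultimately show ?thesis by argo
qed

text \<open>A converse bound: \<open>W_le_trace_gap\<close> and \<open>b_drive\<close> bound both
  summands by the gap and the noise, so a large \<open>\<Omega>\<close> forces a large gap and hence
  strong damping.\<close>

lemma \<Omega>_le: "\<Omega> t \<le> 10 ^ 7 * A ^ 6 * gap^2 + 10 ^ 6 * A ^ 4 * N^2 * real t"
proof -
 have Zp: "0 < Z t" using Z_ge[of t] by linarith
 have dA: "d^2 \<le> A^2" using d_le_A d2 by (intro power_mono) auto
 have "W t \<le> (d * gap)^2" unfolding gap_def by (rule W_le_trace_gap) (rule stepD(7)[OF ltn])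
 also have "... \<le> A^2 * gap^2" unfolding power_mult_distrib using dA by (intro mult_right_mono) auto
 finally have 1: "W t \<le> A^2 * gap^2" .
 define S where "S = d * gap * sqrt (p t) + 2 * N * sqrt (A * (\<beta> * r t))"
 have "S^2 \<le> 2 * (d * gap * sqrt (p t))^2 + 2 * (2 * N * sqrt (A * (\<beta> * r t)))^2"
  unfolding S_def using zero_le_power2[of "d * gap * sqrt (p t) - 2 * N * sqrt (A * (\<beta> * r t))"]
  unfolding power2_sum power2_diff by linarith
 also have "... = 2 * (d^2 * gap^2 * p t) + 8 * (N^2 * A * (\<beta> * r t))" using pt(1) A1 \<beta> rt(1) by (simp add: power_mult_distrib)
 also have "... \<le> 2 * (A^2 * gap^2 * p t) + 8 * (N^2 * A * (\<beta> * r t))"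
  using dA pt(1) by (intro add_right_mono mult_left_mono mult_right_mono) auto
 finally have S2: "S^2 \<le> 2 * (A^2 * gap^2 * p t) + 8 * (N^2 * A * (\<beta> * r t))" .
 have "\<beta> * norm (b t) \<le> (200 * A * r t * (x t - 1 / u t)) * norm (b t)" using x_minus_inv_u(1) by (intro mult_right_mono) auto
 also have "... = 200 * A * r t * ((x t - 1 / u t) * norm (b t))" by simp
 also have "... \<le> 200 * A * r t * S" unfolding S_def using b_drive A1 rt(1) by (intro mult_left_mono) auto
 finally have "(\<beta> * norm (b t))^2 \<le> (200 * A * r t * S)^2" using \<beta> by (intro power_mono) auto
 also have "... = 40000 * A^2 * real t * S^2" by (simp add: power_mult_distrib)
 finally have bb: "\<beta>^2 * (norm (b t))^2 \<le> 40000 * A^2 * real t * S^2" by (simp add: power_mult_distrib)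
 have "\<beta>^2 * (vb t / Z t * (norm (b t))^2) = vb t * (1 / Z t) * (\<beta>^2 * (norm (b t))^2)" by simp
 also have "... \<le> (A * (\<beta> * r t)) * (2 / real t) * (40000 * A^2 * real t * S^2)"
  using vb_le[OF lt] inv_Z bb Zp vb_pos[of t] \<beta> A1 rt(1) by (rule_tac mult_mono[OF mult_mono]) auto
 also have "... = 80000 * A ^ 3 * (\<beta> * r t) * S^2" using rt(1) by (simp add: power_numeral_reduce)
 also have "... \<le> 80000 * A ^ 3 * (\<beta> * r t) * (2 * (A^2 * gap^2 * p t) + 8 * (N^2 * A * (\<beta> * r t)))"
  using S2 A1 \<beta> rt(1) by (intro mult_left_mono) auto
 also have "... = 160000 * A ^ 5 * \<beta> * gap^2 * (p t * r t) + 640000 * A ^ 4 * N^2 * \<beta>^2 * (r t * r t)"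
  by (simp add: power_numeral_reduce algebra_simps)
 also have "... \<le> 160000 * A ^ 5 * \<beta> * gap^2 * (16 * A * \<beta>) + 640000 * A ^ 4 * N^2 * \<beta>^2 * (r t * r t)"
  using pt(4) A1 \<beta> by (intro add_right_mono mult_left_mono) auto
 also have "... = \<beta>^2 * (2560000 * A ^ 6 * gap^2 + 640000 * A ^ 4 * N^2 * real t)"
  unfolding rt(2) by (simp add: power_numeral_reduce algebra_simps)
 finally have 2: "vb t / Z t * (norm (b t))^2 \<le> 2560000 * A ^ 6 * gap^2 + 640000 * A ^ 4 * N^2 * real t"
  using \<beta> by (subst (asm) mult_le_cancel_left_pos) auto
 have 3: "A^2 * gap^2 \<le> A ^ 6 * gap^2" using A_pow_mono[of 2 6] by (intro mult_right_mono) auto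
 have 4: "0 \<le> A ^ 6 * gap^2" "0 \<le> A ^ 4 * N^2 * real t" by simp_all
 have "\<Omega> t \<le> 10000000 * (A ^ 6 * gap^2) + 1000000 * (A ^ 4 * N^2 * real t)" unfolding \<Omega>_def using 1 2 3 4 by argo
 thus ?thesis by (simp add: mult.assoc)
qed

text \<open>Here the gap is at least 900 A^2 N sqrt t, so by \<open>p_lower\<close> the damping is
  at least 72 A N \<beta>, three times the noise in \<open>\<Omega>_step\<close>.\<close>

lemma \<Omega>_drop:
 assumes big: "10 ^ 13 * A ^ 10 * N^2 * real t \<le> \<Omega> t"
 shows "\<Omega> (Suc t) \<le> \<Omega> t - N * \<beta>"
proof -
 have tp: "0 < real t" using rt by simp
 have "10 ^ 6 * A ^ 4 * N^2 * real t \<le> 10 ^ 12 * A ^ 10 * N^2 * real t"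
  using A_pow_mono[of 4 10] A1 by (intro mult_right_mono mult_mono) auto
 hence "9 * 10 ^ 12 * A ^ 10 * N^2 * real t \<le> 10 ^ 7 * A ^ 6 * gap^2" using \<Omega>_le big by (simp add: mult_ac)
 hence "A ^ 6 * (900000 * A ^ 4 * N^2 * real t) \<le> A ^ 6 * gap^2" by (simp add: power_numeral_reduce mult_ac)
 hence "900000 * A ^ 4 * N^2 * real t \<le> gap^2" using A1 by (subst (asm) mult_le_cancel_left_pos) auto
 moreover have "(900 * A^2 * N * r t)^2 \<le> 900000 * A ^ 4 * N^2 * real t"
  using rt(2) by (simp add: power_mult_distrib flip: power_mult)
 ultimately have "(900 * A^2 * N * r t)^2 \<le> gap^2" by linarith
 hence g: "900 * A^2 * N * r t \<le> gap" using gap by (rule power2_le_imp_le)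
 have "72 * A * N * \<beta> = 900 * A * N * (8 / 100 * \<beta>)" by simp
 also have "... \<le> 900 * A * N * (A * (p t * r t))" using p_lower A1 N1 by (intro mult_left_mono) auto
 also have "... = (900 * A^2 * N * r t) * p t" by (simp add: power2_eq_square)
 also have "... \<le> gap * p t" using g pt(1) by (intro mult_right_mono) auto
 finally have "72 * A * N * \<beta> \<le> gap * p t" .
 moreover have "1 * (N * \<beta>) \<le> A * (N * \<beta>)" using A1 N\<beta>_ge by (intro mult_right_mono) auto
 ultimately show ?thesis using \<Omega>_step N\<beta>_ge unfolding mult.assoc by linarith
qed

end

end

section \<open>Decay of the variance and resulting eigenvalue bounds\<close>

context ucb_small
begin

lemma nat_ceiling_le_add_one: "0 \<le> x \<Longrightarrow> real (nat \<lceil>x\<rceil>) \<le> x + 1" for x :: real using of_int_ceiling_le_add_one[of x] by simp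

lemma \<Omega>_start:
 assumes n: "\<tau>2 \<le> n"
 shows "\<Omega> \<tau>2 \<le> 2 * A ^ 4 * \<beta>^2 * real \<tau>2"
proof -
 have lt: "late \<tau>2" by (rule settled_late[OF order_refl n])
 define t where "t = \<tau>2"
 note lt = lt[folded t_def]
 note rt = r[OF lt]
 have "W t \<le> (tr_perp t)^2" by (rule W_le_tr)
 also have "... \<le> (A * (\<beta> * r t))^2" using m(4)[OF lt] tr_perp_ge_1[of t] by (intro power_mono) auto
 also have "... = A^2 * \<beta>^2 * (r t * r t)" by algebra
 also have "... = A^2 * \<beta>^2 * real t" unfolding rt(2) ..
 also have "... \<le> A ^ 4 * \<beta>^2 * real t" using A_pow_mono[of 2 4] by (intro mult_right_mono) auto
 finally have 1: "W t \<le> A ^ 4 * \<beta>^2 * real t" .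
 have tp: "0 < real t" using rt(1) by simp
 have Z: "real t / 2 \<le> Z t" using c_bounds(1,5)[OF lt] unfolding Z_def by linarith
 have "vb t / Z t * (norm (b t))^2 \<le> (A * (\<beta> * r t)) / (real t / 2) * (49 * A ^ 3 * \<epsilon> * \<beta> * r t * real t)"
  using vb_le[OF lt] Z norm_b_le[OF lt] tp vb_pos[of t] A1 \<beta> by (intro mult_mono frac_le) auto
 also have "... = 98 * A ^ 4 * \<epsilon> * \<beta>^2 * (r t * r t)" using tp by (simp add: power2_eq_square power_numeral_reduce)
 also have "... = (98 * \<epsilon>) * (A ^ 4 * \<beta>^2 * real t)" unfolding rt(2) by simp
 also have "... \<le> 1 * (A ^ 4 * \<beta>^2 * real t)" using \<epsilon>(5) by (intro mult_right_mono) auto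
 finally show ?thesis using 1 unfolding \<Omega>_def t_def by simp
qed

text \<open>Above the threshold \<open>\<Omega>\<close> falls by N \<beta> per round; from below it
  can rise by at most 24 A N \<beta> in one round. The maximum records what is left of the initial
  value.\<close>

lemma \<Omega>_upper: "\<tau>2 \<le> t \<Longrightarrow> t \<le> n \<Longrightarrow> \<Omega> t \<le> 10 ^ 13 * A ^ 10 * N^2 * real t + 24 * A * N * \<beta>
  + max 0 (2 * A ^ 4 * \<beta>^2 * real \<tau>2 - N * \<beta> * (real t - real \<tau>2))"
proof (induction t rule: dec_induct)
 case base
 have "0 \<le> A * N * \<beta>" "0 \<le> A ^ 10 * N^2 * real \<tau>2" using A1 N1 \<beta> by simp_all
 moreover have "0 \<le> 10 ^ 13 * A ^ 10 * N^2 * real \<tau>2" using A1 by simp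
 moreover have "2 * A ^ 4 * \<beta>^2 * real \<tau>2 \<le> max 0 (2 * A ^ 4 * \<beta>^2 * real \<tau>2 - N * \<beta> * (real \<tau>2 - real \<tau>2))" by simp
 ultimately show ?case using \<Omega>_start[OF base] unfolding mult.assoc by linarith
next
 case (step t)
 hence tn: "t < n" "\<tau>2 \<le> t" by simp_all
 define X where "X = 2 * A ^ 4 * \<beta>^2 * real \<tau>2 - N * \<beta> * (real t - real \<tau>2)"
 define Y where "Y = 10 ^ 13 * A ^ 10 * N^2"
 have X': "2 * A ^ 4 * \<beta>^2 * real \<tau>2 - N * \<beta> * (real (Suc t) - real \<tau>2) = X - N * \<beta>" by (simp add: X_def algebra_simps)
 have Y: "0 \<le> Y" "Y * real (Suc t) = Y * real t + Y" by (simp_all add: Y_def distrib_left)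
 have nn: "0 \<le> N * \<beta>" "0 \<le> A * N * \<beta>" using A1 N1 \<beta> by simp_all
 have IH: "\<Omega> t \<le> Y * real t + 24 * A * N * \<beta> + max 0 X" using step tn unfolding X_def Y_def by simp
 have "\<Omega> (Suc t) \<le> Y * real (Suc t) + 24 * A * N * \<beta> + max 0 (X - N * \<beta>)"
 proof (cases "Y * real t \<le> \<Omega> t")
  case True
  hence "\<Omega> (Suc t) \<le> \<Omega> t - N * \<beta>" using \<Omega>_drop[OF tn(2,1)] by (simp add: Y_def)
  thus ?thesis using IH Y nn unfolding max_def by (auto split: if_splits)
 next
  case False
  have "0 \<le> gap t * p t" using gap[OF tn(2,1)] p(1)[OF settled_late[OF tn(2)] tn(1)] tn by simp
  hence "\<Omega> (Suc t) \<le> \<Omega> t + 24 * A * N * \<beta>" using \<Omega>_step[OF tn(2,1)] by linarith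
  thus ?thesis using False Y max.cobounded1[of 0 "X - N * \<beta>"] by linarith
 qed
 thus ?case unfolding X' Y_def .
qed

text \<open>Using up an initial value of order \<beta>^2 \<tau>2 at a rate N \<beta>, which is at
  least \<beta>, takes of order \<beta> \<tau>2 rounds.\<close>

definition \<tau>3 :: nat where "\<tau>3 = nat \<lceil>4 * A ^ 4 * \<beta> * real \<tau>2\<rceil>"

lemma \<tau>3: "4 * A ^ 4 * \<beta> * real \<tau>2 \<le> real \<tau>3" "\<tau>2 \<le> \<tau>3" "real \<tau>3 \<le> 10 ^ 15 * A ^ 14 * \<beta>^2 * real t1"
 "\<beta> \<le> real \<tau>3" "2 \<le> real \<tau>3"
proof -
 have t2: "1 \<le> real \<tau>2" using \<tau>0(3) \<tau>1(3) \<tau>2(3) by linarith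
 have k: "1 \<le> A ^ 4 * \<beta>" using mult_mono[OF A_pow[of 4] \<beta>1] A1 by simp
 show 1: "4 * A ^ 4 * \<beta> * real \<tau>2 \<le> real \<tau>3" by (simp add: \<tau>3_def real_nat_ceiling_ge)
 have l: "real \<tau>2 \<le> A ^ 4 * \<beta> * real \<tau>2" using mult_right_mono[OF k, of "real \<tau>2"] by simp
 show "\<tau>2 \<le> \<tau>3" "2 \<le> real \<tau>3" using 1 l t2 by linarith+
 have "1 * \<beta> \<le> A ^ 4 * \<beta>" using A_pow[of 4] \<beta> by (intro mult_right_mono) auto
 also have "... \<le> A ^ 4 * \<beta> * real \<tau>2" using mult_left_mono[OF t2, of "A ^ 4 * \<beta>"] k by simp
 finally show "\<beta> \<le> real \<tau>3" using 1 l t2 by linarith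
 have "real \<tau>3 \<le> 4 * A ^ 4 * \<beta> * real \<tau>2 + 1" unfolding \<tau>3_def using A1 \<beta> by (intro nat_ceiling_le_add_one) simp
 also have "... \<le> 5 * A ^ 4 * \<beta> * real \<tau>2" using l t2 by linarith
 also have "... \<le> 5 * A ^ 4 * \<beta> * (4 * A^2 * real \<tau>1)" using \<tau>2(2) \<beta> A1 by (intro mult_left_mono) auto
 also have "... \<le> 5 * A ^ 4 * \<beta> * (4 * A^2 * (2 * 10 ^ 12 * A ^ 8 * real \<tau>0))" using \<tau>1(2) \<beta> A1 by (intro mult_left_mono) auto
 also have "... \<le> 5 * A ^ 4 * \<beta> * (4 * A^2 * (2 * 10 ^ 12 * A ^ 8 * (3 * \<beta> * real t1)))" using \<tau>0(2) \<beta> A1 by (intro mult_left_mono) auto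
 also have "... = (120 * 10 ^ 12) * (A ^ 14 * \<beta>^2 * real t1)" by algebra
 also have "... \<le> 10 ^ 15 * (A ^ 14 * \<beta>^2 * real t1)" using A1 by (intro mult_right_mono) auto
 finally show "real \<tau>3 \<le> 10 ^ 15 * A ^ 14 * \<beta>^2 * real t1" by (simp only: mult.assoc)
qed

context
 fixes t assumes st: "\<tau>3 \<le> t" and tn: "t \<le> n"
begin

lemma st2: "\<tau>2 \<le> t" using st \<tau>3(2) by simp

lemma lt3: "late t" by (rule settled_late[OF st2 tn])

lemma sqrt_W: "sqrt (W t) \<le> 10 ^ 7 * A ^ 5 * N * r t"
proof (rule real_le_lsqrt)
 have t2: "1 \<le> real \<tau>2" using \<tau>0(3) \<tau>1(3) \<tau>2(3) by linarith
 have tt: "4 * A ^ 4 * \<beta> * real \<tau>2 \<le> real t" using \<tau>3(1) st by linarith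
 have k: "1 \<le> A ^ 4 * \<beta>" using mult_mono[OF A_pow[of 4] \<beta>1] A1 by simp
 have "real \<tau>2 \<le> A ^ 4 * \<beta> * real \<tau>2" using mult_right_mono[OF k, of "real \<tau>2"] by simp
 hence "2 * A ^ 4 * \<beta> * real \<tau>2 \<le> real t - real \<tau>2" using tt t2 by linarith
 hence "\<beta> * (2 * A ^ 4 * \<beta> * real \<tau>2) \<le> (N * \<beta>) * (real t - real \<tau>2)" using N1 \<beta> A1 st2 by (intro mult_mono) auto
 hence "max 0 (2 * A ^ 4 * \<beta>^2 * real \<tau>2 - N * \<beta> * (real t - real \<tau>2)) = 0" by (simp add: power2_eq_square mult_ac)
 hence "\<Omega> t \<le> 10 ^ 13 * A ^ 10 * N^2 * real t + 24 * A * N * \<beta>" using \<Omega>_upper[OF st2 tn] by simp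
 moreover have "A * N * \<beta> \<le> A ^ 10 * N^2 * real t"
  using A_le_pow[of 10] N1 \<tau>3(4) st A1 \<beta> by (intro mult_mono) (auto simp: power2_eq_square)
 moreover have "10 ^ 13 * A ^ 10 * N^2 * real t = 10000000000000 * (A ^ 10 * N^2 * real t)" by simp
 moreover have "24 * A * N * \<beta> = 24 * (A * N * \<beta>)" by simp
 moreover have "0 \<le> A ^ 10 * N^2 * real t" using A1 by simp
 ultimately have "\<Omega> t \<le> 100000000000000 * (A ^ 10 * N^2 * real t)" by linarith
 also have "... = (10 ^ 7 * A ^ 5 * N * r t)^2" by (simp add: power_mult_distrib flip: power_mult)
 finally show "W t \<le> (10 ^ 7 * A ^ 5 * N * r t)^2" using W_le_\<Omega>[of t] by linarith
qed (use A1 N1 in auto)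

text \<open>Bound for the relative spread of the non-leading eigenvalues. It is linear in
  \<epsilon>, which is why part (a) contains no square root.\<close>

definition "\<nu> = 10 ^ 7 * A ^ 6 * \<epsilon>"

lemma \<nu>: "0 < \<nu>" "\<nu> \<le> 1 / 100" "2 * A^2 * \<nu> \<le> \<kappa>"
proof -
 show "0 < \<nu>" using A1 \<epsilon>(1) by (simp add: \<nu>_def)
 have "20000000 * (A ^ 8 * \<kappa>) \<le> 10 ^ 16 * (A ^ 8 * \<kappa>)" using A1 \<kappa>(1) by (intro mult_right_mono) auto
 also have "... \<le> 1" using \<kappa>_small(1)[of 8] by (simp add: mult.assoc)
 finally have "20000000 * (A ^ 8 * \<kappa>) * \<kappa> \<le> 1 * \<kappa>" using \<kappa>(1) by (intro mult_right_mono) auto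
 moreover have "2 * A^2 * \<nu> = 20000000 * (A ^ 8 * \<kappa>) * \<kappa>" unfolding \<nu>_def \<kappa>(2)[symmetric] by algebra
 ultimately show 1: "2 * A^2 * \<nu> \<le> \<kappa>" by linarith
 have "1 * \<nu> \<le> A^2 * \<nu>" using A_pow[of 2] \<open>0 < \<nu>\<close> by (intro mult_right_mono) auto
 moreover have "\<kappa> \<le> 1 / 100" using \<kappa>_small(1)[of 0] by simp
 ultimately show "\<nu> \<le> 1 / 100" using 1 by linarith
qed

lemma sqrt_W_vb: "sqrt (W t) \<le> \<nu> * vb t"
proof -
 have "sqrt (W t) \<le> 10 ^ 7 * A ^ 5 * (\<epsilon> * \<beta>) * r t" unfolding \<epsilon>(3) by (rule sqrt_W)
 also have "... = 10 ^ 7 * A ^ 5 * \<epsilon> * (\<beta> * r t)" by simp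
 also have "... \<le> 10 ^ 7 * A ^ 5 * \<epsilon> * (A * vb t)"
 proof (rule mult_left_mono)
  have "\<beta> * r t \<le> A * m t" by (rule m(2)[OF lt3])
  also have "... \<le> A * vb t" using mineig_le_vb A1 by (intro mult_left_mono) auto
  finally show "\<beta> * r t \<le> A * vb t" .
 qed (use A1 \<epsilon>(1) in auto)
 also have "... = \<nu> * vb t" by (simp add: \<nu>_def power_numeral_reduce)
 finally show ?thesis .
qed

text \<open>The least eigenvalue concerns all vectors, not only those orthogonal to \<theta>. The
  arithmetic-geometric inequality splits the cross term into a small part of the form on the
  complement and t / 4 times the squared component along \<theta>, where the form has plenty to
  spare.\<close>

lemma form_lower: "(1 - 2 * \<nu>) * vb t * (norm z)^2 \<le> z \<bullet> (G t *v z)"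
proof -
 define \<alpha> h where "\<alpha> = z \<bullet> \<theta>" and "h = z - \<alpha> *\<^sub>R \<theta>"
 define q where "q = h \<bullet> (G t *v h)"
 have z: "z = \<alpha> *\<^sub>R \<theta> + h" by (simp add: h_def)
 have hp: "h \<bullet> \<theta> = 0" using \<theta> by (simp add: h_def \<alpha>_def inner_diff_left dot_square_norm)
 have hp': "\<theta> \<bullet> h = 0" using hp by (simp add: inner_commute)
 have nz: "(norm z)^2 = \<alpha>^2 + (norm h)^2" unfolding z norm_add_squared using \<theta> hp' by (simp add: power_mult_distrib)
 have f: "z \<bullet> (G t *v z) = \<alpha>^2 * Z t + 2 * (\<alpha> * (\<theta> \<bullet> (G t *v h))) + q"
 proof -
  have "h \<bullet> (G t *v \<theta>) = \<theta> \<bullet> (G t *v h)" using spd_inner[OF spd_gram[of a t], of h \<theta>] by (simp add: inner_commute)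
  thus ?thesis
   by (subst (1 2) z) (simp add: matrix_vector_right_distrib matrix_vector_mult_scaleR inner_add_left inner_add_right Z_def q_def power2_eq_square algebra_simps)
 qed
 have q0: "0 \<le> q" unfolding q_def by (rule spd_nonneg[OF spd_gram])
 note rt = r[OF lt3]
 have cr: "\<bar>\<theta> \<bullet> (G t *v h)\<bar> \<le> 7 * A * \<kappa> * r t * sqrt q" unfolding q_def by (rule cross_le[OF lt3 hp])
 have "- (2 * (\<alpha> * (\<theta> \<bullet> (G t *v h)))) \<le> 2 * (\<bar>\<alpha>\<bar> * \<bar>\<theta> \<bullet> (G t *v h)\<bar>)"
  unfolding abs_mult[symmetric] using abs_ge_minus_self[of "\<alpha> * (\<theta> \<bullet> (G t *v h))"] by linarith
 also have "... \<le> 2 * (\<bar>\<alpha>\<bar> * (7 * A * \<kappa> * r t * sqrt q))" using cr by (intro mult_left_mono) auto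
 also have "... = 2 * (14 * A * \<kappa> * sqrt q) * (\<bar>\<alpha>\<bar> * r t / 2)" by simp
 also have "... \<le> (14 * A * \<kappa> * sqrt q)^2 + (\<bar>\<alpha>\<bar> * r t / 2)^2" by (rule sum_squares_bound)
 also have "(14 * A * \<kappa> * sqrt q)^2 = 196 * A^2 * \<epsilon> * q" using q0 by (simp add: power_mult_distrib \<kappa>(2))
 also have "(\<bar>\<alpha>\<bar> * r t / 2)^2 = \<alpha>^2 * (real t / 4)" by (simp add: power_mult_distrib power_divide)
 finally have 1: "(1 - 196 * A^2 * \<epsilon>) * q + \<alpha>^2 * (Z t - real t / 4) \<le> z \<bullet> (G t *v z)" unfolding f by (simp add: algebra_simps)
 have s: "196 * A^2 * \<epsilon> \<le> \<nu>"
 proof -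
  have "196 * A^2 * \<epsilon> \<le> 10 ^ 7 * A ^ 6 * \<epsilon>" using A_pow_mono[of 2 6] \<epsilon>(1) A1 by (intro mult_right_mono mult_mono) auto
  thus ?thesis by (simp add: \<nu>_def)
 qed
 have vbp: "0 < vb t" by (rule vb_pos)
 have "(1 - \<nu>) * vb t * (norm h)^2 \<le> q"
 proof -
  have "vb t * (norm h)^2 - sqrt (W t) * (norm h)^2 \<le> q" using form_dev[OF hp, of t] unfolding q_def by linarith
  moreover have "sqrt (W t) * (norm h)^2 \<le> \<nu> * vb t * (norm h)^2" using sqrt_W_vb by (intro mult_right_mono) auto
  ultimately show ?thesis by (simp add: left_diff_distrib)
 qed
 hence "(1 - \<nu>) * ((1 - \<nu>) * vb t * (norm h)^2) \<le> (1 - 196 * A^2 * \<epsilon>) * q" using s \<nu>(2) q0 vbp by (intro mult_mono) auto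
 moreover have "(1 - 2 * \<nu>) * (vb t * (norm h)^2) \<le> (1 - \<nu>) * ((1 - \<nu>) * vb t * (norm h)^2)"
 proof -
  have "(1 - 2 * \<nu>) * (vb t * (norm h)^2) \<le> ((1 - \<nu>) * (1 - \<nu>)) * (vb t * (norm h)^2)"
   using vbp by (intro mult_right_mono) (auto simp: algebra_simps)
  thus ?thesis by (simp only: mult.assoc)
 qed
 moreover have "(1 - 2 * \<nu>) * (vb t * \<alpha>^2) \<le> \<alpha>^2 * (Z t - real t / 4)"
 proof -
  have "4 * A * \<beta> \<le> r t"
  proof -
   have "A * \<beta> * 1 \<le> A * \<beta> * \<beta>^2" using A1 \<beta> \<beta>1 by (intro mult_left_mono) auto
   also have "... = A * \<beta> ^ 3" by algebra
   finally have "10000 * (A * \<beta>) \<le> r t" using rt(4) by (simp add: mult.assoc)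
   moreover have "0 \<le> A * \<beta>" using A1 \<beta> by simp
   ultimately show ?thesis by simp
  qed
  hence "4 * A * \<beta> * r t \<le> r t * r t" by (intro mult_right_mono) auto
  hence "4 * vb t \<le> real t" using vb_le[OF lt3] unfolding rt(2) by simp
  hence "vb t \<le> Z t - real t / 4" using c_bounds(1,5)[OF lt3] unfolding Z_def by linarith
  moreover have "(1 - 2 * \<nu>) * vb t \<le> 1 * vb t" using \<nu>(1) vbp by (intro mult_right_mono) auto
  ultimately have "(1 - 2 * \<nu>) * vb t \<le> Z t - real t / 4" by linarith
  from mult_left_mono[OF this, of "\<alpha>^2"] show ?thesis by (simp add: mult_ac)
 qed
 ultimately have "(1 - 2 * \<nu>) * (vb t * \<alpha>^2) + (1 - 2 * \<nu>) * (vb t * (norm h)^2) \<le> z \<bullet> (G t *v z)" using 1 by linarith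
 thus ?thesis unfolding nz by (simp add: algebra_simps)
qed

lemma eigval_near:
 assumes i: "i \<in> {2..CARD('n)}"
 shows "\<bar>eigval (G t) i - vb t\<bar> \<le> 2 * \<nu> * vb t"
proof -
 have "eigval (G t) i \<le> vb t + sqrt (W t)"
 proof (rule eigval_perp_le[OF _ i])
  fix h assume "h \<bullet> \<theta> = 0"
  thus "h \<bullet> (G t *v h) \<le> (vb t + sqrt (W t)) * (norm h)^2" using form_dev[of h t] by (simp add: distrib_right)
 qed
 moreover have "(1 - 2 * \<nu>) * vb t \<le> eigval (G t) i" by (rule eigval_ge[OF gram_sym]) (use i form_lower in auto)
 moreover have "0 \<le> \<nu> * vb t" using \<nu>(1) vb_pos[of t] by simp
 ultimately show ?thesis using sqrt_W_vb by (simp add: left_diff_distrib abs_le_iff)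
qed

lemma eigval_ratio: "\<exists>\<xi>. eigval (G t) 2 = (1 + \<xi>) * eigval (G t) CARD('n) \<and> \<bar>\<xi>\<bar> \<le> 6 * \<nu>"
proof -
 define e1 e2 where "e1 = eigval (G t) 2" and "e2 = eigval (G t) CARD('n)"
 have v: "0 < vb t" by (rule vb_pos)
 have e: "\<bar>e1 - vb t\<bar> \<le> 2 * \<nu> * vb t" "\<bar>e2 - vb t\<bar> \<le> 2 * \<nu> * vb t"
  unfolding e1_def e2_def using dim by (auto intro!: eigval_near)
 have "\<nu> * vb t \<le> 1 / 100 * vb t" using \<nu>(2) v by (intro mult_right_mono) auto
 hence e2: "vb t * (2 / 3) \<le> e2" using e(2) by linarith
 hence p: "0 < e2" using v by linarith
 have "\<bar>e1 - e2\<bar> \<le> 4 * \<nu> * vb t" using e by linarith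
 also have "... = 6 * \<nu> * (vb t * (2 / 3))" by simp
 also have "... \<le> 6 * \<nu> * e2" using e2 \<nu>(1) by (intro mult_left_mono) auto
 finally have "\<bar>e1 / e2 - 1\<bar> \<le> 6 * \<nu>" using p by (simp add: abs_le_iff field_simps)
 moreover have "e1 = (1 + (e1 / e2 - 1)) * e2" using p by simp
 ultimately show ?thesis unfolding e1_def e2_def by blast
qed

end

section \<open>Recursion for the mean of the non-leading eigenvalues\<close>

definition dev :: "nat \<Rightarrow> real" where "dev t = (vb t)^2 - 2 / (d + 1) * \<beta>^2 * real t"

text \<open>\<open>exploration_rate\<close> with \<mu> replaced by \<open>vb\<close>. Unlike in
  \<open>vb_p_decay\<close> the error is now of order \<kappa> \<beta>^2, since the root of
  \<open>W\<close> is known to be of order N sqrt t.\<close>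

lemma drift_rate:
 assumes st: "\<tau>3 \<le> t" and tn: "t < n"
 shows "\<bar>vb t * p t - (\<beta>^2 - (vb t)^2 / real t)\<bar> \<le> 60000 * A ^ 6 * \<kappa> * \<beta>^2"
proof -
 have s2: "\<tau>2 \<le> t" using st \<tau>3(2) by simp
 note lt = lt3[OF st less_imp_le[OF tn]]
 note rt = r[OF lt] and pt = p[OF lt tn]
 have tp: "0 < real t" using rt(1) by simp
 have g: "0 \<le> gap t" by (rule gap[OF s2 tn])
 have "sqrt (W t) * p t \<le> (10 ^ 7 * A ^ 5 * N * r t) * p t" using sqrt_W[OF st] tn pt(1) by (intro mult_right_mono) auto
 also have "... = 10 ^ 7 * A ^ 5 * N * (p t * r t)" by simp
 also have "... \<le> 10 ^ 7 * A ^ 5 * (\<epsilon> * \<beta>) * (16 * A * \<beta>)" unfolding \<epsilon>(3) using pt(4) A1 N1 by (intro mult_left_mono) auto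
 also have "... = (160000000 * (A ^ 6 * \<kappa>)) * (\<kappa> * \<beta>^2)" unfolding \<kappa>(2)[symmetric] by algebra
 also have "... \<le> A ^ 4 * (\<kappa> * \<beta>^2)"
 proof (rule mult_right_mono)
  have "160000000 * (A ^ 6 * \<kappa>) \<le> 10 ^ 16 * (A ^ 6 * \<kappa>)" using A1 \<kappa>(1) by (intro mult_right_mono) auto
  also have "... \<le> 1" using \<kappa>_small(1)[of 6] by (simp add: mult.assoc)
  finally show "160000000 * (A ^ 6 * \<kappa>) \<le> A ^ 4" using A_pow[of 4] by linarith
 qed (use \<kappa>(1) in auto)
 finally have gp: "gap t * p t \<le> 1861 * (A ^ 4 * \<kappa> * \<beta>^2)" using gap_p[OF lt tn] unfolding gap_def[OF s2 tn] by simp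
 have "((vb t)^2 - (\<mu> t)^2) / real t = gap t * (vb t + \<mu> t) / real t"
  unfolding gap_def[OF s2 tn] by (simp add: power2_eq_square algebra_simps)
 also have "... \<le> gap t * (2 * A * (\<beta> * r t)) / real t"
  using g vb_le[OF lt] \<mu>_bounds(4)[OF lt tn] by (intro divide_right_mono mult_left_mono) auto
 also have "... = 2 * A * gap t * \<beta> * (r t / real t)" by simp
 also have "... = 2 * A * gap t * (\<beta> / r t)" unfolding r_div(2)[OF s2 tn] by simp
 also have "... \<le> 2 * A * gap t * (13 * A * p t)" using beta_r_le_p[OF s2 tn] A1 g by (intro mult_left_mono) auto
 finally have v: "((vb t)^2 - (\<mu> t)^2) / real t \<le> 26 * A^2 * (gap t * p t)" by (simp add: power2_eq_square mult_ac)
 have v0: "0 \<le> ((vb t)^2 - (\<mu> t)^2) / real t" using mu_le_vb[OF lt tn] \<mu>_bounds(1)[OF lt tn] by (simp add: power_mono)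
 have A6: "A ^ 4 * \<kappa> * \<beta>^2 \<le> A ^ 6 * \<kappa> * \<beta>^2" using A_pow_mono[of 4 6] \<kappa>(1) by (intro mult_right_mono) auto
 have "26 * A^2 * (gap t * p t) \<le> 26 * A^2 * (1861 * (A ^ 4 * \<kappa> * \<beta>^2))" using gp A1 by (intro mult_left_mono) auto
 also have "... = 48386 * (A ^ 6 * \<kappa> * \<beta>^2)" by algebra
 finally have v1: "((vb t)^2 - (\<mu> t)^2) / real t \<le> 48386 * (A ^ 6 * \<kappa> * \<beta>^2)" using v by linarith
 have gp0: "0 \<le> gap t * p t" using g pt(1) by simp
 have "vb t * p t - (\<beta>^2 - (vb t)^2 / real t) = (\<mu> t * p t - (\<beta>^2 - (\<mu> t)^2 / real t)) + gap t * p t + ((vb t)^2 - (\<mu> t)^2) / real t"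
  unfolding gap_def[OF s2 tn] by (simp add: algebra_simps diff_divide_distrib)
 moreover have "0 \<le> A ^ 4 * \<kappa> * \<beta>^2" using \<kappa>(1) A1 by simp
 moreover have "\<bar>\<mu> t * p t - (\<beta>^2 - (\<mu> t)^2 / real t)\<bar> \<le> 2100 * (A ^ 4 * \<kappa> * \<beta>^2)"
  using exploration_rate[OF lt tn] by (simp only: mult.assoc)
 ultimately have "\<bar>vb t * p t - (\<beta>^2 - (vb t)^2 / real t)\<bar> \<le> 60000 * (A ^ 6 * \<kappa> * \<beta>^2)"
  using gp gp0 v1 v0 A6 unfolding abs_le_iff by (intro conjI) linarith+
 thus ?thesis by (simp only: mult.assoc)
qed

lemma dev_step:
 assumes st: "\<tau>3 \<le> t" and tn: "t < n"
 shows "\<bar>dev (Suc t) - (1 - 2 / (d - 1) / real t) * dev t\<bar> \<le> 130000 * A ^ 6 * \<kappa> * \<beta>^2"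
proof -
 note lt = lt3[OF st less_imp_le[OF tn]]
 note rt = r[OF lt] and pt = p[OF lt tn]
 have tp: "0 < real t" using rt(1) by simp
 define X where "X = A ^ 6 * \<kappa> * \<beta>^2"
 define R where "R = vb t * p t - (\<beta>^2 - (vb t)^2 / real t)"
 have R: "\<bar>R\<bar> \<le> 60000 * X" unfolding R_def X_def using drift_rate[OF st tn] by (simp only: mult.assoc)
 have dp: "0 < d - 1" "0 < d + 1" using d2 by simp_all
 have "vb (Suc t) = vb t + p t / (d - 1)" by (simp add: vb_Suc p_def[OF lt tn])
 hence "(vb (Suc t))^2 = (vb t)^2 + 2 / (d - 1) * (vb t * p t) + (p t / (d - 1))^2" by (simp add: power2_sum)
 also have "vb t * p t = R + \<beta>^2 - (vb t)^2 / real t" by (simp add: R_def)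
 also have "(vb t)^2 / real t = dev t / real t + 2 / (d + 1) * \<beta>^2" using tp by (simp add: dev_def diff_divide_distrib)
 finally have U: "(vb (Suc t))^2 = (vb t)^2 + 2 / (d - 1) * (R + \<beta>^2 - (dev t / real t + 2 / (d + 1) * \<beta>^2)) + (p t / (d - 1))^2" .
 have V: "(vb t)^2 = dev t + 2 / (d + 1) * \<beta>^2 * real t" by (simp add: dev_def)
 have D: "dev (Suc t) = (vb (Suc t))^2 - 2 / (d + 1) * \<beta>^2 * (real t + 1)" by (simp add: dev_def)
 have "dev (Suc t) - (1 - 2 / (d - 1) / real t) * dev t
   = (p t / (d - 1))^2 + 2 / (d - 1) * R + \<beta>^2 * (2 / (d - 1) * (1 - 2 / (d + 1)) - 2 / (d + 1))"
  unfolding D U V by (simp only: algebra_simps divide_inverse)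
 \<comment> \<open>This equation determines the slope 2 / (d + 1) of the benchmark.\<close>
 also have "2 / (d - 1) * (1 - 2 / (d + 1)) - 2 / (d + 1) = 0"
 proof -
  have "1 - 2 / (d + 1) = (d - 1) / (d + 1)" using dp by (simp add: field_simps)
  moreover have "2 / (d - 1) * ((d - 1) / (d + 1)) = 2 / (d + 1)" using dp by (simp add: divide_simps)
  ultimately show ?thesis by simp
 qed
 finally have e: "dev (Suc t) - (1 - 2 / (d - 1) / real t) * dev t = (p t / (d - 1))^2 + 2 / (d - 1) * R" by simp
 have "(p t / (d - 1))^2 \<le> (p t)^2" using pt(1) d2 by (intro power_mono) (auto simp: divide_le_eq mult_le_cancel_left1)
 also have "... \<le> p t" using pt(1,2) by (simp add: power2_eq_square mult_left_le_one_le)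
 also have "... \<le> X" unfolding X_def using pt(5) eps_le[of 6] by linarith
 finally have 1: "(p t / (d - 1))^2 \<le> X" .
 have "\<bar>2 / (d - 1) * R\<bar> = 2 / (d - 1) * \<bar>R\<bar>" using dp by (simp add: abs_mult)
 also have "... \<le> 2 * (60000 * X)" using R dp d2 by (intro mult_mono) (auto simp: divide_le_eq)
 finally have "\<bar>(p t / (d - 1))^2 + 2 / (d - 1) * R\<bar> \<le> 130000 * X" using 1 zero_le_power2[of "p t / (d - 1)"] by linarith
 thus ?thesis unfolding e X_def by (simp only: mult.assoc)
qed

text \<open>Solutions of the homogeneous recursion decay like t to the power -2 / (d - 1), and the
  errors accumulate at most linearly. Relative to the benchmark \<beta>^2 t the first part gains one
  more power, whence the exponent (d + 1) / (d - 1).\<close>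

lemma dev_bound:
 assumes "\<tau>3 \<le> t" "t \<le> n"
 shows "\<bar>dev t\<bar> \<le> (real \<tau>3 / real t) powr (2 / (d - 1)) * (2 * A^2 * \<beta>^2 * real \<tau>3) + 130000 * A ^ 6 * \<kappa> * \<beta>^2 * real t"
 using assms
proof (induction t rule: dec_induct)
 case base
 note lt = lt3[OF order_refl base]
 define t where "t = \<tau>3"
 have t: "0 < real t" using \<tau>3(5) by (simp add: t_def)
 have lt: "late t" using lt by (simp add: t_def)
 have "(vb t)^2 \<le> (A * (\<beta> * r t))^2" using vb_le[OF lt] vb_pos[of t] by (intro power_mono) auto
 also have "... = A^2 * \<beta>^2 * real t" by (simp add: power_mult_distrib)
 finally have 1: "(vb t)^2 \<le> A^2 * \<beta>^2 * real t" .
 have "2 / (d + 1) * (\<beta>^2 * real t) \<le> A^2 * (\<beta>^2 * real t)"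
 proof (rule mult_right_mono)
  have "2 / (d + 1) \<le> 1" using d2 by (simp add: divide_le_eq)
  thus "2 / (d + 1) \<le> A^2" using A_pow[of 2] by linarith
 qed simp
 moreover have "0 \<le> 2 / (d + 1) * (\<beta>^2 * real t)" using d2 by simp
 ultimately have "\<bar>dev t\<bar> \<le> 2 * A^2 * \<beta>^2 * real t" unfolding dev_def using 1 zero_le_power2[of "vb t"] unfolding mult.assoc by linarith
 moreover have "0 \<le> 130000 * A ^ 6 * \<kappa> * \<beta>^2 * real t" using A1 \<kappa>(1) by simp
 moreover have e: "(real t / real t) powr (2 / (d - 1)) = 1" using t by simp
 ultimately have "\<bar>dev t\<bar> \<le> (real t / real t) powr (2 / (d - 1)) * (2 * A^2 * \<beta>^2 * real t) + 130000 * A ^ 6 * \<kappa> * \<beta>^2 * real t"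
  unfolding e by linarith
 thus ?case unfolding t_def .
next
 case (step t)
 define q where "q = 2 / (d - 1)"
 define E0 where "E0 = 2 * A^2 * \<beta>^2 * real \<tau>3"
 define g where "g = 130000 * A ^ 6 * \<kappa> * \<beta>^2"
 have t3: "2 \<le> real t" using step(1) \<tau>3(5) by linarith
 have q: "0 < q" "q \<le> 2" using d2 by (auto simp: q_def divide_le_eq)
 have g: "0 \<le> g" "0 \<le> E0" using A1 \<kappa>(1) by (simp_all add: g_def E0_def)
 \<comment> \<open>Here t is at least 2, the value of \<open>q\<close> for d = 2, so the factor of
   the recursion is nonnegative.\<close>
 have k: "0 \<le> 1 - q / real t" "1 - q / real t \<le> 1" using q t3 by (auto simp: divide_le_eq)
 have IH: "\<bar>dev t\<bar> \<le> (real \<tau>3 / real t) powr q * E0 + g * real t" using step unfolding q_def E0_def g_def by simp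
 have pw: "(1 - q / real t) * (real \<tau>3 / real t) powr q \<le> (real \<tau>3 / real (Suc t)) powr q"
 proof -
  have "1 - q / real t \<le> exp (- (q / real t))" using exp_ge_add_one_self[of "- (q / real t)"] by simp
  also have "... \<le> exp (- q * ln (1 + 1 / real t))"
   using ln_add_one_self_le_self[of "1 / real t"] q mult_left_mono[of "ln (1 + 1 / real t)" "1 / real t" q] by simp
  also have "... = (real t / real (Suc t)) powr q"
  proof -
   have "real t / real (Suc t) = 1 / (1 + 1 / real t)" using t3 by (simp add: field_simps)
   hence "ln (real t / real (Suc t)) = - ln (1 + 1 / real t)" using t3 by (simp add: ln_div)
   thus ?thesis using t3 by (simp add: powr_def)
  qed
  finally have "(1 - q / real t) * (real \<tau>3 / real t) powr q \<le> (real t / real (Suc t)) powr q * (real \<tau>3 / real t) powr q"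
   by (intro mult_right_mono) auto
  also have "... = (real t / real (Suc t) * (real \<tau>3 / real t)) powr q" by (rule powr_mult[symmetric])
  also have "real t / real (Suc t) * (real \<tau>3 / real t) = real \<tau>3 / real (Suc t)" using t3 by simp
  finally show ?thesis .
 qed
 have "\<bar>dev (Suc t)\<bar> \<le> \<bar>(1 - q / real t) * dev t\<bar> + g" using dev_step[of t] step unfolding q_def g_def by linarith
 also have "\<bar>(1 - q / real t) * dev t\<bar> = (1 - q / real t) * \<bar>dev t\<bar>" using k by (simp add: abs_mult)
 also have "... \<le> (1 - q / real t) * ((real \<tau>3 / real t) powr q * E0 + g * real t)" using IH k by (intro mult_left_mono) auto
 also have "... = ((1 - q / real t) * (real \<tau>3 / real t) powr q) * E0 + (1 - q / real t) * (g * real t)" by algebra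
 also have "... \<le> (real \<tau>3 / real (Suc t)) powr q * E0 + 1 * (g * real t)" using pw k g by (intro add_mono mult_right_mono) auto
 finally have "\<bar>dev (Suc t)\<bar> \<le> (real \<tau>3 / real (Suc t)) powr q * E0 + g * real (Suc t)" by (simp add: distrib_left)
 thus ?case unfolding q_def E0_def g_def .
qed

lemma abs_sqrt_minus_one_le: "0 \<le> x \<Longrightarrow> \<bar>sqrt x - 1\<bar> \<le> \<bar>x - 1\<bar>" for x :: real
proof -
 assume x: "0 \<le> x"
 have "\<bar>x - 1\<bar> = \<bar>sqrt x - 1\<bar> * (sqrt x + 1)"
 proof -
  have "x - 1 = (sqrt x - 1) * (sqrt x + 1)" using x by (simp add: algebra_simps)
  thus ?thesis using x by (simp add: abs_mult)
 qed
 thus ?thesis using x by (simp add: mult_le_cancel_left1)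
qed

lemma eigval_benchmark:
 assumes st: "\<tau>3 \<le> t" and tn: "t \<le> n" and i: "i \<in> {2..CARD('n)}"
 defines "k \<equiv> sqrt (2 * \<beta>^2 * real t / (d + 1))"
 shows "\<bar>eigval (gram a t) i / k - 1\<bar> \<le> 2 * A ^ 3 * (real \<tau>3 / real t) powr ((d + 1) / (d - 1)) + 200000 * A ^ 7 * \<kappa>"
proof -
 note lt = lt3[OF st tn]
 note rt = r[OF lt]
 have tp: "0 < real t" using rt(1) by simp
 define K where "K = 2 * \<beta>^2 * real t / (d + 1)"
 have dp: "0 < d - 1" "0 < d + 1" using d2 by simp_all
 have K: "0 < K" using tp \<beta> dp by (simp add: K_def)
 have k: "0 < k" "k^2 = K" using K by (simp_all add: k_def K_def)
 have dA: "d + 1 \<le> 2 * A" using d_le_A A1 by linarith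
 have v: "0 < vb t" by (rule vb_pos)
 have t3: "0 < real \<tau>3" using \<tau>3(5) by linarith
 define q where "q = 2 / (d - 1)"
 define \<rho> where "\<rho> = real \<tau>3 / real t"
 have \<rho>: "0 < \<rho>" using t3 tp by (simp add: \<rho>_def)
 have "\<bar>dev t\<bar> \<le> \<rho> powr q * (2 * A^2 * \<beta>^2 * (\<rho> * real t)) + 130000 * A ^ 6 * \<kappa> * \<beta>^2 * real t"
  using dev_bound[OF st tn] tp by (simp add: \<rho>_def q_def)
 also have "... = ((d + 1) * A^2 * (\<rho> powr q * \<rho>) + 65000 * (d + 1) * A ^ 6 * \<kappa>) * K" using dp by (simp add: K_def field_simps)
 also have "\<rho> powr q * \<rho> = \<rho> powr ((d + 1) / (d - 1))"
 proof -
  have "(d + 1) / (d - 1) = q + 1" using dp by (simp add: q_def field_simps)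
  thus ?thesis using \<rho> by (simp add: powr_add)
 qed
 also have "((d + 1) * A^2 * \<rho> powr ((d + 1) / (d - 1)) + 65000 * (d + 1) * A ^ 6 * \<kappa>) * K
   \<le> (2 * A * A^2 * \<rho> powr ((d + 1) / (d - 1)) + 65000 * (2 * A) * A ^ 6 * \<kappa>) * K"
 proof (rule mult_right_mono)
  show "(d + 1) * A^2 * \<rho> powr ((d + 1) / (d - 1)) + 65000 * (d + 1) * A ^ 6 * \<kappa> \<le>
   2 * A * A^2 * \<rho> powr ((d + 1) / (d - 1)) + 65000 * (2 * A) * A ^ 6 * \<kappa>"
  using dA A1 \<kappa>(1) by (intro add_mono mult_right_mono mult_left_mono) auto
 qed (use K in simp)
 finally have 1: "\<bar>dev t\<bar> \<le> (2 * A ^ 3 * \<rho> powr ((d + 1) / (d - 1)) + 130000 * A ^ 7 * \<kappa>) * K"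
  by (simp add: power_numeral_reduce mult.assoc)
 have "\<bar>(vb t / k)^2 - 1\<bar> = \<bar>dev t\<bar> / K"
 proof -
  have "2 / (d + 1) * \<beta>^2 * real t = K" by (simp add: K_def)
  hence "(vb t / k)^2 - 1 = dev t / K" using K by (simp add: power_divide k(2) dev_def diff_divide_distrib)
  thus ?thesis using K by simp
 qed
 also have "... \<le> 2 * A ^ 3 * \<rho> powr ((d + 1) / (d - 1)) + 130000 * A ^ 7 * \<kappa>" using 1 K by (simp add: pos_divide_le_eq)
 finally have 2: "\<bar>vb t / k - 1\<bar> \<le> 2 * A ^ 3 * \<rho> powr ((d + 1) / (d - 1)) + 130000 * A ^ 7 * \<kappa>"
  using abs_sqrt_minus_one_le[of "(vb t / k)^2"] v k(1) by simp
 have vk: "vb t \<le> A^2 * k"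
 proof (rule power2_le_imp_le)
  have "(vb t)^2 \<le> (A * (\<beta> * r t))^2" using vb_le[OF lt] v by (intro power_mono) auto
  also have "... = A^2 * \<beta>^2 * real t" by (simp add: power_mult_distrib)
  also have "... = A^2 * ((d + 1) / 2) * K" using dp by (simp add: K_def)
  also have "... \<le> A^2 * A^2 * K" using dA A_le_pow[of 2] K by (intro mult_right_mono mult_left_mono) auto
  also have "... = (A^2 * k)^2" unfolding power_mult_distrib k(2) by algebra
  finally show "(vb t)^2 \<le> (A^2 * k)^2" .
 qed (use k A1 in auto)
 have "\<bar>eigval (gram a t) i - vb t\<bar> \<le> 2 * \<nu> * vb t" by (rule eigval_near[OF st tn i])
 also have "... \<le> 2 * \<nu> * (A^2 * k)" using vk \<nu>(1)[OF st tn] by (intro mult_left_mono) auto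
 also have "... = (2 * A^2 * \<nu>) * k" by simp
 also have "... \<le> \<kappa> * k" using \<nu>(3)[OF st tn] k by (intro mult_right_mono) auto
 finally have 3: "\<bar>eigval (gram a t) i / k - vb t / k\<bar> \<le> \<kappa>"
  using k(1) by (simp add: diff_divide_distrib[symmetric] abs_divide pos_divide_le_eq)
 have "1 * \<kappa> \<le> A ^ 7 * \<kappa>" using A_pow[of 7] \<kappa>(1) by (intro mult_right_mono) auto
 thus ?thesis using 2 3 unfolding \<rho>_def by linarith
qed

end

section \<open>Self-normalised deviations\<close>

lemma borel_measurable_matrix_vector:
 fixes f :: "'w \<Rightarrow> real ^ 'n ^ 'm" and g :: "'w \<Rightarrow> real ^ 'n"
 assumes "f \<in> borel_measurable M" "g \<in> borel_measurable M"
 shows "(\<lambda>\<omega>. f \<omega> *v g \<omega>) \<in> borel_measurable M"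
proof (rule borel_measurable_continuous_Pair[OF assms, where H = "(*v)"])
 show "continuous_on UNIV (\<lambda>x::(real ^ 'n ^ 'm) \<times> (real ^ 'n). fst x *v snd x)"
  unfolding matrix_vector_mult_def by (intro continuous_intros)
qed

lemma borel_measurable_outer_square:
 fixes g :: "'w \<Rightarrow> real ^ 'n"
 assumes "g \<in> borel_measurable M"
 shows "(\<lambda>\<omega>. outer_square (g \<omega>)) \<in> borel_measurable M"
proof (rule measurable_compose[OF assms])
 show "(outer_square :: real ^ 'n \<Rightarrow> _) \<in> borel_measurable borel"
  unfolding outer_square_def by (intro borel_measurable_continuous_onI continuous_intros)
qed

lemma nn_integral_gaussian_exp:
 fixes v b :: real
 assumes v: "v > 0"
 shows "(\<integral>\<^sup>+x. ennreal (exp (b * x - x^2 / (2 * v))) \<partial>lborel) = ennreal (sqrt (2 * pi * v) * exp (b^2 * v / 2))"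
proof -
 define k where "k = sqrt (2 * pi * v) * exp (b^2 * v / 2)"
 have "exp (b * x - x^2 / (2 * v)) = k * normal_density (b * v) (sqrt v) x" for x
 proof -
  have "b * x - x^2 / (2 * v) = b^2 * v / 2 + - (x - b * v)\<^sup>2 / (2 * v)"
   using v by (simp add: power2_diff field_simps power2_eq_square)
  hence "exp (b * x - x^2 / (2 * v)) = exp (b^2 * v / 2) * exp (- (x - b * v)\<^sup>2 / (2 * v))" by (simp only: exp_add)
  thus ?thesis using v by (simp add: k_def normal_density_def real_sqrt_mult)
 qed
 hence "(\<integral>\<^sup>+x. ennreal (exp (b * x - x^2 / (2 * v))) \<partial>lborel) = (\<integral>\<^sup>+x. ennreal k * ennreal (normal_density (b * v) (sqrt v) x) \<partial>lborel)"
  using v by (simp add: k_def ennreal_mult)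
 also have "... = ennreal k * (\<integral>\<^sup>+x. ennreal (normal_density (b * v) (sqrt v) x) \<partial>lborel)" by (rule nn_integral_cmult) simp
 also have "(\<integral>\<^sup>+x. ennreal (normal_density (b * v) (sqrt v) x) \<partial>lborel) = 1"
  using prob_space.emeasure_space_1[OF prob_space_normal_density[of "sqrt v" "b * v"]] v by (simp add: emeasure_density)
 finally show ?thesis by (simp add: k_def)
qed

context sigma_finite_subalgebra
begin

text \<open>The weights \<open>X\<close> are extended nonnegative, so that no integrability has to
  be carried through the supermartingale argument.\<close>

lemma nn_integral_mult_le_cond_exp:
 assumes X: "X \<in> borel_measurable F" and f: "integrable M f" "\<And>\<omega>. 0 \<le> f \<omega>"
  and c: "AE \<omega> in M. real_cond_exp M F f \<omega> \<le> c" "0 \<le> c"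
 shows "(\<integral>\<^sup>+\<omega>. X \<omega> * ennreal (f \<omega>) \<partial>M) \<le> (\<integral>\<^sup>+\<omega>. X \<omega> * ennreal c \<partial>M)"
proof -
 have fm: "(\<lambda>\<omega>. ennreal (f \<omega>)) \<in> borel_measurable M" using f(1) by measurable
 define g where "g = nn_cond_exp M F (\<lambda>\<omega>. ennreal (f \<omega>))"
 have gm: "g \<in> borel_measurable M" unfolding g_def by (rule borel_measurable_nn_cond_exp2)
 have "(\<integral>\<^sup>+\<omega>. g \<omega> \<partial>M) = (\<integral>\<^sup>+\<omega>. ennreal (f \<omega>) \<partial>M)" using nn_cond_exp_intg[of "\<lambda>_. 1", OF _ fm] by (simp add: g_def)
 also have "... < \<infinity>" using f by (simp add: integrable_iff_bounded)
 finally have fin: "AE \<omega> in M. g \<omega> \<noteq> \<infinity>" using gm by (intro nn_integral_PInf_AE) auto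
 have zero: "AE \<omega> in M. nn_cond_exp M F (\<lambda>\<omega>. ennreal (- f \<omega>)) \<omega> = 0"
  using nn_cond_exp_F_meas[of "\<lambda>_. 0"] f(2) by (auto simp: ennreal_neg)
 have "AE \<omega> in M. g \<omega> \<le> ennreal c" using fin zero c(1)
 proof eventually_elim
  case (elim \<omega>)
  hence "enn2real (g \<omega>) \<le> c" by (simp add: real_cond_exp_def g_def)
  hence "ennreal (enn2real (g \<omega>)) \<le> ennreal c" by (rule ennreal_leI)
  thus ?case using elim(1) by (simp add: less_top[symmetric])
 qed
 hence "(\<integral>\<^sup>+\<omega>. X \<omega> * g \<omega> \<partial>M) \<le> (\<integral>\<^sup>+\<omega>. X \<omega> * ennreal c \<partial>M)"
  by (intro nn_integral_mono_AE) (auto elim!: eventually_mono intro: mult_left_mono)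
 thus ?thesis using nn_cond_exp_intg[OF X fm] by (simp add: g_def)
qed

end

section \<open>Exponential moments with random coefficients\<close>

locale subgaussian_step = prob_space M for M :: "'w measure" +
 fixes F and \<sigma> :: real and \<epsilon> :: "'w \<Rightarrow> real"
 assumes sub: "subalgebra M F" and \<sigma>: "\<sigma> > 0" and \<epsilon>: "\<epsilon> \<in> borel_measurable M"
  and mgf: "\<And>l X. X \<in> borel_measurable F \<Longrightarrow>
   (\<integral>\<^sup>+\<omega>. X \<omega> * ennreal (exp (l * \<epsilon> \<omega>)) \<partial>M) \<le> (\<integral>\<^sup>+\<omega>. X \<omega> * ennreal (exp (\<sigma>^2 * l^2 / 2)) \<partial>M)"
begin

abbreviation tilt :: "('w \<Rightarrow> real) \<Rightarrow> 'w \<Rightarrow> ennreal" where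
 "tilt Y \<omega> \<equiv> ennreal (exp (Y \<omega> * \<epsilon> \<omega> - \<sigma>^2 * (Y \<omega>)^2 / 2))"

text \<open>The moment bound is given for deterministic exponents. A simple exponent takes finitely
  many values, and the bound is applied on each of its level sets.\<close>

lemma mult_exp_simple:
 fixes Y :: "'w \<Rightarrow> real"
 assumes X: "X \<in> borel_measurable F" and Y: "simple_function F Y"
 shows "(\<integral>\<^sup>+\<omega>. X \<omega> * tilt Y \<omega> \<partial>M) \<le> (\<integral>\<^sup>+\<omega>. X \<omega> \<partial>M)"
proof -
 note [measurable] = \<epsilon>
 have sp: "space F = space M" using sub by (simp add: subalgebra_def)
 define R where "R = Y ` space M"
 have R: "finite R" using simple_functionD(1)[OF Y] by (simp add: R_def sp)
 have Ys: "{\<omega> \<in> space M. Y \<omega> = y} \<in> sets F" for y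
 proof -
  have "Y -` {y} \<inter> space F \<in> sets F" using simple_functionD(2)[OF Y] by blast
  moreover have "Y -` {y} \<inter> space F = {\<omega> \<in> space M. Y \<omega> = y}" using sp by auto
  ultimately show ?thesis by simp
 qed
 define I where "I y \<omega> = (indicator {\<omega> \<in> space M. Y \<omega> = y} \<omega> :: ennreal)" for y \<omega>
 have I[measurable]: "I y \<in> borel_measurable F" for y unfolding I_def using Ys by measurable
 have IM[measurable]: "I y \<in> borel_measurable M" for y by (rule measurable_from_subalg[OF sub I])
 have XM[measurable]: "X \<in> borel_measurable M" by (rule measurable_from_subalg[OF sub X])
 have split: "g \<omega> = (\<Sum>y\<in>R. I y \<omega> * g \<omega>)" if "\<omega> \<in> space M" for g :: "'w \<Rightarrow> ennreal" and \<omega>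
 proof -
  have "(\<Sum>y\<in>R. I y \<omega>) = (\<Sum>y\<in>{Y \<omega>}. I y \<omega>)" using R that by (intro sum.mono_neutral_right) (auto simp: R_def I_def)
  thus ?thesis using that by (simp add: sum_distrib_right[symmetric] I_def)
 qed
 have one: "(\<integral>\<^sup>+\<omega>. I y \<omega> * (X \<omega> * tilt Y \<omega>) \<partial>M) \<le> (\<integral>\<^sup>+\<omega>. I y \<omega> * X \<omega> \<partial>M)" for y
 proof -
  define k where "k = ennreal (exp (- (\<sigma>^2 * y^2 / 2)))"
  have "(\<integral>\<^sup>+\<omega>. I y \<omega> * (X \<omega> * tilt Y \<omega>) \<partial>M) = (\<integral>\<^sup>+\<omega>. (I y \<omega> * X \<omega> * k) * ennreal (exp (y * \<epsilon> \<omega>)) \<partial>M)"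
  proof (rule nn_integral_cong)
   fix \<omega>
   have "exp (y * \<epsilon> \<omega> - \<sigma>^2 * y^2 / 2) = exp (- (\<sigma>^2 * y^2 / 2)) * exp (y * \<epsilon> \<omega>)" unfolding exp_add[symmetric] by simp
   hence "ennreal (exp (y * \<epsilon> \<omega> - \<sigma>^2 * y^2 / 2)) = k * ennreal (exp (y * \<epsilon> \<omega>))" by (simp add: k_def ennreal_mult)
   thus "I y \<omega> * (X \<omega> * tilt Y \<omega>) = (I y \<omega> * X \<omega> * k) * ennreal (exp (y * \<epsilon> \<omega>))"
    by (cases "Y \<omega> = y") (auto simp: I_def mult.assoc indicator_def)
  qed
  also have "... \<le> (\<integral>\<^sup>+\<omega>. (I y \<omega> * X \<omega> * k) * ennreal (exp (\<sigma>^2 * y^2 / 2)) \<partial>M)" by (rule mgf) (use X in measurable)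
  also have "... = (\<integral>\<^sup>+\<omega>. I y \<omega> * X \<omega> \<partial>M)"
  proof (rule nn_integral_cong)
   fix \<omega>
   have "k * ennreal (exp (\<sigma>^2 * y^2 / 2)) = 1" unfolding k_def
    by (subst ennreal_mult[symmetric]) (simp_all add: exp_add[symmetric])
   thus "I y \<omega> * X \<omega> * k * ennreal (exp (\<sigma>^2 * y^2 / 2)) = I y \<omega> * X \<omega>" by (simp add: mult.assoc)
  qed
  finally show ?thesis .
 qed
 have YM[measurable]: "Y \<in> borel_measurable M" by (rule measurable_from_subalg[OF sub borel_measurable_simple_function[OF Y]])
 have "(\<integral>\<^sup>+\<omega>. X \<omega> * tilt Y \<omega> \<partial>M) = (\<integral>\<^sup>+\<omega>. (\<Sum>y\<in>R. I y \<omega> * (X \<omega> * tilt Y \<omega>)) \<partial>M)" by (intro nn_integral_cong split)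
 also have "... = (\<Sum>y\<in>R. \<integral>\<^sup>+\<omega>. I y \<omega> * (X \<omega> * tilt Y \<omega>) \<partial>M)" by (rule nn_integral_sum) measurable
 also have "... \<le> (\<Sum>y\<in>R. \<integral>\<^sup>+\<omega>. I y \<omega> * X \<omega> \<partial>M)" by (intro sum_mono one)
 also have "... = (\<integral>\<^sup>+\<omega>. (\<Sum>y\<in>R. I y \<omega> * X \<omega>) \<partial>M)" by (rule nn_integral_sum[symmetric]) measurable
 also have "... = (\<integral>\<^sup>+\<omega>. X \<omega> \<partial>M)" by (intro nn_integral_cong split[symmetric])
 finally show ?thesis .
qed

text \<open>Simple functions approximate \<open>Y\<close> pointwise, and Fatou's lemma carries the
  inequality to the limit.\<close>

lemma mult_exp:
 fixes Y :: "'w \<Rightarrow> real"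
 assumes X: "X \<in> borel_measurable F" and Y: "Y \<in> borel_measurable F"
 shows "(\<integral>\<^sup>+\<omega>. X \<omega> * tilt Y \<omega> \<partial>M) \<le> (\<integral>\<^sup>+\<omega>. X \<omega> \<partial>M)"
proof -
 note [measurable] = \<epsilon>
 have sp: "space F = space M" using sub by (simp add: subalgebra_def)
 have XM[measurable]: "X \<in> borel_measurable M" by (rule measurable_from_subalg[OF sub X])
 obtain s where s: "\<And>i. simple_function F (s i)" "\<And>\<omega>. \<omega> \<in> space F \<Longrightarrow> (\<lambda>i. s i \<omega>) \<longlonglongrightarrow> Y \<omega>"
  using borel_measurable_implies_sequence_metric[OF Y, of 0] by blast
 have sM[measurable]: "s i \<in> borel_measurable M" for i
  by (rule measurable_from_subalg[OF sub borel_measurable_simple_function[OF s(1)]])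
 define f where "f i \<omega> = X \<omega> * tilt (s i) \<omega>" for i \<omega>
 have fM: "f i \<in> borel_measurable M" for i unfolding f_def by measurable
 have lim: "(\<lambda>i. f i \<omega>) \<longlonglongrightarrow> X \<omega> * tilt Y \<omega>" if "\<omega> \<in> space M" for \<omega>
 proof -
  have sy: "(\<lambda>i. s i \<omega>) \<longlonglongrightarrow> Y \<omega>" using s(2) that sp by simp
  have "(\<lambda>i. tilt (s i) \<omega>) \<longlonglongrightarrow> tilt Y \<omega>" by (intro tendsto_ennrealI tendsto_intros sy) simp
  thus ?thesis unfolding f_def by (intro tendsto_mult_ennreal tendsto_const) auto
 qed
 have "(\<integral>\<^sup>+\<omega>. X \<omega> * tilt Y \<omega> \<partial>M) = (\<integral>\<^sup>+\<omega>. liminf (\<lambda>i. f i \<omega>) \<partial>M)"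
  by (intro nn_integral_cong) (metis lim lim_imp_Liminf sequentially_bot)
 also have "... \<le> liminf (\<lambda>i. \<integral>\<^sup>+\<omega>. f i \<omega> \<partial>M)" by (rule nn_integral_liminf[OF fM])
 also have "... \<le> (\<integral>\<^sup>+\<omega>. X \<omega> \<partial>M)" using mult_exp_simple[OF X s(1)] by (intro Liminf_le) (auto simp: f_def)
 finally show ?thesis .
qed

text \<open>The quadratic exponent is linearised by \<open>exp (\<gamma> \<epsilon>\<^sup>2) = E exp (\<surd>(2 \<gamma>) X \<epsilon>)\<close> for a standard normal
 \<open>X\<close>.\<close>

lemma mult_exp_square:
 fixes \<alpha> w :: "'w \<Rightarrow> real"
 assumes X: "X \<in> borel_measurable F" and \<alpha>: "\<alpha> \<in> borel_measurable F" and w: "w \<in> borel_measurable F" "\<And>\<omega>. \<omega> \<in> space M \<Longrightarrow> 0 \<le> w \<omega>"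
 shows "(\<integral>\<^sup>+\<omega>. X \<omega> * ennreal (exp (\<alpha> \<omega> * \<epsilon> \<omega> + w \<omega> / (2 * \<sigma>^2 * (1 + w \<omega>)) * (\<epsilon> \<omega>)^2)) \<partial>M)
  \<le> (\<integral>\<^sup>+\<omega>. X \<omega> * ennreal (sqrt (1 + w \<omega>) * exp (\<sigma>^2 * (\<alpha> \<omega>)^2 * (1 + w \<omega>) / 2)) \<partial>M)"
proof -
 interpret PM: pair_sigma_finite M lborel ..
 note [measurable] = \<epsilon> measurable_from_subalg[OF sub X] measurable_from_subalg[OF sub \<alpha>] measurable_from_subalg[OF sub w(1)]
 \<comment> \<open>Chosen so that the coefficient of \<epsilon>^2 in the exponent is s^2 / 2, which
   is what the Gaussian integral in \<open>expand\<close> produces.\<close>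
 define s where "s \<omega> = sqrt (w \<omega> / (1 + w \<omega>)) / \<sigma>" for \<omega>
 define q where "q = 1 / sqrt (2 * pi)"
 let ?\<phi> = "\<lambda>x. ennreal (q * exp (- x\<^sup>2 / 2))" and ?e = "\<lambda>\<omega> x. ennreal (exp ((\<alpha> \<omega> + s \<omega> * x) * \<epsilon> \<omega>))"
  and ?h = "\<lambda>\<omega> x. ennreal (exp (\<sigma>^2 * (\<alpha> \<omega> + s \<omega> * x)^2 / 2))"
  and ?l = "\<lambda>\<omega>. ennreal (exp (\<alpha> \<omega> * \<epsilon> \<omega> + w \<omega> / (2 * \<sigma>^2 * (1 + w \<omega>)) * (\<epsilon> \<omega>)^2))"
  and ?r = "\<lambda>\<omega>. ennreal (sqrt (1 + w \<omega>) * exp (\<sigma>^2 * (\<alpha> \<omega>)^2 * (1 + w \<omega>) / 2))"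
 have q: "0 < q" by (simp add: q_def)
 have sF: "s \<in> borel_measurable F" unfolding s_def using w(1) by measurable
 note [measurable] = measurable_from_subalg[OF sub sF]
 have s2: "\<sigma>^2 * (s \<omega>)^2 = w \<omega> / (1 + w \<omega>)" if "\<omega> \<in> space M" for \<omega> using w(2)[OF that] \<sigma> by (simp add: s_def power_divide)
 have expand: "?l \<omega>
   = (\<integral>\<^sup>+x. ?\<phi> x * ?e \<omega> x \<partial>lborel)" if \<omega>: "\<omega> \<in> space M" for \<omega>
 proof -
  have e: "w \<omega> / (2 * \<sigma>^2 * (1 + w \<omega>)) * (\<epsilon> \<omega>)^2 = (s \<omega> * \<epsilon> \<omega>)^2 / 2"
   using w(2)[OF \<omega>] by (simp add: s_def power_divide power_mult_distrib)
  have "(\<integral>\<^sup>+x. ?\<phi> x * ?e \<omega> x \<partial>lborel)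
    = (\<integral>\<^sup>+x. ennreal (q * exp (\<alpha> \<omega> * \<epsilon> \<omega>)) * ennreal (exp ((s \<omega> * \<epsilon> \<omega>) * x - x^2 / (2 * 1))) \<partial>lborel)"
  proof (rule nn_integral_cong)
   fix x :: real
   have "exp (- x\<^sup>2 / 2) * exp ((\<alpha> \<omega> + s \<omega> * x) * \<epsilon> \<omega>) = exp (\<alpha> \<omega> * \<epsilon> \<omega>) * exp ((s \<omega> * \<epsilon> \<omega>) * x - x^2 / (2 * 1))"
    unfolding exp_add[symmetric] by (simp add: algebra_simps)
   thus "?\<phi> x * ?e \<omega> x = ennreal (q * exp (\<alpha> \<omega> * \<epsilon> \<omega>)) * ennreal (exp ((s \<omega> * \<epsilon> \<omega>) * x - x^2 / (2 * 1)))"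
    using q by (simp add: ennreal_mult[symmetric] mult.assoc)
  qed
  also have "... = ennreal (q * exp (\<alpha> \<omega> * \<epsilon> \<omega>)) * ennreal (sqrt (2 * pi * 1) * exp ((s \<omega> * \<epsilon> \<omega>)^2 * 1 / 2))"
   by (subst nn_integral_cmult) (simp_all only: nn_integral_gaussian_exp[of 1, OF zero_less_one], measurable)
  also have "... = ennreal (exp (\<alpha> \<omega> * \<epsilon> \<omega>) * exp ((s \<omega> * \<epsilon> \<omega>)^2 / 2))"
   using q by (subst ennreal_mult[symmetric]) (simp_all add: q_def)
  finally show ?thesis by (simp only: e exp_add)
 qed
 have fold: "(\<integral>\<^sup>+x. ?\<phi> x * ?h \<omega> x \<partial>lborel)
   = ?r \<omega>" if \<omega>: "\<omega> \<in> space M" for \<omega>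
 proof -
  define v where "v = 1 + w \<omega>"
  have v: "0 < v" "w \<omega> = v - 1" using w(2)[OF \<omega>] by (simp_all add: v_def)
  define c where "c = \<sigma>^2 * (\<alpha> \<omega>)^2 / 2"
  define b where "b = \<sigma>^2 * \<alpha> \<omega> * s \<omega>"
  \<comment> \<open>After the moment bound the exponent in x is still - x^2 / (2 v) with v = 1 + w;
    the Gaussian integral is therefore finite and contributes the factor sqrt (1 + w).\<close>
  have sv: "\<sigma>^2 * (s \<omega>)^2 = 1 - 1 / v" unfolding s2[OF \<omega>] using v by (simp add: diff_divide_distrib)
  have "(\<integral>\<^sup>+x. ?\<phi> x * ?h \<omega> x \<partial>lborel)
    = (\<integral>\<^sup>+x. ennreal (q * exp c) * ennreal (exp (b * x - x^2 / (2 * v))) \<partial>lborel)"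
  proof (rule nn_integral_cong)
   fix x :: real
   have "- x\<^sup>2 / 2 + \<sigma>^2 * (\<alpha> \<omega> + s \<omega> * x)^2 / 2 = c + b * x + (\<sigma>^2 * (s \<omega>)^2) * (x^2 / 2) - x^2 / 2"
    by (simp add: c_def b_def power2_eq_square algebra_simps add_divide_distrib)
   also have "... = c + (b * x - x^2 / (2 * v))" unfolding sv by (simp add: field_simps)
   finally have "exp (- x\<^sup>2 / 2) * exp (\<sigma>^2 * (\<alpha> \<omega> + s \<omega> * x)^2 / 2) = exp c * exp (b * x - x^2 / (2 * v))"
    unfolding exp_add[symmetric] by simp
   thus "?\<phi> x * ?h \<omega> x = ennreal (q * exp c) * ennreal (exp (b * x - x^2 / (2 * v)))"
    using q by (simp add: ennreal_mult[symmetric] mult.assoc)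
  qed
  also have "... = ennreal (q * exp c) * ennreal (sqrt (2 * pi * v) * exp (b^2 * v / 2))"
   by (subst nn_integral_cmult) (simp_all only: nn_integral_gaussian_exp[OF v(1)], measurable)
  also have "... = ennreal (sqrt v * (exp c * exp (b^2 * v / 2)))"
   using q v by (subst ennreal_mult[symmetric]) (simp_all add: q_def real_sqrt_mult)
  also have "exp c * exp (b^2 * v / 2) = exp (\<sigma>^2 * (\<alpha> \<omega>)^2 * v / 2)"
  proof -
   have "b^2 * v = \<sigma>^2 * (\<alpha> \<omega>)^2 * (\<sigma>^2 * (s \<omega>)^2 * v)" by (simp add: b_def power2_eq_square)
   also have "\<sigma>^2 * (s \<omega>)^2 * v = v - 1" unfolding sv using v by (simp add: left_diff_distrib)
   finally have "c + b^2 * v / 2 = \<sigma>^2 * (\<alpha> \<omega>)^2 * v / 2" by (simp add: c_def algebra_simps add_divide_distrib)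
   thus ?thesis by (simp only: exp_add[symmetric])
  qed
  finally show ?thesis by (simp add: v_def)
 qed
 have "(\<integral>\<^sup>+\<omega>. X \<omega> * ?l \<omega> \<partial>M)
   = (\<integral>\<^sup>+\<omega>. \<integral>\<^sup>+x. X \<omega> * (?\<phi> x * ?e \<omega> x) \<partial>lborel \<partial>M)"
  by (intro nn_integral_cong) (simp only: expand, subst nn_integral_cmult, measurable)
 also have "... = (\<integral>\<^sup>+x. \<integral>\<^sup>+\<omega>. X \<omega> * (?\<phi> x * ?e \<omega> x) \<partial>M \<partial>lborel)" by (rule PM.Fubini'[symmetric]) measurable
 also have "... \<le> (\<integral>\<^sup>+x. \<integral>\<^sup>+\<omega>. X \<omega> * (?\<phi> x * ?h \<omega> x) \<partial>M \<partial>lborel)"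
 proof (rule nn_integral_mono)
  fix x :: real
  define Y where "Y \<omega> = \<alpha> \<omega> + s \<omega> * x" for \<omega>
  define X' where "X' \<omega> = X \<omega> * (?\<phi> x * ennreal (exp (\<sigma>^2 * (Y \<omega>)^2 / 2)))" for \<omega>
  have YF: "Y \<in> borel_measurable F" unfolding Y_def using \<alpha> sF by measurable
  have XF: "X' \<in> borel_measurable F" unfolding X'_def using X YF by measurable
  have "(\<integral>\<^sup>+\<omega>. X \<omega> * (?\<phi> x * ennreal (exp (Y \<omega> * \<epsilon> \<omega>))) \<partial>M)
   = (\<integral>\<^sup>+\<omega>. X' \<omega> * tilt Y \<omega> \<partial>M)"
  proof (rule nn_integral_cong)
   fix \<omega>
   have "exp (Y \<omega> * \<epsilon> \<omega>) = exp (\<sigma>^2 * (Y \<omega>)^2 / 2) * exp (Y \<omega> * \<epsilon> \<omega> - \<sigma>^2 * (Y \<omega>)^2 / 2)" unfolding exp_add[symmetric] by simp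
   hence "ennreal (exp (Y \<omega> * \<epsilon> \<omega>)) = ennreal (exp (\<sigma>^2 * (Y \<omega>)^2 / 2)) * tilt Y \<omega>" by (simp add: ennreal_mult)
   thus "X \<omega> * (?\<phi> x * ennreal (exp (Y \<omega> * \<epsilon> \<omega>))) = X' \<omega> * tilt Y \<omega>" by (simp add: X'_def mult.assoc)
  qed
  also have "... \<le> (\<integral>\<^sup>+\<omega>. X' \<omega> \<partial>M)" by (rule mult_exp[OF XF YF])
  finally show "(\<integral>\<^sup>+\<omega>. X \<omega> * (?\<phi> x * ?e \<omega> x) \<partial>M)
   \<le> (\<integral>\<^sup>+\<omega>. X \<omega> * (?\<phi> x * ?h \<omega> x) \<partial>M)" by (simp only: Y_def X'_def)
 qed
 also have "... = (\<integral>\<^sup>+\<omega>. \<integral>\<^sup>+x. X \<omega> * (?\<phi> x * ?h \<omega> x) \<partial>lborel \<partial>M)" by (rule PM.Fubini') measurable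
 also have "... = (\<integral>\<^sup>+\<omega>. X \<omega> * ?r \<omega> \<partial>M)" by (intro nn_integral_cong) (subst nn_integral_cmult, measurable, simp only: fold)
 finally show ?thesis .
qed

end

section \<open>Regularisation by a general prior matrix\<close>

definition prior_gram :: "real ^ 'n ^ 'n \<Rightarrow> (nat \<Rightarrow> real ^ 'n) \<Rightarrow> nat \<Rightarrow> real ^ 'n ^ 'n" where
 "prior_gram D a t = D + (\<Sum>s=1..t. outer_square (a s))"

lemma prior_gram_simps: "prior_gram D a 0 = D" "prior_gram D a (Suc t) = prior_gram D a t + outer_square (a (Suc t))"
 by (simp_all add: prior_gram_def)

lemma prior_gram_one: "prior_gram (mat 1) a t = gram a t" by (simp add: prior_gram_def gram_def)

lemma spd_prior_gram: "spd D \<Longrightarrow> spd (prior_gram D a t)" by (induction t) (auto simp: prior_gram_simps intro: spd_add_outer)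

text \<open>The inverse of \<open>prior_gram\<close> unfolded by the Sherman-Morrison formula; in
  this recursive form measurability follows by induction from elementary operations.\<close>

fun prior_inv :: "real ^ 'n ^ 'n \<Rightarrow> (nat \<Rightarrow> real ^ 'n) \<Rightarrow> nat \<Rightarrow> real ^ 'n ^ 'n" where
 "prior_inv D a 0 = matrix_inv D"
| "prior_inv D a (Suc t) = prior_inv D a t -
   (1 / (1 + a (Suc t) \<bullet> (prior_inv D a t *v a (Suc t)))) *\<^sub>R outer_square (prior_inv D a t *v a (Suc t))"

lemma prior_inv: "spd D \<Longrightarrow> prior_inv D a t = matrix_inv (prior_gram D a t)"
proof (induction t)
 case (Suc t)
 have "matrix_inv (prior_gram D a (Suc t)) *v x = prior_inv D a (Suc t) *v x" for x
  unfolding prior_gram_simps sherman_morrison[OF spd_prior_gram[OF Suc.prems]]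
  by (simp add: Suc matrix_vector_mult_diff_rdistrib scaleR_matrix_vector_assoc[symmetric] outer_square_mult)
 thus ?case by (simp add: matrix_eq)
qed (simp add: prior_gram_simps)

lemma spd_prior_inv: "spd D \<Longrightarrow> spd (prior_inv D a t)" by (simp add: prior_inv spd_matrix_inv spd_prior_gram)

definition prior_width :: "real ^ 'n ^ 'n \<Rightarrow> (nat \<Rightarrow> real ^ 'n) \<Rightarrow> nat \<Rightarrow> real" where
 "prior_width D a t = a (Suc t) \<bullet> (prior_inv D a t *v a (Suc t))"

lemma prior_width_nonneg: "spd D \<Longrightarrow> 0 \<le> prior_width D a t" unfolding prior_width_def by (rule spd_nonneg[OF spd_prior_inv])

text \<open>The Sherman-Morrison update as a quadratic polynomial in the new noise value
  \<open>e\<close>, the form to which \<open>mult_exp_square\<close> applies.\<close>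

lemma self_normalized_step:
 fixes a :: "nat \<Rightarrow> real ^ 'n" and t :: nat and s :: "real ^ 'n"
 assumes D: "spd D"
 defines "w \<equiv> prior_width D a t" and "g \<equiv> a (Suc t) \<bullet> (prior_inv D a t *v s)"
 shows "(s + e *\<^sub>R a (Suc t)) \<bullet> (prior_inv D a (Suc t) *v (s + e *\<^sub>R a (Suc t))) =
  s \<bullet> (prior_inv D a t *v s) - g^2 / (1 + w) + 2 * (g / (1 + w)) * e + w / (1 + w) * e^2"
proof -
 define B where "B = prior_inv D a t"
 define y where "y = a (Suc t)"
 have w: "0 \<le> w" unfolding w_def by (rule prior_width_nonneg[OF D])
 have sy: "s \<bullet> (B *v y) = g" "(B *v y) \<bullet> s = g" "(B *v y) \<bullet> y = w" "y \<bullet> (B *v y) = w" "y \<bullet> (B *v s) = g"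
  using spd_inner[OF spd_prior_inv[OF D], of s a t y] spd_inner[OF spd_prior_inv[OF D], of y a t s]
  by (simp_all add: g_def w_def B_def y_def prior_width_def inner_commute)
 have M: "prior_inv D a (Suc t) *v x = B *v x - (((B *v y) \<bullet> x) / (1 + w)) *\<^sub>R (B *v y)" for x
  by (simp add: B_def y_def w_def prior_width_def matrix_vector_mult_diff_rdistrib scaleR_matrix_vector_assoc[symmetric] outer_square_mult)
 have "(s + e *\<^sub>R y) \<bullet> (prior_inv D a (Suc t) *v (s + e *\<^sub>R y)) = s \<bullet> (B *v s) + 2 * e * g + e^2 * w - (g + e * w)^2 / (1 + w)"
  unfolding M by (simp add: matrix_vector_right_distrib matrix_vector_mult_scaleR inner_add_left inner_add_right
   inner_diff_right sy power2_eq_square algebra_simps add_divide_distrib)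
 also have "... = s \<bullet> (B *v s) - g^2 / (1 + w) + 2 * (g / (1 + w)) * e + w / (1 + w) * e^2"
 proof -
  have n: "1 + w \<noteq> 0" using w by simp
  have "(1 + w) * (2 * e * g + e^2 * w) - (g + e * w)^2 = - g\<^sup>2 + 2 * g * e + w * e^2" by algebra
  hence "((1 + w) * (2 * e * g + e^2 * w) - (g + e * w)^2) / (1 + w) = (- g\<^sup>2 + 2 * g * e + w * e^2) / (1 + w)" by (simp only:)
  moreover have "((1 + w) * (2 * e * g + e^2 * w) - (g + e * w)^2) / (1 + w) = (2 * e * g + e^2 * w) - (g + e * w)^2 / (1 + w)"
   using n by (simp add: diff_divide_distrib)
  moreover have "(- g\<^sup>2 + 2 * g * e + w * e^2) / (1 + w) = - g\<^sup>2 / (1 + w) + 2 * (g / (1 + w)) * e + w / (1 + w) * e^2"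
   by (simp only: add_divide_distrib) simp
  ultimately show ?thesis by simp
 qed
 finally show ?thesis by (simp add: B_def y_def)
qed

section \<open>Measurability with respect to the history\<close>

lemma space_history: "space (history M a r t) = space M" by (simp add: history_def)

lemma history_components:
 fixes a :: "nat \<Rightarrow> 'w \<Rightarrow> real ^ 'n"
 assumes s: "s \<in> {1..t}"
 shows "a s \<in> borel_measurable (history M a r t)" "r s \<in> borel_measurable (history M a r t)"
proof -
 have "(\<lambda>\<omega>. \<lambda>s\<in>{1..t}. (a s \<omega>, r s \<omega>)) \<in> history M a r t \<rightarrow>\<^sub>M PiM {1..t} (\<lambda>_. borel \<Otimes>\<^sub>M borel)"
  unfolding history_def by (rule measurable_vimage_algebra1) (auto simp: space_PiM space_pair_measure)
 from measurable_compose[OF this measurable_component_singleton[OF s]]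
 have p: "(\<lambda>\<omega>. (a s \<omega>, r s \<omega>)) \<in> history M a r t \<rightarrow>\<^sub>M borel \<Otimes>\<^sub>M borel" using s by simp
 show "a s \<in> borel_measurable (history M a r t)" "r s \<in> borel_measurable (history M a r t)"
  using measurable_compose[OF p measurable_fst] measurable_compose[OF p measurable_snd] by simp_all
qed

lemma sets_history_le:
 assumes "space N = space M" "\<And>s. s \<in> {1..t} \<Longrightarrow> a s \<in> borel_measurable N" "\<And>s. s \<in> {1..t} \<Longrightarrow> r s \<in> borel_measurable N"
 shows "sets (history M a r t) \<subseteq> sets N" unfolding history_def using assms
 by (intro sets_image_in_sets measurable_restrict measurable_Pair) auto

lemma sets_history_mono: "s \<le> t \<Longrightarrow> sets (history M a r s) \<subseteq> sets (history M a r t)"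
 by (rule sets_history_le) (auto simp: space_history intro!: history_components)

lemma measurable_history_mono: "s \<le> t \<Longrightarrow> f \<in> borel_measurable (history M a r s) \<Longrightarrow> f \<in> borel_measurable (history M a r t)"
 using sets_history_mono[of s t M a r] by (auto simp: measurable_def space_history)

context linucb
begin

abbreviation "\<F> \<equiv> history M a r"

text \<open>Induction on time, because actions are assumed measurable only with respect to the
  preceding history, and rewards are then determined by action and noise.\<close>

lemma subalgebra_history: "t \<le> T \<Longrightarrow> subalgebra M (\<F> t)"
proof (induction t)
 case 0
 show ?case unfolding subalgebra_def using sets_history_le[of M M 0 a r] by (simp add: space_history)
next
 case (Suc t)
 have am: "a s \<in> borel_measurable M" if "s \<in> {1..Suc t}" for s
 proof -
  have "sets (\<F> (s - 1)) \<subseteq> sets (\<F> t)" by (rule sets_history_mono) (use that in auto)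
  also have "... \<subseteq> sets M" using Suc by (simp add: subalgebra_def)
  finally have sub: "subalgebra M (\<F> (s - 1))" by (simp add: subalgebra_def space_history)
  have "a s \<in> borel_measurable (\<F> (s - 1))" by (rule action_measurable) (use that Suc.prems in auto)
  thus ?thesis by (rule measurable_from_subalg[OF sub])
 qed
 have rm: "r s \<in> borel_measurable M" if "s \<in> {1..Suc t}" for s
 proof -
  have s: "s \<in> {1..T}" using that Suc.prems by auto
  have "(\<lambda>\<omega>. inner (a s \<omega>) \<theta> + \<epsilon> s \<omega>) \<in> borel_measurable M"
   by (intro borel_measurable_add borel_measurable_inner borel_measurable_const am[OF that] noise_measurable[OF s])
  thus ?thesis by (rule measurable_cong[THEN iffD2, rotated]) (rule reward_eq[OF s])
 qed
 show ?case unfolding subalgebra_def space_history by (intro conjI refl sets_history_le am rm)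
qed

lemma action_measurable_M: "t \<in> {1..T} \<Longrightarrow> a t \<in> borel_measurable M"
 by (rule measurable_from_subalg[OF subalgebra_history action_measurable]) auto

lemma noise_history: "s \<in> {1..t} \<Longrightarrow> t \<le> T \<Longrightarrow> \<epsilon> s \<in> borel_measurable (\<F> t)"
proof -
 assume s: "s \<in> {1..t}" and t: "t \<le> T"
 have [measurable]: "a s \<in> borel_measurable (\<F> t)" "r s \<in> borel_measurable (\<F> t)" by (rule history_components[OF s])+
 have "(\<lambda>\<omega>. r s \<omega> - inner (a s \<omega>) \<theta>) \<in> borel_measurable (\<F> t)" by measurable
 thus ?thesis by (rule measurable_cong[THEN iffD2, rotated]) (use reward_eq[of s] s t in \<open>auto simp: space_history\<close>)
qed

lemma subgaussian_step_noise: "t < T \<Longrightarrow> subgaussian_step M (\<F> t) \<sigma> (\<epsilon> (Suc t))"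
proof -
 assume t: "t < T"
 then interpret sub: finite_measure_subalgebra M "\<F> t" by unfold_locales (rule subalgebra_history, simp)
 show ?thesis
 proof
  show "subalgebra M (\<F> t)" using t by (intro subalgebra_history) simp
  show "0 < \<sigma>" by (rule sigma_pos)
  show "\<epsilon> (Suc t) \<in> borel_measurable M" using t by (intro noise_measurable) simp
  fix l :: real and X :: "'w \<Rightarrow> ennreal" assume X: "X \<in> borel_measurable (\<F> t)"
  show "(\<integral>\<^sup>+\<omega>. X \<omega> * ennreal (exp (l * \<epsilon> (Suc t) \<omega>)) \<partial>M) \<le> (\<integral>\<^sup>+\<omega>. X \<omega> * ennreal (exp (\<sigma>^2 * l^2 / 2)) \<partial>M)"
   using noise_exp_integrable[of "Suc t" l] noise_subgaussian[of "Suc t" l] t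
   by (intro sub.nn_integral_mult_le_cond_exp X) auto
 qed
qed

definition noise_sum :: "nat \<Rightarrow> 'w \<Rightarrow> real ^ 'n" where
 "noise_sum t \<omega> = (\<Sum>s=1..t. \<epsilon> s \<omega> *\<^sub>R a s \<omega>)"

lemma noise_sum_Suc: "noise_sum (Suc t) \<omega> = noise_sum t \<omega> + \<epsilon> (Suc t) \<omega> *\<^sub>R a (Suc t) \<omega>" by (simp add: noise_sum_def)

lemma noise_sum_measurable: "t \<le> T \<Longrightarrow> noise_sum t \<in> borel_measurable (\<F> t)" unfolding noise_sum_def
 by (intro borel_measurable_sum borel_measurable_scaleR noise_history history_components(1)) auto

context
 fixes D :: "real ^ 'n ^ 'n"
 assumes D: "spd D"
begin

abbreviation "B t \<omega> \<equiv> prior_inv D (\<lambda>s. a s \<omega>) t"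
abbreviation "w t \<omega> \<equiv> prior_width D (\<lambda>s. a s \<omega>) t"

definition self_normalized :: "nat \<Rightarrow> 'w \<Rightarrow> real" where
 "self_normalized t \<omega> = noise_sum t \<omega> \<bullet> (B t \<omega> *v noise_sum t \<omega>)"

text \<open>The method of mixtures: this is the closed form of the exponential supermartingales
  averaged over a Gaussian parameter with precision \<sigma>^2 D. The product is the square root of
  the determinant of \<open>prior_gram\<close> divided by that of \<open>D\<close>.\<close>

definition mixture :: "nat \<Rightarrow> 'w \<Rightarrow> real" where
 "mixture t \<omega> = exp (self_normalized t \<omega> / (2 * \<sigma>^2)) / (\<Prod>s<t. sqrt (1 + w s \<omega>))"

lemma prior_inv_measurable: "t \<le> k \<Longrightarrow> k \<le> T \<Longrightarrow> (\<lambda>\<omega>. B t \<omega>) \<in> borel_measurable (\<F> k)"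
proof (induction t)
 case (Suc t)
 have [measurable]: "(\<lambda>\<omega>. B t \<omega>) \<in> borel_measurable (\<F> k)" using Suc by simp
 have [measurable]: "a (Suc t) \<in> borel_measurable (\<F> k)" using Suc.prems by (intro history_components) auto
 have [measurable]: "(\<lambda>\<omega>. B t \<omega> *v a (Suc t) \<omega>) \<in> borel_measurable (\<F> k)" by (rule borel_measurable_matrix_vector) measurable
 have [measurable]: "(\<lambda>\<omega>. outer_square (B t \<omega> *v a (Suc t) \<omega>)) \<in> borel_measurable (\<F> k)"
  by (rule borel_measurable_outer_square) measurable
 show ?case by simp measurable
qed simp

lemma prior_width_measurable: "t < T \<Longrightarrow> (\<lambda>\<omega>. w t \<omega>) \<in> borel_measurable (\<F> t)"
proof -
 assume t: "t < T"
 have [measurable]: "(\<lambda>\<omega>. B t \<omega>) \<in> borel_measurable (\<F> t)" using t by (intro prior_inv_measurable) auto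
 have [measurable]: "a (Suc t) \<in> borel_measurable (\<F> t)" using action_measurable[of "Suc t"] t by simp
 have [measurable]: "(\<lambda>\<omega>. B t \<omega> *v a (Suc t) \<omega>) \<in> borel_measurable (\<F> t)" by (rule borel_measurable_matrix_vector) measurable
 show ?thesis unfolding prior_width_def by measurable
qed

lemma self_normalized_measurable: "t \<le> T \<Longrightarrow> self_normalized t \<in> borel_measurable (\<F> t)"
proof -
 assume t: "t \<le> T"
 note [measurable] = noise_sum_measurable[OF t]
 have [measurable]: "(\<lambda>\<omega>. B t \<omega>) \<in> borel_measurable (\<F> t)" using t by (intro prior_inv_measurable) auto
 have [measurable]: "(\<lambda>\<omega>. B t \<omega> *v noise_sum t \<omega>) \<in> borel_measurable (\<F> t)" by (rule borel_measurable_matrix_vector) measurable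
 show ?thesis unfolding self_normalized_def by measurable
qed

lemma width_prod_measurable: "t \<le> T \<Longrightarrow> (\<lambda>\<omega>. \<Prod>s<t. sqrt (1 + w s \<omega>)) \<in> borel_measurable (\<F> t)"
proof -
 assume t: "t \<le> T"
 have "(\<lambda>\<omega>. w s \<omega>) \<in> borel_measurable (\<F> t)" if "s < t" for s
  by (rule measurable_history_mono[OF _ prior_width_measurable]) (use that t in auto)
 hence "(\<lambda>\<omega>. sqrt (1 + w s \<omega>)) \<in> borel_measurable (\<F> t)" if "s < t" for s
  using that by (intro borel_measurable_sqrt[THEN measurable_compose[rotated]] borel_measurable_add borel_measurable_const) auto
 thus ?thesis by (intro borel_measurable_prod) simp
qed

lemma mixture_measurable: "t \<le> T \<Longrightarrow> mixture t \<in> borel_measurable (\<F> t)"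
 unfolding mixture_def using self_normalized_measurable width_prod_measurable by measurable

lemma width_prod_pos: "0 < (\<Prod>s<t. sqrt (1 + w s \<omega>))"
 using prior_width_nonneg[OF D] by (intro prod_pos) (auto intro: add_pos_nonneg)

text \<open>The supermartingale property in integrated form, tested with past-measurable
  weights.\<close>

lemma mixture_step:
 assumes t: "t < T" and X: "X \<in> borel_measurable (\<F> t)"
 shows "(\<integral>\<^sup>+\<omega>. X \<omega> * ennreal (mixture (Suc t) \<omega>) \<partial>M) \<le> (\<integral>\<^sup>+\<omega>. X \<omega> * ennreal (mixture t \<omega>) \<partial>M)"
proof -
 interpret st: subgaussian_step M "\<F> t" \<sigma> "\<epsilon> (Suc t)" by (rule subgaussian_step_noise[OF t])
 define g where "g \<omega> = a (Suc t) \<omega> \<bullet> (B t \<omega> *v noise_sum t \<omega>)" for \<omega>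
 \<comment> \<open>\<open>\<alpha>\<close> and \<open>h\<close> are read off from
   \<open>self_normalized_step\<close>. After \<open>mult_exp_square\<close> the exponent \<sigma>^2
   \<alpha>^2 (1 + w) / 2 equals \<open>h\<close>, and the factor sqrt (1 + w) cancels against the
   new factor in the normalising product.\<close>
 define \<alpha> where "\<alpha> \<omega> = g \<omega> / (\<sigma>^2 * (1 + w t \<omega>))" for \<omega>
 define h where "h \<omega> = (g \<omega>)^2 / (2 * \<sigma>^2 * (1 + w t \<omega>))" for \<omega>
 define C where "C \<omega> = mixture t \<omega> / sqrt (1 + w t \<omega>) * exp (- h \<omega>)" for \<omega>
 define X' where "X' \<omega> = X \<omega> * ennreal (C \<omega>)" for \<omega>
 have wp: "0 \<le> w t \<omega>" "1 + w t \<omega> \<noteq> 0" "0 < 1 + w t \<omega>" for \<omega> using prior_width_nonneg[OF D, of "\<lambda>s. a s \<omega>" t] by auto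
 have s0: "\<sigma> \<noteq> 0" using sigma_pos by simp
 have mp: "0 < mixture t \<omega>" for t \<omega> unfolding mixture_def using width_prod_pos by simp
 have tT: "t \<le> T" using t by simp
 note [measurable] = X mixture_measurable[OF tT] prior_width_measurable[OF t] noise_sum_measurable[OF tT]
 have [measurable]: "(\<lambda>\<omega>. B t \<omega>) \<in> borel_measurable (\<F> t)" using t by (intro prior_inv_measurable) auto
 have [measurable]: "a (Suc t) \<in> borel_measurable (\<F> t)" using action_measurable[of "Suc t"] t by simp
 have [measurable]: "(\<lambda>\<omega>. B t \<omega> *v noise_sum t \<omega>) \<in> borel_measurable (\<F> t)" by (rule borel_measurable_matrix_vector) measurable
 have gm[measurable]: "g \<in> borel_measurable (\<F> t)" unfolding g_def by measurable
 have am: "\<alpha> \<in> borel_measurable (\<F> t)" unfolding \<alpha>_def by measurable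
 have Xm: "X' \<in> borel_measurable (\<F> t)" unfolding X'_def C_def h_def by measurable
 have 1: "mixture (Suc t) \<omega> = C \<omega>
   * exp (\<alpha> \<omega> * \<epsilon> (Suc t) \<omega> + w t \<omega> / (2 * \<sigma>^2 * (1 + w t \<omega>)) * (\<epsilon> (Suc t) \<omega>)^2)" for \<omega>
 proof -
  have "self_normalized (Suc t) \<omega> / (2 * \<sigma>^2) = self_normalized t \<omega> / (2 * \<sigma>^2) + - h \<omega>
    + (\<alpha> \<omega> * \<epsilon> (Suc t) \<omega> + w t \<omega> / (2 * \<sigma>^2 * (1 + w t \<omega>)) * (\<epsilon> (Suc t) \<omega>)^2)"
   unfolding self_normalized_def noise_sum_Suc self_normalized_step[OF D, where a = "\<lambda>s. a s \<omega>"] g_def[symmetric]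
   by (simp add: \<alpha>_def h_def add_divide_distrib diff_divide_distrib mult_ac)
  hence "exp (self_normalized (Suc t) \<omega> / (2 * \<sigma>^2)) = exp (self_normalized t \<omega> / (2 * \<sigma>^2)) * exp (- h \<omega>)
    * exp (\<alpha> \<omega> * \<epsilon> (Suc t) \<omega> + w t \<omega> / (2 * \<sigma>^2 * (1 + w t \<omega>)) * (\<epsilon> (Suc t) \<omega>)^2)" by (simp only: exp_add)
  thus ?thesis unfolding mixture_def C_def by simp
 qed
 have 2: "C \<omega>
   * (sqrt (1 + w t \<omega>) * exp (\<sigma>^2 * (\<alpha> \<omega>)^2 * (1 + w t \<omega>) / 2)) = mixture t \<omega>" for \<omega>
 proof -
  have "\<sigma>^2 * (\<alpha> \<omega>)^2 * (1 + w t \<omega>) / 2 = h \<omega>"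
   using s0 wp(2)[of \<omega>] by (simp add: h_def \<alpha>_def power_divide power_mult_distrib power2_eq_square)
  thus ?thesis using wp(3)[of \<omega>] by (simp add: C_def exp_minus)
 qed
 have Cp: "0 \<le> C \<omega>" for \<omega> unfolding C_def using mp[of t \<omega>] wp(1)[of \<omega>] by simp
 have "(\<integral>\<^sup>+\<omega>. X \<omega> * ennreal (mixture (Suc t) \<omega>) \<partial>M) = (\<integral>\<^sup>+\<omega>. X' \<omega> * ennreal (exp (\<alpha> \<omega> * \<epsilon> (Suc t) \<omega> + w t \<omega> / (2 * \<sigma>^2 * (1 + w t \<omega>)) * (\<epsilon> (Suc t) \<omega>)^2)) \<partial>M)"
  unfolding 1 X'_def by (intro nn_integral_cong) (simp only: ennreal_mult[OF Cp exp_ge_zero] mult.assoc)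
 also have "... \<le> (\<integral>\<^sup>+\<omega>. X' \<omega> * ennreal (sqrt (1 + w t \<omega>) * exp (\<sigma>^2 * (\<alpha> \<omega>)^2 * (1 + w t \<omega>) / 2)) \<partial>M)"
  by (rule st.mult_exp_square[OF Xm am prior_width_measurable[OF t] wp(1)])
 also have "... = (\<integral>\<^sup>+\<omega>. X \<omega> * ennreal (mixture t \<omega>) \<partial>M)"
 proof (rule nn_integral_cong)
  fix \<omega>
  show "X' \<omega> * ennreal (sqrt (1 + w t \<omega>) * exp (\<sigma>^2 * (\<alpha> \<omega>)^2 * (1 + w t \<omega>) / 2)) = X \<omega> * ennreal (mixture t \<omega>)"
   unfolding X'_def mult.assoc[of "X \<omega>"] using Cp[of \<omega>] wp(1)[of \<omega>] by (subst ennreal_mult[symmetric]) (simp_all add: 2)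
 qed
 finally show ?thesis .
qed

text \<open>Ville's maximal inequality in finite time: the mass that has reached the level is
  counted with weight \<open>l\<close>, the rest is carried on by the mixture; the total is at most
  one initially and does not increase.\<close>

lemma mixture_maximal:
 assumes l: "0 < l" and k: "k \<le> T"
 defines "G \<equiv> \<lambda>t. {\<omega> \<in> space M. \<exists>s\<le>t. l \<le> mixture s \<omega>}"
 shows "G k \<in> sets (\<F> k)"
  and "ennreal l * emeasure M (G k) + (\<integral>\<^sup>+\<omega>. indicator (space M - G k) \<omega> * ennreal (mixture k \<omega>) \<partial>M) \<le> 1"
proof -
 have G: "G t \<in> sets (\<F> t)" if "t \<le> T" for t
 proof -
  have "{\<omega> \<in> space (\<F> t). \<exists>s\<in>{..t}. l \<le> mixture s \<omega>} \<in> sets (\<F> t)"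
   using that by (intro sets.sets_Collect_finite_Ex borel_measurable_le measurable_history_mono[OF _ mixture_measurable]) auto
  thus ?thesis unfolding G_def space_history Bex_def atMost_iff .
 qed
 show "G k \<in> sets (\<F> k)" by (rule G[OF k])
 have mp: "0 < mixture t \<omega>" for t \<omega> unfolding mixture_def using width_prod_pos by simp
 show "ennreal l * emeasure M (G k) + (\<integral>\<^sup>+\<omega>. indicator (space M - G k) \<omega> * ennreal (mixture k \<omega>) \<partial>M) \<le> 1" using k
 proof (induction k)
  case 0
  have m0: "mixture 0 \<omega> = 1" for \<omega> by (simp add: mixture_def self_normalized_def noise_sum_def)
  show ?case
  proof (cases "l \<le> 1")
   case True
   hence "G 0 = space M" unfolding G_def by (auto simp: m0)
   thus ?thesis using True by (simp add: emeasure_space_1)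
  next
   case False
   hence "G 0 = {}" unfolding G_def by (auto simp: m0)
   thus ?thesis by (simp add: m0 emeasure_space_1)
  qed
 next
  case (Suc k)
  define H where "H = G (Suc k) - G k"
  have Gm: "G k \<in> sets M" "G (Suc k) \<in> sets M"
   using subsetD[OF conjunct2[OF subalgebra_history[of k, unfolded subalgebra_def]] G[of k]]
    subsetD[OF conjunct2[OF subalgebra_history[of "Suc k", unfolded subalgebra_def]] G[of "Suc k"]] Suc.prems by simp_all
  have Hm: "H \<in> sets M" using Gm by (simp add: H_def)
  have GG: "G k \<subseteq> G (Suc k)" unfolding G_def by (auto intro: le_SucI)
  have mm[measurable]: "mixture (Suc k) \<in> borel_measurable M"
   by (rule measurable_from_subalg[OF subalgebra_history mixture_measurable]) (rule Suc.prems)+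
  have "ennreal l * emeasure M (G (Suc k)) + (\<integral>\<^sup>+\<omega>. indicator (space M - G (Suc k)) \<omega> * ennreal (mixture (Suc k) \<omega>) \<partial>M)
    = ennreal l * emeasure M (G k) + (\<integral>\<^sup>+\<omega>. ennreal l * indicator H \<omega> + indicator (space M - G (Suc k)) \<omega> * ennreal (mixture (Suc k) \<omega>) \<partial>M)"
  proof -
   have "G (Suc k) = G k \<union> H" using GG by (auto simp: H_def)
   moreover have "emeasure M (G k) + emeasure M H = emeasure M (G k \<union> H)"
    by (rule plus_emeasure[OF Gm(1) Hm]) (simp add: H_def)
   ultimately have e: "emeasure M (G (Suc k)) = emeasure M (G k) + emeasure M H" by simp
   have "(\<integral>\<^sup>+\<omega>. ennreal l * indicator H \<omega> + indicator (space M - G (Suc k)) \<omega> * ennreal (mixture (Suc k) \<omega>) \<partial>M)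
     = ennreal l * emeasure M H + (\<integral>\<^sup>+\<omega>. indicator (space M - G (Suc k)) \<omega> * ennreal (mixture (Suc k) \<omega>) \<partial>M)"
   proof (subst nn_integral_add)
    show "(\<lambda>\<omega>. ennreal l * indicator H \<omega>) \<in> borel_measurable M" using Hm by measurable
    show "(\<lambda>\<omega>. indicator (space M - G (Suc k)) \<omega> * ennreal (mixture (Suc k) \<omega>)) \<in> borel_measurable M" using Gm by measurable
   qed (simp only: nn_integral_cmult_indicator[OF Hm])
   thus ?thesis by (simp only: e distrib_left add.assoc)
  qed
  also have "... \<le> ennreal l * emeasure M (G k) + (\<integral>\<^sup>+\<omega>. indicator (space M - G k) \<omega> * ennreal (mixture (Suc k) \<omega>) \<partial>M)"
  proof (intro add_left_mono nn_integral_mono)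
   fix \<omega> assume "\<omega> \<in> space M"
   show "ennreal l * indicator H \<omega> + indicator (space M - G (Suc k)) \<omega> * ennreal (mixture (Suc k) \<omega>) \<le> indicator (space M - G k) \<omega> * ennreal (mixture (Suc k) \<omega>)"
   proof (cases "\<omega> \<in> H")
    case True
    hence "\<exists>s\<le>Suc k. l \<le> mixture s \<omega>" "\<not> (\<exists>s\<le>k. l \<le> mixture s \<omega>)" using \<open>\<omega> \<in> space M\<close> unfolding H_def G_def by blast+
    hence "l \<le> mixture (Suc k) \<omega>" unfolding le_Suc_eq by blast
    moreover have "\<omega> \<in> G (Suc k)" "\<omega> \<notin> G k" using True by (simp_all add: H_def)
    ultimately show ?thesis using True \<open>\<omega> \<in> space M\<close> by (simp add: ennreal_leI)
   next
    case False
    hence "\<omega> \<in> G (Suc k) \<Longrightarrow> \<omega> \<in> G k" by (simp add: H_def)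
    thus ?thesis using False GG by (cases "\<omega> \<in> G k") (auto simp: indicator_def)
   qed
  qed
  also have "... \<le> ennreal l * emeasure M (G k) + (\<integral>\<^sup>+\<omega>. indicator (space M - G k) \<omega> * ennreal (mixture k \<omega>) \<partial>M)"
  proof (intro add_left_mono mixture_step borel_measurable_indicator)
   show "space M - G k \<in> sets (\<F> k)" using sets.compl_sets[OF G[of k]] Suc.prems by (simp add: space_history)
  qed (use Suc.prems in simp)
  also have "... \<le> 1" using Suc.IH Suc.prems by simp
  finally show ?case .
 qed
qed

lemma self_normalized_deviation:
 defines "bad \<equiv> \<lambda>l. {\<omega> \<in> space M. \<exists>t\<le>T. \<sigma>^2 * (2 * l + (\<Sum>s<t. ln (1 + w s \<omega>))) \<le> self_normalized t \<omega>}"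
 shows "bad l \<in> sets M" "measure M (bad l) \<le> exp (- l)"
proof -
 have eq: "bad l = {\<omega> \<in> space M. \<exists>t\<le>T. exp l \<le> mixture t \<omega>}"
 proof -
  have "exp l \<le> mixture t \<omega> \<longleftrightarrow> \<sigma>^2 * (2 * l + (\<Sum>s<t. ln (1 + w s \<omega>))) \<le> self_normalized t \<omega>" for t \<omega>
  proof -
   have "(\<Prod>s<t. sqrt (1 + w s \<omega>)) = exp ((\<Sum>s<t. ln (1 + w s \<omega>)) / 2)"
   proof -
    have "sqrt (1 + w s \<omega>) = exp (ln (1 + w s \<omega>) / 2)" for s
     using prior_width_nonneg[OF D, of "\<lambda>s. a s \<omega>" s] by (simp add: powr_half_sqrt[symmetric] powr_def)
    thus ?thesis by (simp add: exp_sum[symmetric] sum_divide_distrib)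
   qed
   hence "mixture t \<omega> = exp (self_normalized t \<omega> / (2 * \<sigma>^2) - (\<Sum>s<t. ln (1 + w s \<omega>)) / 2)" by (simp add: mixture_def exp_diff)
   hence "exp l \<le> mixture t \<omega> \<longleftrightarrow> l + (\<Sum>s<t. ln (1 + w s \<omega>)) / 2 \<le> self_normalized t \<omega> / (2 * \<sigma>^2)" by (simp add: algebra_simps)
   also have "... \<longleftrightarrow> (l + (\<Sum>s<t. ln (1 + w s \<omega>)) / 2) * (2 * \<sigma>^2) \<le> self_normalized t \<omega>"
    using sigma_pos by (subst pos_le_divide_eq) auto
   finally show ?thesis by (simp add: algebra_simps)
  qed
  thus ?thesis unfolding bad_def by simp
 qed
 have G: "bad l \<in> sets (\<F> T)" unfolding eq by (rule mixture_maximal(1)) auto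
 thus B: "bad l \<in> sets M" using subalgebra_history[of T] by (auto simp: subalgebra_def)
 have "ennreal (exp l) * emeasure M (bad l) \<le> 1"
  using mixture_maximal(2)[of "exp l" T] unfolding eq by (auto intro: order_trans[OF le_iff_add[THEN iffD2]])
 hence "exp l * measure M (bad l) \<le> 1" by (simp add: emeasure_eq_measure ennreal_mult[symmetric])
 thus "measure M (bad l) \<le> exp (- l)" by (simp add: exp_minus field_simps)
qed

end

end

text \<open>Inversion reverses the order of positive definite matrices: Cauchy-Schwarz in the form
  of \<open>A'\<close> for the two preimages of \<open>x\<close>, after which one factor
  cancels.\<close>

lemma inverse_form_le:
 fixes A A' :: "real ^ 'n ^ 'n"
 assumes A: "spd A" and A': "spd A'" and K: "0 \<le> K" "\<And>z. z \<bullet> (A' *v z) \<le> K * (z \<bullet> (A *v z))"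
 shows "x \<bullet> (matrix_inv A *v x) \<le> K * (x \<bullet> (matrix_inv A' *v x))"
proof -
 define u u' where "u = matrix_inv A *v x" and "u' = matrix_inv A' *v x"
 have x: "A *v u = x" "A' *v u' = x" by (simp_all add: u_def u'_def spd_inverse[OF A] spd_inverse[OF A'])
 have xu: "0 \<le> x \<bullet> u" "0 \<le> x \<bullet> u'"
  unfolding u_def u'_def by (rule spd_nonneg[OF spd_matrix_inv[OF A]], rule spd_nonneg[OF spd_matrix_inv[OF A']])
 have "(u \<bullet> x)^2 \<le> (u \<bullet> (A' *v u)) * (u' \<bullet> (A' *v u'))" using spd_cauchy_schwarz[OF A', of u u'] by (simp only: x)
 also have "... \<le> (K * (u \<bullet> (A *v u))) * (u' \<bullet> (A' *v u'))" using K(2)[of u] xu by (intro mult_right_mono) (simp_all add: x inner_commute)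
 finally have "(x \<bullet> u) * (x \<bullet> u) \<le> (K * (x \<bullet> u')) * (x \<bullet> u)" by (simp add: x inner_commute power2_eq_square mult_ac)
 thus ?thesis
 proof (cases "x \<bullet> u = 0")
  case True
  thus ?thesis using K(1) xu(2) by (simp add: u_def u'_def)
 next
  case False
  hence "0 < x \<bullet> u" using xu(1) by simp
  thus ?thesis using \<open>_ \<le> (K * (x \<bullet> u')) * (x \<bullet> u)\<close> by (subst (asm) mult_le_cancel_right_pos) (auto simp: u_def u'_def)
 qed
qed

section \<open>Priors of the predicted shape and the error of the ridge estimate\<close>

definition split_prior :: "real ^ 'n \<Rightarrow> real \<Rightarrow> real \<Rightarrow> real ^ 'n ^ 'n" where
 "split_prior \<theta> p q = q *\<^sub>R mat 1 + (p - q) *\<^sub>R outer_square \<theta>"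

lemma split_prior_mult: "split_prior \<theta> p q *v x = q *\<^sub>R x + ((p - q) * (\<theta> \<bullet> x)) *\<^sub>R \<theta>"
 by (simp add: split_prior_def matrix_vector_mult_add_rdistrib scaleR_matrix_vector_assoc[symmetric] outer_square_mult)

context
 fixes \<theta> :: "real ^ 'n" and p q :: real
 assumes \<theta>: "norm \<theta> = 1" and p: "p > 0" and q: "q > 0"
begin

lemma norm_perp: "(norm (x - (x \<bullet> \<theta>) *\<^sub>R \<theta>))^2 = (norm x)^2 - (x \<bullet> \<theta>)^2"
 unfolding norm_diff_squared using \<theta> by (simp add: power2_eq_square)

lemma split_prior_form: "x \<bullet> (split_prior \<theta> p q *v x) = p * (x \<bullet> \<theta>)^2 + q * (norm (x - (x \<bullet> \<theta>) *\<^sub>R \<theta>))^2"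
proof -
 have "x \<bullet> (split_prior \<theta> p q *v x) = q * (norm x)^2 + (p - q) * (x \<bullet> \<theta>)^2"
  unfolding split_prior_mult by (simp add: inner_add_right dot_square_norm inner_commute[of \<theta> x] power2_eq_square)
 thus ?thesis unfolding norm_perp by (simp add: algebra_simps)
qed

lemma spd_split_prior: "spd (split_prior \<theta> p q)" unfolding spd_def
proof (intro conjI allI impI)
 have "transpose (mat 1 :: real ^ 'n ^ 'n) = mat 1" by (rule transpose_mat)
 thus "transpose (split_prior \<theta> p q) = split_prior \<theta> p q"
  by (simp add: split_prior_def transpose_def vec_eq_iff outer_square_def mat_def mult.commute eq_commute)
next
 fix x :: "real ^ 'n" assume x: "x \<noteq> 0"
 show "0 < x \<bullet> (split_prior \<theta> p q *v x)"
 proof (cases "x \<bullet> \<theta> = 0")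
  case True
  thus ?thesis unfolding split_prior_form using x q by simp
 next
  case False
  thus ?thesis unfolding split_prior_form using p q by (intro add_pos_nonneg) auto
 qed
qed

text \<open>The inner product of \<open>x\<close> with its preimage \<open>z\<close> is split along
  \<theta> and the complement, and the weighted arithmetic-geometric inequality is applied to each
  part. The terms in \<open>z\<close> add up to the same inner product and are absorbed.\<close>

lemma split_prior_inv_le:
 "x \<bullet> (matrix_inv (split_prior \<theta> p q) *v x) \<le> (x \<bullet> \<theta>)^2 / p + (norm (x - (x \<bullet> \<theta>) *\<^sub>R \<theta>))^2 / q"
proof -
 define z where "z = matrix_inv (split_prior \<theta> p q) *v x"
 define y h where "y = x - (x \<bullet> \<theta>) *\<^sub>R \<theta>" and "h = z - (z \<bullet> \<theta>) *\<^sub>R \<theta>"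
 have zx: "split_prior \<theta> p q *v z = x" by (simp add: z_def spd_inverse[OF spd_split_prior])
 have am: "2 * (s * t) \<le> s^2 / k + k * t^2" if "0 < k" for s t k :: real
  using sum_squares_bound[of "s / sqrt k" "sqrt k * t"] that by (simp add: power_mult_distrib power_divide)
 have \<theta>\<theta>: "\<theta> \<bullet> \<theta> = 1" using \<theta> by (simp add: dot_square_norm)
 have "x \<bullet> z = (x \<bullet> \<theta>) * (z \<bullet> \<theta>) + y \<bullet> h"
  by (simp add: y_def h_def inner_diff_left inner_diff_right \<theta>\<theta> inner_commute[of \<theta> x] inner_commute[of \<theta> z] algebra_simps)
 moreover have "y \<bullet> h \<le> norm y * norm h" by (rule norm_cauchy_schwarz)
 moreover have "x \<bullet> z = p * (z \<bullet> \<theta>)^2 + q * (norm h)^2"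
  using split_prior_form[of z] unfolding zx h_def by (simp add: inner_commute)
 ultimately have "x \<bullet> z \<le> (x \<bullet> \<theta>)^2 / p + (norm y)^2 / q"
  using am[OF p, of "x \<bullet> \<theta>" "z \<bullet> \<theta>"] am[OF q, of "norm y" "norm h"] by linarith
 thus ?thesis by (simp add: z_def y_def)
qed

end

lemma prior_inv_antimono:
 assumes D: "spd D"
 shows "x \<bullet> (prior_inv D a t *v x) \<le> x \<bullet> (matrix_inv D *v x)"
proof (induction t)
 case (Suc t)
 define b where "b = prior_inv D a t *v a (Suc t)"
 have "0 \<le> prior_width D a t" by (rule prior_width_nonneg[OF D])
 hence "0 \<le> (b \<bullet> x) * (x \<bullet> b) / (1 + prior_width D a t)" by (simp add: inner_commute)
 hence "x \<bullet> (prior_inv D a (Suc t) *v x) \<le> x \<bullet> (prior_inv D a t *v x)"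
  by (simp add: matrix_vector_mult_diff_rdistrib scaleR_matrix_vector_assoc[symmetric] outer_square_mult inner_diff_right
   b_def prior_width_def)
 thus ?case using Suc by linarith
qed simp

text \<open>The estimate differs from \<theta> by \<Lambda>^-1 (S - \<theta>) with S the noise sum:
  the regularisation contributes - \<theta>, whose norm in \<Lambda>^-1 is at most one. This
  accounts for the summand one in \<open>noise_scale\<close>.\<close>

lemma ridge_error:
 fixes a :: "nat \<Rightarrow> real ^ 'n"
 assumes r: "\<And>s. s \<in> {1..t} \<Longrightarrow> r s = a s \<bullet> \<theta> + e s" and \<theta>: "norm \<theta> = 1"
  and S: "(\<Sum>s=1..t. e s *\<^sub>R a s) \<bullet> (matrix_inv (gram a t) *v (\<Sum>s=1..t. e s *\<^sub>R a s)) \<le> k^2" and k: "0 \<le> k"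
 shows "(ridge a r t - \<theta>) \<bullet> (gram a t *v (ridge a r t - \<theta>)) \<le> (k + 1)^2"
proof -
 define L s where "L = matrix_inv (gram a t)" and "s = (\<Sum>s=1..t. e s *\<^sub>R a s)"
 have L: "spd L" unfolding L_def by (rule spd_matrix_inv[OF spd_gram])
 have "(\<Sum>s=1..t. r s *\<^sub>R a s) = (\<Sum>s=1..t. (a s \<bullet> \<theta>) *\<^sub>R a s) + s"
  unfolding s_def sum.distrib[symmetric] by (intro sum.cong) (simp_all add: r scaleR_left_distrib)
 also have "(\<Sum>s=1..t. (a s \<bullet> \<theta>) *\<^sub>R a s) = gram a t *v \<theta> - \<theta>" by (simp add: gram_mult)
 finally have e: "ridge a r t - \<theta> = L *v (s - \<theta>)"
  by (simp add: ridge_def L_def[symmetric] matrix_vector_right_distrib matrix_vector_mult_diff_distrib spd_inverse(2)[OF spd_gram[of a t], folded L_def])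
 have "(ridge a r t - \<theta>) \<bullet> (gram a t *v (ridge a r t - \<theta>)) = (s - \<theta>) \<bullet> (L *v (s - \<theta>))"
  unfolding e L_def spd_inverse(1)[OF spd_gram] by (rule inner_commute)
 also have "... = s \<bullet> (L *v s) - 2 * (s \<bullet> (L *v \<theta>)) + \<theta> \<bullet> (L *v \<theta>)"
 proof -
  have "\<theta> \<bullet> (L *v s) = s \<bullet> (L *v \<theta>)" unfolding spd_inner[OF L, of \<theta> s] by (rule inner_commute)
  thus ?thesis by (simp add: matrix_vector_mult_diff_distrib inner_diff_left inner_diff_right)
 qed
 also have "... \<le> k^2 + 2 * k + 1"
 proof -
  have t: "\<theta> \<bullet> (L *v \<theta>) \<le> 1" using spd_inv_bounds(2)[OF spd_gram, of 1 a t \<theta>] gram_ge[of _ a t] \<theta> by (simp add: L_def)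
  have "(s \<bullet> (L *v \<theta>))^2 \<le> (s \<bullet> (L *v s)) * (\<theta> \<bullet> (L *v \<theta>))" by (rule spd_cauchy_schwarz[OF L])
  also have "... \<le> k^2 * 1" using S t spd_nonneg[OF L] by (intro mult_mono) (auto simp: s_def L_def)
  finally have "(s \<bullet> (L *v \<theta>))^2 \<le> k^2" by simp
  hence "\<bar>s \<bullet> (L *v \<theta>)\<bar> \<le> k" unfolding abs_le_square_iff[symmetric] using k by linarith
  thus ?thesis using t S unfolding s_def[symmetric] L_def[symmetric] by linarith
 qed
 also have "... = (k + 1)^2" by (simp add: power2_sum)
 finally show ?thesis .
qed

context linucb
begin

definition loglog :: real where "loglog = real CARD('n) + ln (ln (real T))"

text \<open>The shape of the Gram matrix predicted for \<open>2 ^ k \<le> t < 2 ^ (k + 1)\<close>. With this prior the logarithms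
 in the deviation bound add up to a constant at these times.\<close>

definition dyadic_prior :: "nat \<Rightarrow> real ^ 'n ^ 'n" where
 "dyadic_prior k = split_prior \<theta> (2 ^ k) (\<beta> * sqrt (2 ^ k))"

lemma spd_dyadic_prior: "spd (dyadic_prior k)"
 unfolding dyadic_prior_def using beta_pos theta_norm by (intro spd_split_prior) auto

text \<open>The bound belongs to the level 3 loglog, at which one prior fails with probability at
  most exp (- 3 d) / (ln T)^3.\<close>

definition controlled :: "real ^ 'n ^ 'n \<Rightarrow> 'w \<Rightarrow> bool" where
 "controlled D \<omega> \<longleftrightarrow> (\<forall>t\<le>T. self_normalized D t \<omega> \<le> \<sigma>^2 * (6 * loglog + (\<Sum>s<t. ln (1 + prior_width D (\<lambda>s. a s \<omega>) s))))"

lemma ln_T_ge_1: "1 \<le> ln (real T)"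
proof -
 have "exp 1 \<le> real T" using exp_le horizon by linarith
 thus ?thesis by (subst ln_ge_iff) (use horizon in auto)
qed

text \<open>Union bound over the identity and one prior per dyadic scale up to T, at most 4 ln T
  priors in all.\<close>

lemma good_event:
 obtains G where "G \<in> sets M" "measure M G \<ge> 1 - 1 / ln (real T)"
  "\<And>\<omega>. \<omega> \<in> G \<Longrightarrow> \<omega> \<in> space M \<and> controlled (mat 1) \<omega> \<and> (\<forall>k. 2 ^ k \<le> T \<longrightarrow> controlled (dyadic_prior k) \<omega>)"
proof -
 define x where "x = ln (real T)"
 have x: "1 \<le> x" unfolding x_def by (rule ln_T_ge_1)
 define bad where "bad D = {\<omega> \<in> space M. \<exists>t\<le>T. \<sigma>^2 * (2 * (3 * loglog) + (\<Sum>s<t. ln (1 + prior_width D (\<lambda>s. a s \<omega>) s))) \<le> self_normalized D t \<omega>}" for D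
 define I where "I = {k::nat. 2 ^ k \<le> T}"
 define \<D> where "\<D> = insert (mat 1) (dyadic_prior ` I)"
 have Ilog: "real k \<le> 2 * x" if "k \<in> I" for k
 proof -
  have "(2::real) ^ k \<le> real T" using that by (simp add: I_def)
  hence "ln ((2::real) ^ k) \<le> x" unfolding x_def using horizon by (subst ln_le_cancel_iff) auto
  hence "real k * ln 2 \<le> x" by (simp add: ln_realpow)
  moreover have "real k * (1 / 2) \<le> real k * ln 2" using ln2_ge_two_thirds by (intro mult_left_mono) auto
  ultimately show ?thesis by linarith
 qed
 have IS: "I \<subseteq> {..nat \<lfloor>2 * x\<rfloor>}" by (auto intro!: le_nat_floor Ilog)
 hence If: "finite I" by (rule finite_subset) simp
 have "card I \<le> nat \<lfloor>2 * x\<rfloor> + 1" using card_mono[OF _ IS] by simp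
 moreover have "real (nat \<lfloor>2 * x\<rfloor>) \<le> 2 * x" using x by simp
 ultimately have "real (card I) \<le> 2 * x + 1" by linarith
 moreover have "card \<D> \<le> Suc (card I)" unfolding \<D>_def
  using card_image_le[OF If, of dyadic_prior] If by (simp add: card_insert_if)
 ultimately have c: "real (card \<D>) \<le> 4 * x" using x by linarith
 have Df: "finite \<D>" unfolding \<D>_def using If by simp
 have spd1: "spd (mat 1 :: real ^ 'n ^ 'n)" by (simp add: spd_def transpose_mat)
 have spdD: "spd D" if "D \<in> \<D>" for D using that unfolding \<D>_def by (elim insertE imageE) (simp_all add: spd1 spd_dyadic_prior)
 have badm: "bad D \<in> sets M" "measure M (bad D) \<le> exp (- (3 * loglog))" if "D \<in> \<D>" for D
  unfolding bad_def by (rule self_normalized_deviation[OF spdD[OF that]])+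
 define G where "G = space M - (\<Union>D\<in>\<D>. bad D)"
 have Um: "(\<Union>D\<in>\<D>. bad D) \<in> sets M" using Df badm(1) by (intro sets.finite_UN) auto
 have "measure M (\<Union>D\<in>\<D>. bad D) \<le> (\<Sum>D\<in>\<D>. measure M (bad D))" by (rule measure_UNION_le[OF Df badm(1)])
 also have "... \<le> (\<Sum>D\<in>\<D>. exp (- (3 * loglog)))" by (intro sum_mono badm(2))
 also have "... = real (card \<D>) * exp (- (3 * loglog))" by simp
 also have "... \<le> (4 * x) * exp (- (3 * loglog))" using c by (intro mult_right_mono) auto
 also have "... \<le> 1 / x"
 proof -
  have "exp (- (3 * loglog)) = exp (- (3 * real CARD('n))) * exp (- (3 * ln x))"
   unfolding exp_add[symmetric] by (simp add: loglog_def x_def)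
  also have "exp (- (3 * ln x)) = 1 / x ^ 3"
  proof -
   have "exp (3 * ln x) = exp (ln x) ^ 3" using exp_of_nat_mult[of 3 "ln x"] by simp
   thus ?thesis using x by (simp add: exp_minus inverse_eq_divide)
  qed
  finally have e: "exp (- (3 * loglog)) = exp (- (3 * real CARD('n))) * (1 / x ^ 3)" .
  have "exp (- (3 * real CARD('n))) \<le> 1 / 4"
  proof -
   have "(4::real) \<le> 1 + 3 * real CARD('n)" using dim by simp
   also have "... \<le> exp (3 * real CARD('n))" by (rule exp_ge_add_one_self)
   finally show ?thesis by (simp add: exp_minus field_simps)
  qed
  hence "exp (- (3 * loglog)) \<le> 1 / 4 * (1 / x ^ 3)" unfolding e using x by (intro mult_right_mono) auto
  hence "(4 * x) * exp (- (3 * loglog)) \<le> (4 * x) * (1 / 4 * (1 / x ^ 3))" using x by (intro mult_left_mono) auto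
  also have "... = 1 / x^2" using x by (simp add: power_numeral_reduce)
  also have "... \<le> 1 / x" using x by (intro divide_left_mono) (auto simp: power2_eq_square)
  finally show ?thesis .
 qed
 finally have "measure M G \<ge> 1 - 1 / x" unfolding G_def using prob_compl[OF Um] by simp
 moreover have "controlled D \<omega>" if "\<omega> \<in> G" "D \<in> \<D>" for D \<omega>
 proof -
  have "\<omega> \<notin> bad D" "\<omega> \<in> space M" using that by (auto simp: G_def)
  hence "\<not> \<sigma>\<^sup>2 * (2 * (3 * loglog) + (\<Sum>s<t. ln (1 + prior_width D (\<lambda>s. a s \<omega>) s))) \<le> self_normalized D t \<omega>" if "t \<le> T" for t
   using that unfolding bad_def by blast
  thus ?thesis unfolding controlled_def by (simp add: not_le less_imp_le)
 qed
 moreover have "G \<in> sets M" "G \<subseteq> space M" unfolding G_def using Um by auto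
 ultimately show ?thesis by (intro that[of G]) (simp_all add: x_def \<D>_def I_def subset_iff)
qed

lemma self_normalized_one: "self_normalized (mat 1) t \<omega> = noise_sum t \<omega> \<bullet> (matrix_inv (gram (\<lambda>s. a s \<omega>) t) *v noise_sum t \<omega>)"
proof -
 have "spd (mat 1 :: real ^ 'n ^ 'n)" by (simp add: spd_def transpose_mat)
 thus ?thesis unfolding self_normalized_def by (simp add: self_normalized_def prior_inv prior_gram_one)
qed

definition sq_error :: "'w \<Rightarrow> nat \<Rightarrow> real" where
 "sq_error \<omega> t = (ridge (\<lambda>s. a s \<omega>) (\<lambda>s. r s \<omega>) t - \<theta>) \<bullet> (gram (\<lambda>s. a s \<omega>) t *v (ridge (\<lambda>s. a s \<omega>) (\<lambda>s. r s \<omega>) t - \<theta>))"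

lemma sq_error_le:
 assumes \<omega>: "\<omega> \<in> space M" and t: "t \<le> T" and k: "0 \<le> k"
  and S: "noise_sum t \<omega> \<bullet> (matrix_inv (gram (\<lambda>s. a s \<omega>) t) *v noise_sum t \<omega>) \<le> k^2"
 shows "sq_error \<omega> t \<le> (k + 1)^2" unfolding sq_error_def
 by (rule ridge_error[where e = "\<lambda>s. \<epsilon> s \<omega>"]) (use reward_eq \<omega> t k S theta_norm in \<open>auto simp: noise_sum_def\<close>)

text \<open>If the prior is at most \<open>C\<close> times the Gram matrix, replacing the Gram
  matrix by \<open>prior_gram\<close> costs a factor 1 + C. Each logarithm is at most the width
  under the initial prior, because inverses decrease, and \<open>split_prior_inv_le\<close> makes
  these widths explicit.\<close>

lemma sq_error_prior:
 assumes \<omega>: "\<omega> \<in> space M" "controlled (dyadic_prior k) \<omega>" and t: "t \<le> T" and C: "0 \<le> C"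
  and D: "\<And>z. z \<bullet> (dyadic_prior k *v z) \<le> C * (z \<bullet> (gram (\<lambda>s. a s \<omega>) t *v z))"
 shows "sq_error \<omega> t \<le> (sqrt ((1 + C) * (\<sigma>^2 * (6 * loglog + (\<Sum>s=1..t. (a s \<omega> \<bullet> \<theta>)^2 / 2 ^ k +
  (norm (a s \<omega> - (a s \<omega> \<bullet> \<theta>) *\<^sub>R \<theta>))^2 / (\<beta> * sqrt (2 ^ k)))))) + 1)^2"
proof (rule sq_error_le[OF \<omega>(1) t])
 define b where "b = (\<lambda>s. a s \<omega>)"
 define D where "D = dyadic_prior k"
 have sD: "spd D" unfolding D_def by (rule spd_dyadic_prior)
 define f where "f s = (b s \<bullet> \<theta>)^2 / 2 ^ k + (norm (b s - (b s \<bullet> \<theta>) *\<^sub>R \<theta>))^2 / (\<beta> * sqrt (2 ^ k))" for s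
 have f: "b s \<bullet> (matrix_inv D *v b s) \<le> f s" for s
  unfolding D_def dyadic_prior_def f_def using beta_pos theta_norm by (intro split_prior_inv_le) auto
 have w: "ln (1 + prior_width D b s) \<le> f (Suc s)" for s
 proof -
  have "ln (1 + prior_width D b s) \<le> prior_width D b s" by (rule ln_add_one_self_le_self[OF prior_width_nonneg[OF sD]])
  also have "... \<le> b (Suc s) \<bullet> (matrix_inv D *v b (Suc s))" unfolding prior_width_def by (rule prior_inv_antimono[OF sD])
  also have "... \<le> f (Suc s)" by (rule f)
  finally show ?thesis .
 qed
 have "(\<Sum>s<t. ln (1 + prior_width D b s)) \<le> (\<Sum>s<t. f (Suc s))" by (intro sum_mono w)
 also have "... = (\<Sum>s=1..t. f s)" by (rule sum.reindex_bij_witness[of _ "\<lambda>s. s - 1" Suc]) auto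
 finally have fs: "(\<Sum>s<t. ln (1 + prior_width D b s)) \<le> (\<Sum>s=1..t. f s)" .
 have "self_normalized D t \<omega> \<le> \<sigma>^2 * (6 * loglog + (\<Sum>s<t. ln (1 + prior_width D b s)))"
  using \<omega>(2) t unfolding controlled_def D_def b_def by blast
 also have "... \<le> \<sigma>^2 * (6 * loglog + (\<Sum>s=1..t. f s))" using fs by (intro mult_left_mono) auto
 finally have sn: "self_normalized D t \<omega> \<le> \<sigma>^2 * (6 * loglog + (\<Sum>s=1..t. f s))" .
 have sn0: "0 \<le> self_normalized D t \<omega>" unfolding self_normalized_def[OF sD] by (rule spd_nonneg[OF spd_prior_inv[OF sD]])
 have "noise_sum t \<omega> \<bullet> (matrix_inv (gram b t) *v noise_sum t \<omega>) \<le> (1 + C) * (noise_sum t \<omega> \<bullet> (matrix_inv (prior_gram D b t) *v noise_sum t \<omega>))"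
 proof (rule inverse_form_le[OF spd_gram spd_prior_gram[OF sD]])
  fix z
  have "prior_gram D b t = D + (gram b t - mat 1)" by (simp add: prior_gram_def gram_def)
  hence "z \<bullet> (prior_gram D b t *v z) = z \<bullet> (D *v z) + z \<bullet> (gram b t *v z) - z \<bullet> z"
   by (simp add: matrix_vector_mult_add_rdistrib matrix_vector_mult_diff_rdistrib inner_add_right inner_diff_right)
  also have "... \<le> (1 + C) * (z \<bullet> (gram b t *v z))" using D[of z] inner_ge_zero[of z] unfolding D_def b_def distrib_right by linarith
  finally show "z \<bullet> (prior_gram D b t *v z) \<le> (1 + C) * (z \<bullet> (gram b t *v z))" .
 qed (use C in simp)
 also have "noise_sum t \<omega> \<bullet> (matrix_inv (prior_gram D b t) *v noise_sum t \<omega>) = self_normalized D t \<omega>"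
  by (simp add: self_normalized_def[OF sD] prior_inv[OF sD] b_def)
 also have "(1 + C) * self_normalized D t \<omega> \<le> (1 + C) * (\<sigma>^2 * (6 * loglog + (\<Sum>s=1..t. f s)))"
  using sn C by (intro mult_left_mono) auto
 finally have 1: "noise_sum t \<omega> \<bullet> (matrix_inv (gram b t) *v noise_sum t \<omega>) \<le> (1 + C) * (\<sigma>^2 * (6 * loglog + (\<Sum>s=1..t. f s)))" .
 have 0: "0 \<le> (1 + C) * (\<sigma>^2 * (6 * loglog + (\<Sum>s=1..t. f s)))" using sn sn0 C by (intro mult_nonneg_nonneg[of "1 + C"]) linarith+
 show "noise_sum t \<omega> \<bullet> (matrix_inv (gram (\<lambda>s. a s \<omega>) t) *v noise_sum t \<omega>) \<le> (sqrt ((1 + C) * (\<sigma>^2 * (6 * loglog + (\<Sum>s=1..t. (a s \<omega> \<bullet> \<theta>)^2 / 2 ^ k +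
  (norm (a s \<omega> - (a s \<omega> \<bullet> \<theta>) *\<^sub>R \<theta>))^2 / (\<beta> * sqrt (2 ^ k)))))))^2" using 0 1 unfolding f_def b_def by simp
 show "0 \<le> sqrt ((1 + C) * (\<sigma>^2 * (6 * loglog + (\<Sum>s=1..t. (a s \<omega> \<bullet> \<theta>)^2 / 2 ^ k +
  (norm (a s \<omega> - (a s \<omega> \<bullet> \<theta>) *\<^sub>R \<theta>))^2 / (\<beta> * sqrt (2 ^ k))))))" using 0 unfolding f_def b_def by simp
qed

end

section \<open>Spectrum of the Gram matrix of LinUCB\<close>

lemma confidence_radius:
 fixes A :: "real ^ 'n ^ 'n"
 assumes A: "spd A" and k: "k > 0" "\<And>x. k * (norm x)^2 \<le> x \<bullet> (A *v x)" and z: "z \<bullet> (A *v z) \<le> N^2" "0 \<le> N"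
 shows "norm z \<le> N / sqrt k"
proof -
 have "(sqrt k * norm z)^2 \<le> N^2" using k(2)[of z] z(1) k(1) by (simp add: power_mult_distrib)
 hence "sqrt k * norm z \<le> N" using z(2) by (rule power2_le_imp_le)
 thus ?thesis using k(1) by (simp add: pos_le_divide_eq mult.commute)
qed

text \<open>Optimism says that the support function of the ellipsoid around \<open>v\<close>
  dominates the linear functional of \<theta>, so \<theta> lies in the ellipsoid. The decisive
  direction is A (\<theta> - v).\<close>

lemma optimistic_error:
 fixes A :: "real ^ 'n ^ 'n"
 assumes A: "spd A" and \<beta>: "\<beta> > 0" and opt: "\<And>x. x \<in> cball 0 1 \<Longrightarrow> x \<bullet> \<theta> \<le> ucb \<beta> A v x"
 shows "(\<theta> - v) \<bullet> (A *v (\<theta> - v)) \<le> \<beta>^2"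
proof -
 define z where "z = \<theta> - v"
 define q where "q = z \<bullet> (A *v z)"
 show ?thesis
 proof (cases "A *v z = 0")
  case True
  thus ?thesis by (simp add: z_def)
 next
  case False
  define s where "s = 1 / norm (A *v z)"
  have s: "0 < s" using False by (simp add: s_def)
  define x where "x = s *\<^sub>R (A *v z)"
  have q0: "0 \<le> q" unfolding q_def by (rule spd_nonneg[OF A])
  have "norm x = 1" using False by (simp add: x_def s_def)
  hence "x \<bullet> z \<le> \<beta> * sqrt (x \<bullet> (matrix_inv A *v x))" using opt[of x] by (simp add: ucb_def z_def inner_diff_right)
  moreover have "x \<bullet> (matrix_inv A *v x) = s^2 * q"
   by (simp add: x_def matrix_vector_mult_scaleR spd_inverse[OF A] q_def power2_eq_square inner_commute)
  moreover have "x \<bullet> z = s * q" by (simp add: x_def q_def inner_commute)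
  ultimately have "s * q \<le> s * (\<beta> * sqrt q)" using s by (simp add: real_sqrt_mult mult_ac)
  hence "q \<le> \<beta> * sqrt q" using s by (simp only: mult_le_cancel_left_pos)
  hence "sqrt q * sqrt q \<le> \<beta> * sqrt q" using q0 by simp
  hence "sqrt q \<le> \<beta>"
  proof (cases "sqrt q = 0")
   case False
   hence "0 < sqrt q" using q0 by simp
   thus ?thesis using \<open>sqrt q * sqrt q \<le> \<beta> * sqrt q\<close> by (simp only: mult_le_cancel_right_pos)
  qed (use \<beta> in simp)
  hence "(sqrt q)^2 \<le> \<beta>^2" using q0 by (intro power_mono) auto
  thus ?thesis using q0 by (simp add: q_def z_def)
 qed
qed

text \<open>The facts about the constants are extracted from a run of length zero, for which the
  assumptions on the rounds hold vacuously.\<close>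

lemma run_constants:
 assumes dim: "CARD('n::finite) \<ge> 2"
 shows "1 \<le> ucb_run.A1 (real CARD('n))" "real CARD('n) \<le> ucb_run.A1 (real CARD('n))"
  "1 \<le> ucb_run.K0 (real CARD('n))" "1 \<le> ucb_run.A3 (real CARD('n))"
proof -
 interpret ucb_run "\<lambda>_. 0 :: real ^ 'n" "\<lambda>_. 0" "axis undefined 1" 1 0 "\<lambda>_. 0" "\<lambda>_. 0" "real CARD('n)"
  by unfold_locales (use dim in simp_all)
 show "1 \<le> ucb_run.A1 (real CARD('n))" "real CARD('n) \<le> ucb_run.A1 (real CARD('n))"
  "1 \<le> ucb_run.K0 (real CARD('n))" "1 \<le> ucb_run.A3 (real CARD('n))" using A1_ge_1 d_le_A K0_ge(2) A3_ge_1 by simp_all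
qed

section \<open>Sample paths of LinUCB as deterministic runs\<close>

context linucb
begin

lemma estimator_norm: "\<omega> \<in> space M \<Longrightarrow> t < T \<Longrightarrow> norm (\<theta>hat t \<omega>) = 1"
 using estimator_projected[of t \<omega>] by (simp add: is_projected_def)

lemma run_steps:
 assumes \<omega>: "\<omega> \<in> space M"
 shows "\<exists>U \<mu>. \<forall>t<T. ucb_step (gram (\<lambda>s. a s \<omega>) t) \<beta> (\<theta>hat t \<omega>) (a (Suc t) \<omega>) (U t) (\<mu> t)"
proof -
 have "\<exists>U \<mu>. ucb_step (gram (\<lambda>s. a s \<omega>) t) \<beta> (\<theta>hat t \<omega>) (a (Suc t) \<omega>) U \<mu>" if "t < T" for t
  using action_argmax[of "Suc t" \<omega>] that \<omega> estimator_norm[OF \<omega> that] beta_pos by (intro ucb_step_exists spd_gram) auto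
 thus ?thesis by metis
qed

text \<open>The constant 16 in \<open>near\<close> is the square of 2 + 2: the action is within 2
  \<beta> / sqrt k of the projected estimate, and that estimate within 2 \<beta> / sqrt k of
  \<theta>.\<close>

lemma ucb_run_of_errors:
 assumes \<omega>: "\<omega> \<in> space M" and n: "n \<le> T"
  and step: "\<And>t. t < T \<Longrightarrow> ucb_step (gram (\<lambda>s. a s \<omega>) t) \<beta> (\<theta>hat t \<omega>) (a (Suc t) \<omega>) (U t) (\<mu> t)"
  and err: "\<And>t k. t < n \<Longrightarrow> k > 0 \<Longrightarrow> (\<And>x. k * (norm x)^2 \<le> x \<bullet> (gram (\<lambda>s. a s \<omega>) t *v x)) \<Longrightarrow> norm (\<theta>hat t \<omega> - \<theta>) \<le> 2 * \<beta> / sqrt k"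
 shows "ucb_run (\<lambda>s. a s \<omega>) (\<lambda>t. \<theta>hat t \<omega>) \<theta> \<beta> n U \<mu> (real CARD('n))"
proof
 show "2 \<le> CARD('n)" "norm \<theta> = 1" "0 < \<beta>" by (rule dim theta_norm beta_pos)+
 show "ucb_step (gram (\<lambda>s. a s \<omega>) t) \<beta> (\<theta>hat t \<omega>) (a (Suc t) \<omega>) (U t) (\<mu> t)" if "t < n" for t using step that n by simp
 show "(norm (a (Suc t) \<omega> - \<theta>))^2 \<le> 16 * \<beta>^2 / k"
  if t: "t < n" and k: "k > 0" "\<And>x. k * (norm x)^2 \<le> x \<bullet> (gram (\<lambda>s. a s \<omega>) t *v x)" for t k
 proof -
  have tT: "t < T" using t n by simp
  have "norm (a (Suc t) \<omega> - \<theta>hat t \<omega>) \<le> 2 * \<beta> / sqrt k"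
   by (rule ucb_step_near_estimate[OF step[OF tT] spd_gram estimator_norm[OF \<omega> tT] k])
  moreover have "norm (\<theta>hat t \<omega> - \<theta>) \<le> 2 * \<beta> / sqrt k" by (rule err[OF t k])
  moreover have "norm (a (Suc t) \<omega> - \<theta>) \<le> norm (a (Suc t) \<omega> - \<theta>hat t \<omega>) + norm (\<theta>hat t \<omega> - \<theta>)"
   using norm_triangle_ineq[of "a (Suc t) \<omega> - \<theta>hat t \<omega>" "\<theta>hat t \<omega> - \<theta>"] by simp
  ultimately have "norm (a (Suc t) \<omega> - \<theta>) \<le> 4 * \<beta> / sqrt k" by simp
  hence "(norm (a (Suc t) \<omega> - \<theta>))^2 \<le> (4 * \<beta> / sqrt k)^2" by (intro power_mono) auto
  thus ?thesis using k(1) by (simp add: power_divide power_mult_distrib)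
 qed
qed simp

lemma error_radius:
 assumes \<omega>: "\<omega> \<in> space M" and t: "t < T" and e: "sq_error \<omega> t \<le> \<beta>^2"
  and k: "k > 0" "\<And>x. k * (norm x)^2 \<le> x \<bullet> (gram (\<lambda>s. a s \<omega>) t *v x)"
 shows "norm (\<theta>hat t \<omega> - \<theta>) \<le> 2 * \<beta> / sqrt k"
proof -
 have "norm (ridge (\<lambda>s. a s \<omega>) (\<lambda>s. r s \<omega>) t - \<theta>) \<le> \<beta> / sqrt k"
  by (rule confidence_radius[OF spd_gram k e[unfolded sq_error_def]]) (use beta_pos in simp)
 thus ?thesis using is_projected_diff[OF estimator_projected[OF t \<omega>] theta_norm] by simp
qed

lemma optimistic_run:
 assumes \<omega>: "\<omega> \<in> space M"
  and opt: "\<And>t x. t \<in> {1..T} \<Longrightarrow> x \<in> cball 0 1 \<Longrightarrow> inner x \<theta> \<le> ucb \<beta> (gram (\<lambda>s. a s \<omega>) (t - 1)) (\<theta>hat (t - 1) \<omega>) x"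
 obtains U \<mu> where "ucb_run (\<lambda>s. a s \<omega>) (\<lambda>t. \<theta>hat t \<omega>) \<theta> \<beta> T U \<mu> (real CARD('n))"
proof -
 obtain U \<mu> where step: "\<forall>t<T. ucb_step (gram (\<lambda>s. a s \<omega>) t) \<beta> (\<theta>hat t \<omega>) (a (Suc t) \<omega>) (U t) (\<mu> t)"
  using run_steps[OF \<omega>] by blast
 have err: "norm (\<theta>hat t \<omega> - \<theta>) \<le> 2 * \<beta> / sqrt k"
  if t: "t < T" and k: "k > 0" "\<And>x. k * (norm x)^2 \<le> x \<bullet> (gram (\<lambda>s. a s \<omega>) t *v x)" for t k
 proof -
  have "(\<theta> - \<theta>hat t \<omega>) \<bullet> (gram (\<lambda>s. a s \<omega>) t *v (\<theta> - \<theta>hat t \<omega>)) \<le> \<beta>^2"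
   using opt[of "Suc t"] t by (intro optimistic_error[OF spd_gram beta_pos]) simp
  hence "norm (\<theta> - \<theta>hat t \<omega>) \<le> \<beta> / sqrt k" by (rule confidence_radius[OF spd_gram k]) (use beta_pos in simp)
  moreover have "0 \<le> \<beta> / sqrt k" using beta_pos k(1) by simp
  ultimately show ?thesis by (simp add: norm_minus_commute)
 qed
 show ?thesis by (rule that[OF ucb_run_of_errors[OF \<omega> order_refl step[rule_format] err]])
qed

definition scale :: real where "scale = noise_scale \<sigma> CARD('n) T"

lemma loglog_ge: "2 \<le> loglog" "real CARD('n) \<le> loglog"
proof -
 have "0 \<le> ln (ln (real T))" using ln_T_ge_1 by simp
 thus "2 \<le> loglog" "real CARD('n) \<le> loglog" using dim by (simp_all add: loglog_def)
qed

lemma scale: "scale = \<sigma> * sqrt loglog + 1" "1 \<le> scale" "\<sigma>^2 * loglog \<le> scale^2"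
proof -
 show e: "scale = \<sigma> * sqrt loglog + 1" by (simp add: scale_def noise_scale_def loglog_def)
 have p: "0 \<le> \<sigma> * sqrt loglog" using sigma_pos loglog_ge(1) by simp
 thus "1 \<le> scale" using e by simp
 have "(\<sigma> * sqrt loglog)^2 \<le> scale^2" using p e by (intro power_mono) auto
 thus "\<sigma>^2 * loglog \<le> scale^2" using loglog_ge(1) by (simp add: power_mult_distrib)
qed

section \<open>Bootstrapping the estimation error on the good event\<close>

context
 fixes \<omega> A K0 C1 and t1 :: nat
 assumes \<omega>: "\<omega> \<in> space M" and one: "controlled (mat 1) \<omega>" and dyadic: "\<forall>k. 2 ^ k \<le> T \<longrightarrow> controlled (dyadic_prior k) \<omega>"
 defines "A \<equiv> ucb_run.A1 (real CARD('n))" and "K0 \<equiv> ucb_run.K0 (real CARD('n))"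
 defines "C1 \<equiv> 8 * (10 ^ 4 * A^2 * K0)^2"
 assumes large: "(1800 * A ^ 3 + 1920000 * A ^ 4 * \<sigma>^2 * real CARD('n) * (1 + C1) + 9 * 10 ^ 32 * A ^ 21) * scale \<le> \<beta>"
 defines "t1 \<equiv> nat \<lceil>(10 ^ 4 * A^2 * K0 * \<beta> ^ 3)^2\<rceil>"
begin

lemma run_consts: "1 \<le> A" "real CARD('n) \<le> A" "1 \<le> K0" and C1_nonneg: "0 \<le> C1"
 using run_constants[where 'n = 'n] dim by (simp_all add: A_def K0_def C1_def)

lemma large_parts: "1800 * A ^ 3 * scale \<le> \<beta>" "1920000 * A ^ 4 * \<sigma>^2 * real CARD('n) * (1 + C1) \<le> \<beta>"
 "9 * 10 ^ 32 * A ^ 21 * scale \<le> \<beta>" "1 \<le> \<beta>"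
proof -
 define x y z where "x = 1800 * A ^ 3" and "y = 1920000 * A ^ 4 * \<sigma>^2 * real CARD('n) * (1 + C1)" and "z = 9 * 10 ^ 32 * A ^ 21"
 have p: "0 \<le> x" "0 \<le> y" "0 \<le> z" using run_consts C1_nonneg by (simp_all add: x_def y_def z_def)
 have s: "1 \<le> scale" by (rule scale(2))
 have b: "x * scale + y * scale + z * scale \<le> \<beta>" using large unfolding x_def y_def z_def by (simp only: distrib_right)
 have ps: "0 \<le> x * scale" "0 \<le> y * scale" "0 \<le> z * scale" "y \<le> y * scale" "x \<le> x * scale"
  using p s by (simp_all add: mult_le_cancel_left1)
 show "1800 * A ^ 3 * scale \<le> \<beta>" "1920000 * A ^ 4 * \<sigma>^2 * real CARD('n) * (1 + C1) \<le> \<beta>"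
  "9 * 10 ^ 32 * A ^ 21 * scale \<le> \<beta>" using b ps unfolding x_def y_def z_def by linarith+
 have "1 \<le> x" using one_le_power[OF run_consts(1), of 3] by (simp add: x_def)
 thus "1 \<le> \<beta>" using b ps by linarith
qed

lemma t1_bounds: "(10 ^ 4 * A^2 * K0 * \<beta> ^ 3)^2 \<le> real t1" "real (4 * t1) \<le> C1 * \<beta> ^ 6"
proof -
 define x where "x = 10 ^ 4 * A^2 * K0 * \<beta> ^ 3"
 show "(10 ^ 4 * A^2 * K0 * \<beta> ^ 3)^2 \<le> real t1" by (simp add: t1_def real_nat_ceiling_ge)
 have "1 * 1 * 1 * 1 \<le> x" unfolding x_def using run_consts large_parts(4) by (intro mult_mono) auto
 hence "1^2 \<le> x^2" by (intro power_mono) auto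
 moreover have "real t1 \<le> x^2 + 1" using of_int_ceiling_le_add_one[of "x^2"] by (simp add: t1_def x_def)
 moreover have "C1 * \<beta> ^ 6 = 8 * x^2" unfolding C1_def x_def by algebra
 ultimately show "real (4 * t1) \<le> C1 * \<beta> ^ 6" by simp
qed

text \<open>For the identity prior the logarithms telescope to ln D, which is at most d ln (1 + t).
  Up to 4 t1, of order \<beta>^6, this is at most linear in \<beta>, and the hypothesis on \<beta>
  makes \<sigma>^2 times it a small fraction of \<beta>^2.\<close>

lemma error_early:
 assumes t: "t \<le> T" "t \<le> 4 * t1" and run: "ucb_run (\<lambda>s. a s \<omega>) (\<lambda>t. \<theta>hat t \<omega>) \<theta> \<beta> t U \<mu> (real CARD('n))"
 shows "sq_error \<omega> t \<le> (\<beta> / (200 * A^2))^2"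
proof -
 interpret R: ucb_run "\<lambda>s. a s \<omega>" "\<lambda>t. \<theta>hat t \<omega>" \<theta> \<beta> t U \<mu> "real CARD('n)" by (rule run)
 define X where "X = \<beta> / (400 * A^2)"
 have sum: "(\<Sum>s<k. ln (1 + prior_width (mat 1) (\<lambda>s. a s \<omega>) s)) = ln (R.D k)" if "k \<le> t" for k using that
 proof (induction k)
  case 0
  show ?case by (simp add: R.D_def gram_0)
 next
  case (Suc k)
  have "spd (mat 1 :: real ^ 'n ^ 'n)" by (simp add: spd_def transpose_mat)
  hence w: "prior_width (mat 1) (\<lambda>s. a s \<omega>) k = R.w k" by (simp add: prior_width_def R.w_def prior_inv prior_gram_one)
  have "0 < R.w k" using R.stepD(4)[of k] Suc.prems by simp
  hence "ln (R.D (Suc k)) = ln (R.D k) + ln (1 + R.w k)" unfolding R.D_Suc using R.D_ge_1[of k] by (intro ln_mult_pos) linarith+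
  thus ?case using Suc by (simp add: w)
 qed
 have b1: "1 \<le> \<beta>" by (rule large_parts(4))
 have "1 + real t \<le> ((1 + C1) * \<beta>) ^ 6"
 proof -
  have "real t \<le> C1 * \<beta> ^ 6" using t(2) t1_bounds(2) by linarith
  moreover have "1 \<le> \<beta> ^ 6" using b1 by simp
  ultimately have "1 + real t \<le> (1 + C1) * \<beta> ^ 6" by (simp add: distrib_right)
  also have "... \<le> (1 + C1) ^ 6 * \<beta> ^ 6" using C1_nonneg b1 power_increasing[of 1 6 "1 + C1"] by (intro mult_right_mono) auto
  finally show ?thesis by (simp add: power_mult_distrib)
 qed
 hence "ln (1 + real t) \<le> ln (((1 + C1) * \<beta>) ^ 6)" by (subst ln_le_cancel_iff) (use C1_nonneg b1 in auto)
 also have "... = 6 * ln ((1 + C1) * \<beta>)" using C1_nonneg b1 by (subst ln_realpow) auto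
 also have "... \<le> 6 * ((1 + C1) * \<beta>)" using C1_nonneg b1 ln_le_minus_one[of "(1 + C1) * \<beta>"] by simp
 finally have l: "ln (1 + real t) \<le> 6 * ((1 + C1) * \<beta>)" .
 have "ln (R.D t) \<le> ln ((1 + real t) ^ CARD('n))" using R.D_le_pow[of t] R.D_ge_1[of t] by simp
 also have "... = real CARD('n) * ln (1 + real t)" by (simp add: ln_realpow)
 also have "... \<le> real CARD('n) * (6 * ((1 + C1) * \<beta>))" using l by (intro mult_left_mono) auto
 finally have D: "ln (R.D t) \<le> real CARD('n) * (6 * ((1 + C1) * \<beta>))" .
 have "noise_sum t \<omega> \<bullet> (matrix_inv (gram (\<lambda>s. a s \<omega>) t) *v noise_sum t \<omega>) \<le> \<sigma>^2 * (6 * loglog + ln (R.D t))"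
  unfolding sum[OF order_refl, symmetric] using one t(1) unfolding controlled_def self_normalized_one by blast
 also have "... \<le> \<sigma>^2 * (6 * loglog + real CARD('n) * (6 * ((1 + C1) * \<beta>)))" using D by (intro mult_left_mono) auto
 also have "... = 6 * (\<sigma>^2 * loglog) + (6 * (\<sigma>^2 * real CARD('n) * (1 + C1))) * \<beta>" by (simp add: algebra_simps)
 also have "... \<le> X^2 / 2 + X^2 / 2"
 proof (rule add_mono)
  have X2: "X^2 = \<beta>^2 / (160000 * A ^ 4)" by (simp add: X_def power_divide power_mult_distrib flip: power_mult)
  have "(1800 * A ^ 3 * scale)^2 \<le> \<beta>^2" using large_parts(1) run_consts scale(2) by (intro power_mono) auto
  hence "A ^ 6 * (3240000 * scale^2) \<le> \<beta>^2" by (simp add: power_mult_distrib mult_ac flip: power_mult)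
  moreover have "A ^ 4 * (3240000 * scale^2) \<le> A ^ 6 * (3240000 * scale^2)" using run_consts(1) by (intro mult_right_mono power_increasing) auto
  ultimately have "A ^ 4 * (3240000 * scale^2) \<le> \<beta>^2" by linarith
  moreover have "A ^ 4 * (1920000 * scale^2) \<le> A ^ 4 * (3240000 * scale^2)"
   using run_consts(1) by (intro mult_left_mono mult_right_mono) auto
  ultimately have "A ^ 4 * (1920000 * scale^2) \<le> \<beta>^2" by linarith
  hence "6 * scale^2 \<le> X^2 / 2" unfolding X2 using run_consts(1) by (simp add: field_simps)
  thus "6 * (\<sigma>^2 * loglog) \<le> X^2 / 2" using scale(3) by linarith
  have "A ^ 4 * (1920000 * (\<sigma>^2 * real CARD('n) * (1 + C1))) * \<beta> \<le> \<beta> * \<beta>"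
   using large_parts(2) beta_pos by (intro mult_right_mono) (simp_all add: mult_ac)
  thus "(6 * (\<sigma>^2 * real CARD('n) * (1 + C1))) * \<beta> \<le> X^2 / 2"
   unfolding X2 using run_consts(1) by (simp add: field_simps power2_eq_square)
 qed
 also have "... = X^2" by simp
 finally have "sq_error \<omega> t \<le> (X + 1)^2" using run_consts b1 by (intro sq_error_le[OF \<omega> t(1)]) (auto simp: X_def)
 also have "... \<le> (\<beta> / (200 * A^2))^2"
 proof (rule power_mono)
  have "400 * A^2 \<le> 1800 * A ^ 3 * scale"
   using run_consts(1) scale(2) power_increasing[of 2 3 A] mult_mono[of "400 * A^2" "1800 * A ^ 3" 1 scale] by simp
  hence "400 * A^2 \<le> \<beta>" using large_parts(1) by linarith
  hence "1 \<le> X" using run_consts(1) by (simp add: X_def)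
  moreover have "\<beta> / (200 * A^2) = 2 * X" by (simp add: X_def)
  ultimately show "X + 1 \<le> \<beta> / (200 * A^2)" by linarith
 qed (use run_consts b1 in \<open>simp add: X_def\<close>)
 finally show ?thesis .
qed

text \<open>The crude error bound already permits \<open>ucb_fine\<close> with N = \<beta> / (200
  A^2), which bounds the Gram matrix along \<theta> and on the complement. The dyadic prior at the
  scale of \<open>t\<close> is then at most a constant times the Gram matrix, the widths add up to a
  constant, and the error improves to order \<open>scale\<close>.\<close>

lemma error_late:
 assumes t: "t < T" "4 * t1 \<le> t" and run: "ucb_run (\<lambda>s. a s \<omega>) (\<lambda>t. \<theta>hat t \<omega>) \<theta> \<beta> t U \<mu> (real CARD('n))"
  and err: "\<And>s. s < t \<Longrightarrow> sq_error \<omega> s \<le> (\<beta> / (200 * A^2))^2"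
 shows "sq_error \<omega> t \<le> (9 * A * scale)^2"
proof -
 have b1: "1 \<le> \<beta>" by (rule large_parts(4))
 have bA: "200 * A^2 \<le> \<beta>"
 proof -
  have "200 * A^2 \<le> 1800 * A ^ 3 * scale"
   using run_consts(1) scale(2) power_increasing[of 2 3 A] mult_mono[of "200 * A^2" "1800 * A ^ 3" 1 scale] by simp
  thus ?thesis using large_parts(1) by linarith
 qed
 interpret R: ucb_run "\<lambda>s. a s \<omega>" "\<lambda>t. \<theta>hat t \<omega>" \<theta> \<beta> t U \<mu> "real CARD('n)" by (rule run)
 interpret R: ucb_fine "\<lambda>s. a s \<omega>" "\<lambda>t. \<theta>hat t \<omega>" \<theta> \<beta> t U \<mu> "real CARD('n)" "ridge (\<lambda>s. a s \<omega>) (\<lambda>s. r s \<omega>)" "\<beta> / (200 * A^2)" t1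
 proof
  show "is_projected (ridge (\<lambda>s. a s \<omega>) (\<lambda>s. r s \<omega>) s) (\<theta>hat s \<omega>)" if "s < t" for s
   using estimator_projected[of s \<omega>] that t(1) \<omega> by simp
  show "(ridge (\<lambda>s. a s \<omega>) (\<lambda>s. r s \<omega>) s - \<theta>) \<bullet> (gram (\<lambda>s. a s \<omega>) s *v (ridge (\<lambda>s. a s \<omega>) (\<lambda>s. r s \<omega>) s - \<theta>)) \<le> (\<beta> / (200 * A^2))^2"
   if "s < t" for s using err[OF that] by (simp add: sq_error_def)
  show "1 \<le> \<beta>" by (rule b1)
  show "1 \<le> \<beta> / (200 * A^2)" using bA run_consts(1) by simp
  show "200 * (ucb_run.A1 (real CARD('n)))^2 * (\<beta> / (200 * A^2)) \<le> \<beta>" using run_consts(1) by (simp add: A_def[symmetric])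
  show "(10 ^ 4 * (ucb_run.A1 (real CARD('n)))^2 * ucb_run.K0 (real CARD('n)) * \<beta> ^ 3)^2 \<le> real t1"
   using t1_bounds(1) by (simp add: A_def[symmetric] K0_def[symmetric])
 qed
 define g where "g = gram (\<lambda>s. a s \<omega>) t"
 have tt: "t1 \<le> t" using t(2) by simp
 have tp: "1 \<le> real t" by (rule R.t_pos[OF tt])
 have tr: "R.tr_perp t \<le> A * (\<beta> * sqrt (real t))" and mi: "\<beta> * sqrt (real t) \<le> A * R.mineig t"
  using R.crude_t(1,2)[OF tt order_refl] by (simp_all add: A_def)
 have c: "real t / 2 \<le> R.c t" by (rule R.c_half[OF t(2) order_refl])
 obtain k where k: "2 ^ k \<le> t" "t < 2 ^ (k + 1)" using ex_power_ivl1[of 2 t] tp by auto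
 define p where "p = (2::real) ^ k"
 have p: "0 < p" "p \<le> real t" "real t \<le> 2 * p"
 proof -
  have "real (2 ^ k) \<le> real t" "real t < real (2 ^ (k + 1))" using k by (simp_all only: of_nat_le_iff of_nat_less_iff)
  thus "p \<le> real t" "real t \<le> 2 * p" by (simp_all add: p_def)
 qed (simp add: p_def)
 have D: "z \<bullet> (dyadic_prior k *v z) \<le> (2 + A) * (z \<bullet> (g *v z))" for z
 proof -
  have gn: "0 \<le> z \<bullet> (g *v z)" unfolding g_def by (rule spd_nonneg[OF spd_gram])
  have cp: "0 < R.c t" by (rule R.c_pos)
  have "(z \<bullet> \<theta>)^2 \<le> (z \<bullet> (g *v z)) * (1 / R.c t)"
  proof -
   define q where "q = matrix_inv g *v \<theta>"
   have "g *v q = \<theta>" by (simp add: q_def g_def spd_inverse[OF spd_gram])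
   moreover have "q \<bullet> (g *v q) = 1 / R.c t" using R.c_inv[of t] \<open>g *v q = \<theta>\<close> by (simp add: q_def g_def inner_commute)
   ultimately show ?thesis using spd_cauchy_schwarz[OF spd_gram, of z "\<lambda>s. a s \<omega>" t q] by (simp add: g_def)
  qed
  also have "... \<le> (z \<bullet> (g *v z)) * (2 / real t)" using c cp tp gn by (intro mult_left_mono) (auto simp: field_simps)
  finally have 1: "real t * (z \<bullet> \<theta>)^2 \<le> 2 * (z \<bullet> (g *v z))" using tp by (simp add: field_simps)
  have pz: "(norm (z - (z \<bullet> \<theta>) *\<^sub>R \<theta>))^2 \<le> (norm z)^2" by (simp add: norm_perp[OF theta_norm p(1) p(1)])
  have "z \<bullet> (dyadic_prior k *v z) = p * (z \<bullet> \<theta>)^2 + \<beta> * sqrt p * (norm (z - (z \<bullet> \<theta>) *\<^sub>R \<theta>))^2"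
   unfolding dyadic_prior_def p_def using beta_pos by (intro split_prior_form theta_norm) auto
  also have "... \<le> real t * (z \<bullet> \<theta>)^2 + \<beta> * sqrt (real t) * (norm z)^2" using p pz beta_pos by (intro add_mono mult_mono) auto
  also have "... \<le> 2 * (z \<bullet> (g *v z)) + A * (z \<bullet> (g *v z))"
  proof (rule add_mono[OF 1])
   have "\<beta> * sqrt (real t) * (norm z)^2 \<le> A * R.mineig t * (norm z)^2" using mi by (intro mult_right_mono) auto
   also have "... = A * (R.mineig t * (norm z)^2)" by simp
   also have "... \<le> A * (z \<bullet> (g *v z))" using R.mineig_form[of t z] run_consts(1) unfolding g_def by (intro mult_left_mono) auto
   finally show "\<beta> * sqrt (real t) * (norm z)^2 \<le> A * (z \<bullet> (g *v z))" .
  qed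
  also have "... = (2 + A) * (z \<bullet> (g *v z))" by (simp add: distrib_right)
  finally show ?thesis .
 qed
 define S where "S = (\<Sum>s=1..t. (a s \<omega> \<bullet> \<theta>)^2 / 2 ^ k + (norm (a s \<omega> - (a s \<omega> \<bullet> \<theta>) *\<^sub>R \<theta>))^2 / (\<beta> * sqrt (2 ^ k)))"
 have S: "S \<le> 2 + 2 * A"
 proof -
  have "S = (\<Sum>s=1..t. (a s \<omega> \<bullet> \<theta>)^2) / p + (\<Sum>s=1..t. (norm (R.y s))^2) / (\<beta> * sqrt p)"
   by (simp add: S_def p_def sum.distrib sum_divide_distrib R.y_def)
  moreover have "(\<Sum>s=1..t. (a s \<omega> \<bullet> \<theta>)^2) / p \<le> 2"
  proof -
   have "(\<Sum>s=1..t. (a s \<omega> \<bullet> \<theta>)^2) \<le> (\<Sum>s=1..t. 1)"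
   proof (rule sum_mono)
    fix s assume "s \<in> {1..t}"
    hence "norm (a s \<omega>) = 1" by (rule R.norm_a)
    hence "\<bar>a s \<omega> \<bullet> \<theta>\<bar> \<le> 1" using Cauchy_Schwarz_ineq2[of "a s \<omega>" \<theta>] theta_norm by simp
    thus "(a s \<omega> \<bullet> \<theta>)^2 \<le> 1" by (simp add: abs_square_le_1)
   qed
   thus ?thesis using p by (simp add: pos_divide_le_eq)
  qed
  moreover have "(\<Sum>s=1..t. (norm (R.y s))^2) / (\<beta> * sqrt p) \<le> 2 * A"
  proof -
   have "(\<Sum>s=1..t. (norm (R.y s))^2) \<le> R.tr_perp t" using dim by (simp add: R.tr_perp_def)
   also have "... \<le> A * (\<beta> * sqrt (real t))" by (rule tr)
   also have "... \<le> A * (\<beta> * (2 * sqrt p))"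
   proof -
    have "sqrt (real t) \<le> sqrt (4 * p)" using p by (intro real_sqrt_le_mono) linarith
    thus ?thesis using run_consts(1) beta_pos by (intro mult_left_mono) (auto simp: real_sqrt_mult)
   qed
   also have "... = 2 * A * (\<beta> * sqrt p)" by simp
   finally show ?thesis using beta_pos p(1) by (simp add: pos_divide_le_eq)
  qed
  ultimately show ?thesis by linarith
 qed
 have kT: "2 ^ k \<le> T" using k(1) t(1) by simp
 have "sq_error \<omega> t \<le> (sqrt ((1 + (2 + A)) * (\<sigma>^2 * (6 * loglog + S))) + 1)^2"
  unfolding S_def using t(1) run_consts(1) D unfolding g_def by (intro sq_error_prior[OF \<omega> dyadic[rule_format, OF kT]]) auto
 also have "... \<le> (9 * A * scale)^2"
 proof (rule power_mono)
  have "6 * loglog + S \<le> 10 * A * loglog"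
  proof -
   have "2 + 2 * A \<le> 4 * A * 1" using run_consts(1) by simp
   also have "... \<le> 4 * A * loglog" using run_consts(1) loglog_ge(1) by (intro mult_left_mono) auto
   finally have "S \<le> 4 * A * loglog" using S by linarith
   moreover have "6 * loglog * 1 \<le> 6 * loglog * A" using run_consts(1) loglog_ge(1) by (intro mult_left_mono) auto
   ultimately show ?thesis by (simp add: mult_ac)
  qed
  hence "(1 + (2 + A)) * (\<sigma>^2 * (6 * loglog + S)) \<le> (4 * A) * (\<sigma>^2 * (10 * A * loglog))"
   using run_consts(1) loglog_ge(1) by (intro mult_mono[of "1 + (2 + A)"] mult_left_mono) (auto simp: S_def beta_pos less_imp_le intro!: mult_nonneg_nonneg add_nonneg_nonneg sum_nonneg)
  also have "... = 40 * (A^2 * (\<sigma>^2 * loglog))" by (simp add: power2_eq_square)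
  also have "... \<le> 49 * (A^2 * (\<sigma>^2 * loglog))" using loglog_ge(1) by (intro mult_right_mono) auto
  also have "... = (7 * A * (\<sigma> * sqrt loglog))^2" using loglog_ge(1) by (simp add: power_mult_distrib)
  finally have "sqrt ((1 + (2 + A)) * (\<sigma>^2 * (6 * loglog + S))) \<le> 7 * A * (\<sigma> * sqrt loglog)"
   using run_consts(1) sigma_pos loglog_ge(1) by (intro real_le_lsqrt) auto
  also have "... = 7 * A * scale - 7 * A" unfolding scale(1) by (simp add: algebra_simps)
  finally show "sqrt ((1 + (2 + A)) * (\<sigma>^2 * (6 * loglog + S))) + 1 \<le> 9 * A * scale"
   using run_consts(1) scale(2) mult_mono[of 1 A 1 scale] by simp
 qed (use run_consts(1) loglog_ge(1) beta_pos in \<open>auto simp: S_def intro!: add_nonneg_nonneg mult_nonneg_nonneg sum_nonneg\<close>)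
 finally show ?thesis .
qed

lemma radius_le: "(\<beta> / (200 * A^2))^2 \<le> \<beta>^2"
proof (rule power_mono)
 have k: "1 \<le> 200 * A^2" using one_le_power[OF run_consts(1), of 2] by linarith
 thus "\<beta> / (200 * A^2) \<le> \<beta>" using mult_left_mono[OF k, of \<beta>] beta_pos by (simp add: divide_le_eq)
qed (use beta_pos in simp)

text \<open>Strong induction: the run up to round \<open>t\<close> uses errors of earlier rounds
  only, so its bounds on the Gram matrix may be used to estimate the error in round
  \<open>t\<close>.\<close>

lemma error_bounds:
 assumes step: "\<And>t. t < T \<Longrightarrow> ucb_step (gram (\<lambda>s. a s \<omega>) t) \<beta> (\<theta>hat t \<omega>) (a (Suc t) \<omega>) (U t) (\<mu> t)"
 shows "t < T \<Longrightarrow> sq_error \<omega> t \<le> (\<beta> / (200 * A^2))^2 \<and> (4 * t1 \<le> t \<longrightarrow> sq_error \<omega> t \<le> (9 * A * scale)^2)"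
proof (induction t rule: less_induct)
 case (less t)
 have run: "ucb_run (\<lambda>s. a s \<omega>) (\<lambda>t. \<theta>hat t \<omega>) \<theta> \<beta> t U \<mu> (real CARD('n))"
 proof (rule ucb_run_of_errors[OF \<omega> _ step])
  fix s k assume s: "s < t" and k: "0 < k" "\<And>x. k * (norm x)^2 \<le> x \<bullet> (gram (\<lambda>s. a s \<omega>) s *v x)"
  have "sq_error \<omega> s \<le> (\<beta> / (200 * A^2))^2" using less s by simp
  also have "... \<le> \<beta>^2" by (rule radius_le)
  finally show "norm (\<theta>hat s \<omega> - \<theta>) \<le> 2 * \<beta> / sqrt k" using s less.prems by (intro error_radius[OF \<omega> _ _ k]) auto
 qed (use less.prems in auto)
 have small: "(9 * A * scale)^2 \<le> (\<beta> / (200 * A^2))^2"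
 proof (rule power_mono)
  have "9 * A * scale * (200 * A^2) = 1800 * A ^ 3 * scale" by algebra
  moreover have "0 < 200 * A^2" using run_consts(1) by simp
  ultimately show "9 * A * scale \<le> \<beta> / (200 * A^2)" using large_parts(1) by (simp only: pos_le_divide_eq)
 qed (use run_consts(1) scale(2) in simp)
 show ?case
 proof (cases "4 * t1 \<le> t")
  case True
  have "sq_error \<omega> t \<le> (9 * A * scale)^2" by (rule error_late[OF less.prems True run]) (use less in simp)
  thus ?thesis using small by linarith
 next
  case False
  thus ?thesis using error_early[OF _ _ run] less.prems by simp
 qed
qed

text \<open>The analysis is repeated with the improved error 9 A scale, valid from round 4 t1 on.
  The power A^21 in the hypothesis on \<beta> is what turns the smallness condition on \<kappa> in
  \<open>ucb_small\<close> into a condition on scale / \<beta>.\<close>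

lemma large_spectrum:
 assumes t: "10 ^ 15 * A ^ 14 * C1 * \<beta> ^ 8 \<le> real t" "t \<le> T" "1 \<le> t"
 shows "\<exists>\<xi>. eigval (gram (\<lambda>s. a s \<omega>) t) 2 = (1 + \<xi>) * eigval (gram (\<lambda>s. a s \<omega>) t) CARD('n) \<and> \<bar>\<xi>\<bar> \<le> 54 * 10 ^ 7 * A ^ 7 * (scale / \<beta>)"
  and "i \<in> {2..CARD('n)} \<Longrightarrow> \<bar>eigval (gram (\<lambda>s. a s \<omega>) t) i / sqrt (2 * \<beta>^2 * real t / (real CARD('n) + 1)) - 1\<bar> \<le>
   2 * A ^ 3 * (10 ^ 15 * A ^ 14 * C1 * \<beta> ^ 8 / real t) powr ((real CARD('n) + 1) / (real CARD('n) - 1)) + 600000 * A ^ 8 * (sqrt scale / sqrt \<beta>)"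
proof -
 obtain U \<mu> where step: "\<forall>t<T. ucb_step (gram (\<lambda>s. a s \<omega>) t) \<beta> (\<theta>hat t \<omega>) (a (Suc t) \<omega>) (U t) (\<mu> t)"
  using run_steps[OF \<omega>] by blast
 have errs: "sq_error \<omega> t \<le> (\<beta> / (200 * A^2))^2 \<and> (4 * t1 \<le> t \<longrightarrow> sq_error \<omega> t \<le> (9 * A * scale)^2)" if "t < T" for t
  by (rule error_bounds[of U \<mu>]) (use step that in auto)
 have run: "ucb_run (\<lambda>s. a s \<omega>) (\<lambda>t. \<theta>hat t \<omega>) \<theta> \<beta> T U \<mu> (real CARD('n))"
 proof (rule ucb_run_of_errors[OF \<omega> order_refl step[rule_format]])
  fix s k assume s: "s < T" and k: "0 < k" "\<And>x. k * (norm x)^2 \<le> x \<bullet> (gram (\<lambda>s. a s \<omega>) s *v x)"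
  have "sq_error \<omega> s \<le> (\<beta> / (200 * A^2))^2" using errs[OF s] by simp
  also have "... \<le> \<beta>^2" by (rule radius_le)
  finally show "norm (\<theta>hat s \<omega> - \<theta>) \<le> 2 * \<beta> / sqrt k" by (rule error_radius[OF \<omega> s _ k])
 qed
 interpret R: ucb_run "\<lambda>s. a s \<omega>" "\<lambda>t. \<theta>hat t \<omega>" \<theta> \<beta> T U \<mu> "real CARD('n)" by (rule run)
 interpret R: ucb_fine "\<lambda>s. a s \<omega>" "\<lambda>t. \<theta>hat t \<omega>" \<theta> \<beta> T U \<mu> "real CARD('n)" "ridge (\<lambda>s. a s \<omega>) (\<lambda>s. r s \<omega>)" "9 * A * scale" "4 * t1"
 proof
  show "is_projected (ridge (\<lambda>s. a s \<omega>) (\<lambda>s. r s \<omega>) s) (\<theta>hat s \<omega>)" if "s < T" for s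
   using estimator_projected[of s \<omega>] that \<omega> by simp
  show "(ridge (\<lambda>s. a s \<omega>) (\<lambda>s. r s \<omega>) s - \<theta>) \<bullet> (gram (\<lambda>s. a s \<omega>) s *v (ridge (\<lambda>s. a s \<omega>) (\<lambda>s. r s \<omega>) s - \<theta>)) \<le> (9 * A * scale)^2"
   if "4 * t1 \<le> s" "s < T" for s using errs[OF that(2)] that(1) by (simp add: sq_error_def)
  show "1 \<le> \<beta>" by (rule large_parts(4))
  show "1 \<le> 9 * A * scale" using mult_mono[of 1 "9 * A" 1 scale] run_consts(1) scale(2) by simp
  have "200 * A^2 * (9 * A * scale) = 1800 * A ^ 3 * scale" by algebra
  thus "200 * (ucb_run.A1 (real CARD('n)))^2 * (9 * A * scale) \<le> \<beta>"  unfolding A_def[symmetric] using large_parts(1) by linarith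
  show "(10 ^ 4 * (ucb_run.A1 (real CARD('n)))^2 * ucb_run.K0 (real CARD('n)) * \<beta> ^ 3)^2 \<le> real (4 * t1)"
   using t1_bounds(1) by (simp add: A_def[symmetric] K0_def[symmetric])
 qed
 have \<epsilon>: "R.\<epsilon> = 9 * A * (scale / \<beta>)" by (simp add: R.\<epsilon>_def)
 have sp: "0 < scale / \<beta>" using scale(2) beta_pos by simp
 interpret R: ucb_small "\<lambda>s. a s \<omega>" "\<lambda>t. \<theta>hat t \<omega>" \<theta> \<beta> T U \<mu> "real CARD('n)" "ridge (\<lambda>s. a s \<omega>) (\<lambda>s. r s \<omega>)" "9 * A * scale" "4 * t1"
 proof
  have "(10 ^ 16 * A ^ 10 * R.\<kappa>)^2 = 10 ^ 32 * A ^ 20 * R.\<epsilon>" unfolding R.\<kappa>(2)[symmetric] by algebra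
  also have "... = 9 * 10 ^ 32 * A ^ 21 * (scale / \<beta>)" unfolding \<epsilon> by algebra
  also have "... \<le> 1" using large_parts(3) beta_pos by (simp add: pos_divide_le_eq)
  finally have "(10 ^ 16 * A ^ 10 * R.\<kappa>)^2 \<le> 1^2" by simp
  hence "10 ^ 16 * A ^ 10 * R.\<kappa> \<le> 1" by (rule power2_le_imp_le) simp
  thus "10 ^ 16 * ucb_run.A1 (real CARD('n)) ^ 10 * R.\<kappa> \<le> 1" by (simp add: A_def)
 qed
 have "real R.\<tau>3 \<le> 10 ^ 15 * A ^ 14 * \<beta>^2 * real (4 * t1)" unfolding A_def by (rule R.\<tau>3(3))
 also have "... \<le> 10 ^ 15 * A ^ 14 * \<beta>^2 * (C1 * \<beta> ^ 6)" using t1_bounds(2) run_consts(1) by (intro mult_left_mono) auto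
 also have "... = 10 ^ 15 * A ^ 14 * C1 * \<beta> ^ 8" by algebra
 finally have \<tau>: "real R.\<tau>3 \<le> 10 ^ 15 * A ^ 14 * C1 * \<beta> ^ 8" .
 hence \<tau>t: "R.\<tau>3 \<le> t" using t(1) by linarith
 have n: "6 * R.\<nu> = 54 * 10 ^ 7 * A ^ 7 * (scale / \<beta>)" unfolding R.\<nu>_def[OF \<tau>t t(2)] \<epsilon> A_def[symmetric] by algebra
 show "\<exists>\<xi>. eigval (gram (\<lambda>s. a s \<omega>) t) 2 = (1 + \<xi>) * eigval (gram (\<lambda>s. a s \<omega>) t) CARD('n) \<and> \<bar>\<xi>\<bar> \<le> 54 * 10 ^ 7 * A ^ 7 * (scale / \<beta>)"
  using R.eigval_ratio[OF \<tau>t t(2)] unfolding n .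
 assume i: "i \<in> {2..CARD('n)}"
 define e where "e = (real CARD('n) + 1) / (real CARD('n) - 1)"
 have e: "0 \<le> e" using dim by (simp add: e_def)
 have "(real R.\<tau>3 / real t) powr e \<le> (10 ^ 15 * A ^ 14 * C1 * \<beta> ^ 8 / real t) powr e"
  using \<tau> e t(3) by (intro powr_mono2 divide_right_mono) auto
 hence 1: "2 * A ^ 3 * (real R.\<tau>3 / real t) powr e \<le> 2 * A ^ 3 * (10 ^ 15 * A ^ 14 * C1 * \<beta> ^ 8 / real t) powr e"
  using run_consts(1) by (intro mult_left_mono) auto
 have "R.\<kappa> = 3 * sqrt A * (sqrt scale / sqrt \<beta>)" unfolding R.\<kappa>_def \<epsilon> by (simp add: real_sqrt_mult real_sqrt_divide)
 also have "... \<le> 3 * A * (sqrt scale / sqrt \<beta>)"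
 proof -
  have "sqrt A \<le> A" using run_consts(1) by (simp add: real_le_lsqrt power2_eq_square)
  thus ?thesis using scale(2) beta_pos by (intro mult_right_mono mult_left_mono) auto
 qed
 finally have "200000 * A ^ 7 * R.\<kappa> \<le> 200000 * A ^ 7 * (3 * A * (sqrt scale / sqrt \<beta>))" using run_consts(1) by (intro mult_left_mono) auto
 also have "... = 600000 * A ^ 8 * (sqrt scale / sqrt \<beta>)" by algebra
 finally show "\<bar>eigval (gram (\<lambda>s. a s \<omega>) t) i / sqrt (2 * \<beta>^2 * real t / (real CARD('n) + 1)) - 1\<bar> \<le>
   2 * A ^ 3 * (10 ^ 15 * A ^ 14 * C1 * \<beta> ^ 8 / real t) powr ((real CARD('n) + 1) / (real CARD('n) - 1)) + 600000 * A ^ 8 * (sqrt scale / sqrt \<beta>)"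
  using R.eigval_benchmark[OF \<tau>t t(2) i] 1 unfolding e_def A_def[symmetric] by linarith
qed

end

section \<open>Measurability of the claim and the two events that imply it\<close>

lemma gram_measurable: "t \<le> T \<Longrightarrow> (\<lambda>\<omega>. gram (\<lambda>s. a s \<omega>) t) \<in> borel_measurable M" unfolding gram_def
 by (intro borel_measurable_add borel_measurable_const borel_measurable_sum borel_measurable_outer_square action_measurable_M) auto

lemma eigval_gram_measurable: "t \<le> T \<Longrightarrow> i \<in> {1..CARD('n)} \<Longrightarrow> (\<lambda>\<omega>. eigval (gram (\<lambda>s. a s \<omega>) t) i) \<in> borel_measurable M"
 by (rule eigval_measurable[OF gram_measurable]) (auto intro: spd_sym[OF spd_gram])

end

text \<open>Replaces the existential quantifiers, whose witnesses depend on the sample point, by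
  inequalities between measurable functions.\<close>

lemma relative_error_iff:
 fixes x y b :: real
 assumes "y > 0"
 shows "(\<exists>\<xi>. x = (1 + \<xi>) * y \<and> (P \<longrightarrow> \<bar>\<xi>\<bar> \<le> b)) \<longleftrightarrow> (P \<longrightarrow> \<bar>x - y\<bar> \<le> b * y)"
proof -
 have e: "x = (1 + \<xi>) * y \<longleftrightarrow> \<xi> = (x - y) / y" for \<xi> using assms by (auto simp: field_simps)
 have "\<bar>(x - y) / y\<bar> \<le> b \<longleftrightarrow> \<bar>x - y\<bar> \<le> b * y" using assms by (simp add: abs_divide pos_divide_le_eq)
 thus ?thesis unfolding e by simp
qed

context linucb
begin

definition benchmark :: "nat \<Rightarrow> real" where
 "benchmark t = sqrt (2 * \<beta>^2 * real t / (real CARD('n) + 1))"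

lemma benchmark_pos: "1 \<le> t \<Longrightarrow> 0 < benchmark t" using beta_pos by (simp add: benchmark_def)

definition spectral_bound :: "real \<Rightarrow> real \<Rightarrow> bool \<Rightarrow> (nat \<Rightarrow> real) \<Rightarrow> 'w \<Rightarrow> bool" where
 "spectral_bound t\<^sub>3 b P \<Gamma> \<omega> \<longleftrightarrow> (\<forall>t\<in>{1..T}. t\<^sub>3 \<le> real t \<longrightarrow>
   (\<exists>\<xi>. eigval (gram (\<lambda>s. a s \<omega>) t) 2 = (1 + \<xi>) * eigval (gram (\<lambda>s. a s \<omega>) t) CARD('n) \<and> \<bar>\<xi>\<bar> \<le> b) \<and>
   (\<forall>i\<in>{2..CARD('n)}. \<exists>\<Delta>. eigval (gram (\<lambda>s. a s \<omega>) t) i = (1 + \<Delta>) * benchmark t \<and> (P \<longrightarrow> \<bar>\<Delta>\<bar> \<le> \<Gamma> t)))"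

lemma spectral_bound_sets: "{\<omega> \<in> space M. spectral_bound t\<^sub>3 b P \<Gamma> \<omega>} \<in> sets M"
proof -
 have pos: "0 < eigval (gram (\<lambda>s. a s \<omega>) t) CARD('n)" for \<omega> t
  using eigval_ge[OF spd_sym[OF spd_gram], of "CARD('n)" 1 "\<lambda>s. a s \<omega>" t] gram_ge[of _ "\<lambda>s. a s \<omega>" t] dim by fastforce
 have eq: "spectral_bound t\<^sub>3 b P \<Gamma> \<omega> \<longleftrightarrow> (\<forall>t\<in>{1..T}. t\<^sub>3 \<le> real t \<longrightarrow>
   \<bar>eigval (gram (\<lambda>s. a s \<omega>) t) 2 - eigval (gram (\<lambda>s. a s \<omega>) t) CARD('n)\<bar> \<le> b * eigval (gram (\<lambda>s. a s \<omega>) t) CARD('n) \<and>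
   (\<forall>i\<in>{2..CARD('n)}. P \<longrightarrow> \<bar>eigval (gram (\<lambda>s. a s \<omega>) t) i - benchmark t\<bar> \<le> \<Gamma> t * benchmark t))" for \<omega>
  unfolding spectral_bound_def
  using relative_error_iff[OF pos, where P = True] by (auto simp: relative_error_iff[OF benchmark_pos])
 show ?thesis unfolding eq
  using dim horizon by (intro sets.sets_Collect_finite_All' sets.sets_Collect_imp sets.sets_Collect_const sets.sets_Collect_conj
    borel_measurable_le borel_measurable_abs borel_measurable_diff borel_measurable_times eigval_gram_measurable borel_measurable_const) auto
qed

lemma noise_event_bound:
 fixes A K0 C1
 defines "A \<equiv> ucb_run.A1 (real CARD('n))" and "K0 \<equiv> ucb_run.K0 (real CARD('n))"
 defines "C1 \<equiv> 8 * (10 ^ 4 * A^2 * K0)^2"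
 assumes large: "(1800 * A ^ 3 + 1920000 * A ^ 4 * \<sigma>^2 * real CARD('n) * (1 + C1) + 9 * 10 ^ 32 * A ^ 21) * scale \<le> \<beta>"
  and t3: "10 ^ 15 * A ^ 14 * C1 * \<beta> ^ 8 \<le> t\<^sub>3"
  and b: "54 * 10 ^ 7 * A ^ 7 * (scale / \<beta>) \<le> b"
  and \<Gamma>: "\<And>t. 1 \<le> t \<Longrightarrow> 2 * A ^ 3 * (10 ^ 15 * A ^ 14 * C1 * \<beta> ^ 8 / real t) powr ((real CARD('n) + 1) / (real CARD('n) - 1)) + 600000 * A ^ 8 * (sqrt scale / sqrt \<beta>) \<le> \<Gamma> t"
 shows "1 - 1 / ln (real T) \<le> measure M {\<omega> \<in> space M. spectral_bound t\<^sub>3 b P \<Gamma> \<omega>}"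
proof -
 obtain G where G: "G \<in> sets M" "measure M G \<ge> 1 - 1 / ln (real T)"
  "\<And>\<omega>. \<omega> \<in> G \<Longrightarrow> \<omega> \<in> space M \<and> controlled (mat 1) \<omega> \<and> (\<forall>k. 2 ^ k \<le> T \<longrightarrow> controlled (dyadic_prior k) \<omega>)" using good_event by blast
 have "G \<subseteq> {\<omega> \<in> space M. spectral_bound t\<^sub>3 b P \<Gamma> \<omega>}"
 proof (intro subsetI CollectI conjI)
  fix \<omega> assume "\<omega> \<in> G"
  hence \<omega>: "\<omega> \<in> space M" "controlled (mat 1) \<omega>" "\<forall>k. 2 ^ k \<le> T \<longrightarrow> controlled (dyadic_prior k) \<omega>" using G(3) by auto
  show "\<omega> \<in> space M" by (rule \<omega>(1))
  show "spectral_bound t\<^sub>3 b P \<Gamma> \<omega>" unfolding spectral_bound_def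
  proof (intro ballI impI conjI)
   fix t assume t: "t \<in> {1..T}" "t\<^sub>3 \<le> real t"
   have t': "10 ^ 15 * A ^ 14 * C1 * \<beta> ^ 8 \<le> real t" "t \<le> T" "1 \<le> t" using t t3 by auto
   note L = large_spectrum[OF \<omega> large[unfolded C1_def A_def K0_def] t'[unfolded C1_def A_def K0_def], folded A_def K0_def, folded C1_def]
   show "\<exists>\<xi>. eigval (gram (\<lambda>s. a s \<omega>) t) 2 = (1 + \<xi>) * eigval (gram (\<lambda>s. a s \<omega>) t) CARD('n) \<and> \<bar>\<xi>\<bar> \<le> b"
    using L(1) b by (meson order_trans)
   fix i assume i: "i \<in> {2..CARD('n)}"
   have "\<bar>eigval (gram (\<lambda>s. a s \<omega>) t) i / benchmark t - 1\<bar> \<le> \<Gamma> t"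
    unfolding benchmark_def by (rule order_trans[OF L(2)[OF i] \<Gamma>[OF t'(3)]])
   moreover have "eigval (gram (\<lambda>s. a s \<omega>) t) i = (1 + (eigval (gram (\<lambda>s. a s \<omega>) t) i / benchmark t - 1)) * benchmark t"
    using benchmark_pos[OF t'(3)] by simp
   ultimately show "\<exists>\<Delta>. eigval (gram (\<lambda>s. a s \<omega>) t) i = (1 + \<Delta>) * benchmark t \<and> (P \<longrightarrow> \<bar>\<Delta>\<bar> \<le> \<Gamma> t)" by blast
  qed
 qed
 from finite_measure_mono[OF this spectral_bound_sets] G(2) show ?thesis by linarith
qed

text \<open>Meant for \<beta> below a multiple of \<open>scale\<close>, where the claimed errors are
  bounded below by constants. On the optimistic event the crude bounds keep the non-leading
  eigenvalues within a constant factor of each other and below a multiple of the benchmark that is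
  bounded if 1 / \<beta> is.\<close>

lemma optimism_event_bound:
 fixes A3 K0
 defines "A3 \<equiv> ucb_run.A3 (real CARD('n))" and "K0 \<equiv> ucb_run.K0 (real CARD('n))"
 assumes opt: "optimistic M T \<theta> \<beta> a \<theta>hat (1 / ln (real T))"
  and t3: "\<And>t. 1 \<le> t \<Longrightarrow> t\<^sub>3 \<le> real t \<Longrightarrow> 4 * K0 * \<beta> ^ 6 \<le> real t"
  and b: "A3 \<le> b" and \<Gamma>: "\<And>t. 1 \<le> t \<Longrightarrow> P \<Longrightarrow> 1 + A3 * (1 / \<beta> + 1) * real CARD('n) \<le> \<Gamma> t"
 shows "1 - 1 / ln (real T) \<le> measure M {\<omega> \<in> space M. spectral_bound t\<^sub>3 b P \<Gamma> \<omega>}"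
proof -
 define O' where "O' = {\<omega> \<in> space M. \<forall>t\<in>{1..T}. \<forall>x\<in>cball 0 1. inner x \<theta> \<le> ucb \<beta> (gram (\<lambda>s. a s \<omega>) (t - 1)) (\<theta>hat (t - 1) \<omega>) x}"
 have "O' \<subseteq> {\<omega> \<in> space M. spectral_bound t\<^sub>3 b P \<Gamma> \<omega>}"
 proof (intro subsetI CollectI conjI)
  fix \<omega> assume O: "\<omega> \<in> O'"
  thus \<omega>: "\<omega> \<in> space M" by (simp add: O'_def)
  obtain U \<mu> where "ucb_run (\<lambda>s. a s \<omega>) (\<lambda>t. \<theta>hat t \<omega>) \<theta> \<beta> T U \<mu> (real CARD('n))"
   using optimistic_run[OF \<omega>] O unfolding O'_def by blast
  then interpret R: ucb_run "\<lambda>s. a s \<omega>" "\<lambda>t. \<theta>hat t \<omega>" \<theta> \<beta> T U \<mu> "real CARD('n)" .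
  show "spectral_bound t\<^sub>3 b P \<Gamma> \<omega>" unfolding spectral_bound_def
  proof (intro ballI impI conjI)
   fix t assume t: "t \<in> {1..T}" "t\<^sub>3 \<le> real t"
   hence t': "t \<le> T" "1 \<le> t" "4 * K0 * \<beta> ^ 6 \<le> real t" using t3[of t] by auto
   define g where "g = gram (\<lambda>s. a s \<omega>) t"
   have cr: "R.tr_perp t \<le> A3 * (1 + \<beta> * sqrt (real t))" "R.tr_perp t \<le> A3 * R.mineig t"
    using R.crude[OF t'(1)] t'(3) by (simp_all add: A3_def K0_def)
   have mi: "1 \<le> R.mineig t" "R.mineig t = eigval g CARD('n)" by (rule R.mineig_ge_1) (simp add: R.mineig_def g_def)
   have tr: "eigval g i \<le> R.tr_perp t" if "i \<in> {2..CARD('n)}" for i using R.eigval_le_tr_perp[OF that] by (simp add: g_def)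
   show "\<exists>\<xi>. eigval g 2 = (1 + \<xi>) * eigval g CARD('n) \<and> \<bar>\<xi>\<bar> \<le> b"
   proof (intro exI conjI)
    show "eigval g 2 = (1 + (eigval g 2 / eigval g CARD('n) - 1)) * eigval g CARD('n)" using mi by simp
    have "eigval g 2 \<le> A3 * eigval g CARD('n)" using tr[of 2] cr(2) mi(2) dim by simp
    hence 1: "eigval g 2 / eigval g CARD('n) \<le> A3" using mi by (simp add: pos_divide_le_eq)
    have "eigval g CARD('n) \<le> eigval g 2" unfolding g_def using dim by (intro eigval_antimono[OF spd_sym[OF spd_gram]]) auto
    hence "1 \<le> eigval g 2 / eigval g CARD('n)" using mi by (simp add: pos_le_divide_eq)
    thus "\<bar>eigval g 2 / eigval g CARD('n) - 1\<bar> \<le> b" using 1 b by linarith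
   qed
   fix i assume i: "i \<in> {2..CARD('n)}"
   show "\<exists>\<Delta>. eigval g i = (1 + \<Delta>) * benchmark t \<and> (P \<longrightarrow> \<bar>\<Delta>\<bar> \<le> \<Gamma> t)"
   proof (intro exI conjI impI)
    have k: "0 < benchmark t" by (rule benchmark_pos[OF t'(2)])
    show "eigval g i = (1 + (eigval g i / benchmark t - 1)) * benchmark t" using k by simp
    assume P
    have d: "2 \<le> real CARD('n)" using dim by simp
    have s1: "1 \<le> sqrt (real t)" using t'(2) by simp
    have bt: "\<beta> * sqrt (real t) \<le> real CARD('n) * benchmark t"
    proof (rule power2_le_imp_le)
     have "(real CARD('n) + 1) * 1 \<le> 2 * (real CARD('n) * real CARD('n))"
      using d mult_right_mono[OF d of_nat_0_le_iff[of "CARD('n)"]] unfolding mult_1_right by linarith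
     hence "(\<beta>^2 * real t) * (real CARD('n) + 1) \<le> (\<beta>^2 * real t) * (2 * (real CARD('n))^2)" by (intro mult_left_mono) (auto simp: power2_eq_square)
     hence "\<beta>^2 * real t \<le> (real CARD('n))^2 * (2 * \<beta>^2 * real t / (real CARD('n) + 1))" by (simp add: pos_le_divide_eq mult_ac)
     thus "(\<beta> * sqrt (real t))^2 \<le> (real CARD('n) * benchmark t)^2" by (simp add: power_mult_distrib benchmark_def)
    qed (use k in simp)
    have A3: "1 \<le> A3" unfolding A3_def by (rule R.A3_ge_1)
    have "1 + \<beta> * sqrt (real t) \<le> (1 / \<beta> + 1) * (\<beta> * sqrt (real t))" using s1 beta_pos by (simp add: distrib_right)
    also have "... \<le> (1 / \<beta> + 1) * (real CARD('n) * benchmark t)" using bt beta_pos by (intro mult_left_mono) auto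
    finally have "A3 * (1 + \<beta> * sqrt (real t)) \<le> A3 * ((1 / \<beta> + 1) * (real CARD('n) * benchmark t))" using A3 by (intro mult_left_mono) auto
    hence "eigval g i \<le> A3 * ((1 / \<beta> + 1) * (real CARD('n) * benchmark t))" using tr[OF i] cr(1) by linarith
    hence 1: "eigval g i / benchmark t \<le> A3 * (1 / \<beta> + 1) * real CARD('n)" using k by (simp add: pos_divide_le_eq mult_ac)
    have "R.mineig t \<le> eigval g i" unfolding mi(2) g_def using i by (intro eigval_antimono[OF spd_sym[OF spd_gram]]) auto
    hence "0 \<le> eigval g i / benchmark t" using mi(1) k by simp
    thus "\<bar>eigval g i / benchmark t - 1\<bar> \<le> \<Gamma> t" using 1 \<Gamma>[OF t'(2) \<open>P\<close>] by linarith
   qed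
  qed
 qed
 \<comment> \<open>Monotonicity asks for measurability of the larger set only; that of the
   optimistic event, an uncountable intersection over the ball, is never established.\<close>
 from finite_measure_mono[OF this spectral_bound_sets] opt show ?thesis unfolding optimistic_def O'_def by linarith
qed

end

section \<open>Choice of the constants\<close>

theorem proposition4:
  fixes \<sigma> :: real
  assumes "CARD('n::finite) \<ge> 2"
    and "\<sigma> > 0"
  shows "\<exists>C\<^sub>0>0. \<exists>C\<^sub>a>0. \<forall>c>0. \<exists>C\<^sub>b>0.
    \<forall>(M :: 'w measure) T (\<theta> :: real ^ 'n) \<beta> a r \<epsilon> \<theta>hat.
      linucb M T \<theta> \<sigma> \<beta> a r \<epsilon> \<theta>hat \<longrightarrow>
      optimistic M T \<theta> \<beta> a \<theta>hat (1 / ln (real T)) \<longrightarrow>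
      (\<exists>t\<^sub>3>0. t\<^sub>3 \<le> C\<^sub>0 * (\<beta> ^ 8 / \<sigma> ^ 6) \<and>
        measure M {\<omega> \<in> space M. \<forall>t\<in>{1..T}. t\<^sub>3 \<le> real t \<longrightarrow>
          (let d = CARD('n); \<Lambda> = gram (\<lambda>s. a s \<omega>) t in
            (\<exists>\<xi>. eigval \<Lambda> 2 = (1 + \<xi>) * eigval \<Lambda> d \<and>
              \<bar>\<xi>\<bar> \<le> C\<^sub>a * (real d * noise_scale \<sigma> d T / \<beta>)) \<and>
            (\<forall>i\<in>{2..d}. \<exists>\<Delta>.
              eigval \<Lambda> i = (1 + \<Delta>) * sqrt (2 * \<beta>\<^sup>2 * real t / (real d + 1)) \<and>
              (\<beta> \<ge> c * ((real d)\<^sup>2 * noise_scale \<sigma> d T) \<longrightarrow>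
                \<bar>\<Delta>\<bar> \<le> C\<^sub>b *
                  (real d * (\<beta> ^ 8 / (real t * \<sigma> ^ 6)) powr ((real d + 1) / (real d - 1))
                   + sqrt (noise_scale \<sigma> d T) / sqrt \<beta>))))}
          \<ge> 1 - 1 / ln (real T))"
proof -
 define d where "d = real CARD('n)"
 define A K0 A3 where "A = ucb_run.A1 d" and "K0 = ucb_run.K0 d" and "A3 = ucb_run.A3 d"
 define C1 where "C1 = 8 * (10 ^ 4 * A^2 * K0)^2"
 define K where "K = 1800 * A ^ 3 + 1920000 * A ^ 4 * \<sigma>^2 * d * (1 + C1) + 9 * 10 ^ 32 * A ^ 21"
 define H where "H = 10 ^ 15 * A ^ 14 * C1"
 \<comment> \<open>\<open>H\<close> is the threshold of the deviation regime; the second summand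
   makes t \<ge> E \<beta>^8 imply t \<ge> 4 K0 \<beta>^6 for every t \<ge> 1.\<close>
 define E where "E = H + (4 * K0)^2"
 define q where "q = (d + 1) / (d - 1)"
 have d: "2 \<le> d" using assms(1) by (simp add: d_def)
 have A: "1 \<le> A" "1 \<le> K0" "1 \<le> A3" using run_constants[OF assms(1)] by (simp_all add: A_def K0_def A3_def d_def)
 have C1: "0 \<le> C1" by (simp add: C1_def)
 have HE: "0 \<le> H" "0 < E" "H \<le> E" "(4 * K0)^2 \<le> E" using A C1 by (simp_all add: H_def E_def add_nonneg_pos)
 have K: "1 \<le> K"
 proof -
  have "1 \<le> A ^ 3" using A(1) by simp
  moreover have "0 \<le> 1920000 * A ^ 4 * \<sigma>^2 * d * (1 + C1)" "0 \<le> 9 * 10 ^ 32 * A ^ 21" using A C1 d by simp_all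
  ultimately show ?thesis unfolding K_def by linarith
 qed
 \<comment> \<open>The factor \<sigma>^6 cancels the denominator in the bound for the starting time.
   The summand A3 K serves the case \<beta> < K scale, where A3 is at most A3 K scale /
   \<beta>.\<close>
 define C\<^sub>0 C\<^sub>a where "C\<^sub>0 = E * \<sigma> ^ 6" and "C\<^sub>a = 54 * 10 ^ 7 * A ^ 7 + A3 * K"
 have C: "0 < C\<^sub>0" "0 < C\<^sub>a" using HE assms(2) A K by (simp_all add: C\<^sub>0_def C\<^sub>a_def add_pos_nonneg)
 show ?thesis
 proof (rule exI[of _ C\<^sub>0], rule conjI, rule C(1), rule exI[of _ C\<^sub>a], rule conjI, rule C(2), intro allI impI, goal_cases)
  case (1 c)
  note c = 1
  \<comment> \<open>\<open>Q\<close> bounds the relative deviation for c \<le> \<beta> < K scale;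
    the factor \<open>sqrt K\<close> in the next constant compensates for scale / \<beta> being
    possibly as small as 1 / K.\<close>
  define Q where "Q = 1 + A3 * (1 / c + 1) * d"
  define C\<^sub>b where "C\<^sub>b = 2 * A ^ 3 * (E * \<sigma> ^ 6) powr q + 600000 * A ^ 8 + Q * sqrt K"
  have Q: "0 \<le> Q" using A c d by (simp add: Q_def)
  have Cb: "0 < C\<^sub>b" using A Q K unfolding C\<^sub>b_def by (intro add_pos_nonneg add_nonneg_pos) auto
  show ?case
  proof (rule exI[of _ C\<^sub>b], rule conjI, rule Cb, intro allI impI, goal_cases)
   case (1 M T \<theta> \<beta> a r \<epsilon> \<theta>hat)
   note opt = 1(2)
   interpret linucb M T \<theta> \<sigma> \<beta> a r \<epsilon> \<theta>hat by (rule 1)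
   define x where "x = sqrt scale / sqrt \<beta>"
   have x: "0 < x" using scale(2) beta_pos by (simp add: x_def)
   define b where "b = C\<^sub>a * (d * scale / \<beta>)"
   define P where "P \<longleftrightarrow> c * (d^2 * scale) \<le> \<beta>"
   define \<Gamma> where "\<Gamma> t = C\<^sub>b * (d * (\<beta> ^ 8 / (real t * \<sigma> ^ 6)) powr q + x)" for t :: nat
   have sb: "0 < scale / \<beta>" using scale(2) beta_pos by simp
   have sd: "scale / \<beta> \<le> d * scale / \<beta>" using mult_right_mono[of 1 d "scale / \<beta>"] d sb by simp
   have main: "1 - 1 / ln (real T) \<le> measure M {\<omega> \<in> space M. spectral_bound (E * \<beta> ^ 8) b P \<Gamma> \<omega>}"
   \<comment> \<open>For smaller \<open>\<beta>\<close> the claimed bounds follow from the crude estimates on the optimistic event; otherwise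
    the deviation bounds suffice. The failure probabilities are never added.\<close>
   proof (cases "K * scale \<le> \<beta>")
    case True
    show ?thesis
    proof (rule noise_event_bound[folded d_def, folded A_def K0_def, folded C1_def, folded H_def K_def, folded q_def])
     show "K * scale \<le> \<beta>" by (rule True)
     show "H * \<beta> ^ 8 \<le> E * \<beta> ^ 8" using HE beta_pos by (intro mult_right_mono) auto
     show "54 * 10 ^ 7 * A ^ 7 * (scale / \<beta>) \<le> b"
      unfolding b_def using sd sb A K C by (intro mult_mono) (simp_all add: C\<^sub>a_def)
     fix t :: nat assume t: "1 \<le> t"
     define z where "z = \<beta> ^ 8 / (real t * \<sigma> ^ 6)"
     have z: "0 \<le> z" using beta_pos sigma_pos by (simp add: z_def)
     have q0: "0 \<le> q" using d by (simp add: q_def)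
     have "(H * \<beta> ^ 8 / real t) powr q \<le> (E * \<sigma> ^ 6 * z) powr q"
     proof (rule powr_mono2[OF q0])
      show "0 \<le> H * \<beta> ^ 8 / real t" using HE beta_pos by simp
      have "H * \<beta> ^ 8 / real t \<le> E * \<beta> ^ 8 / real t" using HE beta_pos by (intro divide_right_mono mult_right_mono) auto
      also have "... = E * \<sigma> ^ 6 * z" using sigma_pos by (simp add: z_def)
      finally show "H * \<beta> ^ 8 / real t \<le> E * \<sigma> ^ 6 * z" .
     qed
     also have "... = (E * \<sigma> ^ 6) powr q * z powr q" by (rule powr_mult)
     finally have "2 * A ^ 3 * (H * \<beta> ^ 8 / real t) powr q \<le> 2 * A ^ 3 * ((E * \<sigma> ^ 6) powr q * z powr q)" using A by (intro mult_left_mono) auto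
     also have "... = (2 * A ^ 3 * (E * \<sigma> ^ 6) powr q) * z powr q" by simp
     also have "... \<le> C\<^sub>b * (d * z powr q)" using A Q K d by (intro mult_mono) (auto simp: C\<^sub>b_def mult_le_cancel_right1)
     finally have 1: "2 * A ^ 3 * (H * \<beta> ^ 8 / real t) powr q \<le> C\<^sub>b * (d * z powr q)" .
     have "600000 * A ^ 8 * x \<le> C\<^sub>b * x" using A Q K x by (intro mult_right_mono) (auto simp: C\<^sub>b_def)
     thus "2 * A ^ 3 * (H * \<beta> ^ 8 / real t) powr q + 600000 * A ^ 8 * (sqrt scale / sqrt \<beta>) \<le> \<Gamma> t"
      using 1 unfolding \<Gamma>_def z_def x_def distrib_left by linarith
    qed
   next
    case False
    hence F: "\<beta> < K * scale" by simp
    show ?thesis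
    proof (rule optimism_event_bound[OF opt, folded d_def, folded A3_def K0_def])
     fix t :: nat assume t: "1 \<le> t" "E * \<beta> ^ 8 \<le> real t"
     show "4 * K0 * \<beta> ^ 6 \<le> real t"
     \<comment> \<open>For small \<beta> the power \<beta>^8 does not dominate \<beta>^6, but then 4
       K0 \<beta>^6 \<le> 1 \<le> t.\<close>
     proof (cases "4 * K0 * \<beta>^2 \<le> 1")
      case True
      have "\<beta>^2 * 1 \<le> \<beta>^2 * (4 * K0)" using A by (intro mult_left_mono) auto
      hence "\<beta>^2 \<le> 1" using True by (simp add: mult_ac)
      hence "(\<beta>^2) ^ 2 \<le> 1" by (rule power_le_one[rotated]) simp
      hence "(4 * K0 * \<beta>^2) * (\<beta>^2) ^ 2 \<le> 1 * 1" using True by (intro mult_mono) auto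
      moreover have "4 * K0 * \<beta> ^ 6 = (4 * K0 * \<beta>^2) * (\<beta>^2) ^ 2" by algebra
      moreover have "1 \<le> real t" using t(1) by simp
      ultimately show ?thesis by linarith
     next
      case False
      have "(4 * K0 * \<beta> ^ 6) * 1 \<le> (4 * K0 * \<beta> ^ 6) * (4 * K0 * \<beta>^2)" using False A beta_pos by (intro mult_left_mono) auto
      also have "... = (4 * K0)^2 * \<beta> ^ 8" by algebra
      also have "... \<le> E * \<beta> ^ 8" using HE(4) beta_pos by (intro mult_right_mono) auto
      finally show ?thesis using t(2) by simp
     qed
    next
     have "1 \<le> K * (scale / \<beta>)" using F beta_pos by (simp add: pos_le_divide_eq)
     hence "A3 * 1 \<le> A3 * (K * (scale / \<beta>))" using A by (intro mult_left_mono) auto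
     also have "... = (A3 * K) * (scale / \<beta>)" by simp
     also have "... \<le> C\<^sub>a * (d * scale / \<beta>)" using sd sb A K C by (intro mult_mono) (simp_all add: C\<^sub>a_def)
     finally show "A3 \<le> b" by (simp add: b_def)
    next
     fix t :: nat assume t: "1 \<le> t" and P
     \<comment> \<open>This is where the condition \<beta> \<ge> c d^2 scale enters: it keeps 1 /
       \<beta> below 1 / c, so that \<open>Q\<close> can be fixed in advance.\<close>
     have "1 * 1 \<le> d^2 * scale" using d scale(2) by (intro mult_mono) auto
     hence "c * 1 \<le> c * (d^2 * scale)" using c by (intro mult_left_mono) auto
     hence "c \<le> \<beta>" using \<open>P\<close> by (simp add: P_def)
     hence "1 / \<beta> \<le> 1 / c" using c by (intro divide_left_mono) auto
     hence "1 + A3 * (1 / \<beta> + 1) * d \<le> Q" unfolding Q_def using A d by (intro add_left_mono mult_right_mono mult_left_mono) auto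
     also have "Q * 1 \<le> Q * (sqrt K * x)"
     proof (rule mult_left_mono[OF _ Q])
      have "1 \<le> sqrt (K * scale / \<beta>)" using F beta_pos by (simp add: pos_le_divide_eq)
      also have "... = sqrt K * x" by (simp add: x_def real_sqrt_mult real_sqrt_divide)
      finally show "1 \<le> sqrt K * x" .
     qed
     also have "... = (Q * sqrt K) * x" by simp
     also have "... \<le> C\<^sub>b * (d * (\<beta> ^ 8 / (real t * \<sigma> ^ 6)) powr q + x)"
      using A Q K d x Cb by (intro mult_mono) (auto simp: C\<^sub>b_def)
     finally show "1 + A3 * (1 / \<beta> + 1) * d \<le> \<Gamma> t" by (simp add: \<Gamma>_def)
    qed
   qed
   show ?case
   proof (intro exI[of _ "E * \<beta> ^ 8"] conjI, goal_cases)
    case 1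
    show ?case using HE beta_pos by simp
   next
    case 2
    show ?case using sigma_pos by (simp add: C\<^sub>0_def)
   next
    case 3
    show ?case using main unfolding spectral_bound_def Let_def benchmark_def b_def P_def \<Gamma>_def x_def scale_def q_def d_def .
   qed
  qed
 qed
qed

end
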